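(* Let $N=\mathbf{Z}^d$, let $\widetilde{\Sigma}$ be a complete nonsingular fan in $\widetilde N=\{\mathbf n\in N : \text{the } d\text{-th coordinate of }\mathbf n\text{ is }0\}$, and let $\Sigma$ be a complete nonsingular fan in $N$ containing $\widetilde\Sigma$ as a subfan, satisfying all the assumptions of the setting described in the context (in particular $\widetilde V$ is isomorphic to either $\mathbf{P}^{d-1}$ or a toric bundle over $\mathbf{P}^1$, with the vectors $\mathbf e_i,\mathbf a_i,\mathbf b_i,\mathbf c_i$ chosen as there). Let $V$ be the nonsingular complete toric $d$-fold corresponding to $\Sigma$, and let $k$ be a nonnegative integer. For $t\in\mathbf{C}$ let $V_t$ be obtained by patching $V^+$ and $V^-$ along their open subsets identified with $\widetilde V\times\mathbf{C}^\times$, via the automorphism $(x^-_1,\ldots,x^-_{d-1},y^-_1,\ldots,y^-_\rho,w)\mapsto(x^+_1,\ldots,x^+_{d-1},y^+_1,\ldots,y^+_\rho,z)$ of $\widetilde V\times\mathbf{C}^\times$ given by $$x^+_1=x^-_1w^{c_{1,1}}+t\,y^-_1w^{k},\quad x^+_i=x^-_iw^{c_{1,i}}\ (2\le i\le d-1),\quad y^+_j=y^-_j\ (1\le j\le\rho),\quad z=1/w.$$ Suppose that the following conditions are satisfied: 1. $b_{2,1}=\cdots=b_{m,1}=0$, and 2. $kc_{1,d}+c_{1,1}\ge0,\ \ldots,\ kc_{n,d}+c_{n,1}\ge0$. Then for any $t\in\mathbf C^\times=\mathbf C\setminus\{0\}$ we have $$V_t\cong\left(2k,-ka_{1,2},\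ldots,-ka_{1,d-1}\right)^{-}V.$$
   Context: **Conventions.** All varieties are over $\mathbf{C}$; cones are nonsingular rational cones and fans are nonsingular. $N=\mathbf{Z}^d$ (column vectors). For a fan $\Sigma$, $\mathrm{G}(\Sigma)$ is the set of primitive generators of its one-dimensional cones, and $\mathrm{G}(\sigma)=\sigma\cap \mathrm{G}(\Sigma)$ for $\sigma\in\Sigma$. **Homogeneous coordinates.** For a fan $\Sigma$ containing at least one cone of full dimension, with toric variety $V$, put $\mathbf U(\Sigma)=\{(X_\rho)_{\rho\in \mathrm G(\Sigma)}\in\mathbf C^{\mathrm G(\Sigma)} : \prod_{\rho\in \mathrm G(\Sigma)\setminus \mathrm G(\sigma)}X_\rho\ne0 \text{ for some }\sigma\in\Sigma\}$. The group $G=\mathrm{Hom}_{\mathbf Z}(\mathrm{Pic}(V),\mathbf C^\times)$ acts by $g\cdot(X_\rho)_\rho=(g([D_\rho])X_\rho)_\rho$, where $D_\rho$ is the torus-invariant prime divisor of $\rho$, and $V=\mathbf U(\Sigma)/G$ (geometric quotient). The $X_\rho$ are the homogeneous coordinates of $V$. For $\sigma\in\Sigma$, $\mathbf U(\Sigma)_\sigma=\{X\in\mathbf U(\Sigma):\prod_{\rho\in \mathrm G(\Sigma)\setminus \mathrm G(\sigma)}X_\rho\neq0\}$, and $\mathbf U(\Sigma)_\sigma/G$ is the affine open toric subvariety of $\sigma$. **Setting.** Let $\widetilde N\subset N$ be the sublattice of vectors with $d$-th coordinate $0$, $\widetilde\Sigma$ a complete fan in $\widetilde N$, and $\Sigma$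 a complete fan in $N$ containing $\widetilde\Sigma$ as a subfan. Let $\Sigma^+$ (resp. $\Sigma^-$) be the subfan of $\sigma\in\Sigma$ all of whose points have nonnegative (resp. nonpositive) $d$-th coordinate; then $\widetilde\Sigma=\Sigma^+\cap\Sigma^-$. Let $V,V^+,V^-$ be the toric varieties of $\Sigma,\Sigma^+,\Sigma^-$ (fans in $N$), and $\widetilde V$ the toric $(d-1)$-fold of $\widetilde\Sigma$ (fan in $\widetilde N$). Write $$\mathrm G(\widetilde\Sigma)=\{\mathbf e_1,\ldots,\mathbf e_{d-1},\mathbf a_1,\ldots,\mathbf a_\rho\},\quad \mathrm G(\Sigma^+)=\{\mathbf b_1,\ldots,\mathbf b_m\}\cup \mathrm G(\widetilde\Sigma),\quad \mathrm G(\Sigma^-)=\{\mathbf c_1,\ldots,\mathbf c_n\}\cup \mathrm G(\widetilde\Sigma),$$ where $\{\mathbf e_1,\ldots,\mathbf e_{d-1},\mathbf b_1\}$ is the standard basis of $N$, and denote coordinates by $\mathbf a_j={}^t(a_{j,1},\ldots,a_{j,d})$, $\mathbf b_j={}^t(b_{j,1},\ldots,b_{j,d})$, $\mathbf c_j={}^t(c_{j,1},\ldots,c_{j,d})$. Assumptions: - $\widetilde V$ is isomorphic to either $\mathbf P^{d-1}$ or a toric bundle over $\mathbf P^1$. - If $\widetilde V$ is isomorphic to a toric bundle over $\mathbf P^1$, the torus-invariant prime divisors on $\widetilde V$ corresponding to $\mathbf e_1$ and $\mathbf a_1$ are fibers of the bundle. - $\{\mathbf e_1,\ldots,\mathbf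 e_{d-1},\mathbf b_1\}$ generates a $d$-dimensional cone of $\Sigma^+$, and $\{\mathbf e_1,\ldots,\mathbf e_{d-1},\mathbf c_1\}$ generates a $d$-dimensional cone of $\Sigma^-$ (so $c_{1,d}=-1$). **Identifications with $\widetilde V\times\mathbf C^\times$.** Let $(X^+_1,\ldots,X^+_{d-1},Y^+_1,\ldots,Y^+_\rho,Z^+_1,\ldots,Z^+_m)$ be the homogeneous coordinates of $V^+$ corresponding to $\mathbf e_1,\ldots,\mathbf e_{d-1},\mathbf a_1,\ldots,\mathbf a_\rho,\mathbf b_1,\ldots,\mathbf b_m$, and $(X^-_1,\ldots,X^-_{d-1},Y^-_1,\ldots,Y^-_\rho,W^-_1,\ldots,W^-_n)$ those of $V^-$ corresponding to $\mathbf e_1,\ldots,\mathbf e_{d-1},\mathbf a_1,\ldots,\mathbf a_\rho,\mathbf c_1,\ldots,\mathbf c_n$; let $G^\pm=\mathrm{Hom}_{\mathbf Z}(\mathrm{Pic}(V^\pm),\mathbf C^\times)$. The open subset $\left(\bigcup_{\sigma\in\widetilde\Sigma}\mathbf U(\Sigma^+)_\sigma\right)/G^+\subset V^+$ is identified with $\widetilde V\times\mathbf C^\times$ by $$x^+_i=X^+_i\prod_{j=2}^m(Z^+_j)^{b_{j,i}}\ (1\le i\le d-1),\quad y^+_j=Y^+_j,\quad z=Z^+_1\prod_{j=2}^m(Z^+_j)^{b_{j,d}},$$ and the open subset $\left(\bigcup_{\sigma\in\widetilde\Sigma}\mathbf U(\Sigma^-)_\sigma\right)/G^-\subset V^-$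 is identified with $\widetilde V\times\mathbf C^\times$ by $$x^-_i=X^-_i\prod_{j=2}^n(W^-_j)^{c_{j,i}+c_{1,i}c_{j,d}}\ (1\le i\le d-1),\quad y^-_j=Y^-_j,\quad w=W^-_1\prod_{j=2}^n(W^-_j)^{-c_{j,d}}.$$ Here $(x^\pm_1,\ldots,x^\pm_{d-1},y^\pm_1,\ldots,y^\pm_\rho)$ are homogeneous coordinates of $\widetilde V$ corresponding to $\mathbf e_1,\ldots,\mathbf e_{d-1},\mathbf a_1,\ldots,\mathbf a_\rho$, and $z,w\in\mathbf C^\times$. **The variety $\mathbf q^-V$.** For $\mathbf q=(q_1,\ldots,q_{d-1})\in\mathbf Z^{d-1}$, define the complete fan $$\mathbf q^-\Sigma:=\Sigma^+\cup\{\mathbf q^-\sigma : \sigma\in\Sigma^-\},$$ where $\mathbf q^-\sigma$ is the image of $\sigma$ under the linear automorphism of $N_{\mathbf R}=\mathbf R^d$ sending ${}^t(v_1,\ldots,v_d)$ to ${}^t(v_1+q_1v_d,\ldots,v_{d-1}+q_{d-1}v_d,v_d)$. Then $\mathbf q^-V$ denotes the nonsingular toric $d$-fold corresponding to $\mathbf q^-\Sigma$. *)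

theory Defs
  imports "HOL-Analysis.Abstract_Topology" "HOL-Algebra.Free_Abelian_Groups" "HOL-Algebra.Coset"
    Complex_Main
begin

text \<open>
  Tuples indexed by a set \<open>I\<close> are total functions vanishing outside \<open>I\<close>.  Hence the lattice
  of vectors in \<open>\<int>\<^sup>d\<close> with last coordinate \<open>0\<close> is literally \<open>lattice (d - 1)\<close>.
\<close>

definition tuples :: "'i set \<Rightarrow> ('i \<Rightarrow> 'a::zero) set" where
  "tuples I = {x. \<forall>i. i \<notin> I \<longrightarrow> x i = 0}"

section \<open>Varieties as spaces with functions\<close>

text \<open>
  Over the algebraically closed field \<open>\<complex>\<close> a (classical) variety is a topological space with a sheaf
  of complex-valued functions.  \<open>Reg X W\<close> is meant for open \<open>W\<close> and consists of the functions
  whose restriction to \<open>W\<close> is regular; the values outside \<open>W\<close> are irrelevant.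
\<close>

record 'a space_fun =
  Top :: "'a topology"
  Reg :: "'a set \<Rightarrow> ('a \<Rightarrow> complex) set"

abbreviation pts :: "'a space_fun \<Rightarrow> 'a set" where
  "pts X \<equiv> topspace (Top X)"

definition morphism :: "'a space_fun \<Rightarrow> 'b space_fun \<Rightarrow> ('a \<Rightarrow> 'b) \<Rightarrow> bool" where
  "morphism X Y f \<longleftrightarrow> continuous_map (Top X) (Top Y) f \<and>
     (\<forall>W. openin (Top Y) W \<longrightarrow> (\<forall>h \<in> Reg Y W. h \<circ> f \<in> Reg X {x \<in> pts X. f x \<in> W}))"

definition isomorphism :: "'a space_fun \<Rightarrow> 'b space_fun \<Rightarrow> ('a \<Rightarrow> 'b) \<Rightarrow> bool" where
  "isomorphism X Y f \<longleftrightarrow> morphism X Y f \<and>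
     (\<exists>g. morphism Y X g \<and> (\<forall>x \<in> pts X. g (f x) = x) \<and> (\<forall>y \<in> pts Y. f (g y) = y))"

definition isomorphic :: "'a space_fun \<Rightarrow> 'b space_fun \<Rightarrow> bool" where
  "isomorphic X Y \<longleftrightarrow> (\<exists>f. isomorphism X Y f)"

definition open_subspace :: "'a space_fun \<Rightarrow> 'a set \<Rightarrow> 'a space_fun" where
  "open_subspace X U = \<lparr>Top = subtopology (Top X) U, Reg = Reg X\<rparr>"

inductive_set poly_fun :: "'i set \<Rightarrow> (('i \<Rightarrow> complex) \<Rightarrow> complex) set" for I :: "'i set" where
  const: "(\<lambda>_. c) \<in> poly_fun I"
| coord: "i \<in> I \<Longrightarrow> (\<lambda>x. x i) \<in> poly_fun I"
| add: "p \<in> poly_fun I \<Longrightarrow> q \<in> poly_fun I \<Longrightarrow> (\<lambda>x. p x + q x) \<in> poly_fun I"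
| mult: "p \<in> poly_fun I \<Longrightarrow> q \<in> poly_fun I \<Longrightarrow> (\<lambda>x. p x * q x) \<in> poly_fun I"

definition zariski :: "'i set \<Rightarrow> ('i \<Rightarrow> complex) topology" where
  "zariski I = topology (\<lambda>W. \<exists>S \<subseteq> poly_fun I. W = {x \<in> tuples I. \<exists>p \<in> S. p x \<noteq> 0})"

lemma istopology_zariski:
  "istopology (\<lambda>W. \<exists>S \<subseteq> poly_fun I. W = {x \<in> tuples I. \<exists>p \<in> S. p x \<noteq> 0})"
  unfolding istopology_def
proof (intro conjI allI impI)
  fix W W'
  assume "\<exists>S \<subseteq> poly_fun I. W = {x \<in> tuples I. \<exists>p \<in> S. p x \<noteq> 0}"
    and "\<exists>S \<subseteq> poly_fun I. W' = {x \<in> tuples I. \<exists>p \<in> S. p x \<noteq> 0}"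
  then obtain S S' where S: "S \<subseteq> poly_fun I" "W = {x \<in> tuples I. \<exists>p \<in> S. p x \<noteq> 0}"
    and S': "S' \<subseteq> poly_fun I" "W' = {x \<in> tuples I. \<exists>p \<in> S'. p x \<noteq> 0}"
    by auto
  let ?T = "(\<lambda>(p, q). \<lambda>x. p x * q x) ` (S \<times> S')"
  have "?T \<subseteq> poly_fun I"
    using S(1) S'(1) by (auto intro: poly_fun.mult)
  moreover have "W \<inter> W' = {x \<in> tuples I. \<exists>p \<in> ?T. p x \<noteq> 0}"
    unfolding S(2) S'(2) by auto
  ultimately show "\<exists>S \<subseteq> poly_fun I. W \<inter> W' = {x \<in> tuples I. \<exists>p \<in> S. p x \<noteq> 0}"
    by blast
next
  fix \<K>
  assume *: "\<forall>K \<in> \<K>. \<exists>S \<subseteq> poly_fun I. K = {x \<in> tuples I. \<exists>p \<in> S. p x \<noteq> 0}"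
  let ?S = "{p \<in> poly_fun I. \<forall>x \<in> tuples I. p x \<noteq> 0 \<longrightarrow> x \<in> \<Union>\<K>}"
  have "x \<in> {x \<in> tuples I. \<exists>p \<in> ?S. p x \<noteq> 0}" if "K \<in> \<K>" "x \<in> K" for x K
  proof -
    obtain S where S: "S \<subseteq> poly_fun I" "K = {x \<in> tuples I. \<exists>p \<in> S. p x \<noteq> 0}"
      using * \<open>K \<in> \<K>\<close> by (elim ballE exE conjE) auto
    then obtain p where "x \<in> tuples I" "p \<in> S" "p x \<noteq> 0"
      using \<open>x \<in> K\<close> by blast
    moreover from this S have "p \<in> poly_fun I" "\<forall>y \<in> tuples I. p y \<noteq> 0 \<longrightarrow> y \<in> K"
      by auto
    ultimately show ?thesis
      using \<open>K \<in> \<K>\<close> by blast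
  qed
  then have "\<Union>\<K> = {x \<in> tuples I. \<exists>p \<in> ?S. p x \<noteq> 0}"
    by blast
  then show "\<exists>S \<subseteq> poly_fun I. \<Union>\<K> = {x \<in> tuples I. \<exists>p \<in> S. p x \<noteq> 0}"
    by (intro exI[of _ ?S] conjI) blast+
qed

lemma openin_zariski:
  "openin (zariski I) W \<longleftrightarrow> (\<exists>S \<subseteq> poly_fun I. W = {x \<in> tuples I. \<exists>p \<in> S. p x \<noteq> 0})"
  unfolding zariski_def topology_inverse'[OF istopology_zariski] ..

definition quasi_affine :: "'i set \<Rightarrow> ('i \<Rightarrow> complex) set \<Rightarrow> ('i \<Rightarrow> complex) space_fun" where
  "quasi_affine I U =
     \<lparr>Top = subtopology (zariski I) U,
      Reg = (\<lambda>W. {f. \<forall>x \<in> W. \<exists>W' p q. openin (subtopology (zariski I) U) W' \<and> x \<in> W' \<and> W' \<subseteq> W \<and>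
                    p \<in> poly_fun I \<and> q \<in> poly_fun I \<and> (\<forall>y \<in> W'. q y \<noteq> 0 \<and> f y = p y / q y)})\<rparr>"

text \<open>
  The image of \<open>X\<close> under \<open>\<pi>\<close> with the final structure.  Both geometric quotients (with \<open>\<pi>\<close> the orbit
  map, so that the structure sheaf consists of the invariant functions) and gluings (with \<open>\<pi>\<close> the map
  from a disjoint union) are of this form.
\<close>

definition quotient_space :: "'a space_fun \<Rightarrow> ('a \<Rightarrow> 'b) \<Rightarrow> 'b space_fun" where
  "quotient_space X \<pi> =
     \<lparr>Top = topology (\<lambda>W. W \<subseteq> \<pi> ` pts X \<and> openin (Top X) {x \<in> pts X. \<pi> x \<in> W}),
      Reg = (\<lambda>W. {f. f \<circ> \<pi> \<in> Reg X {x \<in> pts X. \<pi> x \<in> W}})\<rparr>"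

lemma openin_quotient_space:
  "openin (Top (quotient_space X \<pi>)) W \<longleftrightarrow>
     W \<subseteq> \<pi> ` pts X \<and> openin (Top X) {x \<in> pts X. \<pi> x \<in> W}"
proof -
  have "istopology (\<lambda>W. W \<subseteq> \<pi> ` pts X \<and> openin (Top X) {x \<in> pts X. \<pi> x \<in> W})"
    unfolding istopology_def
  proof (intro conjI allI impI; (elim conjE)?)
    fix S T
    assume "openin (Top X) {x \<in> pts X. \<pi> x \<in> S}" "openin (Top X) {x \<in> pts X. \<pi> x \<in> T}"
    moreover have "{x \<in> pts X. \<pi> x \<in> S \<inter> T} = {x \<in> pts X. \<pi> x \<in> S} \<inter> {x \<in> pts X. \<pi> x \<in> T}"
      by auto
    ultimately show "openin (Top X) {x \<in> pts X. \<pi> x \<in> S \<inter> T}"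
      by auto
  next
    fix \<K>
    assume *: "\<forall>K \<in> \<K>. K \<subseteq> \<pi> ` pts X \<and> openin (Top X) {x \<in> pts X. \<pi> x \<in> K}"
    then show "\<Union>\<K> \<subseteq> \<pi> ` pts X"
      by blast
    have "{x \<in> pts X. \<pi> x \<in> \<Union>\<K>} = (\<Union>K \<in> \<K>. {x \<in> pts X. \<pi> x \<in> K})"
      by auto
    with * show "openin (Top X) {x \<in> pts X. \<pi> x \<in> \<Union>\<K>}"
      by auto
  qed auto
  then show ?thesis
    by (simp add: quotient_space_def topology_inverse')
qed

definition sum_space :: "'a space_fun \<Rightarrow> 'b space_fun \<Rightarrow> ('a + 'b) space_fun" where
  "sum_space X Y =
     \<lparr>Top = topology (\<lambda>W. openin (Top X) (Inl -` W) \<and> openin (Top Y) (Inr -` W)),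
      Reg = (\<lambda>W. {f. f \<circ> Inl \<in> Reg X (Inl -` W) \<and> f \<circ> Inr \<in> Reg Y (Inr -` W)})\<rparr>"

lemma openin_sum_space:
  "openin (Top (sum_space X Y)) W \<longleftrightarrow> openin (Top X) (Inl -` W) \<and> openin (Top Y) (Inr -` W)"
proof -
  have "istopology (\<lambda>W. openin (Top X) (Inl -` W) \<and> openin (Top Y) (Inr -` W))"
    unfolding istopology_def by (auto simp: vimage_Union)
  then show ?thesis
    by (simp add: sum_space_def topology_inverse')
qed

text \<open>\<open>R\<close> is the set of pairs of points to be identified.\<close>

definition glue :: "'a space_fun \<Rightarrow> 'b space_fun \<Rightarrow> ('a \<times> 'b) set \<Rightarrow> ('a + 'b) set space_fun" where
  "glue X Y R =
     (let E = (\<lambda>(x, y). (Inl x, Inr y)) ` R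
      in quotient_space (sum_space X Y) (\<lambda>s. (E \<union> E\<inverse>)\<^sup>* `` {s}))"

text \<open>
  The product variety, not the product topology: its open sets are generated by the
  non-vanishing loci in \<open>U \<times> V\<close> of functions \<open>(x, y) \<mapsto> \<Sum>i. f i x * g i y\<close> with \<open>f i\<close> regular
  on \<open>U\<close> and \<open>g i\<close> regular on \<open>V\<close>.
\<close>

definition tensor_fun ::
    "'a space_fun \<Rightarrow> 'b space_fun \<Rightarrow> 'a set \<Rightarrow> 'b set \<Rightarrow> ('a \<times> 'b \<Rightarrow> complex) set" where
  "tensor_fun X Y U V =
     {h. \<exists>(n::nat) f g. (\<forall>i<n. f i \<in> Reg X U \<and> g i \<in> Reg Y V) \<and>
           h = (\<lambda>(x, y). \<Sum>i<n. f i x * g i y)}"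

definition prod_space :: "'a space_fun \<Rightarrow> 'b space_fun \<Rightarrow> ('a \<times> 'b) space_fun" where
  "prod_space X Y =
     \<lparr>Top = topology_generated_by
              {{p \<in> U \<times> V. h p \<noteq> 0} | U V h.
                 openin (Top X) U \<and> openin (Top Y) V \<and> h \<in> tensor_fun X Y U V},
      Reg = (\<lambda>W. {f. \<forall>p \<in> W. \<exists>U V h h'. openin (Top X) U \<and> openin (Top Y) V \<and>
                    h \<in> tensor_fun X Y U V \<and> h' \<in> tensor_fun X Y U V \<and>
                    p \<in> {p' \<in> U \<times> V. h' p' \<noteq> 0} \<and> {p' \<in> U \<times> V. h' p' \<noteq> 0} \<subseteq> W \<and>
                    (\<forall>p' \<in> U \<times> V. h' p' \<noteq> 0 \<longrightarrow> f p' = h p' / h' p')})\<rparr>"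

definition locally_trivial ::
    "'a space_fun \<Rightarrow> 'b space_fun \<Rightarrow> ('a \<Rightarrow> 'b) \<Rightarrow> 'c space_fun \<Rightarrow> bool" where
  "locally_trivial X Y \<pi> F \<longleftrightarrow>
     (\<forall>y \<in> pts Y. \<exists>U \<phi>. openin (Top Y) U \<and> y \<in> U \<and>
        isomorphism (open_subspace X {x \<in> pts X. \<pi> x \<in> U}) (prod_space (open_subspace Y U) F) \<phi> \<and>
        (\<forall>x \<in> pts X. \<pi> x \<in> U \<longrightarrow> fst (\<phi> x) = \<pi> x))"

definition proj_space :: "nat \<Rightarrow> (nat \<Rightarrow> complex) set space_fun" where
  "proj_space n =
     quotient_space (quasi_affine {0..n} (tuples {0..n} - {\<lambda>_. 0}))
       (\<lambda>x. {(\<lambda>i. s * x i) | s. s \<noteq> 0})"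

section \<open>Nonsingular fans\<close>

definition lattice :: "nat \<Rightarrow> (nat \<Rightarrow> int) set" where
  "lattice d = tuples {1..d}"

definition std :: "nat \<Rightarrow> nat \<Rightarrow> int" where
  "std i = (\<lambda>l. if l = i then 1 else 0)"

definition lattice_basis :: "nat \<Rightarrow> (nat \<Rightarrow> int) set \<Rightarrow> bool" where
  "lattice_basis d B \<longleftrightarrow> finite B \<and> B \<subseteq> lattice d \<and>
     (\<forall>v \<in> lattice d. \<exists>!c. c \<in> tuples B \<and> v = (\<lambda>i. \<Sum>u\<in>B. c u * u i))"

definition cone_of :: "(nat \<Rightarrow> int) set \<Rightarrow> (nat \<Rightarrow> real) set" where
  "cone_of S = {v. \<exists>r. (\<forall>u\<in>S. 0 \<le> r u) \<and> v = (\<lambda>i. \<Sum>u\<in>S. r u * of_int (u i))}"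

definition nonsingular_cone :: "nat \<Rightarrow> (nat \<Rightarrow> real) set \<Rightarrow> bool" where
  "nonsingular_cone d \<sigma> \<longleftrightarrow> (\<exists>B S. lattice_basis d B \<and> S \<subseteq> B \<and> \<sigma> = cone_of S)"

definition face :: "nat \<Rightarrow> (nat \<Rightarrow> real) set \<Rightarrow> (nat \<Rightarrow> real) set \<Rightarrow> bool" where
  "face d \<tau> \<sigma> \<longleftrightarrow>
     (\<exists>m. (\<forall>v\<in>\<sigma>. 0 \<le> (\<Sum>i=1..d. m i * v i)) \<and> \<tau> = {v\<in>\<sigma>. (\<Sum>i=1..d. m i * v i) = 0})"

definition fan :: "nat \<Rightarrow> (nat \<Rightarrow> real) set set \<Rightarrow> bool" where
  "fan d \<Sigma> \<longleftrightarrow> finite \<Sigma> \<and> \<Sigma> \<noteq> {} \<and> (\<forall>\<sigma>\<in>\<Sigma>. nonsingular_cone d \<sigma>) \<and>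
     (\<forall>\<sigma>\<in>\<Sigma>. \<forall>\<tau>. face d \<tau> \<sigma> \<longrightarrow> \<tau> \<in> \<Sigma>) \<and>
     (\<forall>\<sigma>\<in>\<Sigma>. \<forall>\<tau>\<in>\<Sigma>. face d (\<sigma> \<inter> \<tau>) \<sigma> \<and> face d (\<sigma> \<inter> \<tau>) \<tau>)"

definition complete_fan :: "nat \<Rightarrow> (nat \<Rightarrow> real) set set \<Rightarrow> bool" where
  "complete_fan d \<Sigma> \<longleftrightarrow> fan d \<Sigma> \<and> \<Union>\<Sigma> = tuples {1..d}"

definition primitive :: "(nat \<Rightarrow> int) \<Rightarrow> bool" where
  "primitive v \<longleftrightarrow> (\<forall>k w. v = (\<lambda>i. k * w i) \<longrightarrow> \<bar>k\<bar> = 1)"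

definition gens :: "(nat \<Rightarrow> real) set set \<Rightarrow> (nat \<Rightarrow> int) set" where
  "gens \<Sigma> = {v. primitive v \<and> cone_of {v} \<in> \<Sigma>}"

definition cone_gens :: "(nat \<Rightarrow> real) set set \<Rightarrow> (nat \<Rightarrow> real) set \<Rightarrow> (nat \<Rightarrow> int) set" where
  "cone_gens \<Sigma> \<sigma> = {v \<in> gens \<Sigma>. (\<lambda>i. of_int (v i)) \<in> \<sigma>}"

section \<open>Toric varieties in homogeneous coordinates\<close>

type_synonym coords = "(nat \<Rightarrow> int) \<Rightarrow> complex"

definition U_chart :: "(nat \<Rightarrow> real) set set \<Rightarrow> (nat \<Rightarrow> real) set \<Rightarrow> coords set" where
  "U_chart \<Sigma> \<sigma> = {X \<in> tuples (gens \<Sigma>). (\<Prod>v \<in> gens \<Sigma> - cone_gens \<Sigma> \<sigma>. X v) \<noteq> 0}"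

definition U_fan :: "(nat \<Rightarrow> real) set set \<Rightarrow> coords set" where
  "U_fan \<Sigma> = (\<Union>\<sigma>\<in>\<Sigma>. U_chart \<Sigma> \<sigma>)"

text \<open>
  The Picard group of the (nonsingular) toric variety of \<open>\<Sigma>\<close>: the free abelian group on the
  torus-invariant prime divisors \<open>D\<^sub>v\<close> (represented by \<open>frag_of v\<close>) modulo the divisors
  \<open>\<Sum>v. \<langle>m, v\<rangle> D\<^sub>v\<close> of the characters \<open>m\<close>.
\<close>

definition char_div :: "nat \<Rightarrow> (nat \<Rightarrow> real) set set \<Rightarrow> (nat \<Rightarrow> int) \<Rightarrow> ((nat \<Rightarrow> int) \<Rightarrow>\<^sub>0 int)" where
  "char_div d \<Sigma> m = (\<Sum>v \<in> gens \<Sigma>. frag_cmul (\<Sum>i=1..d. m i * v i) (frag_of v))"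

definition principal_divs :: "nat \<Rightarrow> (nat \<Rightarrow> real) set set \<Rightarrow> ((nat \<Rightarrow> int) \<Rightarrow>\<^sub>0 int) set" where
  "principal_divs d \<Sigma> = char_div d \<Sigma> ` lattice d"

definition Pic :: "nat \<Rightarrow> (nat \<Rightarrow> real) set set \<Rightarrow> ((nat \<Rightarrow> int) \<Rightarrow>\<^sub>0 int) set monoid" where
  "Pic d \<Sigma> = free_Abelian_group (gens \<Sigma>) Mod principal_divs d \<Sigma>"

definition div_class ::
    "nat \<Rightarrow> (nat \<Rightarrow> real) set set \<Rightarrow> (nat \<Rightarrow> int) \<Rightarrow> ((nat \<Rightarrow> int) \<Rightarrow>\<^sub>0 int) set" where
  "div_class d \<Sigma> v = principal_divs d \<Sigma> #>\<^bsub>free_Abelian_group (gens \<Sigma>)\<^esub> frag_of v"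

definition Cstar :: "complex monoid" where
  "Cstar = \<lparr>carrier = UNIV - {0}, monoid.mult = (*), one = 1\<rparr>"

definition orbit :: "nat \<Rightarrow> (nat \<Rightarrow> real) set set \<Rightarrow> coords \<Rightarrow> coords set" where
  "orbit d \<Sigma> X = {(\<lambda>v. g (div_class d \<Sigma> v) * X v) | g. g \<in> hom (Pic d \<Sigma>) Cstar}"

text \<open>Only meaningful for fans containing a cone of full dimension.\<close>

definition toric :: "nat \<Rightarrow> (nat \<Rightarrow> real) set set \<Rightarrow> coords set space_fun" where
  "toric d \<Sigma> = quotient_space (quasi_affine (gens \<Sigma>) (U_fan \<Sigma>)) (orbit d \<Sigma>)"

definition toric_divisor :: "nat \<Rightarrow> (nat \<Rightarrow> real) set set \<Rightarrow> (nat \<Rightarrow> int) \<Rightarrow> coords set set" where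
  "toric_divisor d \<Sigma> v = {p \<in> pts (toric d \<Sigma>). \<forall>X\<in>p. X v = 0}"

text \<open>
  The following two definitions apply to \<open>toric d \<Sigma>\<close> (with \<open>I = gens \<Sigma>\<close>) as well as to
  \<open>proj_space n\<close> (with \<open>I = {0..n}\<close>), where points are classes of homogeneous coordinates.
\<close>

definition torus :: "'i set \<Rightarrow> ('i \<Rightarrow> complex) set space_fun \<Rightarrow> ('i \<Rightarrow> complex) set set" where
  "torus I X = {p \<in> pts X. \<forall>x\<in>p. \<forall>i\<in>I. x i \<noteq> 0}"

definition torus_mult :: "('i \<Rightarrow> complex) set \<Rightarrow> ('i \<Rightarrow> complex) set \<Rightarrow> ('i \<Rightarrow> complex) set" where
  "torus_mult p q = {(\<lambda>i. x i * y i) | x y. x \<in> p \<and> y \<in> q}"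

definition toric_morphism :: "'i set \<Rightarrow> 'j set \<Rightarrow> ('i \<Rightarrow> complex) set space_fun \<Rightarrow>
    ('j \<Rightarrow> complex) set space_fun \<Rightarrow> (('i \<Rightarrow> complex) set \<Rightarrow> ('j \<Rightarrow> complex) set) \<Rightarrow> bool" where
  "toric_morphism I J X Y f \<longleftrightarrow> morphism X Y f \<and>
     (\<forall>p \<in> torus I X. f p \<in> torus J Y) \<and>
     (\<forall>p \<in> torus I X. \<forall>q \<in> torus I X. f (torus_mult p q) = torus_mult (f p) (f q))"

definition toric_bundle_over_P1 ::
    "nat \<Rightarrow> (nat \<Rightarrow> real) set set \<Rightarrow> (coords set \<Rightarrow> (nat \<Rightarrow> complex) set) \<Rightarrow> bool" where
  "toric_bundle_over_P1 n \<Delta> \<pi> \<longleftrightarrow> complete_fan n \<Delta> \<and>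
     toric_morphism (gens \<Delta>) {0..1} (toric n \<Delta>) (proj_space 1) \<pi> \<and>
     (\<exists>n' \<Phi>. complete_fan n' \<Phi> \<and> locally_trivial (toric n \<Delta>) (proj_space 1) \<pi> (toric n' \<Phi>))"

text \<open>\<open>toric d \<Sigma>\<close> is isomorphic to a toric bundle over \<open>\<P>\<^sup>1\<close> such that \<open>D\<^sub>u\<close> and \<open>D\<^sub>v\<close> become fibers.\<close>

definition bundle_with_fibers ::
    "nat \<Rightarrow> (nat \<Rightarrow> real) set set \<Rightarrow> (nat \<Rightarrow> int) \<Rightarrow> (nat \<Rightarrow> int) \<Rightarrow> bool" where
  "bundle_with_fibers d \<Sigma> u v \<longleftrightarrow>
     (\<exists>n \<Delta> \<pi> \<phi>. toric_bundle_over_P1 n \<Delta> \<pi> \<and> isomorphism (toric d \<Sigma>) (toric n \<Delta>) \<phi> \<and>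
        (\<forall>w \<in> {u, v}. \<exists>y \<in> pts (proj_space 1).
           toric_divisor d \<Sigma> w = {p \<in> pts (toric d \<Sigma>). \<pi> (\<phi> p) = y}))"

section \<open>The construction\<close>

definition plus_fan :: "nat \<Rightarrow> (nat \<Rightarrow> real) set set \<Rightarrow> (nat \<Rightarrow> real) set set" where
  "plus_fan d \<Sigma> = {\<sigma> \<in> \<Sigma>. \<forall>v\<in>\<sigma>. 0 \<le> v d}"

definition minus_fan :: "nat \<Rightarrow> (nat \<Rightarrow> real) set set \<Rightarrow> (nat \<Rightarrow> real) set set" where
  "minus_fan d \<Sigma> = {\<sigma> \<in> \<Sigma>. \<forall>v\<in>\<sigma>. v d \<le> 0}"

definition shear :: "nat \<Rightarrow> (nat \<Rightarrow> int) \<Rightarrow> (nat \<Rightarrow> real) \<Rightarrow> (nat \<Rightarrow> real)" where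
  "shear d q v = (\<lambda>i. if i \<in> {1..<d} then v i + of_int (q i) * v d else v i)"

definition q_minus_fan ::
    "nat \<Rightarrow> (nat \<Rightarrow> int) \<Rightarrow> (nat \<Rightarrow> real) set set \<Rightarrow> (nat \<Rightarrow> real) set set" where
  "q_minus_fan d q \<Sigma> = plus_fan d \<Sigma> \<union> (\<lambda>\<sigma>. shear d q ` \<sigma>) ` minus_fan d \<Sigma>"

text \<open>
  The three maps below are given as graphs, so that no representatives have to be chosen;
  \<open>\<Sigma>t\<close>, \<open>\<Sigma>p\<close>, \<open>\<Sigma>m\<close> are the fans of the varieties \<open>V\<close>-tilde, \<open>V\<^sup>+\<close>, \<open>V\<^sup>-\<close>, and a point of the product
  of \<open>V\<close>-tilde and \<open>\<complex>\<^sup>\<times>\<close> is a pair of an orbit and a nonzero number.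
\<close>

definition ident_plus :: "nat \<Rightarrow> (nat \<Rightarrow> real) set set \<Rightarrow> (nat \<Rightarrow> real) set set \<Rightarrow> nat \<Rightarrow> nat \<Rightarrow>
    (nat \<Rightarrow> nat \<Rightarrow> int) \<Rightarrow> (nat \<Rightarrow> nat \<Rightarrow> int) \<Rightarrow> (coords set \<times> (coords set \<times> complex)) set" where
  "ident_plus d \<Sigma>t \<Sigma>p r m a b =
     {(orbit d \<Sigma>p X, (orbit (d - 1) \<Sigma>t x, z)) | X x z.
        X \<in> (\<Union>\<sigma>\<in>\<Sigma>t. U_chart \<Sigma>p \<sigma>) \<and> x \<in> U_fan \<Sigma>t \<and>
        (\<forall>i \<in> {1..<d}. x (std i) = X (std i) * (\<Prod>j=2..m. X (b j) powi b j i)) \<and>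
        (\<forall>j \<in> {1..r}. x (a j) = X (a j)) \<and>
        z = X (b 1) * (\<Prod>j=2..m. X (b j) powi b j d)}"

definition ident_minus :: "nat \<Rightarrow> (nat \<Rightarrow> real) set set \<Rightarrow> (nat \<Rightarrow> real) set set \<Rightarrow> nat \<Rightarrow> nat \<Rightarrow>
    (nat \<Rightarrow> nat \<Rightarrow> int) \<Rightarrow> (nat \<Rightarrow> nat \<Rightarrow> int) \<Rightarrow> (coords set \<times> (coords set \<times> complex)) set" where
  "ident_minus d \<Sigma>t \<Sigma>m r n a c =
     {(orbit d \<Sigma>m X, (orbit (d - 1) \<Sigma>t x, w)) | X x w.
        X \<in> (\<Union>\<sigma>\<in>\<Sigma>t. U_chart \<Sigma>m \<sigma>) \<and> x \<in> U_fan \<Sigma>t \<and>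
        (\<forall>i \<in> {1..<d}. x (std i) = X (std i) * (\<Prod>j=2..n. X (c j) powi (c j i + c 1 i * c j d))) \<and>
        (\<forall>j \<in> {1..r}. x (a j) = X (a j)) \<and>
        w = X (c 1) * (\<Prod>j=2..n. X (c j) powi (- c j d))}"

definition patching :: "nat \<Rightarrow> (nat \<Rightarrow> real) set set \<Rightarrow> nat \<Rightarrow> (nat \<Rightarrow> nat \<Rightarrow> int) \<Rightarrow> (nat \<Rightarrow> nat \<Rightarrow> int) \<Rightarrow>
    nat \<Rightarrow> complex \<Rightarrow> ((coords set \<times> complex) \<times> (coords set \<times> complex)) set" where
  "patching d \<Sigma>t r a c k t =
     {((orbit (d - 1) \<Sigma>t x, w), (orbit (d - 1) \<Sigma>t x', z)) | x w x' z.
        x \<in> U_fan \<Sigma>t \<and> w \<noteq> 0 \<and> x' \<in> U_fan \<Sigma>t \<and>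
        x' (std 1) = x (std 1) * w powi c 1 1 + t * x (a 1) * w ^ k \<and>
        (\<forall>i \<in> {2..<d}. x' (std i) = x (std i) * w powi c 1 i) \<and>
        (\<forall>j \<in> {1..r}. x' (a j) = x (a j)) \<and>
        z = 1 / w}"

definition deformed_variety :: "nat \<Rightarrow> (nat \<Rightarrow> real) set set \<Rightarrow> (nat \<Rightarrow> real) set set \<Rightarrow>
    nat \<Rightarrow> nat \<Rightarrow> nat \<Rightarrow> (nat \<Rightarrow> nat \<Rightarrow> int) \<Rightarrow> (nat \<Rightarrow> nat \<Rightarrow> int) \<Rightarrow> (nat \<Rightarrow> nat \<Rightarrow> int) \<Rightarrow>
    nat \<Rightarrow> complex \<Rightarrow> (coords set + coords set) set space_fun" where
  "deformed_variety d \<Sigma>t \<Sigma> r m n a b c k t =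
     glue (toric d (plus_fan d \<Sigma>)) (toric d (minus_fan d \<Sigma>))
       ((ident_minus d \<Sigma>t (minus_fan d \<Sigma>) r n a c O patching d \<Sigma>t r a c k t O
         (ident_plus d \<Sigma>t (plus_fan d \<Sigma>) r m a b)\<inverse>)\<inverse>)"

end

theory Submission
  imports Defs "HOL-Computational_Algebra.Polynomial" "HOL-Computational_Algebra.Fundamental_Theorem_Algebra"
begin

text \<open>
  Write \<open>D\<^sub>v\<close> for the torus-invariant divisor of a ray \<open>v\<close>.  Suppose first that \<open>a 1 1 = - 1\<close> and
  \<open>a j 1 = 0\<close> for \<open>j \<ge> 2\<close>, so that the coordinates of \<open>std 1\<close> and \<open>a 1\<close> have the same degree.  Then
  \<open>(X, Y) \<mapsto> (z\<^sup>k X - t Y, X / t)\<close>, applied to these two coordinates on \<open>V\<^sup>+\<close>, and the addition of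
  \<open>X \<Prod>j. W\<^sub>j ^ (k c\<^sub>j\<^sub>,\<^sub>d + c\<^sub>j\<^sub>,\<^sub>1) / t\<close> to \<open>Y\<close> on \<open>V\<^sup>-\<close> are automorphisms of \<open>V\<^sup>+\<close> and \<open>V\<^sup>-\<close>; the two
  conditions of the theorem make them polynomial.  They turn \<open>x\<^sup>+ = x\<^sup>- w\<^sup>c + t y w\<^sup>k\<close> into a monomial
  transition, which is the one between the charts of the sheared fan.

  The coordinates of the \<open>a j\<close> come from the hypothesis on \<open>V\<close>-tilde: there is a regular function outside
  \<open>D\<^bsub>a 1\<^esub>\<close> that vanishes exactly on \<open>D\<^bsub>std 1\<^esub>\<close>.  For a bundle it is a coordinate of the base; for a
  projective space it is a quotient of powers of the equations of the two divisors, which exist because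
  polynomial rings are factorial.  Such a function is nowhere zero, hence constant, along the lines on
  which only a coordinate different from those of \<open>std 1\<close> and \<open>a 1\<close> varies.  So it is a polynomial in
  the coordinate of \<open>std 1\<close> alone, and this is compatible with the torus action only if
  \<open>a j 1 = 0\<close> for \<open>j \<ge> 2\<close>.  Completeness and nonsingularity then force \<open>a 1 1 = - 1\<close>.
\<close>

section \<open>Unique factorization for polynomial functions\<close>

text \<open>The shear vector can be read off from the two substitutions. Let X', Y' be the new
  coordinates of \<open>std 1\<close> and \<open>a 1\<close>. On the overlap X' on the plus side is
  w^(c_11 - k) times X' on the minus side, and Y' is w^k times Y'. The one-parameter subgroup of the
  relation a_1 = sum of a_1i e_i rescales Y' by w^(-k) and the i-th basis coordinate by w^(k a_1i).
  As a_11 = -1, the exponents of w become c_11 - 2k and c_1i + k a_1i, which, since c_1d = -1, are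
  the coordinates of c_1 sheared by (2k, -k a_12, ...).

  The hypothesis on V-tilde speaks of an abstract isomorphism, which need not respect the torus.
  Hence the rays cannot be recovered by comparing fans; they are recovered from regular functions,
  and this is where unique factorization enters.\<close>

definition is_subring :: "'a::idom set \<Rightarrow> bool" where
  "is_subring A \<longleftrightarrow> 0 \<in> A \<and> 1 \<in> A \<and>
     (\<forall>x\<in>A. \<forall>y\<in>A. x + y \<in> A \<and> x * y \<in> A) \<and> (\<forall>x\<in>A. - x \<in> A)"

text \<open>Rings are subsets of one domain because the coefficient ring changes within an induction
  over the set of variables. Divisibility is therefore relative: the quotient has to lie in
  \<open>A\<close> too.\<close>

definition sdvd :: "'a::idom set \<Rightarrow> 'a \<Rightarrow> 'a \<Rightarrow> bool" where
  "sdvd A x y \<longleftrightarrow> (\<exists>z\<in>A. y = x * z)"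

definition sprime :: "'a::idom set \<Rightarrow> 'a \<Rightarrow> bool" where
  "sprime A p \<longleftrightarrow> p \<in> A \<and> p \<noteq> 0 \<and> \<not> sdvd A p 1 \<and>
     (\<forall>x\<in>A. \<forall>y\<in>A. sdvd A p (x * y) \<longrightarrow> sdvd A p x \<or> sdvd A p y)"

text \<open>Factors are primes, not merely irreducible elements. In this form uniqueness of the
  factorization is automatic, and only existence has to be carried over to polynomial rings.\<close>

definition factorial_subring :: "'a::idom set \<Rightarrow> bool" where
  "factorial_subring A \<longleftrightarrow> is_subring A \<and>
     (\<forall>x\<in>A. x \<noteq> 0 \<longrightarrow> (\<exists>u ps. u \<in> A \<and> sdvd A u 1 \<and> (\<forall>p\<in>set ps. sprime A p) \<and> x = u * prod_list ps))"

definition polys_over :: "'a::idom set \<Rightarrow> 'a poly set" where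
  "polys_over A = {f. \<forall>i. coeff f i \<in> A}"

lemma is_subringD:
  assumes "is_subring A"
  shows "0 \<in> A" "1 \<in> A" "x \<in> A \<Longrightarrow> y \<in> A \<Longrightarrow> x + y \<in> A" "x \<in> A \<Longrightarrow> y \<in> A \<Longrightarrow> x * y \<in> A"
    "x \<in> A \<Longrightarrow> - x \<in> A" "x \<in> A \<Longrightarrow> y \<in> A \<Longrightarrow> x - y \<in> A" "x \<in> A \<Longrightarrow> x ^ n \<in> A"
proof -
  show "0 \<in> A" "1 \<in> A" "x \<in> A \<Longrightarrow> y \<in> A \<Longrightarrow> x + y \<in> A" "x \<in> A \<Longrightarrow> y \<in> A \<Longrightarrow> x * y \<in> A"
    "x \<in> A \<Longrightarrow> - x \<in> A"
    using assms unfolding is_subring_def by auto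
  show "x \<in> A \<Longrightarrow> y \<in> A \<Longrightarrow> x - y \<in> A"
    using assms unfolding is_subring_def diff_conv_add_uminus by blast
  show "x \<in> A \<Longrightarrow> x ^ n \<in> A"
    using assms unfolding is_subring_def by (induction n) auto
qed

lemma is_subring_sum:
  assumes "is_subring A" "\<And>i. i \<in> S \<Longrightarrow> f i \<in> A"
  shows "sum f S \<in> A"
  using assms(2) by (induction S rule: infinite_finite_induct) (auto intro: is_subringD[OF assms(1)])

lemma is_subring_prod_list:
  assumes "is_subring A" "set ps \<subseteq> A"
  shows "prod_list ps \<in> A"
  using assms(2) by (induction ps) (auto intro: is_subringD[OF assms(1)])

lemma sprime_in_subring: "sprime A p \<Longrightarrow> p \<in> A"
  by (simp add: sprime_def)

lemma sprime_prod_list_in_subring: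
  "is_subring A \<Longrightarrow> \<forall>p\<in>set ps. sprime A p \<Longrightarrow> prod_list ps \<in> A"
  by (rule is_subring_prod_list) (auto simp: sprime_def)

lemma sprime_dvd_prod_list:
  assumes "is_subring A" "sprime A p" "set xs \<subseteq> A" "sdvd A p (prod_list xs)"
  shows "\<exists>x\<in>set xs. sdvd A p x"
  using assms(3,4)
proof (induction xs)
  case Nil
  then show ?case using assms(2) by (simp add: sprime_def)
next
  case (Cons x xs)
  then show ?case
    using assms(2) is_subring_prod_list[OF assms(1), of xs] unfolding sprime_def by auto
qed

section \<open>Polynomial rings over a factorial ring (Gauss)\<close>

lemma polys_overI: "(\<And>i. coeff f i \<in> A) \<Longrightarrow> f \<in> polys_over A"
  by (simp add: polys_over_def)

lemma polys_overD: "f \<in> polys_over A \<Longrightarrow> coeff f i \<in> A"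
  by (simp add: polys_over_def)

lemma is_subring_polys_over:
  assumes A: "is_subring A"
  shows "is_subring (polys_over A)"
  unfolding is_subring_def polys_over_def
  using is_subringD[OF A]
  by (auto simp: coeff_mult coeff_1 intro!: is_subring_sum[OF A])

lemma const_polys_over: "is_subring A \<Longrightarrow> x \<in> A \<Longrightarrow> [:x:] \<in> polys_over A"
  by (auto simp: polys_over_def coeff_pCons is_subringD split: nat.splits)

lemma monom_polys_over: "is_subring A \<Longrightarrow> x \<in> A \<Longrightarrow> monom x n \<in> polys_over A"
  by (auto simp: polys_over_def is_subringD)

lemma sdvd_const_iff:
  assumes A: "is_subring A"
  shows "sdvd (polys_over A) [:x:] f \<longleftrightarrow> (\<forall>i. sdvd A x (coeff f i))"
proof
  assume "sdvd (polys_over A) [:x:] f"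
  then show "\<forall>i. sdvd A x (coeff f i)"
    unfolding sdvd_def polys_over_def by auto
next
  assume "\<forall>i. sdvd A x (coeff f i)"
  then obtain z where z: "\<And>i. z i \<in> A" "\<And>i. coeff f i = x * z i"
    unfolding sdvd_def by metis
  let ?g = "Poly (map z [0..<Suc (degree f)])"
  have coeff: "coeff ?g i = (if i \<le> degree f then z i else 0)" for i
    by (simp add: nth_default_def coeff_Poly_eq del: upt_Suc)
  have "?g \<in> polys_over A"
    by (rule polys_overI) (simp only: coeff z is_subringD[OF A] split: if_split, simp)
  moreover have "f = [:x:] * ?g"
  proof (rule poly_eqI)
    fix i
    have "coeff ([:x:] * ?g) i = x * coeff ?g i"
      by (simp del: upt_Suc map_upt_Suc coeff_Poly_eq)
    also have "\<dots> = coeff f i"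
      by (cases "i \<le> degree f") (simp_all only: coeff z(2)[symmetric] if_True if_False, simp add: coeff_eq_0)
    finally show "coeff f i = coeff ([:x:] * ?g) i" ..
  qed
  ultimately show "sdvd (polys_over A) [:x:] f"
    unfolding sdvd_def by blast
qed

text \<open>Gauss's lemma. Let \<open>i\<close> and \<open>j\<close> be the lowest degrees in which
  the coefficients of \<open>f\<close> and \<open>g\<close> are not divisible by \<open>p\<close>.
  In the coefficient of \<open>f * g\<close> at \<open>i + j\<close> every summand except
  \<open>coeff f i * coeff g j\<close> is a multiple of \<open>p\<close>, so \<open>p\<close> would
  divide that product of two coefficients prime to it.\<close>

lemma sprime_const:
  assumes A: "is_subring A" and p: "sprime A p"
  shows "sprime (polys_over A) [:p:]"
proof -
  have "False" if f: "f \<in> polys_over A" "g \<in> polys_over A" and dvd: "sdvd (polys_over A) [:p:] (f * g)"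
    and nf: "\<not> sdvd (polys_over A) [:p:] f" and ng: "\<not> sdvd (polys_over A) [:p:] g" for f g
  proof -
    define i where "i = (LEAST i. \<not> sdvd A p (coeff f i))"
    define j where "j = (LEAST i. \<not> sdvd A p (coeff g i))"
    have i: "\<not> sdvd A p (coeff f i)" "\<And>k. k < i \<Longrightarrow> sdvd A p (coeff f k)"
      using nf unfolding sdvd_const_iff[OF A] i_def by (metis LeastI_ex, metis not_less_Least)
    have j: "\<not> sdvd A p (coeff g j)" "\<And>k. k < j \<Longrightarrow> sdvd A p (coeff g k)"
      using ng unfolding sdvd_const_iff[OF A] j_def by (metis LeastI_ex, metis not_less_Least)
    have "\<exists>z\<in>A. (\<Sum>k\<in>{..i+j} - {i}. coeff f k * coeff g (i + j - k)) = p * z"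
    proof -
      have "\<exists>z\<in>A. coeff f k * coeff g (i + j - k) = p * z" if "k \<in> {..i+j} - {i}" for k
      proof (cases "k < i")
        case True
        then obtain z where "z \<in> A" "coeff f k = p * z" using i(2) unfolding sdvd_def by blast
        then show ?thesis
          using polys_overD[OF f(2)] is_subringD(4)[OF A] by (metis mult.assoc)
      next
        case False
        with that have "i + j - k < j" by auto
        then obtain z where "z \<in> A" "coeff g (i + j - k) = p * z" using j(2) unfolding sdvd_def by blast
        then show ?thesis
          using polys_overD[OF f(1)] is_subringD(4)[OF A] by (metis mult.left_commute)
      qed
      then obtain z where z: "\<And>k. k \<in> {..i+j} - {i} \<Longrightarrow> z k \<in> A \<and> coeff f k * coeff g (i + j - k) = p * z k"
        by metis
      have "(\<Sum>k\<in>{..i+j} - {i}. coeff f k * coeff g (i + j - k)) = p * (\<Sum>k\<in>{..i+j} - {i}. z k)"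
        unfolding sum_distrib_left by (rule sum.cong) (use z in auto)
      moreover have "(\<Sum>k\<in>{..i+j} - {i}. z k) \<in> A"
        by (rule is_subring_sum[OF A]) (use z in auto)
      ultimately show ?thesis by blast
    qed
    then obtain z where z: "z \<in> A" "(\<Sum>k\<in>{..i+j} - {i}. coeff f k * coeff g (i + j - k)) = p * z"
      by blast
    have "coeff (f * g) (i + j) = coeff f i * coeff g j + p * z"
      unfolding coeff_mult by (subst sum.remove[of _ i]) (auto simp: z)
    moreover obtain y where "y \<in> A" "coeff (f * g) (i + j) = p * y"
      using dvd[unfolded sdvd_const_iff[OF A]] unfolding sdvd_def by blast
    ultimately have "coeff f i * coeff g j = p * (y - z)" "y - z \<in> A"
      using z is_subringD[OF A] by (simp_all add: algebra_simps)
    then have "sdvd A p (coeff f i * coeff g j)"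
      unfolding sdvd_def by blast
    then show False
      using p i(1) j(1) f polys_overD unfolding sprime_def by blast
  qed
  moreover have "\<not> sdvd (polys_over A) [:p:] 1"
    using p unfolding sdvd_const_iff[OF A] sprime_def by (auto intro!: exI[of _ 0])
  ultimately show ?thesis
    using p const_polys_over[OF A] unfolding sprime_def by auto
qed

text \<open>Instead of dividing by the leading coefficient of \<open>r\<close>, each reduction
  multiplies \<open>f\<close> by it, so all coefficients stay in \<open>A\<close>. The disjunct
  \<open>s = 0\<close> covers constant \<open>r\<close>, for which no degree is smaller.\<close>

lemma pseudo_division:
  assumes A: "is_subring A" and r: "r \<in> polys_over A" "r \<noteq> 0" and f: "f \<in> polys_over A"
  shows "\<exists>k q s. q \<in> polys_over A \<and> s \<in> polys_over A \<and> [:lead_coeff r ^ k:] * f = q * r + s \<and>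
           (s = 0 \<or> degree s < degree r)"
  using f
proof (induction "degree f" arbitrary: f rule: less_induct)
  case less
  note P = is_subringD[OF is_subring_polys_over[OF A]]
  show ?case
  proof (cases "f = 0 \<or> degree f < degree r")
    case True
    then show ?thesis
      using less.prems P by (intro exI[of _ 0] exI[of _ f]) auto
  next
    case False
    let ?c = "lead_coeff r" and ?m = "monom (lead_coeff f) (degree f - degree r)"
    have c: "?c \<in> A" "lead_coeff f \<in> A" using r less.prems by (auto simp: polys_over_def)
    have m: "?m \<in> polys_over A" using c monom_polys_over[OF A] by blast
    define f' where "f' = [:?c:] * f - ?m * r"
    have f': "f' \<in> polys_over A"
      unfolding f'_def
      by (rule P(6)[OF P(4)[OF const_polys_over[OF A c(1)] less.prems] P(4)[OF m r(1)]])
    have "f' = 0 \<or> degree f' < degree f"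
    proof (rule disjCI)
      assume "\<not> degree f' < degree f"
      have "degree f' \<le> degree f"
        unfolding f'_def
      proof (rule degree_diff_le)
        show "degree ([:?c:] * f) \<le> degree f" by simp
        show "degree (?m * r) \<le> degree f"
          using False degree_mult_le[of ?m r] degree_monom_le[of "lead_coeff f" "degree f - degree r"] by linarith
      qed
      with \<open>\<not> degree f' < degree f\<close> have deg: "degree f' = degree f" by simp
      have "coeff f' (degree f) = 0"
        unfolding f'_def using False by (simp add: coeff_monom_mult)
      with deg show "f' = 0" by (metis leading_coeff_0_iff)
    qed
    then have "\<exists>k q s. q \<in> polys_over A \<and> s \<in> polys_over A \<and> [:?c ^ k:] * f' = q * r + s \<and>
           (s = 0 \<or> degree s < degree r)"
    proof
      assume "f' = 0"
      then show ?thesis using P by (intro exI[of _ 0]) auto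
    next
      assume "degree f' < degree f"
      then show ?thesis using less.hyps f' by blast
    qed
    then obtain k q s where *: "q \<in> polys_over A" "s \<in> polys_over A" "[:?c ^ k:] * f' = q * r + s"
      "s = 0 \<or> degree s < degree r"
      by blast
    have "[:?c ^ Suc k:] * f = [:?c ^ k:] * ([:?c:] * f)"
      by (simp add: mult.commute)
    also have "[:?c:] * f = f' + ?m * r" by (simp add: f'_def)
    also have "[:?c ^ k:] * (f' + ?m * r) = (q + [:?c ^ k:] * ?m) * r + s"
      using *(3) by (simp add: algebra_simps)
    finally have "[:?c ^ Suc k:] * f = (q + [:?c ^ k:] * ?m) * r + s" .
    moreover have "q + [:?c ^ k:] * ?m \<in> polys_over A"
      by (rule P(3)[OF *(1) P(4)[OF const_polys_over[OF A is_subringD(7)[OF A c(1)]] m]])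
    ultimately show ?thesis using * by blast
  qed
qed

text \<open>By \<open>sdvd_const_iff\<close> no prime of \<open>A\<close> divides all coefficients:
  the condition that the content is a unit, expressed without a gcd.\<close>

definition primitive_over :: "'a::idom set \<Rightarrow> 'a poly \<Rightarrow> bool" where
  "primitive_over A f \<longleftrightarrow> (\<forall>p. sprime A p \<longrightarrow> \<not> sdvd (polys_over A) [:p:] f)"

lemma degree_0_eq_const: "degree f = 0 \<Longrightarrow> f = [:lead_coeff f:]"
  by (metis degree_0_id)

lemma const_poly_mult_cancel: "(c::'a::idom) \<noteq> 0 \<Longrightarrow> [:c:] * x = [:c:] * y \<Longrightarrow> x = y"
  by (metis mult_left_cancel pCons_eq_0_iff)

text \<open>If \<open>f * k\<close> equals a constant times \<open>g\<close>, each prime factor of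
  the constant divides \<open>f\<close> or \<open>k\<close> by \<open>sprime_const\<close>. It
  cannot divide the primitive \<open>f\<close>, so it is cancelled from \<open>k\<close>; the
  remaining unit is inverted.\<close>

lemma primitive_dvd_cancel_const:
  assumes A: "is_subring A" and f: "f \<in> polys_over A" "primitive_over A f"
    and u: "u \<in> A" "sdvd A u 1" and ps: "\<forall>p\<in>set ps. sprime A p"
    and g: "g \<in> polys_over A" and dvd: "sdvd (polys_over A) f ([:u * prod_list ps:] * g)"
  shows "sdvd (polys_over A) f g"
  using ps dvd
proof (induction ps)
  note P = is_subringD[OF is_subring_polys_over[OF A]]
  case Nil
  obtain u' where u': "u' \<in> A" "1 = u * u'" using u unfolding sdvd_def by blast
  obtain k where k: "k \<in> polys_over A" "[:u:] * g = f * k"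
    using Nil unfolding sdvd_def by auto
  have "g = [:u * u':] * g" by (simp flip: u'(2))
  also have "[:u * u':] * g = f * ([:u':] * k)"
    using arg_cong[OF k(2), of "\<lambda>x. [:u':] * x"] by (simp add: ac_simps)
  finally show ?case
    unfolding sdvd_def using P(4)[OF const_polys_over[OF A u'(1)] k(1)] by blast
next
  case (Cons p ps)
  note P = is_subringD[OF is_subring_polys_over[OF A]]
  obtain k where k: "k \<in> polys_over A" "[:u * prod_list (p # ps):] * g = f * k"
    using Cons.prems unfolding sdvd_def by auto
  have p: "sprime A p" using Cons.prems by simp
  let ?g = "[:u * prod_list ps:] * g"
  have "prod_list ps \<in> A" using sprime_prod_list_in_subring[OF A] Cons.prems by auto
  then have g': "?g \<in> polys_over A"
    using P(4)[OF const_polys_over[OF A] g] is_subringD(4)[OF A u(1)] by blast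
  have eq: "f * k = [:p:] * ?g" using k(2) by (simp add: ac_simps)
  have "sdvd (polys_over A) [:p:] k"
    using sprime_const[OF A p] f eq k(1) g' p unfolding sprime_def primitive_over_def sdvd_def by blast
  then obtain k' where k': "k' \<in> polys_over A" "k = [:p:] * k'" unfolding sdvd_def by blast
  have "p \<noteq> 0" using p unfolding sprime_def by simp
  then have "?g = f * k'" using eq k' const_poly_mult_cancel[of p ?g "f * k'"] by (metis mult.left_commute)
  then have "sdvd (polys_over A) f ?g" unfolding sdvd_def using k' by blast
  then show ?case using Cons by auto
qed

text \<open>Clearing denominators in a factorization over the field of fractions. Each prime of the
  constant divides \<open>q\<close> or \<open>r\<close> and is removed from that factor, which
  leaves the degrees unchanged; \<open>c\<close> collects what was taken out of
  \<open>r\<close>.\<close>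

lemma primitive_factor_const:
  assumes A: "is_subring A" and f: "f \<in> polys_over A"
    and u: "u \<in> A" "sdvd A u 1" and ps: "\<forall>p\<in>set ps. sprime A p"
    and qr: "q \<in> polys_over A" "r \<in> polys_over A" "[:u * prod_list ps:] * f = q * r"
  shows "\<exists>q1 r1 c. q1 \<in> polys_over A \<and> r1 \<in> polys_over A \<and> c \<in> A \<and> f = q1 * r1 \<and>
           degree q1 = degree q \<and> degree r1 = degree r \<and> r = [:c:] * r1"
  using ps qr
proof (induction ps arbitrary: q r)
  note P = is_subringD[OF is_subring_polys_over[OF A]]
  case Nil
  obtain u' where u': "u' \<in> A" "1 = u * u'" using u unfolding sdvd_def by blast
  have "f = [:u * u':] * f" by (simp flip: u'(2))
  also have "\<dots> = ([:u':] * q) * r"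
    using arg_cong[OF Nil(4), of "\<lambda>x. [:u':] * x"] by (simp add: ac_simps)
  finally have "f = ([:u':] * q) * r" .
  moreover have "degree ([:u':] * q) = degree q" using u' by auto
  ultimately show ?case
    using Nil P(4)[OF const_polys_over[OF A u'(1)] Nil(2)] is_subringD(2)[OF A]
    by (intro exI[of _ "[:u':] * q"] exI[of _ r] exI[of _ 1]) (simp_all flip: one_pCons)
next
  case (Cons p ps)
  have p: "sprime A p" using Cons.prems by simp
  then have p0: "p \<noteq> 0" "p \<in> A" unfolding sprime_def by auto
  have "prod_list ps \<in> A" using sprime_prod_list_in_subring[OF A] Cons.prems by auto
  then have f': "[:u * prod_list ps:] * f \<in> polys_over A"
    using is_subringD(4)[OF is_subring_polys_over[OF A] const_polys_over[OF A] f] is_subringD(4)[OF A u(1)] by blast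
  have eq: "q * r = [:p:] * ([:u * prod_list ps:] * f)" using Cons.prems(4) by (simp add: ac_simps)
  then have "sdvd (polys_over A) [:p:] (q * r)" unfolding sdvd_def using f' by blast
  then have "sdvd (polys_over A) [:p:] q \<or> sdvd (polys_over A) [:p:] r"
    using sprime_const[OF A p] Cons.prems unfolding sprime_def by blast
  then show ?case
  proof
    assume "sdvd (polys_over A) [:p:] q"
    then obtain q' where q': "q' \<in> polys_over A" "q = [:p:] * q'" unfolding sdvd_def by blast
    then have "[:u * prod_list ps:] * f = q' * r"
      using eq const_poly_mult_cancel[OF p0(1), of "[:u * prod_list ps:] * f" "q' * r"] by (metis mult.assoc)
    then show ?thesis using Cons.IH[of q' r] q' Cons.prems p0 by auto
  next
    assume "sdvd (polys_over A) [:p:] r"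
    then obtain r' where r': "r' \<in> polys_over A" "r = [:p:] * r'" unfolding sdvd_def by blast
    then have "[:u * prod_list ps:] * f = q * r'"
      using eq const_poly_mult_cancel[OF p0(1), of "[:u * prod_list ps:] * f" "q * r'"] by (metis mult.left_commute)
    then obtain q1 r1 c where *: "q1 \<in> polys_over A" "r1 \<in> polys_over A" "c \<in> A" "f = q1 * r1"
      "degree q1 = degree q" "degree r1 = degree r'" "r' = [:c:] * r1"
      using Cons.IH[of q r'] r' Cons.prems by auto
    then have "r = [:p * c:] * r1" "degree r = degree r'" using r' p0 by (auto simp: ac_simps)
    then show ?thesis using * is_subringD(4)[OF A p0(2) *(3)] by metis
  qed
qed

text \<open>A prime dividing all coefficients divides the leading coefficient, so it is associated
  to one of the finitely many primes in \<open>ps\<close>. Removing it shortens this list, and the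
  length of \<open>ps\<close> is the induction measure.\<close>

lemma primitive_part_exists:
  assumes A: "is_subring A" and f: "f \<in> polys_over A" "f \<noteq> 0"
    and u: "u \<in> A" and ps: "\<forall>p\<in>set ps. sprime A p" and lc: "sdvd A u 1" "lead_coeff f = u * prod_list ps"
  shows "\<exists>cs f0. (\<forall>p\<in>set cs. sprime A p) \<and> f0 \<in> polys_over A \<and> primitive_over A f0 \<and>
           f = [:prod_list cs:] * f0"
  using f u ps lc
proof (induction "length ps" arbitrary: ps f u rule: less_induct)
  case less
  show ?case
  proof (cases "primitive_over A f")
    case True
    then show ?thesis using less.prems by (intro exI[of _ "[]"] exI[of _ f]) (simp flip: one_pCons)
  next
    case False
    then obtain p where p: "sprime A p" "sdvd (polys_over A) [:p:] f" unfolding primitive_over_def by blast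
    obtain f1 where f1: "f1 \<in> polys_over A" "f = [:p:] * f1" using p unfolding sdvd_def by blast
    have p0: "p \<noteq> 0" "p \<in> A" using p unfolding sprime_def by auto
    have lc: "u * prod_list ps = p * lead_coeff f1" using f1 less.prems(6) p0 by (simp add: lead_coeff_mult)
    have "lead_coeff f1 \<in> A" using f1 polys_overD by blast
    then have "sdvd A p (u * prod_list ps)" unfolding sdvd_def using lc by blast
    moreover have "prod_list ps \<in> A" using sprime_prod_list_in_subring[OF A] less.prems by auto
    moreover have "\<not> sdvd A p u"
    proof
      assume "sdvd A p u"
      then obtain v where v: "v \<in> A" "u = p * v" unfolding sdvd_def by blast
      obtain u' where u': "u' \<in> A" "1 = u * u'" using less.prems(5) unfolding sdvd_def by blast
      have "1 = p * (v * u')" using v u' by (simp add: ac_simps)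
      then show False using p(1) is_subringD(4)[OF A v(1) u'(1)] unfolding sprime_def sdvd_def by blast
    qed
    ultimately have "sdvd A p (prod_list ps)" using p(1) less.prems(3) unfolding sprime_def by blast
    then obtain q where q: "q \<in> set ps" "sdvd A p q"
      using sprime_dvd_prod_list[OF A p(1), of ps] less.prems(4) sprime_in_subring by blast
    obtain w where w: "w \<in> A" "q = p * w" using q unfolding sdvd_def by blast
    have qp: "sprime A q" using q less.prems(4) by blast
    have q0: "q \<noteq> 0" "q \<in> A" using qp unfolding sprime_def by auto
    have "sdvd A q (p * w)" unfolding sdvd_def using w is_subringD(2)[OF A] by auto
    then have "sdvd A q p \<or> sdvd A q w" using qp w p0 unfolding sprime_def by blast
    moreover have "\<not> sdvd A q w"
    proof
      assume "sdvd A q w"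
      then obtain v where v: "v \<in> A" "w = q * v" unfolding sdvd_def by blast
      have "q * 1 = q * (p * v)" using w(2) v(2) by (metis mult.left_commute mult.right_neutral)
      then have "1 = p * v" using q0 by (metis mult_left_cancel)
      then show False using p(1) v unfolding sprime_def sdvd_def by blast
    qed
    ultimately obtain v where v: "v \<in> A" "p = q * v" unfolding sdvd_def by blast
    have "p * 1 = p * (w * v)" using v(2) w(2) by (metis mult.assoc mult.right_neutral)
    then have wv: "1 = w * v" using p0 by (metis mult_left_cancel)
    obtain u' where u': "u' \<in> A" "1 = u * u'" using less.prems(5) unfolding sdvd_def by blast
    have "u * w * (u' * v) = (u * u') * (w * v)" by (simp only: ac_simps)
    then have "1 = u * w * (u' * v)" by (simp flip: wv u'(2))
    then have unit: "sdvd A (u * w) 1"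
      unfolding sdvd_def using is_subringD(4)[OF A u'(1) v(1)] by blast
    define ps' where "ps' = remove1 q ps"
    have prod: "prod_list ps = q * prod_list ps'"
      unfolding ps'_def using q(1) by (induction ps) (auto simp: ac_simps)
    have lc1: "lead_coeff f1 = (u * w) * prod_list ps'"
    proof -
      have "p * lead_coeff f1 = p * ((u * w) * prod_list ps')"
        unfolding lc[symmetric] prod w(2) by (simp only: ac_simps)
      then show ?thesis using p0 by simp
    qed
    have "length ps' < length ps"
      using length_pos_if_in_set[OF q(1)] by (simp add: ps'_def length_remove1 q(1))
    moreover have "f1 \<noteq> 0" using f1 less.prems by auto
    moreover have "\<forall>p\<in>set ps'. sprime A p" using less.prems(4) set_remove1_subset unfolding ps'_def by fast
    ultimately obtain cs f0 where cs: "\<forall>p\<in>set cs. sprime A p" "f0 \<in> polys_over A" "primitive_over A f0"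
      "f1 = [:prod_list cs:] * f0"
      using less.hyps[of ps' f1 "u * w"] f1 is_subringD(4)[OF A less.prems(3) w(1)] unit lc1 by blast
    have "f = [:prod_list (p # cs):] * f0" using f1 cs(4) by (simp add: ac_simps)
    then show ?thesis using cs p by (intro exI[of _ "p # cs"] exI[of _ f0]) auto
  qed
qed

text \<open>Induction on the degree after splitting off the content. A primitive \<open>f0\<close>
  either splits into factors of smaller degree or is shown to be prime; the second case is the
  Euclidean argument over the field of fractions, carried out with pseudo-division so that
  everything stays over \<open>A\<close>.\<close>

theorem factorial_subring_polys_over:
  assumes A: "factorial_subring A"
  shows "factorial_subring (polys_over A)"
proof -
  have sA: "is_subring A" using A unfolding factorial_subring_def by blast
  note sP = is_subring_polys_over[OF sA]
  note P = is_subringD[OF sP]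
  have fact: "\<exists>u ps. u \<in> A \<and> sdvd A u 1 \<and> (\<forall>p\<in>set ps. sprime A p) \<and> x = u * prod_list ps"
    if "x \<in> A" "x \<noteq> 0" for x
    using A that unfolding factorial_subring_def by blast
  let ?Q = "\<lambda>f. \<exists>u ps. u \<in> polys_over A \<and> sdvd (polys_over A) u 1 \<and>
    (\<forall>p\<in>set ps. sprime (polys_over A) p) \<and> f = u * prod_list ps"
  have Q_mult: "?Q (f * g)" if f: "?Q f" and g: "?Q g" for f g
  proof -
    obtain u ps where *: "u \<in> polys_over A" "sdvd (polys_over A) u 1"
      "\<forall>p\<in>set ps. sprime (polys_over A) p" "f = u * prod_list ps"
      using f by blast
    obtain v qs where **: "v \<in> polys_over A" "sdvd (polys_over A) v 1"
      "\<forall>p\<in>set qs. sprime (polys_over A) p" "g = v * prod_list qs"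
      using g by blast
    obtain u' v' where "u' \<in> polys_over A" "1 = u * u'" "v' \<in> polys_over A" "1 = v * v'"
      using *(2) **(2) unfolding sdvd_def by blast
    moreover from this have "1 = (u * v) * (u' * v')" by (metis mult.assoc mult.left_commute mult_1_right)
    ultimately have "sdvd (polys_over A) (u * v) 1" unfolding sdvd_def using P(4) by blast
    moreover have "f * g = (u * v) * prod_list (ps @ qs)" using *(4) **(4) by (simp add: ac_simps)
    moreover have "\<forall>p\<in>set (ps @ qs). sprime (polys_over A) p" using *(3) **(3) by auto
    ultimately show ?thesis using P(4)[OF *(1) **(1)] by blast
  qed
  have Q_prime: "?Q f" if "sprime (polys_over A) f" for f
    using that P(2) by (intro exI[of _ 1] exI[of _ "[f]"]) (auto simp: sdvd_def)
  have Q_primes: "?Q [:prod_list ps:]" if "\<forall>p\<in>set ps. sprime A p" for ps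
    using that
  proof (induction ps)
    case Nil
    show ?case using P(2) by (intro exI[of _ 1] exI[of _ "[]"]) (auto simp: sdvd_def)
  next
    case (Cons p ps)
    have "?Q ([:p:] * [:prod_list ps:])"
      by (rule Q_mult[OF Q_prime Cons.IH]) (use Cons.prems sprime_const[OF sA] in auto)
    moreover have "[:prod_list (p # ps):] = [:p:] * [:prod_list ps:]" by simp
    ultimately show ?case by (simp only:)
  qed
  have "?Q f" if "f \<in> polys_over A" "f \<noteq> 0" for f
    using that
  proof (induction "degree f" arbitrary: f rule: less_induct)
    case less
    obtain u ps where u: "u \<in> A" "sdvd A u 1" "\<forall>p\<in>set ps. sprime A p" "lead_coeff f = u * prod_list ps"
      using fact[of "lead_coeff f"] less.prems polys_overD by (metis leading_coeff_0_iff)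
    obtain u' where u': "u' \<in> A" "1 = u * u'" using u unfolding sdvd_def by blast
    show ?case
    proof (cases "degree f = 0")
      case True
      then have "f = [:u:] * [:prod_list ps:]" using u(4) degree_0_eq_const[of f] by simp
      moreover have "?Q [:u:]"
      proof -
        have "[:u:] * [:u':] = [:u * u':]" by simp
        then have "1 = [:u:] * [:u':]" by (simp only: u'(2)[symmetric] one_pCons)
        then have "sdvd (polys_over A) [:u:] 1"
          unfolding sdvd_def using const_polys_over[OF sA u'(1)] by blast
        then show ?thesis using const_polys_over[OF sA u(1)]
          by (intro exI[of _ "[:u:]"] exI[of _ "[]"] conjI) simp_all
      qed
      ultimately show ?thesis using Q_mult Q_primes[OF u(3)] by metis
    next
      case False
      obtain cs f0 where cs: "\<forall>p\<in>set cs. sprime A p" "f0 \<in> polys_over A" "primitive_over A f0"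
        "f = [:prod_list cs:] * f0"
        using primitive_part_exists[OF sA less.prems u(1,3,2,4)] by blast
      have "f0 \<noteq> 0" using cs less.prems by auto
      have deg: "degree f0 = degree f" using cs less.prems by auto
      have "?Q f0"
      proof (cases "\<exists>g h. g \<in> polys_over A \<and> h \<in> polys_over A \<and> f0 = g * h \<and> degree g < degree f \<and> degree h < degree f")
        case True
        then obtain g h where "g \<in> polys_over A" "h \<in> polys_over A" "f0 = g * h" "degree g < degree f" "degree h < degree f"
          by blast
        moreover from this have "g \<noteq> 0" "h \<noteq> 0" using \<open>f0 \<noteq> 0\<close> by auto
        ultimately show ?thesis using less.hyps[of g] less.hyps[of h] Q_mult by metis
      next
        case irred: False
        have "sdvd (polys_over A) f0 h"
          if g: "g \<in> polys_over A" and h: "h \<in> polys_over A" and gh: "sdvd (polys_over A) f0 (g * h)"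
            and ng: "\<not> sdvd (polys_over A) f0 g" for g h
        proof -
          \<comment> \<open>The ideal generated by \<open>f0\<close> and \<open>g\<close>. Its
            nonzero element \<open>r\<close> of least degree plays the role of a greatest common
            divisor over the field of fractions.\<close>
          define J where "J = {x * f0 + y * g | x y. x \<in> polys_over A \<and> y \<in> polys_over A}"
          have J: "J \<subseteq> polys_over A" unfolding J_def using P(3,4) cs(2) g by auto
          have "f0 = 1 * f0 + 0 * g" by simp
          then have f0J: "f0 \<in> J" unfolding J_def using P(1,2) by blast
          have "g = 0 * f0 + 1 * g" by simp
          then have gJ: "g \<in> J" unfolding J_def using P(1,2) by blast
          obtain r where r: "r \<in> J" "r \<noteq> 0" "\<And>s. s \<in> J \<Longrightarrow> s \<noteq> 0 \<Longrightarrow> degree r \<le> degree s"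
            using ex_has_least_nat[of "\<lambda>r. r \<in> J \<and> r \<noteq> 0" f0 degree] f0J \<open>f0 \<noteq> 0\<close> by blast
          have rP: "r \<in> polys_over A" using r J by blast
          let ?c = "lead_coeff r"
          have c: "?c \<in> A" "?c \<noteq> 0" using rP r(2) polys_overD by auto
          \<comment> \<open>The pseudo-remainder of an element of \<open>J\<close> lies in
            \<open>J\<close> and has smaller degree than \<open>r\<close>, so it vanishes.\<close>
          have div: "\<exists>k q. q \<in> polys_over A \<and> [:?c ^ k:] * x = q * r" if x: "x \<in> J" for x
          proof -
            obtain k q s where *: "q \<in> polys_over A" "s \<in> polys_over A" "[:?c ^ k:] * x = q * r + s"
              "s = 0 \<or> degree s < degree r"
              using pseudo_division[OF sA rP r(2), of x] x J by blast
            have ck: "[:?c ^ k:] \<in> polys_over A" using const_polys_over[OF sA is_subringD(7)[OF sA c(1)]] .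
            obtain x1 x2 r1 r2 where **: "x = x1 * f0 + x2 * g" "r = r1 * f0 + r2 * g"
              "x1 \<in> polys_over A" "x2 \<in> polys_over A" "r1 \<in> polys_over A" "r2 \<in> polys_over A"
              using x r(1) unfolding J_def by blast
            have "s = [:?c ^ k:] * x - q * r" using *(3) by simp
            also have "\<dots> = ([:?c ^ k:] * x1 - q * r1) * f0 + ([:?c ^ k:] * x2 - q * r2) * g"
              unfolding **(1) by (subst (2) **(2)) (simp add: algebra_simps del: mult_pCons_left mult_pCons_right)
            finally have "s = ([:?c ^ k:] * x1 - q * r1) * f0 + ([:?c ^ k:] * x2 - q * r2) * g" .
            moreover have "[:?c ^ k:] * x1 - q * r1 \<in> polys_over A" "[:?c ^ k:] * x2 - q * r2 \<in> polys_over A"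
              using P(6)[OF P(4) P(4)] ck * ** by blast+
            ultimately have "s \<in> J" unfolding J_def by blast
            then have "s = 0" using r(3) *(4) by fastforce
            then show ?thesis using * by auto
          qed
          show ?thesis
          proof (cases "degree r = 0")
            case True
            then have rc: "r = [:?c:]" by (rule degree_0_eq_const)
            obtain r1 r2 where r12: "r = r1 * f0 + r2 * g" "r1 \<in> polys_over A" "r2 \<in> polys_over A"
              using r(1) unfolding J_def by blast
            obtain k where k: "k \<in> polys_over A" "g * h = f0 * k" using gh unfolding sdvd_def by blast
            \<comment> \<open>Bezout: a nonzero constant in the ideal makes a constant multiple of
              \<open>h\<close> divisible by \<open>f0\<close>, and since \<open>f0\<close> is
              primitive the constant can be cancelled.\<close>
            have "r * h = r1 * f0 * h + r2 * (g * h)"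
              by (subst r12(1)) (simp only: distrib_right mult.assoc)
            also have "\<dots> = f0 * (r1 * h + r2 * k)"
              unfolding k(2) by (simp only: distrib_left ac_simps)
            finally have "r * h = f0 * (r1 * h + r2 * k)" .
            then have "sdvd (polys_over A) f0 ([:?c:] * h)"
              unfolding sdvd_def rc[symmetric] using P(3)[OF P(4)[OF r12(2) h] P(4)[OF r12(3) k(1)]] by blast
            moreover obtain v qs where "v \<in> A" "sdvd A v 1" "\<forall>p\<in>set qs. sprime A p" "?c = v * prod_list qs"
              using fact[OF c] by blast
            ultimately show ?thesis using primitive_dvd_cancel_const[OF sA cs(2,3) _ _ _ h] by metis
          next
            case False
            obtain k q where kq: "q \<in> polys_over A" "[:?c ^ k:] * f0 = q * r" using div[OF f0J] by blast
            obtain k' q' where kq': "q' \<in> polys_over A" "[:?c ^ k':] * g = q' * r" using div[OF gJ] by blast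
            have ck: "?c ^ j \<in> A" "?c ^ j \<noteq> 0" for j using c is_subringD(7)[OF sA] by auto
            \<comment> \<open>Clearing the constant in \<open>[:?c ^ k:] * f0 = q * r\<close> splits
              \<open>f0\<close> with \<open>r1\<close> of positive degree. As \<open>f0\<close> does
              not split into smaller degrees, \<open>q1\<close> is constant, and as
              \<open>f0\<close> is primitive, \<open>q1\<close> is a unit. So \<open>r\<close> is a
              constant multiple of \<open>f0\<close>, and \<open>f0\<close> divides a constant
              multiple of \<open>g\<close>.\<close>
            obtain v qs where v: "v \<in> A" "sdvd A v 1" "\<forall>p\<in>set qs. sprime A p" "?c ^ k = v * prod_list qs"
              using fact[OF ck] by blast
            obtain q1 r1 e where q1: "q1 \<in> polys_over A" "r1 \<in> polys_over A" "e \<in> A" "f0 = q1 * r1"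
              "degree q1 = degree q" "degree r1 = degree r" "r = [:e:] * r1"
              using primitive_factor_const[OF sA cs(2) v(1,2,3) kq(1) rP] kq(2) unfolding v(4) by blast
            have "q1 \<noteq> 0" "r1 \<noteq> 0" using q1(4) \<open>f0 \<noteq> 0\<close> by auto
            then have "degree f = degree q1 + degree r1" using deg q1(4) degree_mult_eq by metis
            then have "degree q1 = 0" using irred q1 False by fastforce
            then have q1c: "q1 = [:lead_coeff q1:]" by (rule degree_0_eq_const)
            obtain w ws where w: "w \<in> A" "sdvd A w 1" "\<forall>p\<in>set ws. sprime A p" "lead_coeff q1 = w * prod_list ws"
              using fact[of "lead_coeff q1"] q1(1) \<open>q1 \<noteq> 0\<close> polys_overD by (metis leading_coeff_0_iff)
            have "ws = []"
            proof (cases ws)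
              case (Cons p ps)
              have "prod_list ps \<in> A" using w(3) sprime_prod_list_in_subring[OF sA] Cons by auto
              then have "[:w * prod_list ps:] * r1 \<in> polys_over A"
                using P(4)[OF const_polys_over[OF sA is_subringD(4)[OF sA w(1)]] q1(2)] by blast
              moreover have "f0 = [:p:] * ([:w * prod_list ps:] * r1)"
                using q1(4) q1c w(4) Cons by (simp add: ac_simps)
              ultimately have "sdvd (polys_over A) [:p:] f0" unfolding sdvd_def by blast
              then show ?thesis using cs(3) w(3) Cons unfolding primitive_over_def by auto
            qed
            then have "q1 = [:w:]" using q1c w(4) by simp
            obtain w' where w': "w' \<in> A" "1 = w * w'" using w unfolding sdvd_def by blast
            have "r1 = [:w * w':] * r1" by (simp flip: w'(2))
            also have "\<dots> = f0 * [:w':]" using q1(4) \<open>q1 = [:w:]\<close> by (simp add: ac_simps)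
            finally have "r1 = f0 * [:w':]" .
            then have "[:?c ^ k':] * g = f0 * (q' * [:e:] * [:w':])"
              using kq'(2) q1(7) by (metis mult.assoc mult.left_commute)
            then have "sdvd (polys_over A) f0 ([:?c ^ k':] * g)"
              unfolding sdvd_def using P(4)[OF P(4)[OF kq'(1)]] const_polys_over[OF sA] q1(3) w'(1) by blast
            moreover obtain v qs where "v \<in> A" "sdvd A v 1" "\<forall>p\<in>set qs. sprime A p" "?c ^ k' = v * prod_list qs"
              using fact[OF ck] by blast
            ultimately have "sdvd (polys_over A) f0 g" using primitive_dvd_cancel_const[OF sA cs(2,3) _ _ _ g] by metis
            with ng show ?thesis by blast
          qed
        qed
        moreover have "\<not> sdvd (polys_over A) f0 1"
        proof
          assume "sdvd (polys_over A) f0 1"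
          then obtain z where "1 = f0 * z" unfolding sdvd_def by blast
          then have "degree f0 = 0" by (metis degree_1 degree_mult_eq add_eq_0_iff_both_eq_0 mult_zero_left mult_zero_right zero_neq_one)
          then show False using False deg by simp
        qed
        ultimately have "sprime (polys_over A) f0" using cs(2) \<open>f0 \<noteq> 0\<close> unfolding sprime_def by blast
        then show ?thesis by (rule Q_prime)
      qed
      then show ?thesis using Q_mult[OF Q_primes[OF cs(1)]] cs(4) by metis
    qed
  qed
  then show ?thesis unfolding factorial_subring_def using sP by blast
qed

section \<open>Polynomial functions in several variables\<close>

lemma poly_fun_mono: "p \<in> poly_fun I \<Longrightarrow> I \<subseteq> J \<Longrightarrow> p \<in> poly_fun J"
  by (induction rule: poly_fun.induct) (auto intro: poly_fun.intros)

lemma poly_fun_uminus: "p \<in> poly_fun I \<Longrightarrow> (\<lambda>x. - p x) \<in> poly_fun I"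
  using poly_fun.mult[OF poly_fun.const[of "-1"], of p I] by simp

lemma poly_fun_diff: "p \<in> poly_fun I \<Longrightarrow> q \<in> poly_fun I \<Longrightarrow> (\<lambda>x. p x - q x) \<in> poly_fun I"
  using poly_fun.add[OF _ poly_fun_uminus, of p I q] by simp

lemma poly_fun_sum: "(\<And>i. i \<in> S \<Longrightarrow> f i \<in> poly_fun I) \<Longrightarrow> (\<lambda>x. \<Sum>i\<in>S. f i x) \<in> poly_fun I"
  by (induction S rule: infinite_finite_induct) (auto intro: poly_fun.intros)

lemma poly_fun_prod: "(\<And>i. i \<in> S \<Longrightarrow> f i \<in> poly_fun I) \<Longrightarrow> (\<lambda>x. \<Prod>i\<in>S. f i x) \<in> poly_fun I"
  by (induction S rule: infinite_finite_induct) (auto intro: poly_fun.intros)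

lemma poly_fun_power: "p \<in> poly_fun I \<Longrightarrow> (\<lambda>x. p x ^ n) \<in> poly_fun I"
  by (induction n) (auto intro: poly_fun.intros)

lemma poly_fun_cong: "p \<in> poly_fun I \<Longrightarrow> (\<And>i. i \<in> I \<Longrightarrow> x i = y i) \<Longrightarrow> p x = p y"
  by (induction rule: poly_fun.induct) auto

lemma poly_fun_compose:
  "p \<in> poly_fun I \<Longrightarrow> (\<And>i. i \<in> I \<Longrightarrow> (\<lambda>x. f x i) \<in> poly_fun J) \<Longrightarrow> (\<lambda>x. p (f x)) \<in> poly_fun J"
  by (induction rule: poly_fun.induct) (auto intro: poly_fun.intros)

lemma poly_fun_on_curve:
  assumes "p \<in> poly_fun I" "\<And>i. i \<in> I \<Longrightarrow> \<exists>q. \<forall>s. \<gamma> s i = poly q s"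
  shows "\<exists>q. \<forall>s. p (\<gamma> s) = poly q s"
  using assms(1)
proof (induction rule: poly_fun.induct)
  case (const c)
  show ?case by (rule exI[of _ "[:c:]"]) simp
next
  case (add p q)
  then show ?case by (metis poly_add)
next
  case (mult p q)
  then show ?case by (metis poly_mult)
qed (use assms(2) in auto)

lemma poly_fun_zeros_on_curve:
  assumes "p \<in> poly_fun I" "\<And>i. i \<in> I \<Longrightarrow> \<exists>q. \<forall>s. \<gamma> s i = poly q s" "p (\<gamma> s0) \<noteq> 0"
  shows "finite {s. p (\<gamma> s) = 0}"
proof -
  obtain q where q: "\<And>s. p (\<gamma> s) = poly q s" using poly_fun_on_curve[of p I \<gamma>] assms(1,2) by blast
  then have "q \<noteq> 0" using assms(3) by auto
  then show ?thesis unfolding q by (rule poly_roots_finite)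
qed

definition line :: "('i \<Rightarrow> complex) \<Rightarrow> ('i \<Rightarrow> complex) \<Rightarrow> complex \<Rightarrow> 'i \<Rightarrow> complex" where
  "line x y s = (\<lambda>i. x i + s * (y i - x i))"

lemma line_simps [simp]: "line x y 0 = x" "line x y 1 = y"
  by (simp_all add: line_def)

lemma line_poly: "\<exists>q. \<forall>s. line x y s i = poly q s"
  by (rule exI[of _ "[:x i, y i - x i:]"]) (simp add: line_def)

lemma line_tuples: "x \<in> tuples I \<Longrightarrow> y \<in> tuples I \<Longrightarrow> line x y s \<in> tuples I"
  by (simp add: tuples_def line_def)

lemma poly_fun_zeros_on_line:
  assumes "p \<in> poly_fun I" "p (line x y s0) \<noteq> 0"
  shows "finite {s. p (line x y s) = 0}"
proof (rule poly_fun_zeros_on_curve[OF assms(1), where \<gamma> = "line x y"])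
  show "\<exists>q. \<forall>s. line x y s i = poly q s" for i by (rule line_poly)
qed (rule assms(2))

lemma finite_nonroot: "finite {s::complex. P s} \<Longrightarrow> \<exists>s. \<not> P s"
  using infinite_UNIV_char_0[where 'a = complex] by (metis (mono_tags) UNIV_eq_I mem_Collect_eq)

text \<open>Irreducibility of affine space. If \<open>x\<close> avoids the zeros of all of
  \<open>S\<close> and \<open>y\<close> those of \<open>p\<close>, then on the line joining them
  each of the finitely many functions has only finitely many zeros, so some point of the line avoids
  them all.\<close>

lemma poly_fun_common_nonzero:
  assumes "finite S" "\<And>p. p \<in> S \<Longrightarrow> p \<in> poly_fun I" "\<And>p. p \<in> S \<Longrightarrow> \<exists>x\<in>tuples I. p x \<noteq> 0"
  shows "\<exists>x\<in>tuples I. \<forall>p\<in>S. p x \<noteq> 0"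
  using assms
proof (induction S)
  case empty
  show ?case by (intro bexI[of _ "\<lambda>_. 0"]) (auto simp: tuples_def)
next
  case (insert p S)
  have "\<exists>x\<in>tuples I. \<forall>p\<in>S. p x \<noteq> 0"
  proof (rule insert.IH)
    fix q assume q: "q \<in> S"
    show "q \<in> poly_fun I" by (rule insert.prems(1)) (simp add: q)
    show "\<exists>x\<in>tuples I. q x \<noteq> 0" by (rule insert.prems(2)) (simp add: q)
  qed
  then obtain x where x: "x \<in> tuples I" "\<forall>p\<in>S. p x \<noteq> 0" by auto
  obtain y where y: "y \<in> tuples I" "p y \<noteq> 0" using insert.prems(2)[OF insertI1] by auto
  have "finite {s. q (line x y s) = 0}" if "q \<in> insert p S" for q
  proof (cases "q = p")
    case True
    then show ?thesis using poly_fun_zeros_on_line[OF insert.prems(1)[OF that], of x y 1] y by simp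
  next
    case False
    then show ?thesis using poly_fun_zeros_on_line[OF insert.prems(1)[OF that], of x y 0] x that by simp
  qed
  then have "finite (\<Union>q\<in>insert p S. {s. q (line x y s) = 0})" using insert.hyps by auto
  then have "finite {s. \<exists>q\<in>insert p S. q (line x y s) = 0}" by (rule rev_finite_subset) auto
  from finite_nonroot[OF this] obtain s where "\<forall>q\<in>insert p S. q (line x y s) \<noteq> 0" by blast
  then show ?case using line_tuples[OF x(1) y(1)] by blast
qed

section \<open>Polynomial functions form a factorial ring\<close>

typedef 'i polyfun = "poly_fun (UNIV :: 'i set)"
  morphisms pfun Abs_polyfun
  using poly_fun.const by blast

setup_lifting type_definition_polyfun

instantiation polyfun :: (type) comm_ring_1
begin
lift_definition zero_polyfun :: "'a polyfun" is "\<lambda>_. 0" by (rule poly_fun.const)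
lift_definition one_polyfun :: "'a polyfun" is "\<lambda>_. 1" by (rule poly_fun.const)
lift_definition plus_polyfun :: "'a polyfun \<Rightarrow> 'a polyfun \<Rightarrow> 'a polyfun" is "\<lambda>p q x. p x + q x"
  by (rule poly_fun.add)
lift_definition times_polyfun :: "'a polyfun \<Rightarrow> 'a polyfun \<Rightarrow> 'a polyfun" is "\<lambda>p q x. p x * q x"
  by (rule poly_fun.mult)
lift_definition uminus_polyfun :: "'a polyfun \<Rightarrow> 'a polyfun" is "\<lambda>p x. - p x"
  by (rule poly_fun_uminus)
lift_definition minus_polyfun :: "'a polyfun \<Rightarrow> 'a polyfun \<Rightarrow> 'a polyfun" is "\<lambda>p q x. p x - q x"
  by (rule poly_fun_diff)
instance
  by standard (transfer, simp add: fun_eq_iff algebra_simps)+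
end

instance polyfun :: (type) idom
proof
  fix p q :: "'a polyfun"
  assume "p \<noteq> 0" "q \<noteq> 0"
  then obtain x y where "pfun p x \<noteq> 0" "pfun q y \<noteq> 0"
    by (metis (no_types) ext pfun_inject zero_polyfun.rep_eq)
  then have "\<exists>x\<in>tuples UNIV. \<forall>f\<in>{pfun p, pfun q}. f x \<noteq> 0"
    using pfun[of p] pfun[of q] by (intro poly_fun_common_nonzero) (auto simp: tuples_def)
  then obtain z where "pfun (p * q) z \<noteq> 0"
    by (auto simp: times_polyfun.rep_eq)
  then show "p * q \<noteq> 0"
    by (auto simp: zero_polyfun.rep_eq)
qed

lemmas pfun_simps = zero_polyfun.rep_eq one_polyfun.rep_eq plus_polyfun.rep_eq times_polyfun.rep_eq
  uminus_polyfun.rep_eq minus_polyfun.rep_eq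

lemma pfun_eqI: "(\<And>x. pfun p x = pfun q x) \<Longrightarrow> p = q"
  by (metis ext pfun_inject)

text \<open>The ambient ring uses all variables of the index type, so that it is a single integral
  domain; polynomials in the variables of \<open>I\<close> form a subring of it, and adjoining a
  variable enlarges the subring only.\<close>

definition polys_in :: "'i set \<Rightarrow> 'i polyfun set" where
  "polys_in I = {p. pfun p \<in> poly_fun I}"

lift_definition pvar :: "'i \<Rightarrow> 'i polyfun" is "\<lambda>i x. x i" by (simp add: poly_fun.coord)

lemma is_subring_polys_in: "is_subring (polys_in I)"
  unfolding is_subring_def polys_in_def
  by (auto simp: pfun_simps intro: poly_fun.intros poly_fun_uminus)

lemma pfun_poly: "pfun (poly q y) x = poly (map_poly (\<lambda>c. pfun c x) q) (pfun y x)"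
  by (induction q) (auto simp: pfun_simps map_poly_pCons)

text \<open>The variable \<open>i\<close> is transcendental over the functions in the variables
  \<open>I\<close>: changing the \<open>i\<close>-th argument leaves the coefficients fixed, so at
  each point the specialized one-variable polynomial vanishes for all values of its
  variable.\<close>

lemma poly_pvar_eq_0:
  assumes "q \<in> polys_over (polys_in I)" "i \<notin> I" "poly q (pvar i) = 0"
  shows "q = 0"
proof (rule poly_eqI, rule pfun_eqI)
  fix n x
  have "poly (map_poly (\<lambda>c. pfun c x) q) s = 0" for s
  proof -
    have "map_poly (\<lambda>c. pfun c x) q = map_poly (\<lambda>c. pfun c (x(i := s))) q"
    proof (rule poly_eqI)
      fix k
      have "coeff q k \<in> polys_in I" using assms(1) by (rule polys_overD)
      then have "pfun (coeff q k) x = pfun (coeff q k) (x(i := s))"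
        using assms(2) poly_fun_cong[of "pfun (coeff q k)" I x "x(i := s)"]
        unfolding polys_in_def by fastforce
      then show "coeff (map_poly (\<lambda>c. pfun c x) q) k = coeff (map_poly (\<lambda>c. pfun c (x(i := s))) q) k"
        by (simp add: coeff_map_poly pfun_simps)
    qed
    then have "poly (map_poly (\<lambda>c. pfun c x) q) s = pfun (poly q (pvar i)) (x(i := s))"
      by (simp add: pfun_poly pvar.rep_eq)
    then show ?thesis using assms(3) by (simp add: pfun_simps)
  qed
  then have "map_poly (\<lambda>c. pfun c x) q = 0" by (simp only: poly_all_0_iff_0[symmetric] simp_thms)
  then show "pfun (coeff q n) x = pfun (coeff 0 n) x"
    by (metis coeff_0 coeff_map_poly pfun_simps(1))
qed

lemma polys_in_insert:
  "polys_in (insert i I) = (\<lambda>q. poly q (pvar i)) ` polys_over (polys_in I)"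
proof (intro equalityI subsetI)
  fix p :: "'a polyfun"
  note A = is_subring_polys_in[of I]
  note P = is_subringD[OF is_subring_polys_over[OF A]]
  assume "p \<in> polys_in (insert i I)"
  then have "pfun p \<in> poly_fun (insert i I)" unfolding polys_in_def by simp
  then have "\<exists>q\<in>polys_over (polys_in I). pfun p = pfun (poly q (pvar i))"
  proof (induction rule: poly_fun.induct)
    case (const c)
    have "Abs_polyfun (\<lambda>_. c) \<in> polys_in I"
      by (simp add: polys_in_def Abs_polyfun_inverse poly_fun.const)
    then show ?case
      by (intro bexI[of _ "[:Abs_polyfun (\<lambda>_. c):]"] const_polys_over[OF A])
         (simp add: Abs_polyfun_inverse poly_fun.const)
  next
    case (coord j)
    show ?case
    proof (cases "j = i")
      case True
      have "[:0, 1:] \<in> polys_over (polys_in I)"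
        using is_subringD[OF A] by (auto simp: polys_over_def coeff_pCons split: nat.splits)
      then show ?thesis using True by (intro bexI[of _ "[:0, 1:]"]) (auto simp: pvar.rep_eq)
    next
      case False
      then have "pvar j \<in> polys_in I" using coord by (simp add: polys_in_def pvar.rep_eq poly_fun.coord)
      then show ?thesis using const_polys_over[OF A] by (intro bexI[of _ "[:pvar j:]"]) (auto simp: pvar.rep_eq)
    qed
  next
    case (add p q)
    then obtain p' q' where "p' \<in> polys_over (polys_in I)" "q' \<in> polys_over (polys_in I)"
      "p = pfun (poly p' (pvar i))" "q = pfun (poly q' (pvar i))" by blast
    then show ?case using P(3) by (intro bexI[of _ "p' + q'"]) (auto simp: pfun_simps)
  next
    case (mult p q)
    then obtain p' q' where "p' \<in> polys_over (polys_in I)" "q' \<in> polys_over (polys_in I)"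
      "p = pfun (poly p' (pvar i))" "q = pfun (poly q' (pvar i))" by blast
    then show ?case using P(4) by (intro bexI[of _ "p' * q'"]) (auto simp: pfun_simps)
  qed
  then show "p \<in> (\<lambda>q. poly q (pvar i)) ` polys_over (polys_in I)" by (auto simp: pfun_inject)
next
  fix p assume "p \<in> (\<lambda>q. poly q (pvar i)) ` polys_over (polys_in I)"
  then obtain q where q: "q \<in> polys_over (polys_in I)" "p = poly q (pvar i)" by blast
  have "pvar i \<in> polys_in (insert i I)" by (simp add: polys_in_def pvar.rep_eq poly_fun.coord)
  moreover have "coeff q k \<in> polys_in (insert i I)" for k
    using polys_overD[OF q(1), of k] poly_fun_mono[of _ I "insert i I"] unfolding polys_in_def by blast
  ultimately show "p \<in> polys_in (insert i I)"
    unfolding q(2) poly_altdef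
    by (intro is_subring_sum[OF is_subring_polys_in] is_subringD(4,7)[OF is_subring_polys_in])
qed

text \<open>Divisibility and primality refer to the subring only, so it suffices that
  \<open>f\<close> is an injective homomorphism on \<open>A\<close>; nothing is asked of it
  outside.\<close>

lemma factorial_subring_transport:
  assumes f: "factorial_subring A"
    and inj: "inj_on f A" and one: "f 1 = 1" and zero: "f 0 = 0"
    and add: "\<And>x y. x \<in> A \<Longrightarrow> y \<in> A \<Longrightarrow> f (x + y) = f x + f y"
    and mult: "\<And>x y. x \<in> A \<Longrightarrow> y \<in> A \<Longrightarrow> f (x * y) = f x * f y"
    and sub: "is_subring (f ` A)"
  shows "factorial_subring (f ` A)"
proof -
  have sA: "is_subring A" using f unfolding factorial_subring_def by blast
  note A = is_subringD[OF sA]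
  have dvd: "sdvd (f ` A) (f x) (f y) \<longleftrightarrow> sdvd A x y" if "x \<in> A" "y \<in> A" for x y
  proof
    assume "sdvd (f ` A) (f x) (f y)"
    then obtain z where z: "z \<in> A" "f y = f x * f z" unfolding sdvd_def by auto
    then have "f y = f (x * z)" using mult[OF that(1) z(1)] by simp
    then show "sdvd A x y" unfolding sdvd_def
      using inj_onD[OF inj _ that(2) A(4)[OF that(1) z(1)]] z(1) by blast
  next
    assume "sdvd A x y"
    then obtain z where z: "z \<in> A" "y = x * z" unfolding sdvd_def by blast
    then show "sdvd (f ` A) (f x) (f y)" unfolding sdvd_def using mult[OF that(1) z(1)] by blast
  qed
  have prime: "sprime (f ` A) (f p)" if p: "sprime A p" for p
  proof -
    have pA: "p \<in> A" "p \<noteq> 0" "\<not> sdvd A p 1" using p unfolding sprime_def by auto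
    have "f p \<noteq> 0" using pA inj_onD[OF inj _ pA(1) A(1)] zero by auto
    moreover have "\<not> sdvd (f ` A) (f p) 1" using dvd[OF pA(1) A(2)] pA one by simp
    moreover have "sdvd (f ` A) (f p) (f x) \<or> sdvd (f ` A) (f p) (f y)"
      if "x \<in> A" "y \<in> A" "sdvd (f ` A) (f p) (f x * f y)" for x y
    proof -
      have "sdvd (f ` A) (f p) (f (x * y))" using that(3) mult[OF that(1,2)] by simp
      then have "sdvd A p (x * y)" using dvd[OF pA(1) A(4)[OF that(1,2)]] by simp
      then have "sdvd A p x \<or> sdvd A p y" using p that(1,2) unfolding sprime_def by blast
      then show ?thesis using dvd[OF pA(1) that(1)] dvd[OF pA(1) that(2)] by simp
    qed
    ultimately show ?thesis unfolding sprime_def using pA(1) by (simp only: ball_simps) blast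
  qed
  have "\<exists>u ps. u \<in> f ` A \<and> sdvd (f ` A) u 1 \<and> (\<forall>p\<in>set ps. sprime (f ` A) p) \<and> f x = u * prod_list ps"
    if "x \<in> A" "f x \<noteq> 0" for x
  proof -
    have "x \<noteq> 0" using that zero by auto
    with f that(1) have "\<exists>u ps. u \<in> A \<and> sdvd A u 1 \<and> (\<forall>p\<in>set ps. sprime A p) \<and> x = u * prod_list ps"
      unfolding factorial_subring_def by (elim conjE ballE[of _ _ x]) simp_all
    then obtain u ps where *: "u \<in> A" "sdvd A u 1" "\<forall>p\<in>set ps. sprime A p" "x = u * prod_list ps"
      by (elim exE conjE)
    have "f (prod_list ps) = prod_list (map f ps)" using *(3)
    proof (induction ps)
      case (Cons p ps)
      then have "f (p * prod_list ps) = f p * f (prod_list ps)"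
        by (intro mult sprime_in_subring sprime_prod_list_in_subring[OF sA]) simp_all
      then show ?case using Cons by simp
    qed (simp add: one)
    then have "f x = f u * prod_list (map f ps)"
      using mult[OF *(1) sprime_prod_list_in_subring[OF sA *(3)]] *(4) by simp
    moreover have "sdvd (f ` A) (f u) 1" using dvd[OF *(1) A(2)] *(2) one by simp
    moreover have "\<forall>q\<in>set (map f ps). sprime (f ` A) q"
    proof
      fix q assume "q \<in> set (map f ps)"
      then obtain p where "p \<in> set ps" "q = f p" by auto
      then show "sprime (f ` A) q" using *(3) prime[of p] by simp
    qed
    ultimately show ?thesis using imageI[OF *(1), of f] by metis
  qed
  then show ?thesis unfolding factorial_subring_def using sub by simp
qed

text \<open>Adjoin one variable at a time. The base case is the field of constants, where every
  nonzero element is a unit and the list of primes is empty.\<close>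

theorem factorial_subring_polys_in:
  assumes "finite I"
  shows "factorial_subring (polys_in I)"
  using assms
proof (induction I)
  case empty
  have const: "\<exists>c. \<forall>x. pfun p x = c" if "p \<in> polys_in {}" for p :: "'a polyfun"
  proof -
    have "pfun p \<in> poly_fun {}" using that by (simp add: polys_in_def)
    then show ?thesis by (induction rule: poly_fun.induct) auto
  qed
  have "sdvd (polys_in {}) p 1" if p: "p \<in> polys_in {}" "p \<noteq> 0" for p :: "'a polyfun"
  proof -
    obtain c where c: "\<And>x. pfun p x = c" using const[OF p(1)] by blast
    have "c \<noteq> 0" using p(2) c pfun_eqI[of p 0] by (auto simp: pfun_simps)
    then have "1 = p * Abs_polyfun (\<lambda>_. inverse c)"
      by (intro pfun_eqI) (simp add: pfun_simps c Abs_polyfun_inverse poly_fun.const)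
    moreover have "Abs_polyfun (\<lambda>_. inverse c) \<in> polys_in {}"
      by (simp add: polys_in_def Abs_polyfun_inverse poly_fun.const)
    ultimately show ?thesis unfolding sdvd_def by blast
  qed
  then have "\<exists>u ps. u \<in> polys_in {} \<and> sdvd (polys_in {}) u 1 \<and> (\<forall>p\<in>set ps. sprime (polys_in {}) p) \<and>
      x = u * prod_list ps"
    if "x \<in> polys_in {}" "x \<noteq> 0" for x :: "'a polyfun"
    using that by (intro exI[of _ x] exI[of _ "[]"]) simp
  then show ?case
    unfolding factorial_subring_def using is_subring_polys_in[of "{}::'a set"] by simp
next
  case (insert i I)
  show ?case
    unfolding polys_in_insert
  proof (rule factorial_subring_transport[OF factorial_subring_polys_over[OF insert.IH]])
    show "inj_on (\<lambda>q. poly q (pvar i)) (polys_over (polys_in I))"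
    proof (rule inj_onI)
      fix p q assume pq: "p \<in> polys_over (polys_in I)" "q \<in> polys_over (polys_in I)"
        "poly p (pvar i) = poly q (pvar i)"
      have "p - q = 0"
        using poly_pvar_eq_0[OF is_subringD(6)[OF is_subring_polys_over[OF is_subring_polys_in]] insert.hyps(2)] pq
        by simp
      then show "p = q" by simp
    qed
    show "is_subring ((\<lambda>q. poly q (pvar i)) ` polys_over (polys_in I))"
      unfolding polys_in_insert[symmetric] by (rule is_subring_polys_in)
  qed auto
qed

text \<open>In a factorization of \<open>u\<close> the unit vanishes nowhere, so one of the primes
  vanishes at \<open>x0\<close>. Divisibility is spelled out with plain functions, which is how the
  result is applied to equations of divisors.\<close>

lemma poly_fun_prime_factor:
  assumes I: "finite I" and u: "u \<in> poly_fun I" "x0 \<in> tuples I" "u x0 = 0" "\<exists>x. u x \<noteq> 0"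
  shows "\<exists>f\<in>poly_fun I. f x0 = 0 \<and> (\<exists>x. f x \<noteq> 0) \<and> (\<exists>g\<in>poly_fun I. \<forall>x. u x = f x * g x) \<and>
    (\<forall>p\<in>poly_fun I. \<forall>q\<in>poly_fun I. (\<exists>g\<in>poly_fun I. \<forall>x. p x * q x = f x * g x) \<longrightarrow>
       (\<exists>g\<in>poly_fun I. \<forall>x. p x = f x * g x) \<or> (\<exists>g\<in>poly_fun I. \<forall>x. q x = f x * g x))"
proof -
  note A = is_subring_polys_in[of I]
  have rep: "\<exists>P\<in>polys_in I. pfun P = p" if "p \<in> poly_fun I" for p
  proof -
    have "pfun (Abs_polyfun p) = p"
      by (rule Abs_polyfun_inverse, rule poly_fun_mono[OF that]) simp
    then show ?thesis using that by (intro bexI[of _ "Abs_polyfun p"]) (simp_all add: polys_in_def)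
  qed
  obtain U where U: "U \<in> polys_in I" "pfun U = u" using rep[OF u(1)] by blast
  have "U \<noteq> 0" using U u(4) by (auto simp: pfun_simps)
  then obtain e ps where e: "e \<in> polys_in I" "sdvd (polys_in I) e 1" "\<forall>p\<in>set ps. sprime (polys_in I) p" "U = e * prod_list ps"
    using factorial_subring_polys_in[OF I] U unfolding factorial_subring_def by blast
  obtain e' where "1 = e * e'" using e(2) unfolding sdvd_def by blast
  then have "pfun e x0 * pfun e' x0 = 1" by (metis pfun_simps(2,4))
  then have "pfun e x0 \<noteq> 0" by auto
  moreover have "pfun e x0 * pfun (prod_list ps) x0 = 0" using u(3) U(2) e(4) by (metis pfun_simps(4))
  ultimately have "pfun (prod_list ps) x0 = 0" by simp
  then have "\<exists>F\<in>set ps. pfun F x0 = 0"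
    by (induction ps) (auto simp: pfun_simps)
  then obtain F where F: "F \<in> set ps" "pfun F x0 = 0" by blast
  have Fp: "sprime (polys_in I) F" using e F by blast
  then have F': "pfun F \<in> poly_fun I" "F \<noteq> 0" unfolding sprime_def polys_in_def by auto
  have sdvd: "(\<exists>g\<in>poly_fun I. \<forall>x. pfun P x = pfun F x * g x) \<longleftrightarrow> sdvd (polys_in I) F P" for P
  proof
    assume "\<exists>g\<in>poly_fun I. \<forall>x. pfun P x = pfun F x * g x"
    then obtain g where g: "g \<in> poly_fun I" "\<And>x. pfun P x = pfun F x * g x" by blast
    obtain G where "G \<in> polys_in I" "pfun G = g" using rep[OF g(1)] by blast
    then show "sdvd (polys_in I) F P" unfolding sdvd_def using g
      by (intro bexI[of _ G] pfun_eqI) (auto simp: pfun_simps)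
  next
    assume "sdvd (polys_in I) F P"
    then show "\<exists>g\<in>poly_fun I. \<forall>x. pfun P x = pfun F x * g x"
      unfolding sdvd_def polys_in_def by (auto simp: pfun_simps)
  qed
  show ?thesis
  proof (rule bexI[of _ "pfun F"], intro conjI ballI impI)
    show "\<exists>x. pfun F x \<noteq> 0" using F' pfun_eqI[of F 0] by (auto simp: pfun_simps)
    have "prod_list ps = F * prod_list (remove1 F ps)" using F(1) by (induction ps) (auto simp: ac_simps)
    moreover have "prod_list (remove1 F ps) \<in> polys_in I"
      using sprime_prod_list_in_subring[OF A, of "remove1 F ps"] e(3) set_remove1_subset[of F ps] by blast
    ultimately have "sdvd (polys_in I) F U" unfolding sdvd_def using e(1,4) is_subringD(4)[OF A]
      by (intro bexI[of _ "e * prod_list (remove1 F ps)"]) (auto simp: ac_simps)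
    then show "\<exists>g\<in>poly_fun I. \<forall>x. u x = pfun F x * g x" using sdvd[of U] U by simp
    fix p q assume pq: "p \<in> poly_fun I" "q \<in> poly_fun I" "\<exists>g\<in>poly_fun I. \<forall>x. p x * q x = pfun F x * g x"
    obtain P Q where PQ: "P \<in> polys_in I" "pfun P = p" "Q \<in> polys_in I" "pfun Q = q"
      using rep[OF pq(1)] rep[OF pq(2)] by blast
    have "sdvd (polys_in I) F (P * Q)" using pq(3) sdvd[of "P * Q"] PQ by (simp add: pfun_simps)
    then have "sdvd (polys_in I) F P \<or> sdvd (polys_in I) F Q" using Fp PQ unfolding sprime_def by blast
    then show "(\<exists>g\<in>poly_fun I. \<forall>x. p x = pfun F x * g x) \<or> (\<exists>g\<in>poly_fun I. \<forall>x. q x = pfun F x * g x)"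
      using sdvd[of P] sdvd[of Q] PQ by simp
  qed (simp_all add: F F')
qed

section \<open>Morphisms of spaces with functions\<close>

lemma morphism_compose:
  assumes f: "morphism X Y f" and g: "morphism Y Z g"
  shows "morphism X Z (g \<circ> f)"
proof -
  have cf: "continuous_map (Top X) (Top Y) f" and cg: "continuous_map (Top Y) (Top Z) g"
    using f g unfolding morphism_def by auto
  have "h \<circ> (g \<circ> f) \<in> Reg X {x \<in> pts X. (g \<circ> f) x \<in> W}" if W: "openin (Top Z) W" and h: "h \<in> Reg Z W" for W h
  proof -
    let ?V = "{y \<in> pts Y. g y \<in> W}"
    have "h \<circ> g \<in> Reg Y ?V" using g W h unfolding morphism_def by blast
    moreover have "openin (Top Y) ?V" using cg W unfolding continuous_map_def by blast
    ultimately have "(h \<circ> g) \<circ> f \<in> Reg X {x \<in> pts X. f x \<in> ?V}" using f unfolding morphism_def by blast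
    moreover have "{x \<in> pts X. f x \<in> ?V} = {x \<in> pts X. (g \<circ> f) x \<in> W}"
      using cf unfolding continuous_map_def by auto
    ultimately show ?thesis by (simp add: comp_assoc)
  qed
  then show ?thesis unfolding morphism_def using continuous_map_compose[OF cf cg] by blast
qed

lemma morphism_pts: "morphism X Y f \<Longrightarrow> x \<in> pts X \<Longrightarrow> f x \<in> pts Y"
  unfolding morphism_def continuous_map_def by blast

lemma morphism_preimage: "morphism X Y f \<Longrightarrow> openin (Top Y) W \<Longrightarrow> openin (Top X) {x \<in> pts X. f x \<in> W}"
  unfolding morphism_def continuous_map_def by blast

lemma morphism_Reg:
  "morphism X Y f \<Longrightarrow> openin (Top Y) W \<Longrightarrow> h \<in> Reg Y W \<Longrightarrow> h \<circ> f \<in> Reg X {x \<in> pts X. f x \<in> W}"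
  unfolding morphism_def by blast

section \<open>Quotients and disjoint unions\<close>

lemma topspace_eqI:
  assumes "openin T S" "\<And>W. openin T W \<Longrightarrow> W \<subseteq> S"
  shows "topspace T = S"
  by (intro subset_antisym assms(2) openin_topspace openin_subset[OF assms(1)])

lemma pts_quotient_space: "pts (quotient_space X \<pi>) = \<pi> ` pts X"
proof -
  have "openin (Top (quotient_space X \<pi>)) (\<pi> ` pts X)"
  proof -
    have "{x \<in> pts X. \<pi> x \<in> \<pi> ` pts X} = pts X" by auto
    then show ?thesis unfolding openin_quotient_space by simp
  qed
  then show ?thesis
    by (rule topspace_eqI) (simp add: openin_quotient_space)
qed

lemma morphism_quotient_map: "morphism X (quotient_space X \<pi>) \<pi>"
  unfolding morphism_def continuous_map_def
  by (auto simp: pts_quotient_space openin_quotient_space) (simp add: quotient_space_def)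

text \<open>Universal property of the final structure. Maps out of toric varieties and out of
  gluings are constructed below by checking them upstairs.\<close>

lemma morphism_from_quotient:
  assumes "morphism X Z (h \<circ> \<pi>)"
  shows "morphism (quotient_space X \<pi>) Z h"
proof -
  have pre: "{x \<in> pts X. \<pi> x \<in> {p \<in> \<pi> ` pts X. h p \<in> W}} = {x \<in> pts X. (h \<circ> \<pi>) x \<in> W}" for W
    by auto
  have "openin (Top (quotient_space X \<pi>)) {p \<in> \<pi> ` pts X. h p \<in> W}" if "openin (Top Z) W" for W
    unfolding openin_quotient_space pre using morphism_preimage[OF assms that] by auto
  moreover have "h p \<in> pts Z" if "p \<in> \<pi> ` pts X" for p
    using that morphism_pts[OF assms] by auto
  moreover have "f \<circ> h \<in> Reg (quotient_space X \<pi>) {p \<in> \<pi> ` pts X. h p \<in> W}"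
    if "openin (Top Z) W" "f \<in> Reg Z W" for W f
    using morphism_Reg[OF assms that] pre by (simp add: quotient_space_def comp_assoc)
  ultimately show ?thesis
    unfolding morphism_def continuous_map_def pts_quotient_space by blast
qed

lemma pts_sum_space: "pts (sum_space X Y) = Inl ` pts X \<union> Inr ` pts Y"
proof -
  have "openin (Top (sum_space X Y)) (Inl ` pts X \<union> Inr ` pts Y)"
  proof -
    have "Inl -` (Inl ` pts X \<union> Inr ` pts Y) = pts X" "Inr -` (Inl ` pts X \<union> Inr ` pts Y) = pts Y"
      by auto
    then show ?thesis unfolding openin_sum_space by simp
  qed
  moreover have "W \<subseteq> Inl ` pts X \<union> Inr ` pts Y" if "openin (Top (sum_space X Y)) W" for W
  proof
    fix s assume s: "s \<in> W"
    from that have "Inl -` W \<subseteq> pts X" "Inr -` W \<subseteq> pts Y"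
      unfolding openin_sum_space by (auto dest: openin_subset)
    with s show "s \<in> Inl ` pts X \<union> Inr ` pts Y" by (cases s) auto
  qed
  ultimately show ?thesis by (rule topspace_eqI)
qed

lemma morphism_Inl: "morphism X (sum_space X Y) Inl"
proof -
  have "{x \<in> pts X. Inl x \<in> W} = Inl -` W" if "openin (Top (sum_space X Y)) W" for W
    using that openin_subset unfolding openin_sum_space by fastforce
  then show ?thesis
    unfolding morphism_def continuous_map_def
    by (auto simp: pts_sum_space openin_sum_space) (simp add: sum_space_def)
qed

lemma morphism_Inr: "morphism Y (sum_space X Y) Inr"
proof -
  have "{x \<in> pts Y. Inr x \<in> W} = Inr -` W" if "openin (Top (sum_space X Y)) W" for W
    using that openin_subset unfolding openin_sum_space by fastforce
  then show ?thesis
    unfolding morphism_def continuous_map_def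
    by (auto simp: pts_sum_space openin_sum_space) (simp add: sum_space_def)
qed

lemma morphism_case_sum:
  assumes f: "morphism X Z f" and g: "morphism Y Z g"
  shows "morphism (sum_space X Y) Z (case_sum f g)"
proof -
  have l: "Inl -` {s \<in> Inl ` pts X \<union> Inr ` pts Y. case_sum f g s \<in> W} = {x \<in> pts X. f x \<in> W}" for W
    by auto
  have r: "Inr -` {s \<in> Inl ` pts X \<union> Inr ` pts Y. case_sum f g s \<in> W} = {x \<in> pts Y. g x \<in> W}" for W
    by auto
  have "case_sum f g s \<in> pts Z" if "s \<in> Inl ` pts X \<union> Inr ` pts Y" for s
    using that morphism_pts[OF f] morphism_pts[OF g] by auto
  moreover have "h \<circ> case_sum f g \<in> Reg (sum_space X Y) {s \<in> Inl ` pts X \<union> Inr ` pts Y. case_sum f g s \<in> W}"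
    if "openin (Top Z) W" "h \<in> Reg Z W" for W h
  proof -
    have "(h \<circ> case_sum f g) \<circ> Inl = h \<circ> f" "(h \<circ> case_sum f g) \<circ> Inr = h \<circ> g" by auto
    then show ?thesis
      using morphism_Reg[OF f that] morphism_Reg[OF g that] l r by (simp add: sum_space_def)
  qed
  moreover have "openin (Top (sum_space X Y)) {s \<in> Inl ` pts X \<union> Inr ` pts Y. case_sum f g s \<in> W}"
    if "openin (Top Z) W" for W
    unfolding openin_sum_space l r using morphism_preimage[OF f that] morphism_preimage[OF g that] by simp
  ultimately show ?thesis
    unfolding morphism_def continuous_map_def pts_sum_space by simp
qed

section \<open>Quasi-affine varieties and regular functions\<close>

lemma topspace_zariski: "topspace (zariski I) = tuples I"
proof -
  have "openin (zariski I) (tuples I)"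
    unfolding openin_zariski by (intro exI[of _ "{\<lambda>_. 1}"]) (auto intro: poly_fun.const)
  moreover have "W \<subseteq> tuples I" if "openin (zariski I) W" for W
    using that unfolding openin_zariski by auto
  ultimately show ?thesis by (rule topspace_eqI)
qed

lemma pts_quasi_affine [simp]: "U \<subseteq> tuples I \<Longrightarrow> pts (quasi_affine I U) = U"
  by (auto simp: quasi_affine_def topspace_zariski)

lemma openin_quasi_affine:
  assumes U: "U \<subseteq> tuples I"
  shows "openin (Top (quasi_affine I U)) W \<longleftrightarrow>
    W \<subseteq> U \<and> (\<forall>x\<in>W. \<exists>q\<in>poly_fun I. q x \<noteq> 0 \<and> (\<forall>y\<in>U. q y \<noteq> 0 \<longrightarrow> y \<in> W))"
proof
  assume "openin (Top (quasi_affine I U)) W"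
  then obtain S where S: "S \<subseteq> poly_fun I" "W = {x \<in> tuples I. \<exists>p\<in>S. p x \<noteq> 0} \<inter> U"
    by (auto simp: quasi_affine_def openin_subtopology openin_zariski)
  show "W \<subseteq> U \<and> (\<forall>x\<in>W. \<exists>q\<in>poly_fun I. q x \<noteq> 0 \<and> (\<forall>y\<in>U. q y \<noteq> 0 \<longrightarrow> y \<in> W))"
  proof (intro conjI ballI)
    fix x assume "x \<in> W"
    then obtain p where "p \<in> S" "p x \<noteq> 0" using S(2) by blast
    then show "\<exists>q\<in>poly_fun I. q x \<noteq> 0 \<and> (\<forall>y\<in>U. q y \<noteq> 0 \<longrightarrow> y \<in> W)"
      using S U by (intro bexI[of _ p]) auto
  qed (simp add: S(2))
next
  assume *: "W \<subseteq> U \<and> (\<forall>x\<in>W. \<exists>q\<in>poly_fun I. q x \<noteq> 0 \<and> (\<forall>y\<in>U. q y \<noteq> 0 \<longrightarrow> y \<in> W))"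
  let ?S = "{q \<in> poly_fun I. \<forall>y\<in>U. q y \<noteq> 0 \<longrightarrow> y \<in> W}"
  have "W = {x \<in> tuples I. \<exists>p\<in>?S. p x \<noteq> 0} \<inter> U"
  proof (intro equalityI subsetI)
    fix x assume "x \<in> W"
    moreover from this * obtain q where "q \<in> poly_fun I" "q x \<noteq> 0" "\<forall>y\<in>U. q y \<noteq> 0 \<longrightarrow> y \<in> W"
      by (elim conjE ballE[of _ _ x]) auto
    ultimately show "x \<in> {x \<in> tuples I. \<exists>p\<in>?S. p x \<noteq> 0} \<inter> U" using * U by auto
  qed auto
  moreover have "openin (zariski I) {x \<in> tuples I. \<exists>p\<in>?S. p x \<noteq> 0}"
    unfolding openin_zariski by (rule exI[of _ ?S]) simp
  ultimately have "openin (subtopology (zariski I) U) W"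
    unfolding openin_subtopology by (intro exI conjI)
  then show "openin (Top (quasi_affine I U)) W"
    by (simp add: quasi_affine_def)
qed

text \<open>One fraction is required to be valid on the whole principal open subset of
  \<open>U\<close> where \<open>q\<close> does not vanish. This avoids carrying neighbourhoods
  around: shrinking one means multiplying \<open>p\<close> and \<open>q\<close> by the same
  function.\<close>

definition regular_at :: "'i set \<Rightarrow> ('i \<Rightarrow> complex) set \<Rightarrow> (('i \<Rightarrow> complex) \<Rightarrow> complex) \<Rightarrow> ('i \<Rightarrow> complex) \<Rightarrow> bool" where
  "regular_at I U f x \<longleftrightarrow>
     (\<exists>p q. p \<in> poly_fun I \<and> q \<in> poly_fun I \<and> q x \<noteq> 0 \<and> (\<forall>y\<in>U. q y \<noteq> 0 \<longrightarrow> f y = p y / q y))"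

lemma regular_atI:
  "p \<in> poly_fun I \<Longrightarrow> q \<in> poly_fun I \<Longrightarrow> q x \<noteq> 0 \<Longrightarrow> (\<And>y. y \<in> U \<Longrightarrow> q y \<noteq> 0 \<Longrightarrow> f y = p y / q y) \<Longrightarrow>
   regular_at I U f x"
  unfolding regular_at_def by blast

lemma regular_atE:
  assumes "regular_at I U f x"
  obtains p q where "p \<in> poly_fun I" "q \<in> poly_fun I" "q x \<noteq> 0" "\<And>y. y \<in> U \<Longrightarrow> q y \<noteq> 0 \<Longrightarrow> f y = p y / q y"
  using assms unfolding regular_at_def by blast

text \<open>Multiply numerator and denominator of a local fraction by a function that is nonzero at
  the point and vanishes on \<open>U\<close> outside the neighbourhood. The new fraction is valid
  wherever its denominator is nonzero. Openness of \<open>W\<close> appears on the right because the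
  local neighbourhoods cover \<open>W\<close>.\<close>

lemma Reg_quasi_affine:
  assumes U: "U \<subseteq> tuples I"
  shows "f \<in> Reg (quasi_affine I U) W \<longleftrightarrow>
    openin (Top (quasi_affine I U)) W \<and> (\<forall>x\<in>W. regular_at I U f x)"
proof -
  have top: "Top (quasi_affine I U) = subtopology (zariski I) U" by (simp add: quasi_affine_def)
  have Reg: "f \<in> Reg (quasi_affine I U) W \<longleftrightarrow> (\<forall>x\<in>W. \<exists>W' p q. openin (Top (quasi_affine I U)) W' \<and> x \<in> W' \<and> W' \<subseteq> W \<and>
                    p \<in> poly_fun I \<and> q \<in> poly_fun I \<and> (\<forall>y \<in> W'. q y \<noteq> 0 \<and> f y = p y / q y))"
    by (simp add: quasi_affine_def)
  show ?thesis
  proof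
    assume L: "f \<in> Reg (quasi_affine I U) W"
    have *: "x \<in> U \<and> regular_at I U f x \<and> (\<exists>q\<in>poly_fun I. q x \<noteq> 0 \<and> (\<forall>y\<in>U. q y \<noteq> 0 \<longrightarrow> y \<in> W))"
      if xW: "x \<in> W" for x
    proof -
      obtain W' p q where W': "openin (Top (quasi_affine I U)) W'" "x \<in> W'" "W' \<subseteq> W"
        and pq: "p \<in> poly_fun I" "q \<in> poly_fun I" "\<forall>y \<in> W'. q y \<noteq> 0 \<and> f y = p y / q y"
        using L[unfolded Reg, rule_format, OF xW] by (elim exE conjE)
      have "x \<in> U" using W' unfolding openin_quasi_affine[OF U] by blast
      obtain s where s: "s \<in> poly_fun I" "s x \<noteq> 0" "\<forall>y\<in>U. s y \<noteq> 0 \<longrightarrow> y \<in> W'"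
        using W'(1)[unfolded openin_quasi_affine[OF U], THEN conjunct2, rule_format, OF W'(2)]
        by (elim bexE conjE)
      have "regular_at I U f x"
        by (rule regular_atI[of "\<lambda>x. p x * s x" I "\<lambda>x. q x * s x"])
           (use pq s W' in \<open>auto intro: poly_fun.mult\<close>)
      moreover have "\<exists>q\<in>poly_fun I. q x \<noteq> 0 \<and> (\<forall>y\<in>U. q y \<noteq> 0 \<longrightarrow> y \<in> W)"
        using s W'(3) by (intro bexI[of _ s]) auto
      ultimately show ?thesis using \<open>x \<in> U\<close> by simp
    qed
    then have "\<forall>x\<in>W. regular_at I U f x" by blast
    moreover have "openin (Top (quasi_affine I U)) W"
      unfolding openin_quasi_affine[OF U] using * by blast
    ultimately show "openin (Top (quasi_affine I U)) W \<and> (\<forall>x\<in>W. regular_at I U f x)" by blast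
  next
    assume R: "openin (Top (quasi_affine I U)) W \<and> (\<forall>x\<in>W. regular_at I U f x)"
    show "f \<in> Reg (quasi_affine I U) W"
      unfolding Reg
    proof
      fix x assume x: "x \<in> W"
      then obtain p q where pq: "p \<in> poly_fun I" "q \<in> poly_fun I" "q x \<noteq> 0" "\<And>y. y \<in> U \<Longrightarrow> q y \<noteq> 0 \<Longrightarrow> f y = p y / q y"
        using R regular_atE by metis
      have "openin (Top (quasi_affine I U)) {y \<in> U. q y \<noteq> 0}"
        unfolding openin_quasi_affine[OF U] using pq by auto
      then have "openin (Top (quasi_affine I U)) (W \<inter> {y \<in> U. q y \<noteq> 0})" using R by blast
      moreover have "W \<subseteq> U" using R unfolding openin_quasi_affine[OF U] by blast
      ultimately show "\<exists>W' p q. openin (Top (quasi_affine I U)) W' \<and> x \<in> W' \<and> W' \<subseteq> W \<and>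
                    p \<in> poly_fun I \<and> q \<in> poly_fun I \<and> (\<forall>y \<in> W'. q y \<noteq> 0 \<and> f y = p y / q y)"
        using pq x by (intro exI[of _ "W \<inter> {y \<in> U. q y \<noteq> 0}"] exI[of _ p] exI[of _ q]) auto
    qed
  qed
qed

lemma regular_at_poly: "p \<in> poly_fun I \<Longrightarrow> regular_at I U p x"
  by (rule regular_atI[OF _ poly_fun.const[of 1 I]]) simp_all

lemma regular_at_add:
  assumes "regular_at I U f x" "regular_at I U g x"
  shows "regular_at I U (\<lambda>y. f y + g y) x"
proof -
  obtain p q where pq: "p \<in> poly_fun I" "q \<in> poly_fun I" "q x \<noteq> 0" "\<And>y. y \<in> U \<Longrightarrow> q y \<noteq> 0 \<Longrightarrow> f y = p y / q y"
    using assms(1) regular_atE by metis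
  obtain r s where rs: "r \<in> poly_fun I" "s \<in> poly_fun I" "s x \<noteq> 0" "\<And>y. y \<in> U \<Longrightarrow> s y \<noteq> 0 \<Longrightarrow> g y = r y / s y"
    using assms(2) regular_atE by metis
  show ?thesis
    by (rule regular_atI[of "\<lambda>y. p y * s y + r y * q y" I "\<lambda>y. q y * s y"])
       (use pq(1-3) rs(1-3) in \<open>auto simp: pq(4) rs(4) add_frac_eq intro!: poly_fun.intros\<close>)
qed

lemma regular_at_mult:
  assumes "regular_at I U f x" "regular_at I U g x"
  shows "regular_at I U (\<lambda>y. f y * g y) x"
proof -
  obtain p q where pq: "p \<in> poly_fun I" "q \<in> poly_fun I" "q x \<noteq> 0" "\<And>y. y \<in> U \<Longrightarrow> q y \<noteq> 0 \<Longrightarrow> f y = p y / q y"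
    using assms(1) regular_atE by metis
  obtain r s where rs: "r \<in> poly_fun I" "s \<in> poly_fun I" "s x \<noteq> 0" "\<And>y. y \<in> U \<Longrightarrow> s y \<noteq> 0 \<Longrightarrow> g y = r y / s y"
    using assms(2) regular_atE by metis
  show ?thesis
    by (rule regular_atI[of "\<lambda>y. p y * r y" I "\<lambda>y. q y * s y"])
       (use pq(1-3) rs(1-3) in \<open>auto simp: pq(4) rs(4) intro!: poly_fun.intros\<close>)
qed

text \<open>Equality of \<open>f\<close> and \<open>g\<close> is only assumed on the open set where
  \<open>h\<close> is nonzero. Writing \<open>h\<close> as \<open>r / s\<close> near the point, the
  factor \<open>r * s\<close> in the denominator confines the fraction to that set.\<close>

lemma regular_at_cong_nonzero:
  assumes f: "regular_at I U f x" and h: "regular_at I U h x" "h x \<noteq> 0" and x: "x \<in> U"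
    and eq: "\<And>y. y \<in> U \<Longrightarrow> h y \<noteq> 0 \<Longrightarrow> g y = f y"
  shows "regular_at I U g x"
proof -
  obtain p q where pq: "p \<in> poly_fun I" "q \<in> poly_fun I" "q x \<noteq> 0" "\<And>y. y \<in> U \<Longrightarrow> q y \<noteq> 0 \<Longrightarrow> f y = p y / q y"
    using f regular_atE by metis
  obtain r s where rs: "r \<in> poly_fun I" "s \<in> poly_fun I" "s x \<noteq> 0" "\<And>y. y \<in> U \<Longrightarrow> s y \<noteq> 0 \<Longrightarrow> h y = r y / s y"
    using h(1) regular_atE by metis
  show ?thesis
  proof (rule regular_atI[of "\<lambda>y. p y * (r y * s y)" I "\<lambda>y. q y * (r y * s y)"])
    show "q x * (r x * s x) \<noteq> 0" using pq(3) rs(3) rs(4)[OF x rs(3)] h(2) by auto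
    fix y assume "y \<in> U" "q y * (r y * s y) \<noteq> 0"
    then show "g y = p y * (r y * s y) / (q y * (r y * s y))"
      using eq[of y] pq(4)[of y] rs(4)[of y] by simp
  qed (use pq(1,2) rs(1,2) in \<open>auto intro!: poly_fun.intros\<close>)
qed

lemma regular_at_cong:
  assumes "regular_at I U f x" "x \<in> U" "\<And>y. y \<in> U \<Longrightarrow> g y = f y"
  shows "regular_at I U g x"
proof (rule regular_at_cong_nonzero[where h = "\<lambda>_. 1"])
  show "regular_at I U f x" "x \<in> U" by fact+
  show "regular_at I U (\<lambda>_. 1) x" by (rule regular_at_poly[OF poly_fun.const])
  show "g y = f y" if "y \<in> U" for y by (rule assms(3)[OF that])
qed simp

lemma regular_at_inverse:
  assumes f: "regular_at I U f x" "f x \<noteq> 0" and x: "x \<in> U"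
  shows "regular_at I U (\<lambda>y. inverse (f y)) x"
proof -
  obtain p q where pq: "p \<in> poly_fun I" "q \<in> poly_fun I" "q x \<noteq> 0" "\<And>y. y \<in> U \<Longrightarrow> q y \<noteq> 0 \<Longrightarrow> f y = p y / q y"
    using f regular_atE by metis
  show ?thesis
  proof (rule regular_atI[of "\<lambda>y. q y * q y" I "\<lambda>y. p y * q y"])
    show "p x * q x \<noteq> 0" using pq(3) pq(4)[OF x pq(3)] f(2) by auto
    fix y assume "y \<in> U" "p y * q y \<noteq> 0"
    then show "inverse (f y) = q y * q y / (p y * q y)"
      using pq(4)[of y] by simp
  qed (use pq(1,2) in \<open>auto intro!: poly_fun.intros\<close>)
qed

lemma regular_at_power: "regular_at I U f x \<Longrightarrow> regular_at I U (\<lambda>y. f y ^ n) x"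
proof (induction n)
  case 0
  then show ?case using regular_at_poly[OF poly_fun.const] by simp
next
  case (Suc n)
  then show ?case using regular_at_mult[of I U f x "\<lambda>y. f y ^ n"] by simp
qed

lemma regular_at_powi:
  assumes "regular_at I U f x" "f x \<noteq> 0" "x \<in> U"
  shows "regular_at I U (\<lambda>y. f y powi n) x"
proof (cases "n \<ge> 0")
  case True
  show ?thesis unfolding power_int_def if_P[OF True] by (rule regular_at_power[OF assms(1)])
next
  case False
  show ?thesis unfolding power_int_def if_not_P[OF False]
    by (rule regular_at_power[OF regular_at_inverse[OF assms]])
qed

lemma regular_at_prod:
  "(\<And>i. i \<in> S \<Longrightarrow> regular_at I U (f i) x) \<Longrightarrow> regular_at I U (\<lambda>y. \<Prod>i\<in>S. f i y) x"
proof (induction S rule: infinite_finite_induct)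
  case (insert i S)
  have "regular_at I U (\<lambda>y. f i y * (\<Prod>i\<in>S. f i y)) x"
    by (rule regular_at_mult) (simp_all add: insert)
  then show ?case using insert by simp
qed (simp_all add: regular_at_poly poly_fun.const)

lemma regular_at_poly_compose:
  assumes "p \<in> poly_fun J" "\<And>j. j \<in> J \<Longrightarrow> regular_at I U (\<lambda>y. F y j) x"
  shows "regular_at I U (\<lambda>y. p (F y)) x"
  using assms(1)
proof (induction rule: poly_fun.induct)
  case (const c)
  show ?case by (rule regular_at_poly[OF poly_fun.const])
qed (fact assms(2), (rule regular_at_add regular_at_mult; assumption)+)

lemma regular_at_compose:
  assumes g: "regular_at J U' g (F x)" and F: "\<And>j. j \<in> J \<Longrightarrow> regular_at I U (\<lambda>y. F y j) x"
    and x: "x \<in> U" "F ` U \<subseteq> U'"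
  shows "regular_at I U (\<lambda>y. g (F y)) x"
proof -
  obtain p q where pq: "p \<in> poly_fun J" "q \<in> poly_fun J" "q (F x) \<noteq> 0" "\<And>y. y \<in> U' \<Longrightarrow> q y \<noteq> 0 \<Longrightarrow> g y = p y / q y"
    using g regular_atE by metis
  have p: "regular_at I U (\<lambda>y. p (F y)) x" and q: "regular_at I U (\<lambda>y. q (F y)) x"
    using regular_at_poly_compose pq(1,2) F by blast+
  show ?thesis
    by (rule regular_at_cong_nonzero[OF regular_at_mult[OF p regular_at_inverse[OF q pq(3) x(1)]] q pq(3) x(1)])
       (use pq(4) x(2) in \<open>auto simp: divide_inverse\<close>)
qed

lemma openin_regular_at_nonzero:
  assumes U: "U \<subseteq> tuples I" and W: "openin (Top (quasi_affine I U)) W"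
    and f: "\<And>x. x \<in> W \<Longrightarrow> regular_at I U f x"
  shows "openin (Top (quasi_affine I U)) {x \<in> W. f x \<noteq> 0}"
  unfolding openin_quasi_affine[OF U]
proof (intro conjI ballI)
  show "{x \<in> W. f x \<noteq> 0} \<subseteq> U" using W unfolding openin_quasi_affine[OF U] by blast
  fix x assume x: "x \<in> {x \<in> W. f x \<noteq> 0}"
  then have xU: "x \<in> U" using W unfolding openin_quasi_affine[OF U] by blast
  obtain p q where pq: "p \<in> poly_fun I" "q \<in> poly_fun I" "q x \<noteq> 0" "\<And>y. y \<in> U \<Longrightarrow> q y \<noteq> 0 \<Longrightarrow> f y = p y / q y"
    using f x regular_atE by (metis (no_types, lifting) mem_Collect_eq)
  obtain s where s: "s \<in> poly_fun I" "s x \<noteq> 0" "\<forall>y\<in>U. s y \<noteq> 0 \<longrightarrow> y \<in> W"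
    using W x unfolding openin_quasi_affine[OF U] by blast
  have "(\<lambda>y. s y * (p y * q y)) \<in> poly_fun I" using s pq by (auto intro!: poly_fun.mult)
  moreover have "s x * (p x * q x) \<noteq> 0" using s pq(3) pq(4)[OF xU pq(3)] x by auto
  moreover have "\<forall>y\<in>U. s y * (p y * q y) \<noteq> 0 \<longrightarrow> y \<in> {x \<in> W. f x \<noteq> 0}" using s(3) pq(4) by simp
  ultimately show "\<exists>q\<in>poly_fun I. q x \<noteq> 0 \<and> (\<forall>y\<in>U. q y \<noteq> 0 \<longrightarrow> y \<in> {x \<in> W. f x \<noteq> 0})"
    by fast
qed

lemma morphism_quasi_affine:
  assumes U: "U \<subseteq> tuples I" and U': "U' \<subseteq> tuples J" and F: "F ` U \<subseteq> U'"
    and reg: "\<And>j x. j \<in> J \<Longrightarrow> x \<in> U \<Longrightarrow> regular_at I U (\<lambda>y. F y j) x"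
  shows "morphism (quasi_affine I U) (quasi_affine J U') F"
proof -
  have op: "openin (Top (quasi_affine I U)) {x \<in> U. F x \<in> W}" if W: "openin (Top (quasi_affine J U')) W" for W
    unfolding openin_quasi_affine[OF U]
  proof (intro conjI ballI)
    fix x assume x: "x \<in> {x \<in> U. F x \<in> W}"
    then obtain s where s: "s \<in> poly_fun J" "s (F x) \<noteq> 0" "\<forall>y\<in>U'. s y \<noteq> 0 \<longrightarrow> y \<in> W"
      using W unfolding openin_quasi_affine[OF U'] by blast
    have "openin (Top (quasi_affine I U)) {y \<in> U. s (F y) \<noteq> 0}"
      by (rule openin_regular_at_nonzero[OF U])
         (use U in \<open>auto simp: openin_quasi_affine intro!: regular_at_poly_compose[OF s(1)] reg bexI[of _ "\<lambda>_. 1"] poly_fun.const\<close>)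
    moreover have "x \<in> {y \<in> U. s (F y) \<noteq> 0}" using x s by blast
    ultimately obtain q where "q \<in> poly_fun I" "q x \<noteq> 0" "\<forall>y\<in>U. q y \<noteq> 0 \<longrightarrow> s (F y) \<noteq> 0"
      unfolding openin_quasi_affine[OF U] by blast
    then show "\<exists>q\<in>poly_fun I. q x \<noteq> 0 \<and> (\<forall>y\<in>U. q y \<noteq> 0 \<longrightarrow> y \<in> {x \<in> U. F x \<in> W})"
      using s(3) F by (intro bexI[of _ q]) auto
  qed auto
  have "h \<circ> F \<in> Reg (quasi_affine I U) {x \<in> U. F x \<in> W}"
    if W: "openin (Top (quasi_affine J U')) W" and h: "h \<in> Reg (quasi_affine J U') W" for W h
    unfolding Reg_quasi_affine[OF U]
  proof (intro conjI ballI op[OF W])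
    fix x assume x: "x \<in> {x \<in> U. F x \<in> W}"
    then have "regular_at J U' h (F x)" using h unfolding Reg_quasi_affine[OF U'] by blast
    then show "regular_at I U (h \<circ> F) x"
      unfolding comp_def by (rule regular_at_compose) (use reg F x in auto)
  qed
  then show ?thesis
    unfolding morphism_def continuous_map_def using U U' F op by auto
qed

lemma openin_quasi_affine_trans:
  assumes "U \<subseteq> tuples I" "openin (Top (quasi_affine I U)) U1" "openin (Top (quasi_affine I U1)) W"
  shows "openin (Top (quasi_affine I U)) W"
proof -
  have sub: "U1 \<subseteq> U" using assms(2) unfolding openin_quasi_affine[OF assms(1)] by blast
  then have "U1 \<subseteq> tuples I" using assms(1) by blast
  have "Top (quasi_affine I U1) = subtopology (Top (quasi_affine I U)) U1"
    using sub by (simp add: quasi_affine_def subtopology_subtopology Int_absorb1)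
  then show ?thesis using assms(2,3) openin_trans_full by metis
qed

lemma regular_at_open_subset:
  assumes U: "U \<subseteq> tuples I" and U1: "openin (Top (quasi_affine I U)) U1" and x: "x \<in> U1"
    and f: "regular_at I U1 f x"
  shows "regular_at I U f x"
proof -
  obtain p q where pq: "p \<in> poly_fun I" "q \<in> poly_fun I" "q x \<noteq> 0" "\<And>y. y \<in> U1 \<Longrightarrow> q y \<noteq> 0 \<Longrightarrow> f y = p y / q y"
    using f regular_atE by metis
  obtain s where s: "s \<in> poly_fun I" "s x \<noteq> 0" "\<forall>y\<in>U. s y \<noteq> 0 \<longrightarrow> y \<in> U1"
    using U1 x unfolding openin_quasi_affine[OF U] by blast
  show ?thesis
    by (rule regular_atI[of "\<lambda>y. p y * s y" I "\<lambda>y. q y * s y"])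
       (use pq(1-3) s in \<open>auto simp: pq(4) intro!: poly_fun.mult\<close>)
qed

lemma morphism_quasi_affine_local:
  assumes U: "U \<subseteq> tuples I" and U12: "openin (Top (quasi_affine I U)) U1" "openin (Top (quasi_affine I U)) U2"
    "U = U1 \<union> U2" and f: "morphism (quasi_affine I U1) Z f" "morphism (quasi_affine I U2) Z f"
  shows "morphism (quasi_affine I U) Z f"
proof -
  have sub: "U1 \<subseteq> tuples I" "U2 \<subseteq> tuples I" using U U12(3) by auto
  have eq: "{x \<in> U. f x \<in> W} = {x \<in> U1. f x \<in> W} \<union> {x \<in> U2. f x \<in> W}" for W
    using U12(3) by auto
  have op: "openin (Top (quasi_affine I U)) {x \<in> U. f x \<in> W}" if "openin (Top Z) W" for W
    unfolding eq
    using morphism_preimage[OF f(1) that] morphism_preimage[OF f(2) that] sub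
      openin_quasi_affine_trans[OF U U12(1)] openin_quasi_affine_trans[OF U U12(2)]
    by (intro openin_Un) auto
  have "h \<circ> f \<in> Reg (quasi_affine I U) {x \<in> U. f x \<in> W}" if "openin (Top Z) W" "h \<in> Reg Z W" for W h
    unfolding Reg_quasi_affine[OF U]
  proof (intro conjI ballI op that(1))
    fix x assume x: "x \<in> {x \<in> U. f x \<in> W}"
    show "regular_at I U (h \<circ> f) x"
    proof (cases "x \<in> U1")
      case True
      then have "regular_at I U1 (h \<circ> f) x"
        using morphism_Reg[OF f(1) that] x sub by (simp add: Reg_quasi_affine)
      then show ?thesis by (rule regular_at_open_subset[OF U U12(1) True])
    next
      case False
      then have x2: "x \<in> U2" using x U12(3) by auto
      then have "regular_at I U2 (h \<circ> f) x"
        using morphism_Reg[OF f(2) that] x sub by (simp add: Reg_quasi_affine)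
      then show ?thesis by (rule regular_at_open_subset[OF U U12(2) x2])
    qed
  qed
  moreover have "f x \<in> pts Z" if "x \<in> U" for x
    using that U12(3) morphism_pts[OF f(1)] morphism_pts[OF f(2)] sub by auto
  ultimately show ?thesis unfolding morphism_def continuous_map_def using U op by simp
qed

lemma morphism_quasi_affine_cong:
  assumes U: "U \<subseteq> tuples I" and f: "morphism (quasi_affine I U) Z f" and eq: "\<And>x. x \<in> U \<Longrightarrow> g x = f x"
  shows "morphism (quasi_affine I U) Z g"
proof -
  have pre: "{x \<in> U. g x \<in> W} = {x \<in> U. f x \<in> W}" for W using eq by auto
  have "h \<circ> g \<in> Reg (quasi_affine I U) {x \<in> U. g x \<in> W}" if W: "openin (Top Z) W" "h \<in> Reg Z W" for W h
  proof -
    have *: "h \<circ> f \<in> Reg (quasi_affine I U) {x \<in> U. f x \<in> W}"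
      using morphism_Reg[OF f W] U by simp
    show ?thesis
      unfolding Reg_quasi_affine[OF U]
    proof (intro conjI ballI)
      show "openin (Top (quasi_affine I U)) {x \<in> U. g x \<in> W}"
        using * unfolding pre Reg_quasi_affine[OF U] by blast
      fix x assume "x \<in> {x \<in> U. g x \<in> W}"
      then have "regular_at I U (h \<circ> f) x" "x \<in> U" using * unfolding pre Reg_quasi_affine[OF U] by blast+
      then show "regular_at I U (h \<circ> g) x" by (rule regular_at_cong) (simp add: eq)
    qed
  qed
  moreover have "openin (Top (quasi_affine I U)) {x \<in> U. g x \<in> W}" if "openin (Top Z) W" for W
    unfolding pre using morphism_preimage[OF f that] U by simp
  moreover have "g x \<in> pts Z" if "x \<in> U" for x using morphism_pts[OF f, of x] eq[OF that] that U by simp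
  ultimately show ?thesis
    unfolding morphism_def continuous_map_def using U by simp
qed

text \<open>\<open>f\<close> and \<open>g\<close> embed the two pieces with exactly the coincidences
  recorded in \<open>R\<close>. Openness of the embeddings is never discussed: the inverse is given
  by the local sections \<open>n1\<close> and \<open>n2\<close> on the homogeneous coordinates, and
  descends because a map out of a quotient is a morphism once its composite with \<pi> is.\<close>

lemma isomorphic_glue_quotient:
  fixes X :: "'a space_fun" and Y :: "'b space_fun" and \<pi> :: "('i \<Rightarrow> complex) \<Rightarrow> 'c"
  defines "Z \<equiv> \<lambda>I U. quotient_space (quasi_affine I U) \<pi>"
  assumes U: "U \<subseteq> tuples I" and U12: "openin (Top (quasi_affine I U)) U1" "openin (Top (quasi_affine I U)) U2"
      "U = U1 \<union> U2"
    and f: "morphism X (Z I U) f" "inj_on f (pts X)" and g: "morphism Y (Z I U) g" "inj_on g (pts Y)"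
    and R: "R \<subseteq> pts X \<times> pts Y" "\<And>x y. x \<in> pts X \<Longrightarrow> y \<in> pts Y \<Longrightarrow> f x = g y \<longleftrightarrow> (x, y) \<in> R"
    and n1: "morphism (quasi_affine I U1) X n1" "\<And>u. u \<in> U1 \<Longrightarrow> f (n1 u) = \<pi> u"
    and n2: "morphism (quasi_affine I U2) Y n2" "\<And>u. u \<in> U2 \<Longrightarrow> g (n2 u) = \<pi> u"
  shows "isomorphic (glue X Y R) (Z I U)"
proof -
  have sub: "U1 \<subseteq> tuples I" "U2 \<subseteq> tuples I" using U U12(3) by auto
  define E :: "(('a + 'b) \<times> ('a + 'b)) set" where "E = (\<lambda>(x, y). (Inl x, Inr y)) ` R"
  define cls where "cls = (\<lambda>s. (E \<union> E\<inverse>)\<^sup>* `` {s})"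
  have glue: "glue X Y R = quotient_space (sum_space X Y) cls"
    by (simp add: glue_def E_def cls_def)
  have fgR: "f x = g y" if "(x, y) \<in> R" for x y using R(2)[of x y] R(1) that by blast
  have fg: "case_sum f g s = case_sum f g s'" if "(s, s') \<in> (E \<union> E\<inverse>)\<^sup>*" for s s'
    using that
  proof (induction rule: rtrancl_induct)
    case (step s' s'')
    have "case_sum f g s' = case_sum f g s''" using step(2) unfolding E_def by (auto dest: fgR)
    then show ?case using step by simp
  qed simp
  have cls_eq: "cls s = cls s'" if "(s, s') \<in> E" for s s'
  proof -
    have "(s, s') \<in> (E \<union> E\<inverse>)\<^sup>*" "(s', s) \<in> (E \<union> E\<inverse>)\<^sup>*" using that by auto
    then show ?thesis unfolding cls_def by (auto intro: rtrancl_trans)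
  qed
  define F where "F = (\<lambda>c. case_sum f g (SOME s. s \<in> c))"
  have F: "F (cls s) = case_sum f g s" for s
  proof -
    have "s \<in> cls s" by (simp add: cls_def)
    then have "(SOME s'. s' \<in> cls s) \<in> cls s" by (rule someI)
    then show ?thesis unfolding F_def using fg[of s] by (simp add: cls_def)
  qed
  have Fm: "morphism (glue X Y R) (Z I U) F"
    unfolding glue
  proof (rule morphism_from_quotient)
    have "F \<circ> cls = case_sum f g" by (simp add: fun_eq_iff F)
    then show "morphism (sum_space X Y) (Z I U) (F \<circ> cls)" using morphism_case_sum[OF f(1) g(1)] by simp
  qed
  \<comment> \<open>For a point in both images the choice of the left summand is immaterial:
    \<open>kg\<close> shows that the right summand gives the same class.\<close>
  define k where "k = (\<lambda>z. if z \<in> f ` pts X then cls (Inl (inv_into (pts X) f z)) else cls (Inr (inv_into (pts Y) g z)))"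
  have kf: "k (f x) = cls (Inl x)" if "x \<in> pts X" for x
    using that inv_into_f_f[OF f(2) that] by (simp add: k_def)
  have kg: "k (g y) = cls (Inr y)" if y: "y \<in> pts Y" for y
  proof (cases "g y \<in> f ` pts X")
    case True
    then obtain x where x: "x \<in> pts X" "f x = g y" by force
    then have "(Inl x, Inr y) \<in> E" using R(2)[OF x(1) y] unfolding E_def by force
    then show ?thesis using kf[OF x(1)] x(2) cls_eq by simp
  next
    case False
    then show ?thesis using inv_into_f_f[OF g(2) y] by (simp add: k_def)
  qed
  have Z: "pts (Z I U) = \<pi> ` U" unfolding Z_def pts_quotient_space using U by simp
  have n1X: "n1 u \<in> pts X" if "u \<in> U1" for u using morphism_pts[OF n1(1)] that sub by simp
  have n2Y: "n2 u \<in> pts Y" if "u \<in> U2" for u using morphism_pts[OF n2(1)] that sub by simp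
  have km: "morphism (Z I U) (glue X Y R) k"
    unfolding Z_def
  proof (rule morphism_from_quotient, rule morphism_quasi_affine_local[OF U U12])
    have "morphism (quasi_affine I U1) (glue X Y R) (cls \<circ> (Inl \<circ> n1))"
      unfolding glue by (intro morphism_compose[OF morphism_compose[OF n1(1) morphism_Inl] morphism_quotient_map])
    then show "morphism (quasi_affine I U1) (glue X Y R) (k \<circ> \<pi>)"
      by (rule morphism_quasi_affine_cong[OF sub(1)]) (use kf[OF n1X] n1(2) in simp)
    have "morphism (quasi_affine I U2) (glue X Y R) (cls \<circ> (Inr \<circ> n2))"
      unfolding glue by (intro morphism_compose[OF morphism_compose[OF n2(1) morphism_Inr] morphism_quotient_map])
    then show "morphism (quasi_affine I U2) (glue X Y R) (k \<circ> \<pi>)"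
      by (rule morphism_quasi_affine_cong[OF sub(2)]) (use kg[OF n2Y] n2(2) in simp)
  qed
  have "k (F c) = c" if "c \<in> pts (glue X Y R)" for c
    using that F kf kg unfolding glue pts_quotient_space pts_sum_space by auto
  moreover have "F (k z) = z" if z: "z \<in> pts (Z I U)" for z
  proof -
    from z obtain u where u: "u \<in> U" "z = \<pi> u" unfolding Z by blast
    show ?thesis
    proof (cases "u \<in> U1")
      case True
      then have "z = f (n1 u)" "k z = cls (Inl (n1 u))" using n1 kf[OF n1X[OF True]] u by auto
      then show ?thesis using F by simp
    next
      case False
      then have u2: "u \<in> U2" using u U12(3) by auto
      then have "z = g (n2 u)" "k z = cls (Inr (n2 u))" using n2 kg[OF n2Y[OF u2]] u by auto
      then show ?thesis using F by simp
    qed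
  qed
  ultimately show ?thesis unfolding isomorphic_def isomorphism_def using Fm km by blast
qed

section \<open>Torus orbits\<close>

definition pairing :: "nat \<Rightarrow> (nat \<Rightarrow> 'a::comm_ring) \<Rightarrow> (nat \<Rightarrow> 'a) \<Rightarrow> 'a" where
  "pairing d m x = (\<Sum>i=1..d. m i * x i)"

definition rvec :: "(nat \<Rightarrow> int) \<Rightarrow> nat \<Rightarrow> real" where
  "rvec v = (\<lambda>i. of_int (v i))"

lemma pairing_add: "pairing d m (\<lambda>i. x i + y i) = pairing d m x + pairing d m y"
  by (simp add: pairing_def algebra_simps sum.distrib)

lemma pairing_scale: "pairing d m (\<lambda>i. r * x i) = r * pairing d m x"
  by (simp add: pairing_def sum_distrib_left algebra_simps)

lemma pairing_sum: "pairing d m (\<lambda>i. \<Sum>v\<in>S. f v i) = (\<Sum>v\<in>S. pairing d m (f v))"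
  unfolding pairing_def sum_distrib_left by (rule sum.swap)

lemma pairing_sum_scale: "pairing d m (\<lambda>i. \<Sum>v\<in>S. r v * f v i) = (\<Sum>v\<in>S. r v * pairing d m (f v))"
  using pairing_sum[where f = "\<lambda>v i. r v * f v i"] by (simp add: pairing_scale)

lemma pairing_sum_left: "pairing d (\<lambda>i. \<Sum>v\<in>S. f v i) x = (\<Sum>v\<in>S. pairing d (f v) x)"
  unfolding pairing_def sum_distrib_right by (rule sum.swap)

lemma pairing_rvec: "pairing d (rvec m) (rvec v) = of_int (pairing d m v)"
  by (simp add: pairing_def rvec_def)

lemma pairing_std: "i \<in> {1..d} \<Longrightarrow> pairing d (std i) v = v i"
  by (simp add: pairing_def std_def if_distrib[of "\<lambda>x. x * _"] cong: if_cong)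

lemma pairing_std_right: "i \<in> {1..d} \<Longrightarrow> pairing d m (std i) = m i"
  by (simp add: pairing_def std_def if_distrib[of "\<lambda>x. _ * x"] cong: if_cong)

definition tor :: "nat \<Rightarrow> (nat \<Rightarrow> int) set \<Rightarrow> ((nat \<Rightarrow> int) \<Rightarrow> complex) set" where
  "tor d I = {g. (\<forall>v. g v \<noteq> 0) \<and> (\<forall>i\<in>{1..d}. (\<Prod>v\<in>I. g v powi v i) = 1)}"

lemma prod_powi_sum:
  fixes x :: complex
  assumes "x \<noteq> 0"
  shows "(\<Prod>i\<in>S. x powi f i) = x powi (\<Sum>i\<in>S. f i)"
  by (induction S rule: infinite_finite_induct) (use assms in \<open>auto simp: power_int_add\<close>)

lemma powi_prod:
  fixes f :: "'a \<Rightarrow> complex"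
  shows "(\<Prod>i\<in>S. f i) powi k = (\<Prod>i\<in>S. f i powi k)"
  by (induction S rule: infinite_finite_induct) (auto simp: power_int_mult_distrib)

lemma prod_powi_pairing:
  fixes g :: "(nat \<Rightarrow> int) \<Rightarrow> complex"
  assumes "\<And>v. v \<in> I \<Longrightarrow> g v \<noteq> 0"
  shows "(\<Prod>v\<in>I. g v powi pairing d m v) = (\<Prod>i=1..d. (\<Prod>v\<in>I. g v powi v i) powi m i)"
proof -
  have "(\<Prod>v\<in>I. g v powi pairing d m v) = (\<Prod>v\<in>I. \<Prod>i=1..d. g v powi (m i * v i))"
    by (intro prod.cong) (simp_all add: pairing_def prod_powi_sum assms)
  also have "\<dots> = (\<Prod>i=1..d. \<Prod>v\<in>I. g v powi (m i * v i))" by (rule prod.swap)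
  also have "\<dots> = (\<Prod>i=1..d. (\<Prod>v\<in>I. g v powi v i) powi m i)"
    by (intro prod.cong refl) (simp add: powi_prod power_int_mult mult.commute flip: power_int_mult)
  finally show ?thesis .
qed

lemma tor_pairing: "g \<in> tor d I \<Longrightarrow> (\<Prod>v\<in>I. g v powi pairing d m v) = 1"
  by (subst prod_powi_pairing) (auto simp: tor_def)

lemma tor_one: "(\<lambda>_. 1) \<in> tor d I"
  by (simp add: tor_def)

lemma tor_mult: "g \<in> tor d I \<Longrightarrow> h \<in> tor d I \<Longrightarrow> (\<lambda>v. g v * h v) \<in> tor d I"
  by (simp add: tor_def power_int_mult_distrib prod.distrib)

lemma tor_inverse: "g \<in> tor d I \<Longrightarrow> (\<lambda>v. inverse (g v)) \<in> tor d I"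
  by (simp add: tor_def power_int_inverse prod_inversef[unfolded comp_def])

lemma tor_nonzero: "g \<in> tor d I \<Longrightarrow> g v \<noteq> 0"
  by (simp add: tor_def)

lemma group_Cstar: "group Cstar"
proof (rule groupI)
  fix x assume "x \<in> carrier Cstar"
  then show "\<exists>y\<in>carrier Cstar. y \<otimes>\<^bsub>Cstar\<^esub> x = \<one>\<^bsub>Cstar\<^esub>"
    by (intro bexI[of _ "inverse x"]) (auto simp: Cstar_def)
qed (auto simp: Cstar_def)

text \<open>A homomorphism on the Picard group is one on the free group of divisors that kills the
  principal ones. The divisors of the coordinate characters generate these, which gives the
  equations of \<open>tor\<close>; conversely \<open>tor_pairing\<close> extends the equations to
  all characters. Off the rays \<open>X\<close> is zero, so the free values there have no
  effect.\<close>

lemma orbit_eq: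
  assumes fin: "finite (gens \<Sigma>)" and X: "X \<in> tuples (gens \<Sigma>)"
  shows "orbit d \<Sigma> X = (\<lambda>g v. g v * X v) ` tor d (gens \<Sigma>)"
proof -
  define I where "I = gens \<Sigma>"
  define F where "F = free_Abelian_group I"
  define H where "H = principal_divs d \<Sigma>"
  interpret F: comm_group F unfolding F_def by (rule abelian_free_Abelian_group)
  have carF: "x \<in> carrier F \<longleftrightarrow> Poly_Mapping.keys x \<subseteq> I" for x by (simp add: F_def)
  have addF: "x \<otimes>\<^bsub>F\<^esub> y = x + y" for x y by (simp add: F_def)
  have oneF: "\<one>\<^bsub>F\<^esub> = 0" by (simp add: F_def)
  have finI: "finite I" using fin by (simp add: I_def)
  have look: "Poly_Mapping.lookup (char_div d \<Sigma> m) v = (if v \<in> I then pairing d m v else 0)" for m v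
  proof -
    have "Poly_Mapping.lookup (char_div d \<Sigma> m) v = (\<Sum>u\<in>I. pairing d m u * (if v = u then 1 else 0))"
      by (simp add: char_div_def lookup_sum I_def pairing_def)
    also have "\<dots> = (if v \<in> I then pairing d m v else 0)"
      using finI by (simp add: if_distrib[of "\<lambda>x. _ * x"] cong: if_cong)
    finally show ?thesis .
  qed
  have char_in: "char_div d \<Sigma> m \<in> carrier F" for m
    unfolding carF by (auto simp: in_keys_iff look split: if_splits)
  have char_add: "char_div d \<Sigma> m + char_div d \<Sigma> m' = char_div d \<Sigma> (\<lambda>i. m i + m' i)" for m m'
    by (rule poly_mapping_eqI) (simp add: lookup_add look pairing_def algebra_simps sum.distrib)
  have char_neg: "- char_div d \<Sigma> m = char_div d \<Sigma> (\<lambda>i. - m i)" for m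
    by (rule poly_mapping_eqI) (simp add: look pairing_def sum_negf)
  have lat: "(\<lambda>i. m i + m' i) \<in> lattice d" "(\<lambda>i. - m i) \<in> lattice d"
    if "m \<in> lattice d" "m' \<in> lattice d" for m m'
    using that by (auto simp: lattice_def tuples_def)
  have "subgroup H F"
  proof (rule F.subgroupI)
    show "H \<subseteq> carrier F" unfolding H_def principal_divs_def using char_in by auto
    have "(\<lambda>_. 0) \<in> lattice d" by (simp add: lattice_def tuples_def)
    then show "H \<noteq> {}" unfolding H_def principal_divs_def by blast
    show "inv\<^bsub>F\<^esub> x \<in> H" if x: "x \<in> H" for x
    proof -
      obtain m where m: "m \<in> lattice d" "x = char_div d \<Sigma> m" using x unfolding H_def principal_divs_def by blast
      have "inv\<^bsub>F\<^esub> x = - x" unfolding F_def by (rule inv_free_Abelian_group) (use char_in carF m in blast)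
      then show ?thesis unfolding H_def principal_divs_def using m lat(2)[OF m(1) m(1)] char_neg by auto
    qed
    show "x \<otimes>\<^bsub>F\<^esub> y \<in> H" if xy: "x \<in> H" "y \<in> H" for x y
    proof -
      obtain m where m: "m \<in> lattice d" "x = char_div d \<Sigma> m" using xy unfolding H_def principal_divs_def by blast
      obtain m' where m': "m' \<in> lattice d" "y = char_div d \<Sigma> m'" using xy unfolding H_def principal_divs_def by blast
      show ?thesis unfolding addF H_def principal_divs_def using m m' lat(1)[OF m(1) m'(1)] char_add by auto
    qed
  qed
  then have H: "H \<lhd> F" by (rule F.subgroup_imp_normal)
  have Pic: "Pic d \<Sigma> = F Mod H" by (simp add: Pic_def F_def H_def I_def)
  have cls: "div_class d \<Sigma> v = H #>\<^bsub>F\<^esub> frag_of v" for v by (simp add: div_class_def F_def H_def I_def)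
  show ?thesis
  proof (intro equalityI subsetI)
    fix Y assume "Y \<in> orbit d \<Sigma> X"
    then obtain g where g: "g \<in> hom (F Mod H) Cstar" "Y = (\<lambda>v. g (div_class d \<Sigma> v) * X v)"
      unfolding orbit_def Pic by blast
    define G where "G = (\<lambda>x. g (H #>\<^bsub>F\<^esub> x))"
    have "G \<in> hom F Cstar"
      unfolding G_def using hom_compose[OF normal.r_coset_hom_Mod[OF H] g(1)] by (simp add: comp_def)
    then have G0: "G x \<noteq> 0" and Gadd: "G (x + y) = G x * G y" if "x \<in> carrier F" "y \<in> carrier F" for x y
      using that unfolding hom_def Cstar_def addF by auto
    have zero: "0 \<in> carrier F" using oneF F.one_closed by simp
    have Gzero: "G 0 = 1" using Gadd[OF zero zero] G0[OF zero zero] by simp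
    have cmul_in: "frag_cmul k x \<in> carrier F" if "x \<in> carrier F" for k x
      using that keys_cmul[of k x] unfolding carF by blast
    have Gnat: "G (frag_cmul (int n) x) = G x ^ n" if x: "x \<in> carrier F" for n x
    proof (induction n)
      case (Suc n)
      have "frag_cmul (int (Suc n)) x = frag_cmul (int n) x + x" by (simp add: frag_cmul_distrib add.commute)
      then show ?case using Gadd[OF cmul_in[OF x] x] Suc by simp
    qed (simp add: Gzero)
    have Gcmul: "G (frag_cmul k x) = G x powi k" if x: "x \<in> carrier F" for k x
    proof (cases "k \<ge> 0")
      case True
      then show ?thesis using Gnat[OF x, of "nat k"] by (simp add: power_int_def)
    next
      case False
      have "G (frag_cmul k x + frag_cmul (int (nat (- k))) x) = 1"
        using False by (simp add: Gzero flip: frag_cmul_distrib)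
      then have "G (frag_cmul k x) * G x ^ nat (- k) = 1"
        using Gadd[OF cmul_in[OF x] cmul_in[OF x]] Gnat[OF x] by metis
      then show ?thesis using False G0[OF x x] by (simp add: power_int_def field_simps)
    qed
    have of_in: "frag_of v \<in> carrier F" if "v \<in> I" for v using that by (simp add: carF)
    have Gsum: "(\<Sum>v\<in>S. frag_cmul (k v) (frag_of v)) \<in> carrier F \<and>
        G (\<Sum>v\<in>S. frag_cmul (k v) (frag_of v)) = (\<Prod>v\<in>S. G (frag_of v) powi k v)" if "S \<subseteq> I" for S k
      using that
    proof (induction S rule: infinite_finite_induct)
      case (insert v S)
      have v: "frag_cmul (k v) (frag_of v) \<in> carrier F" using insert.prems by (intro cmul_in of_in) simp
      have S: "(\<Sum>v\<in>S. frag_cmul (k v) (frag_of v)) \<in> carrier F" using insert by simp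
      have "frag_cmul (k v) (frag_of v) + (\<Sum>v\<in>S. frag_cmul (k v) (frag_of v)) \<in> carrier F"
        using F.m_closed[OF v S] by (simp add: addF)
      then show ?case
        using insert Gadd[OF v S] Gcmul[OF of_in[of v]] by simp
    qed (simp_all add: zero Gzero)
    define h where "h = (\<lambda>v. if v \<in> I then G (frag_of v) else 1)"
    have "h \<in> tor d I"
      unfolding tor_def
    proof (intro CollectI conjI allI ballI)
      show "h v \<noteq> 0" for v unfolding h_def using G0[OF of_in of_in] by auto
      fix i assume i: "i \<in> {1..d}"
      have "std i \<in> lattice d" using i by (auto simp: std_def lattice_def tuples_def)
      then have "char_div d \<Sigma> (std i) \<in> H" unfolding H_def principal_divs_def by blast
      then have "H #>\<^bsub>F\<^esub> char_div d \<Sigma> (std i) = H #>\<^bsub>F\<^esub> 0"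
        using F.coset_join2[OF char_in \<open>subgroup H F\<close>] F.coset_mult_one[of H] \<open>subgroup H F\<close> oneF
        by (metis subgroup.subset)
      then have "G (char_div d \<Sigma> (std i)) = 1" unfolding G_def[symmetric] using Gzero unfolding G_def by metis
      moreover have "G (char_div d \<Sigma> (std i)) = (\<Prod>v\<in>I. G (frag_of v) powi pairing d (std i) v)"
        using Gsum[of I "pairing d (std i)"] by (simp add: char_div_def I_def pairing_def)
      ultimately show "(\<Prod>v\<in>I. h v powi v i) = 1"
        using pairing_std[OF i] by (simp add: h_def cong: prod.cong)
    qed
    moreover have "Y = (\<lambda>v. h v * X v)"
    proof
      fix v
      show "Y v = h v * X v"
        using X unfolding g(2) cls G_def[symmetric] h_def by (auto simp: tuples_def I_def G_def)
    qed
    ultimately show "Y \<in> (\<lambda>g v. g v * X v) ` tor d (gens \<Sigma>)" by (simp add: I_def)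
  next
    fix Y assume "Y \<in> (\<lambda>g v. g v * X v) ` tor d (gens \<Sigma>)"
    then obtain h where h: "h \<in> tor d I" "Y = (\<lambda>v. h v * X v)" unfolding I_def by blast
    \<comment> \<open>The homomorphism on the free group with value \<open>h v\<close> on the
      divisor of \<open>v\<close>; it descends to the quotient because it kills principal
      divisors.\<close>
    define \<phi> where "\<phi> = (\<lambda>c. \<Prod>v\<in>I. h v powi Poly_Mapping.lookup c v)"
    have h0: "h v \<noteq> 0" for v using h(1) by (rule tor_nonzero)
    have "\<phi> \<in> hom F Cstar"
      by (rule homI) (simp_all add: \<phi>_def Cstar_def addF finI h0 lookup_add power_int_add prod.distrib)
    then have gh: "group_hom F Cstar \<phi>"
      unfolding group_hom_def group_hom_axioms_def using group_Cstar F.is_group by simp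
    have "H \<subseteq> kernel F Cstar \<phi>"
    proof
      fix x assume "x \<in> H"
      then obtain m where m: "x = char_div d \<Sigma> m" unfolding H_def principal_divs_def by blast
      have "\<phi> x = (\<Prod>v\<in>I. h v powi pairing d m v)" unfolding \<phi>_def m look by (rule prod.cong) auto
      then have "\<phi> x = 1" using tor_pairing[OF h(1)] by simp
      then show "x \<in> kernel F Cstar \<phi>" using char_in m by (simp add: kernel_def Cstar_def)
    qed
    then obtain g where g: "g \<in> hom (F Mod H) Cstar" "\<And>x. x \<in> carrier F \<Longrightarrow> g (H #>\<^bsub>F\<^esub> x) = \<phi> x"
      using group_hom.FactGroup_universal_kernel[OF gh H] by blast
    have "Y = (\<lambda>v. g (div_class d \<Sigma> v) * X v)"
    proof
      fix v
      show "Y v = g (div_class d \<Sigma> v) * X v"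
      proof (cases "v \<in> I")
        case True
        then have "g (div_class d \<Sigma> v) = \<phi> (frag_of v)" unfolding cls using g(2) by (simp add: carF)
        also have "\<dots> = (\<Prod>u\<in>I. if u = v then h v else 1)"
          unfolding \<phi>_def by (rule prod.cong) auto
        also have "\<dots> = h v" using finI True by simp
        finally show ?thesis using h(2) by simp
      next
        case False
        then show ?thesis using X h(2) by (simp add: tuples_def I_def)
      qed
    qed
    then show "Y \<in> orbit d \<Sigma> X" unfolding orbit_def Pic using g(1) by blast
  qed
qed

lemma orbit_self: "finite (gens \<Sigma>) \<Longrightarrow> X \<in> tuples (gens \<Sigma>) \<Longrightarrow> X \<in> orbit d \<Sigma> X"
  using tor_one[of d "gens \<Sigma>"] by (simp add: orbit_eq image_iff) (metis mult_1)

lemma orbit_eq_iff: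
  assumes fin: "finite (gens \<Sigma>)" and X: "X \<in> tuples (gens \<Sigma>)" and Y: "Y \<in> tuples (gens \<Sigma>)"
  shows "orbit d \<Sigma> X = orbit d \<Sigma> Y \<longleftrightarrow> (\<exists>g\<in>tor d (gens \<Sigma>). Y = (\<lambda>v. g v * X v))"
proof
  assume "orbit d \<Sigma> X = orbit d \<Sigma> Y"
  then have "Y \<in> orbit d \<Sigma> X" using orbit_self[OF fin Y] by blast
  then show "\<exists>g\<in>tor d (gens \<Sigma>). Y = (\<lambda>v. g v * X v)" unfolding orbit_eq[OF fin X] by blast
next
  assume "\<exists>g\<in>tor d (gens \<Sigma>). Y = (\<lambda>v. g v * X v)"
  then obtain g where g: "g \<in> tor d (gens \<Sigma>)" "Y = (\<lambda>v. g v * X v)" by blast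
  show "orbit d \<Sigma> X = orbit d \<Sigma> Y"
    unfolding orbit_eq[OF fin X] orbit_eq[OF fin Y]
  proof (intro equalityI subsetI)
    fix Z assume "Z \<in> (\<lambda>h v. h v * X v) ` tor d (gens \<Sigma>)"
    then obtain h where h: "h \<in> tor d (gens \<Sigma>)" "Z = (\<lambda>v. h v * X v)" by blast
    have "Z = (\<lambda>v. (h v * inverse (g v)) * Y v)"
      unfolding h(2) g(2) using tor_nonzero[OF g(1)] by (simp add: fun_eq_iff)
    then show "Z \<in> (\<lambda>h v. h v * Y v) ` tor d (gens \<Sigma>)"
      using tor_mult[OF h(1) tor_inverse[OF g(1)]] by (rule image_eqI)
  next
    fix Z assume "Z \<in> (\<lambda>h v. h v * Y v) ` tor d (gens \<Sigma>)"
    then obtain h where h: "h \<in> tor d (gens \<Sigma>)" "Z = (\<lambda>v. h v * Y v)" by blast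
    have "Z = (\<lambda>v. (h v * g v) * X v)" unfolding h(2) g(2) by (simp add: fun_eq_iff)
    then show "Z \<in> (\<lambda>h v. h v * X v) ` tor d (gens \<Sigma>)"
      using tor_mult[OF h(1) g(1)] by (rule image_eqI)
  qed
qed

lemma U_chart_iff:
  assumes "finite (gens \<Sigma>)"
  shows "X \<in> U_chart \<Sigma> \<sigma> \<longleftrightarrow> X \<in> tuples (gens \<Sigma>) \<and> (\<forall>v\<in>gens \<Sigma>. X v = 0 \<longrightarrow> rvec v \<in> \<sigma>)"
  using assms by (auto simp: U_chart_def cone_gens_def rvec_def)

lemma U_fan_iff:
  assumes "finite (gens \<Sigma>)"
  shows "X \<in> U_fan \<Sigma> \<longleftrightarrow> X \<in> tuples (gens \<Sigma>) \<and> (\<exists>\<sigma>\<in>\<Sigma>. \<forall>v\<in>gens \<Sigma>. X v = 0 \<longrightarrow> rvec v \<in> \<sigma>)"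
  by (auto simp: U_fan_def U_chart_iff[OF assms])

lemma U_fan_tuples: "U_fan \<Sigma> \<subseteq> tuples (gens \<Sigma>)"
  by (auto simp: U_fan_def U_chart_def)

lemma tor_mult_in_U_fan:
  assumes "finite (gens \<Sigma>)" "X \<in> U_fan \<Sigma>" "\<And>v. g v \<noteq> 0"
  shows "(\<lambda>v. g v * X v) \<in> U_fan \<Sigma>"
  using assms by (auto simp: U_fan_iff tuples_def)

lemma openin_U_chart:
  assumes fin: "finite (gens \<Sigma>)" and \<sigma>: "\<sigma> \<in> \<Sigma>"
  shows "openin (Top (quasi_affine (gens \<Sigma>) (U_fan \<Sigma>))) (U_chart \<Sigma> \<sigma>)"
proof -
  have "(\<lambda>X. \<Prod>v\<in>gens \<Sigma> - cone_gens \<Sigma> \<sigma>. X v) \<in> poly_fun (gens \<Sigma>)"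
    by (rule poly_fun_prod) (auto intro: poly_fun.coord)
  moreover have "U_chart \<Sigma> \<sigma> \<subseteq> U_fan \<Sigma>" using \<sigma> by (auto simp: U_fan_def)
  ultimately show ?thesis
    unfolding openin_quasi_affine[OF U_fan_tuples] U_chart_def using U_fan_tuples[of \<Sigma>] by auto
qed

lemma pts_toric: "pts (toric d \<Sigma>) = orbit d \<Sigma> ` U_fan \<Sigma>"
  by (simp add: toric_def pts_quotient_space U_fan_tuples)

section \<open>Combinatorics of nonsingular fans\<close>

text \<open>The dual basis consists of coordinate functions: \<open>\<mu> u j\<close> is the
  coefficient of \<open>u\<close> in the expansion of \<open>std j\<close>. Uniqueness of the
  expansion of a basis vector gives the duality relations.\<close>

lemma lattice_basis_dual:
  assumes B: "lattice_basis d B"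
  obtains \<mu> where "\<And>u u'. u \<in> B \<Longrightarrow> u' \<in> B \<Longrightarrow> pairing d (\<mu> u) u' = (if u = u' then 1 else 0)"
proof -
  have fin: "finite B" and sub: "B \<subseteq> lattice d"
    and uniq: "\<And>v. v \<in> lattice d \<Longrightarrow> \<exists>!c. c \<in> tuples B \<and> v = (\<lambda>i. \<Sum>u\<in>B. c u * u i)"
    using B unfolding lattice_basis_def by auto
  have std: "std j \<in> lattice d" if "j \<in> {1..d}" for j
    using that by (auto simp: std_def lattice_def tuples_def)
  have "\<forall>j. \<exists>c. j \<in> {1..d} \<longrightarrow> c \<in> tuples B \<and> std j = (\<lambda>i. \<Sum>u\<in>B. c u * u i)"
    using uniq[OF std] by blast
  then obtain C where C: "\<And>j. j \<in> {1..d} \<Longrightarrow> C j \<in> tuples B"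
    "\<And>j. j \<in> {1..d} \<Longrightarrow> std j = (\<lambda>i. \<Sum>u\<in>B. C j u * u i)"
    by metis
  define \<mu> where "\<mu> = (\<lambda>u j. C j u)"
  have exp: "v = (\<lambda>i. \<Sum>u\<in>B. pairing d (\<mu> u) v * u i)" if v: "v \<in> lattice d" for v
  proof
    fix i
    have "v i = (\<Sum>j=1..d. v j * std j i)"
    proof (cases "i \<in> {1..d}")
      case True
      then show ?thesis by (simp add: std_def if_distrib[of "\<lambda>x. _ * x"] cong: if_cong)
    next
      case False
      then have "v i = 0" "\<And>j. j \<in> {1..d} \<Longrightarrow> std j i = 0"
        using v by (auto simp: lattice_def tuples_def std_def)
      then show ?thesis by simp
    qed
    also have "\<dots> = (\<Sum>j=1..d. v j * (\<Sum>u\<in>B. C j u * u i))"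
    proof (rule sum.cong)
      fix j assume "j \<in> {1..d}"
      from C(2)[OF this] show "v j * std j i = v j * (\<Sum>u\<in>B. C j u * u i)" by metis
    qed simp
    also have "\<dots> = (\<Sum>j=1..d. \<Sum>u\<in>B. (\<mu> u j * v j) * u i)"
      by (simp add: sum_distrib_left \<mu>_def algebra_simps)
    also have "\<dots> = (\<Sum>u\<in>B. \<Sum>j=1..d. (\<mu> u j * v j) * u i)" by (rule sum.swap)
    also have "\<dots> = (\<Sum>u\<in>B. pairing d (\<mu> u) v * u i)" by (simp add: pairing_def sum_distrib_right)
    finally show "v i = (\<Sum>u\<in>B. pairing d (\<mu> u) v * u i)" .
  qed
  have "pairing d (\<mu> u) u' = (if u = u' then 1 else 0)" if u: "u \<in> B" "u' \<in> B" for u u'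
  proof -
    let ?c = "\<lambda>w. if w \<in> B then pairing d (\<mu> w) u' else 0" and ?c' = "\<lambda>w. if w = u' then 1 else 0 :: int"
    have "u' \<in> lattice d" using u sub by blast
    moreover have "?c \<in> tuples B \<and> u' = (\<lambda>i. \<Sum>w\<in>B. ?c w * w i)"
      using exp[OF \<open>u' \<in> lattice d\<close>] by (simp add: tuples_def)
    moreover have "?c' \<in> tuples B \<and> u' = (\<lambda>i. \<Sum>w\<in>B. ?c' w * w i)"
      using u fin by (auto simp: tuples_def if_distrib[of "\<lambda>x. x * _"] cong: if_cong)
    ultimately have "?c = ?c'" using uniq by blast
    then show ?thesis using u by (metis (mono_tags, lifting))
  qed
  then show thesis by (rule that)
qed

text \<open>Only the dual vectors are kept from the lattice basis. They read off the coefficients of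
  points of the cone, over the reals as well, and they certify integrality.\<close>

lemma nonsingular_cone_dual:
  assumes "nonsingular_cone d \<sigma>"
  obtains S \<mu> where "finite S" "S \<subseteq> lattice d" "\<sigma> = cone_of S"
    "\<And>u u'. u \<in> S \<Longrightarrow> u' \<in> S \<Longrightarrow> pairing d (\<mu> u) u' = (if u = u' then 1 else 0)"
proof -
  obtain B S where BS: "lattice_basis d B" "S \<subseteq> B" "\<sigma> = cone_of S"
    using assms unfolding nonsingular_cone_def by blast
  obtain \<mu> where \<mu>: "\<And>u u'. u \<in> B \<Longrightarrow> u' \<in> B \<Longrightarrow> pairing d (\<mu> u) u' = (if u = u' then 1 else 0)"
    using lattice_basis_dual[OF BS(1)] by blast
  have "finite B" "B \<subseteq> lattice d" using BS(1) unfolding lattice_basis_def by auto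
  then show thesis using that[of S \<mu>] BS(2,3) \<mu> finite_subset by blast
qed

lemma cone_of_combI: "(\<And>u. u \<in> S \<Longrightarrow> 0 \<le> r u) \<Longrightarrow> (\<lambda>i. \<Sum>u\<in>S. r u * rvec u i) \<in> cone_of S"
  unfolding cone_of_def rvec_def by blast

lemma cone_of_combE:
  assumes "x \<in> cone_of S"
  obtains r where "\<And>u. u \<in> S \<Longrightarrow> 0 \<le> r u" "x = (\<lambda>i. \<Sum>u\<in>S. r u * rvec u i)"
  using assms unfolding cone_of_def rvec_def by blast

lemma rvec_in_cone_of:
  assumes "finite S" "v \<in> S"
  shows "rvec v \<in> cone_of S"
proof -
  have "rvec v = (\<lambda>i. \<Sum>u\<in>S. (if u = v then 1 else 0) * rvec u i)"
    using assms by (simp add: if_distrib[of "\<lambda>x. x * _"] cong: if_cong)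
  then show ?thesis using cone_of_combI[of S "\<lambda>u. if u = v then 1 else 0"] by simp
qed

lemma cone_of_singleton: "x \<in> cone_of {v} \<longleftrightarrow> (\<exists>r\<ge>0. x = (\<lambda>i. r * rvec v i))"
  unfolding cone_of_def rvec_def by (auto intro: exI[of _ "\<lambda>_. _"])

lemma pairing_comb:
  fixes r :: "(nat \<Rightarrow> int) \<Rightarrow> real"
  assumes "finite S" "u \<in> S"
    and "\<And>u u'. u \<in> S \<Longrightarrow> u' \<in> S \<Longrightarrow> pairing d (\<mu> u) u' = (if u = u' then 1 else 0)"
  shows "pairing d (rvec (\<mu> u)) (\<lambda>i. \<Sum>u\<in>S. r u * rvec u i) = r u"
proof -
  have "pairing d (rvec (\<mu> u)) (\<lambda>i. \<Sum>u\<in>S. r u * rvec u i) = (\<Sum>u'\<in>S. r u' * of_int (if u = u' then 1 else 0))"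
    unfolding pairing_sum_scale pairing_rvec by (rule sum.cong) (use assms in auto)
  also have "\<dots> = r u" using assms(1,2) by (simp add: if_distrib[of "\<lambda>x. _ * of_int x"] cong: if_cong)
  finally show ?thesis .
qed

text \<open>Membership becomes a system of linear equations and weak inequalities in
  \<open>x\<close>, hence a closed condition that passes to limits.\<close>

lemma mem_cone_of_iff:
  fixes x :: "nat \<Rightarrow> real"
  assumes S: "finite S" "\<And>u u'. u \<in> S \<Longrightarrow> u' \<in> S \<Longrightarrow> pairing d (\<mu> u) u' = (if u = u' then 1 else 0)"
  shows "x \<in> cone_of S \<longleftrightarrow> (\<forall>u\<in>S. 0 \<le> pairing d (rvec (\<mu> u)) x) \<and>
    (\<forall>i. x i = (\<Sum>u\<in>S. pairing d (rvec (\<mu> u)) x * rvec u i))"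
proof
  assume "x \<in> cone_of S"
  then obtain r where r: "\<And>u. u \<in> S \<Longrightarrow> 0 \<le> r u" "x = (\<lambda>i. \<Sum>u\<in>S. r u * rvec u i)"
    using cone_of_combE[of x S] by blast
  have eq: "pairing d (rvec (\<mu> u)) x = r u" if "u \<in> S" for u
    unfolding r(2) by (rule pairing_comb[OF S(1) that S(2)])
  then have "x i = (\<Sum>u\<in>S. pairing d (rvec (\<mu> u)) x * rvec u i)" for i
    using r(2) by simp
  with eq r(1) show "(\<forall>u\<in>S. 0 \<le> pairing d (rvec (\<mu> u)) x) \<and>
    (\<forall>i. x i = (\<Sum>u\<in>S. pairing d (rvec (\<mu> u)) x * rvec u i))" by simp
next
  assume *: "(\<forall>u\<in>S. 0 \<le> pairing d (rvec (\<mu> u)) x) \<and>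
    (\<forall>i. x i = (\<Sum>u\<in>S. pairing d (rvec (\<mu> u)) x * rvec u i))"
  then have "x = (\<lambda>i. \<Sum>u\<in>S. pairing d (rvec (\<mu> u)) x * rvec u i)" by blast
  moreover have "(\<lambda>i. \<Sum>u\<in>S. pairing d (rvec (\<mu> u)) x * rvec u i) \<in> cone_of S"
    by (rule cone_of_combI) (use * in blast)
  ultimately show "x \<in> cone_of S" by metis
qed

section \<open>Faces, rays and stars\<close>

lemma face_iff:
  "face d \<tau> \<sigma> \<longleftrightarrow> (\<exists>m. (\<forall>x\<in>\<sigma>. 0 \<le> pairing d m x) \<and> \<tau> = {x\<in>\<sigma>. pairing d m x = 0})"
  unfolding face_def pairing_def ..

lemma face_contains_summands:
  assumes face: "face d \<tau> \<sigma>" and R: "finite R" "\<And>v. v \<in> R \<Longrightarrow> rvec v \<in> \<sigma>" "\<And>v. v \<in> R \<Longrightarrow> 0 < r v"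
    and sum: "(\<lambda>i. \<Sum>v\<in>R. r v * rvec v i) \<in> \<tau>" and v: "v \<in> R"
  shows "rvec v \<in> \<tau>"
proof -
  obtain m where m: "\<And>x. x \<in> \<sigma> \<Longrightarrow> 0 \<le> pairing d m x" "\<tau> = {x\<in>\<sigma>. pairing d m x = 0}"
    using face unfolding face_iff by blast
  have "(\<Sum>v\<in>R. r v * pairing d m (rvec v)) = 0"
    using sum unfolding m(2) by (simp add: pairing_sum_scale)
  moreover have "\<forall>v\<in>R. 0 \<le> r v * pairing d m (rvec v)"
    using R(3) m(1)[OF R(2)] by (simp add: less_imp_le)
  ultimately have "r v * pairing d m (rvec v) = 0"
    using sum_nonneg_eq_0_iff[OF R(1), of "\<lambda>v. r v * pairing d m (rvec v)"] v by simp
  then show ?thesis using R(2,3)[OF v] unfolding m(2) by auto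
qed

text \<open>A face that contains a point of the relative interior is the whole cone: the supporting
  functional vanishes on a sum with positive weights, hence on each generator.\<close>

lemma face_eq_of_sum:
  assumes face: "face d \<tau> (cone_of S)" and S: "finite S" "\<And>v. v \<in> S \<Longrightarrow> 0 < r v"
    and sum: "(\<lambda>i. \<Sum>v\<in>S. r v * rvec v i) \<in> \<tau>"
  shows "\<tau> = cone_of S"
proof -
  obtain m where m: "\<And>x. x \<in> cone_of S \<Longrightarrow> 0 \<le> pairing d m x" "\<tau> = {x\<in>cone_of S. pairing d m x = 0}"
    using face unfolding face_iff by blast
  have "rvec v \<in> \<tau>" if "v \<in> S" for v
    by (rule face_contains_summands[OF face S(1) rvec_in_cone_of[OF S(1)] S(2) sum that])
  then have z: "pairing d m (rvec v) = 0" if "v \<in> S" for v using that unfolding m(2) by blast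
  have "pairing d m x = 0" if x: "x \<in> cone_of S" for x
  proof -
    obtain q where "x = (\<lambda>i. \<Sum>u\<in>S. q u * rvec u i)" using cone_of_combE[OF x] by blast
    then show ?thesis by (simp add: pairing_sum_scale z)
  qed
  then show ?thesis unfolding m(2) by blast
qed

lemma primitive_nonzero: "primitive v \<Longrightarrow> v \<noteq> (\<lambda>_. 0)"
  unfolding primitive_def by force

lemma fanD:
  assumes "fan d \<Sigma>"
  shows "finite \<Sigma>" "\<Sigma> \<noteq> {}" "\<sigma> \<in> \<Sigma> \<Longrightarrow> nonsingular_cone d \<sigma>"
    "\<sigma> \<in> \<Sigma> \<Longrightarrow> face d \<tau> \<sigma> \<Longrightarrow> \<tau> \<in> \<Sigma>"
    "\<sigma> \<in> \<Sigma> \<Longrightarrow> \<tau> \<in> \<Sigma> \<Longrightarrow> face d (\<sigma> \<inter> \<tau>) \<sigma>"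
  using assms unfolding fan_def by auto

text \<open>Besides the dual vectors this identifies \<open>S\<close> with the set of rays of the
  fan lying in \<sigma>, so that vanishing patterns of homogeneous coordinates can be compared with
  generators of cones.\<close>

lemma fan_cone:
  assumes fan: "fan d \<Sigma>" and \<sigma>: "\<sigma> \<in> \<Sigma>"
  obtains S \<mu> where "finite S" "S \<subseteq> lattice d" "\<sigma> = cone_of S"
    "\<And>u u'. u \<in> S \<Longrightarrow> u' \<in> S \<Longrightarrow> pairing d (\<mu> u) u' = (if u = u' then 1 else 0)"
    "S \<subseteq> gens \<Sigma>" "\<And>v. v \<in> gens \<Sigma> \<Longrightarrow> rvec v \<in> \<sigma> \<Longrightarrow> v \<in> S"
proof -
  obtain S \<mu> where S: "finite S" "S \<subseteq> lattice d" "\<sigma> = cone_of S"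
    "\<And>u u'. u \<in> S \<Longrightarrow> u' \<in> S \<Longrightarrow> pairing d (\<mu> u) u' = (if u = u' then 1 else 0)"
    using nonsingular_cone_dual[OF fanD(3)[OF fan \<sigma>]] by blast
  have gen: "u \<in> gens \<Sigma>" if u: "u \<in> S" for u
  proof -
    have "primitive u"
      unfolding primitive_def
    proof (intro allI impI)
      fix k w assume "u = (\<lambda>i. k * w i)"
      then have "pairing d (\<mu> u) u = k * pairing d (\<mu> u) w" by (metis pairing_scale)
      then have "k * pairing d (\<mu> u) w = 1" using S(4)[OF u u] by simp
      then show "\<bar>k\<bar> = 1" by (metis abs_zmult_eq_1 abs_1)
    qed
    moreover have "face d (cone_of {u}) (cone_of S)"
      unfolding face_iff
    proof (intro exI conjI ballI)
      \<comment> \<open>The sum of the dual vectors of the other generators: nonnegative on the cone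
        and zero exactly on the ray of \<open>u\<close>.\<close>
      let ?m = "\<lambda>i. \<Sum>u'\<in>S - {u}. rvec (\<mu> u') i"
      have m: "pairing d ?m (\<lambda>i. \<Sum>u\<in>S. r u * rvec u i) = (\<Sum>u'\<in>S - {u}. r u')" for r
        unfolding pairing_sum_left using pairing_comb[OF S(1) _ S(4)] by (intro sum.cong) auto
      show "0 \<le> pairing d ?m x" if x: "x \<in> cone_of S" for x
      proof -
        obtain r where "\<And>u. u \<in> S \<Longrightarrow> 0 \<le> r u" "x = (\<lambda>i. \<Sum>u\<in>S. r u * rvec u i)"
          using cone_of_combE[OF x] by blast
        then show ?thesis by (auto simp: m intro!: sum_nonneg)
      qed
      show "cone_of {u} = {x \<in> cone_of S. pairing d ?m x = 0}"
      proof (intro equalityI subsetI)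
        fix x assume "x \<in> cone_of {u}"
        then obtain r where r: "r \<ge> 0" "x = (\<lambda>i. r * rvec u i)" unfolding cone_of_singleton by blast
        let ?r = "\<lambda>w. if w = u then r else 0"
        have "x = (\<lambda>i. \<Sum>u\<in>S. ?r u * rvec u i)"
          using r u S(1) by (simp add: if_distrib[of "\<lambda>x. x * _"] cong: if_cong)
        moreover have "(\<Sum>u'\<in>S - {u}. ?r u') = 0" by (rule sum.neutral) auto
        ultimately show "x \<in> {x \<in> cone_of S. pairing d ?m x = 0}"
          using m[of ?r] cone_of_combI[of S ?r] r(1) by simp
      next
        fix x assume x: "x \<in> {x \<in> cone_of S. pairing d ?m x = 0}"
        then obtain r where r: "\<And>u. u \<in> S \<Longrightarrow> 0 \<le> r u" "x = (\<lambda>i. \<Sum>u\<in>S. r u * rvec u i)"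
          using cone_of_combE[of x S] by blast
        have "(\<Sum>u'\<in>S - {u}. r u') = 0" using x r(2) m by simp
        then have "\<forall>u'\<in>S - {u}. r u' = 0"
          using sum_nonneg_eq_0_iff[of "S - {u}" r] S(1) r(1) by simp
        then have "x = (\<lambda>i. r u * rvec u i)"
          unfolding r(2) using u S(1) by (simp add: sum.remove[of S u])
        then show "x \<in> cone_of {u}" unfolding cone_of_singleton using r(1)[OF u] by blast
      qed
    qed
    ultimately show ?thesis unfolding gens_def using fanD(4)[OF fan \<sigma>] S(3) by blast
  qed
  have mem: "v \<in> S" if v: "v \<in> gens \<Sigma>" "rvec v \<in> \<sigma>" for v
  proof -
    have prim: "primitive v" and cv: "cone_of {v} \<in> \<Sigma>" using v(1) unfolding gens_def by auto
    obtain r where r: "\<And>u. u \<in> S \<Longrightarrow> 0 \<le> r u" "rvec v = (\<lambda>i. \<Sum>u\<in>S. r u * rvec u i)"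
      using v(2) S(3) cone_of_combE[of "rvec v" S] by blast
    have "\<exists>u\<in>S. r u \<noteq> 0"
    proof (rule ccontr)
      assume "\<not> ?thesis"
      then have "rvec v = (\<lambda>_. 0)" unfolding r(2) by simp
      then show False using primitive_nonzero[OF prim] by (auto simp: rvec_def fun_eq_iff)
    qed
    then obtain u where u: "u \<in> S" "r u \<noteq> 0" by blast
    \<comment> \<open>The ray of \<open>v\<close> meets \<sigma> in a face. Every generator
      occurring in \<open>v\<close> with nonzero coefficient lies in that face, hence on the ray of
      \<open>v\<close>.\<close>
    obtain m where m: "\<And>x. x \<in> \<sigma> \<Longrightarrow> 0 \<le> pairing d m x" "\<sigma> \<inter> cone_of {v} = {x\<in>\<sigma>. pairing d m x = 0}"
      using fanD(5)[OF fan \<sigma> cv] unfolding face_iff by blast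
    have "rvec v \<in> cone_of {v}" by (rule rvec_in_cone_of) auto
    then have "pairing d m (rvec v) = 0" using m(2) v(2) by blast
    then have "(\<Sum>u\<in>S. r u * pairing d m (rvec u)) = 0" unfolding r(2) pairing_sum_scale .
    moreover have uS: "rvec u \<in> \<sigma>" if "u \<in> S" for u using rvec_in_cone_of[OF S(1) that] S(3) by simp
    ultimately have "\<forall>u\<in>S. r u * pairing d m (rvec u) = 0"
      using sum_nonneg_eq_0_iff[OF S(1), of "\<lambda>u. r u * pairing d m (rvec u)"] r(1) m(1) by simp
    then have "r u * pairing d m (rvec u) = 0" using u by blast
    then have "rvec u \<in> cone_of {v}" using u m(2) uS by auto
    then obtain l where l: "l \<ge> 0" "rvec u = (\<lambda>i. l * rvec v i)" unfolding cone_of_singleton by blast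
    \<comment> \<open>The real factor \<open>l\<close> between \<open>u\<close> and \<open>v\<close>
      is inverted by an integer: pairing with the dual vector of \<open>u\<close> gives
      \<open>l * N = 1\<close>, so \<open>v\<close> is an integral multiple of \<open>u\<close> and
      primitivity leaves \<open>N = 1\<close>.\<close>
    define N where "N = pairing d (\<mu> u) v"
    have "l * of_int N = pairing d (rvec (\<mu> u)) (rvec u)"
      unfolding l(2) pairing_scale pairing_rvec N_def by simp
    also have "\<dots> = 1" unfolding pairing_rvec using S(4)[OF u(1) u(1)] by simp
    finally have lN: "l * of_int N = 1" .
    have "v = (\<lambda>i. N * u i)"
    proof
      fix i
      have "real_of_int (u i) = l * of_int (v i)" using l(2) by (simp add: rvec_def fun_eq_iff)
      then have "real_of_int (N * u i) = (l * of_int N) * of_int (v i)" by simp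
      then have "real_of_int (N * u i) = of_int (v i)" unfolding lN by simp
      then show "v i = N * u i" by linarith
    qed
    moreover have "N > 0" using l(1) lN by (metis mult_nonneg_nonpos not_less of_int_le_0_iff not_one_le_zero)
    ultimately have "N = 1" using prim unfolding primitive_def by (metis abs_of_pos)
    then show "v \<in> S" using \<open>v = (\<lambda>i. N * u i)\<close> u(1) by simp
  qed
  show thesis by (rule that[OF S]) (use gen mem in auto)
qed

lemma fan_gens:
  assumes fan: "fan d \<Sigma>"
  shows "finite (gens \<Sigma>)" "gens \<Sigma> \<subseteq> lattice d"
proof -
  have "\<exists>S. finite S \<and> S \<subseteq> lattice d \<and> (\<forall>v\<in>gens \<Sigma>. rvec v \<in> \<sigma> \<longrightarrow> v \<in> S)" if "\<sigma> \<in> \<Sigma>" for \<sigma>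
    using fan_cone[OF fan that] by metis
  then obtain S where S: "\<And>\<sigma>. \<sigma> \<in> \<Sigma> \<Longrightarrow> finite (S \<sigma>) \<and> S \<sigma> \<subseteq> lattice d \<and> (\<forall>v\<in>gens \<Sigma>. rvec v \<in> \<sigma> \<longrightarrow> v \<in> S \<sigma>)"
    by metis
  have sub: "gens \<Sigma> \<subseteq> (\<Union>\<sigma>\<in>\<Sigma>. S \<sigma>)"
  proof
    fix v assume v: "v \<in> gens \<Sigma>"
    then have "cone_of {v} \<in> \<Sigma>" "rvec v \<in> cone_of {v}" by (auto simp: gens_def intro: rvec_in_cone_of)
    then show "v \<in> (\<Union>\<sigma>\<in>\<Sigma>. S \<sigma>)" using S v by blast
  qed
  show "finite (gens \<Sigma>)" using finite_subset[OF sub] S fanD(1)[OF fan] by simp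
  show "gens \<Sigma> \<subseteq> lattice d" using sub S by blast
qed

lemma infinite_nonneg_limit:
  fixes A B :: real
  assumes "infinite N" "\<And>n::nat. n \<in> N \<Longrightarrow> 0 \<le> A + B / real n"
  shows "0 \<le> A"
proof (rule ccontr)
  assume "\<not> 0 \<le> A"
  then obtain k :: nat where k: "\<bar>B\<bar> < real k * - A" using reals_Archimedean3[of "- A"] by auto
  obtain n where n: "n \<in> N" "n > k" using assms(1) unfolding infinite_nat_iff_unbounded by blast
  have "0 \<le> A + B / real n" by (rule assms(2)[OF n(1)])
  then have "0 \<le> A * real n + B" using n(2) by (simp add: field_simps)
  moreover have "real k * - A \<le> real n * - A" using n(2) \<open>\<not> 0 \<le> A\<close> by (intro mult_right_mono) auto
  ultimately show False using k by (simp add: algebra_simps)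
qed

text \<open>
  A cone containing infinitely many of the points \<open>p + \<delta> / n\<close>, where \<open>p\<close> is the sum of \<open>R\<close>, contains \<open>p\<close> and
  hence \<open>R\<close>; since \<open>\<chi>\<close> is negative at these points, it is negative at some generator.
\<close>

lemma star_cone:
  fixes \<delta> :: "nat \<Rightarrow> real"
  assumes fan: "fan d \<Sigma>" and sub: "\<Sigma>' \<subseteq> \<Sigma>" and \<sigma>: "\<sigma> \<in> \<Sigma>" and R: "finite R" "\<And>v. v \<in> R \<Longrightarrow> rvec v \<in> \<sigma>"
    and cover: "\<And>n::nat. n \<ge> 1 \<Longrightarrow> \<exists>\<tau>\<in>\<Sigma>'. (\<lambda>i. (\<Sum>v\<in>R. rvec v i) + \<delta> i / real n) \<in> \<tau>"
    and neg: "\<And>v. v \<in> R \<Longrightarrow> pairing d \<chi> (rvec v) = 0" "pairing d \<chi> \<delta> < 0"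
  shows "\<exists>\<tau>\<in>\<Sigma>'. (\<forall>v\<in>R. rvec v \<in> \<tau>) \<and> (\<exists>u\<in>gens \<Sigma>. rvec u \<in> \<tau> \<and> pairing d \<chi> (rvec u) < 0)"
proof -
  define p where "p = (\<lambda>i. \<Sum>v\<in>R. rvec v i)"
  define x where "x = (\<lambda>(n::nat) i. p i + \<delta> i / real n)"
  have px: "pairing d m (x n) = pairing d m p + pairing d m \<delta> / real n" for m n
    using pairing_add[of d m p "\<lambda>i. \<delta> i / real n"] pairing_scale[of d m "1 / real n" \<delta>] by (simp add: x_def)
  obtain s where s: "\<And>n. n \<ge> 1 \<Longrightarrow> s n \<in> \<Sigma>' \<and> x n \<in> s n"
    using cover unfolding x_def p_def by metis
  have "finite (s ` {1..})" using finite_subset[OF sub fanD(1)[OF fan]] s by (auto intro: finite_subset[of _ \<Sigma>'])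
  then obtain n0 where n0: "n0 \<in> {1..}" "infinite {n \<in> {1..}. s n = s n0}"
    using pigeonhole_infinite[of "{1::nat..}" s] infinite_Ici by blast
  define \<tau> N where "\<tau> = s n0" and "N = {n \<in> {1::nat..}. s n = s n0}"
  have \<tau>: "\<tau> \<in> \<Sigma>'" "\<And>n. n \<in> N \<Longrightarrow> x n \<in> \<tau>" "infinite N"
    using s n0 unfolding \<tau>_def N_def by force+
  then have \<tau>\<Sigma>: "\<tau> \<in> \<Sigma>" using sub by blast
  obtain S \<mu> where S: "finite S" "\<tau> = cone_of S"
    "\<And>u u'. u \<in> S \<Longrightarrow> u' \<in> S \<Longrightarrow> pairing d (\<mu> u) u' = (if u = u' then 1 else 0)" "S \<subseteq> gens \<Sigma>"
    using fan_cone[OF fan \<tau>\<Sigma>] by metis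
  have mem: "y \<in> cone_of S \<longleftrightarrow> (\<forall>u\<in>S. 0 \<le> pairing d (rvec (\<mu> u)) y) \<and>
    (\<forall>i. y i = (\<Sum>u\<in>S. pairing d (rvec (\<mu> u)) y * rvec u i))" for y
    by (rule mem_cone_of_iff[OF S(1)]) (rule S(3))
  have x\<tau>: "(\<forall>u\<in>S. 0 \<le> pairing d (rvec (\<mu> u)) (x n)) \<and>
    (\<forall>i. x n i = (\<Sum>u\<in>S. pairing d (rvec (\<mu> u)) (x n) * rvec u i))" if "n \<in> N" for n
    using \<tau>(2)[OF that] unfolding S(2) mem by simp
  have "p \<in> \<tau>"
    unfolding S(2)
  proof (rule mem[THEN iffD2], intro conjI ballI allI)
    show "0 \<le> pairing d (rvec (\<mu> u)) p" if u: "u \<in> S" for u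
      by (rule infinite_nonneg_limit[OF \<tau>(3), of _ "pairing d (rvec (\<mu> u)) \<delta>"]) (use x\<tau> u px in auto)
    fix i
    let ?A = "p i - (\<Sum>u\<in>S. pairing d (rvec (\<mu> u)) p * rvec u i)"
    let ?B = "\<delta> i - (\<Sum>u\<in>S. pairing d (rvec (\<mu> u)) \<delta> * rvec u i)"
    have AB: "?A + ?B / real n = 0" if "n \<in> N" for n
    proof -
      have "x n i = (\<Sum>u\<in>S. pairing d (rvec (\<mu> u)) (x n) * rvec u i)" using x\<tau>[OF that] by blast
      also have "\<dots> = (\<Sum>u\<in>S. pairing d (rvec (\<mu> u)) p * rvec u i) + (\<Sum>u\<in>S. pairing d (rvec (\<mu> u)) \<delta> * rvec u i) / real n"
        unfolding px by (simp add: algebra_simps sum.distrib sum_divide_distrib)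
      finally show ?thesis by (simp add: x_def algebra_simps diff_divide_distrib)
    qed
    have "0 \<le> ?A" by (rule infinite_nonneg_limit[OF \<tau>(3), of _ ?B]) (simp add: AB)
    moreover have "0 \<le> - ?A"
    proof (rule infinite_nonneg_limit[OF \<tau>(3), of _ "- ?B"])
      fix n assume "n \<in> N"
      from AB[OF this] show "0 \<le> - ?A + - ?B / real n" by (simp only: minus_divide_left[symmetric])
    qed
    ultimately show "p i = (\<Sum>u\<in>S. pairing d (rvec (\<mu> u)) p * rvec u i)" by simp
  qed
  obtain S' \<mu>' where S': "finite S'" "\<sigma> = cone_of S'"
    using fan_cone[OF fan \<sigma>] by metis
  have "p \<in> \<sigma>"
  proof -
    have "\<exists>r. (\<forall>u\<in>S'. 0 \<le> r u) \<and> rvec v = (\<lambda>i. \<Sum>u\<in>S'. r u * rvec u i)" if "v \<in> R" for v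
      using cone_of_combE[of "rvec v" S'] R(2)[OF that] S'(2) by metis
    then obtain r where r: "\<And>v u. v \<in> R \<Longrightarrow> u \<in> S' \<Longrightarrow> 0 \<le> r v u" "\<And>v. v \<in> R \<Longrightarrow> rvec v = (\<lambda>i. \<Sum>u\<in>S'. r v u * rvec u i)"
      by metis
    have "p = (\<lambda>i. \<Sum>u\<in>S'. (\<Sum>v\<in>R. r v u) * rvec u i)"
    proof
      fix i
      have "p i = (\<Sum>v\<in>R. \<Sum>u\<in>S'. r v u * rvec u i)" unfolding p_def by (rule sum.cong) (use r(2) in metis)+
      also have "\<dots> = (\<Sum>u\<in>S'. \<Sum>v\<in>R. r v u * rvec u i)" by (rule sum.swap)
      finally show "p i = (\<Sum>u\<in>S'. (\<Sum>v\<in>R. r v u) * rvec u i)" by (simp add: sum_distrib_right)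
    qed
    then show ?thesis unfolding S'(2) using cone_of_combI[of S' "\<lambda>u. \<Sum>v\<in>R. r v u"] r(1) by (simp add: sum_nonneg)
  qed
  then have "(\<lambda>i. \<Sum>v\<in>R. 1 * rvec v i) \<in> \<sigma> \<inter> \<tau>" using \<open>p \<in> \<tau>\<close> unfolding p_def by simp
  then have "rvec v \<in> \<sigma> \<inter> \<tau>" if "v \<in> R" for v
    using face_contains_summands[OF fanD(5)[OF fan \<sigma> \<tau>\<Sigma>] R, of "\<lambda>_. 1"] that by simp
  moreover have "\<exists>u\<in>S. pairing d \<chi> (rvec u) < 0"
  proof (rule ccontr)
    assume "\<not> ?thesis"
    then have pos: "0 \<le> pairing d \<chi> (rvec u)" if "u \<in> S" for u using that by force
    obtain n where n: "n \<in> N" "n > 0" using \<tau>(3) unfolding infinite_nat_iff_unbounded by blast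
    obtain r where r: "\<And>u. u \<in> S \<Longrightarrow> 0 \<le> r u" "x n = (\<lambda>i. \<Sum>u\<in>S. r u * rvec u i)"
      using \<tau>(2)[OF n(1)] S(2) cone_of_combE[of "x n" S] by metis
    have "0 \<le> pairing d \<chi> (x n)" unfolding r(2) pairing_sum_scale using r(1) pos by (intro sum_nonneg) simp
    moreover have "pairing d \<chi> p = 0" unfolding p_def pairing_sum using neg(1) by simp
    moreover have "pairing d \<chi> \<delta> / real n < 0" using neg(2) n(2) by (simp add: divide_neg_pos)
    ultimately show False unfolding px by simp
  qed
  then obtain u where u: "u \<in> S" "pairing d \<chi> (rvec u) < 0" by blast
  moreover have "u \<in> gens \<Sigma>" using u(1) S(4) by blast
  moreover have "rvec u \<in> \<tau>" using rvec_in_cone_of[OF S(1) u(1)] S(2) by simp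
  ultimately show ?thesis using \<tau>(1) by (intro bexI[of _ \<tau>] conjI ballI bexI[of _ u]) auto
qed

lemma sum_in_tuples:
  fixes f :: "'a \<Rightarrow> nat \<Rightarrow> real"
  shows "(\<And>v. v \<in> S \<Longrightarrow> f v \<in> tuples I) \<Longrightarrow> (\<lambda>i. \<Sum>v\<in>S. r v * f v i) \<in> tuples I"
  by (simp add: tuples_def)

lemma rvec_tuples: "v \<in> lattice d \<Longrightarrow> rvec v \<in> tuples {1..d}"
  by (simp add: lattice_def tuples_def rvec_def)

lemma cone_subset_tuples:
  assumes fan: "fan d \<Sigma>" and \<sigma>: "\<sigma> \<in> \<Sigma>"
  shows "\<sigma> \<subseteq> tuples {1..d}"
proof -
  obtain S \<mu> where S: "finite S" "S \<subseteq> lattice d" "\<sigma> = cone_of S"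
    using fan_cone[OF fan \<sigma>] by metis
  show ?thesis
  proof
    fix x assume "x \<in> \<sigma>"
    then obtain r where x: "x = (\<lambda>i. \<Sum>u\<in>S. r u * rvec u i)" using S(3) cone_of_combE[of x S] by metis
    show "x \<in> tuples {1..d}" unfolding x using S(2) by (intro sum_in_tuples rvec_tuples) blast
  qed
qed

lemma gens_rvec_in: "v \<in> gens \<Sigma> \<Longrightarrow> cone_of {v} \<in> \<Sigma> \<and> rvec v \<in> cone_of {v}"
  by (auto simp: gens_def intro: rvec_in_cone_of)

lemma pairing_reduce: "d \<ge> 1 \<Longrightarrow> x d = 0 \<Longrightarrow> pairing d m x = pairing (d - 1) m x"
  by (cases d) (auto simp: pairing_def)

lemma complete_fan_star:
  assumes fan: "complete_fan d \<Sigma>" and R: "finite R" "\<sigma> \<in> \<Sigma>" "\<And>v. v \<in> R \<Longrightarrow> rvec v \<in> \<sigma>"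
    and w: "w \<in> lattice d" and \<chi>: "\<And>v. v \<in> R \<Longrightarrow> pairing d \<chi> v = 0" "pairing d \<chi> w < 0"
  shows "\<exists>\<tau>\<in>\<Sigma>. (\<forall>v\<in>R. rvec v \<in> \<tau>) \<and> (\<exists>u\<in>gens \<Sigma>. rvec u \<in> \<tau> \<and> pairing d \<chi> u < 0)"
proof -
  have f: "fan d \<Sigma>" and U: "\<Union>\<Sigma> = tuples {1..d}" using fan by (auto simp: complete_fan_def)
  have "\<exists>\<tau>\<in>\<Sigma>. (\<forall>v\<in>R. rvec v \<in> \<tau>) \<and> (\<exists>u\<in>gens \<Sigma>. rvec u \<in> \<tau> \<and> pairing d (rvec \<chi>) (rvec u) < 0)"
  proof (rule star_cone[OF f subset_refl R(2,1)])
    fix n :: nat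
    have "(\<lambda>i. \<Sum>v\<in>R. 1 * rvec v i) \<in> tuples {1..d}"
      using R(3) cone_subset_tuples[OF f R(2)] by (intro sum_in_tuples) blast
    then have "(\<lambda>i. (\<Sum>v\<in>R. rvec v i) + rvec w i / real n) \<in> tuples {1..d}"
      using rvec_tuples[OF w] by (simp add: tuples_def)
    then show "\<exists>\<tau>\<in>\<Sigma>. (\<lambda>i. (\<Sum>v\<in>R. rvec v i) + rvec w i / real n) \<in> \<tau>" using U by blast
  qed (use R(3) \<chi> in \<open>simp_all add: pairing_rvec\<close>)
  then show ?thesis by (simp add: pairing_rvec)
qed

section \<open>A complete fan split by a hyperplane\<close>

locale split_fan =
  fixes d :: nat and \<Sigma>t \<Sigma> :: "(nat \<Rightarrow> real) set set"
  assumes d2: "2 \<le> d"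
    and fan_tilde: "complete_fan (d - 1) \<Sigma>t"
    and fan: "complete_fan d \<Sigma>"
    and subfan: "\<Sigma>t \<subseteq> \<Sigma>"
begin

lemma fans: "fan d \<Sigma>" "fan (d - 1) \<Sigma>t" "\<Union>\<Sigma> = tuples {1..d}" "\<Union>\<Sigma>t = tuples {1..d - 1}"
  using fan fan_tilde by (auto simp: complete_fan_def)

lemma tilde_coord: "\<sigma> \<in> \<Sigma>t \<Longrightarrow> x \<in> \<sigma> \<Longrightarrow> x d = 0"
  using cone_subset_tuples[OF fans(2)] d2 by (force simp: tuples_def)

lemma tuples_tilde: "x \<in> tuples {1..d} \<Longrightarrow> x d = 0 \<Longrightarrow> x \<in> tuples {1..d - 1}"
proof -
  assume x: "x \<in> tuples {1..d}" "x d = 0"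
  have "x i = 0" if "i \<notin> {1..d - 1}" for i
    using x that by (cases "i = d") (auto simp: tuples_def)
  then show ?thesis by (simp add: tuples_def)
qed

text \<open>The given point lies in the relative interior of \<sigma> and in the hyperplane, hence
  by completeness in a cone \<tau> of \<open>\<Sigma>t\<close>. The common face of \<sigma> and
  \<tau> contains this interior point, so it is all of \<sigma>, which is thereby a face of
  \<tau>.\<close>

lemma combination_in_tilde:
  assumes \<sigma>: "\<sigma> \<in> \<Sigma>" "\<sigma> = cone_of S" "finite S" and r: "\<And>u. u \<in> S \<Longrightarrow> 0 < r u" "(\<Sum>u\<in>S. r u * rvec u d) = 0"
  shows "\<sigma> \<in> \<Sigma>t"
proof -
  define p where "p = (\<lambda>i. \<Sum>u\<in>S. r u * rvec u i)"
  have "p \<in> cone_of S" unfolding p_def by (rule cone_of_combI) (use r(1) in \<open>simp add: less_imp_le\<close>)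
  then have p\<sigma>: "p \<in> \<sigma>" using \<sigma> by simp
  then have "p \<in> tuples {1..d}" using cone_subset_tuples[OF fans(1) \<sigma>(1)] by blast
  then have "p \<in> tuples {1..d - 1}" using r(2) by (intro tuples_tilde) (simp_all add: p_def)
  then obtain \<tau> where \<tau>: "\<tau> \<in> \<Sigma>t" "p \<in> \<tau>" using fans(4) by blast
  have \<tau>\<Sigma>: "\<tau> \<in> \<Sigma>" using \<tau> subfan by blast
  have "face d (\<sigma> \<inter> \<tau>) (cone_of S)" using fanD(5)[OF fans(1) \<sigma>(1) \<tau>\<Sigma>] \<sigma>(2) by simp
  moreover have "(\<lambda>i. \<Sum>u\<in>S. r u * rvec u i) \<in> \<sigma> \<inter> \<tau>" using p\<sigma> \<tau> unfolding p_def by simp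
  ultimately have "\<sigma> \<inter> \<tau> = cone_of S" using face_eq_of_sum[where r = r and S = S, OF _ \<sigma>(3)] r(1) by simp
  then have "\<tau> \<inter> \<sigma> = \<sigma>" using \<sigma>(2) by blast
  then have "face d \<sigma> \<tau>" using fanD(5)[OF fans(1) \<tau>\<Sigma> \<sigma>(1)] by simp
  then obtain m where m: "\<forall>x\<in>\<tau>. 0 \<le> pairing d m x" "\<sigma> = {x \<in> \<tau>. pairing d m x = 0}"
    unfolding face_iff by blast
  have "pairing d m x = pairing (d - 1) m x" if "x \<in> \<tau>" for x
    using pairing_reduce[of d x m] tilde_coord[OF \<tau>(1) that] d2 by simp
  then have "face (d - 1) \<sigma> \<tau>" unfolding face_iff using m by (intro exI[of _ m]) auto
  then show ?thesis using fanD(4)[OF fans(2) \<tau>(1)] by blast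
qed

lemma cone_in_tilde:
  assumes \<sigma>: "\<sigma> \<in> \<Sigma>" and zero: "\<And>x. x \<in> \<sigma> \<Longrightarrow> x d = 0"
  shows "\<sigma> \<in> \<Sigma>t"
proof -
  obtain S \<mu> where S: "finite S" "\<sigma> = cone_of S" using fan_cone[OF fans(1) \<sigma>] by metis
  have "rvec u d = 0" if "u \<in> S" for u using zero rvec_in_cone_of[OF S(1) that] S(2) by blast
  then show ?thesis using combination_in_tilde[OF \<sigma> S(2,1), of "\<lambda>_. 1"] by simp
qed

lemma tilde_in_plus_minus: "\<sigma> \<in> \<Sigma>t \<Longrightarrow> \<sigma> \<in> plus_fan d \<Sigma> \<and> \<sigma> \<in> minus_fan d \<Sigma>"
proof -
  assume \<sigma>: "\<sigma> \<in> \<Sigma>t"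
  have "\<forall>x\<in>\<sigma>. 0 \<le> x d \<and> x d \<le> 0"
  proof
    fix x assume "x \<in> \<sigma>"
    from tilde_coord[OF \<sigma> this] show "0 \<le> x d \<and> x d \<le> 0" by simp
  qed
  then show ?thesis using \<sigma> subfan unfolding plus_fan_def minus_fan_def by blast
qed

text \<open>A cone with generators strictly on both sides would have an interior point on the
  hyperplane. Then \<open>combination_in_tilde\<close> puts the whole cone into the hyperplane, a
  contradiction.\<close>

lemma plus_or_minus:
  assumes \<sigma>: "\<sigma> \<in> \<Sigma>"
  shows "\<sigma> \<in> plus_fan d \<Sigma> \<or> \<sigma> \<in> minus_fan d \<Sigma>"
proof (rule ccontr)
  assume no: "\<not> ?thesis"
  obtain S \<mu> where S: "finite S" "\<sigma> = cone_of S" using fan_cone[OF fans(1) \<sigma>] by metis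
  have "\<exists>u\<in>S. rvec u d < 0"
  proof (rule ccontr)
    assume *: "\<not> ?thesis"
    have "0 \<le> x d" if x: "x \<in> \<sigma>" for x
    proof -
      obtain r where "\<And>u. u \<in> S \<Longrightarrow> 0 \<le> r u" "x = (\<lambda>i. \<Sum>u\<in>S. r u * rvec u i)"
        using x S(2) cone_of_combE[of x S] by metis
      then show ?thesis using * by (auto intro!: sum_nonneg mult_nonneg_nonneg simp: not_less)
    qed
    then show False using no \<sigma> by (auto simp: plus_fan_def)
  qed
  then obtain u1 where u1: "u1 \<in> S" "rvec u1 d < 0" by blast
  have "\<exists>u\<in>S. rvec u d > 0"
  proof (rule ccontr)
    assume *: "\<not> ?thesis"
    have "x d \<le> 0" if x: "x \<in> \<sigma>" for x
    proof -
      obtain r where "\<And>u. u \<in> S \<Longrightarrow> 0 \<le> r u" "x = (\<lambda>i. \<Sum>u\<in>S. r u * rvec u i)"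
        using x S(2) cone_of_combE[of x S] by metis
      then show ?thesis using * by (auto intro!: sum_nonpos mult_nonneg_nonpos simp: not_less)
    qed
    then show False using no \<sigma> by (auto simp: minus_fan_def)
  qed
  then obtain u2 where u2: "u2 \<in> S" "rvec u2 d > 0" by blast
  define A where "A = (\<Sum>u\<in>S. rvec u d)"
  \<comment> \<open>\<open>A\<close> is the last coordinate of the sum of all generators. Extra
    weight \<open>- A / rvec u0 d\<close> on a generator of suitable sign is nonnegative and moves
    the sum into the hyperplane.\<close>
  define u0 where "u0 = (if A \<ge> 0 then u1 else u2)"
  have u0: "u0 \<in> S" "- A / rvec u0 d \<ge> 0" "rvec u0 d \<noteq> 0"
    using u1 u2 by (auto simp: u0_def divide_nonneg_neg divide_nonpos_pos)
  define r where "r = (\<lambda>u. 1 + (if u = u0 then - A / rvec u0 d else 0))"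
  have "(\<Sum>u\<in>S. r u * rvec u d) = A + (\<Sum>u\<in>S. if u = u0 then - A else 0)"
    unfolding A_def r_def sum.distrib[symmetric] by (rule sum.cong) (use u0(3) in \<open>auto simp: algebra_simps\<close>)
  also have "\<dots> = 0" using u0(1) S(1) by simp
  finally have "\<sigma> \<in> \<Sigma>t"
    using combination_in_tilde[OF \<sigma> S(2,1), of r] u0(2) by (simp add: r_def)
  then show False using no tilde_in_plus_minus by blast
qed

lemma cover_plus:
  assumes x: "x \<in> tuples {1..d}" "0 \<le> x d"
  shows "\<exists>\<sigma>\<in>plus_fan d \<Sigma>. x \<in> \<sigma>"
proof (cases "x d = 0")
  case True
  then show ?thesis using tuples_tilde[OF x(1)] fans(4) tilde_in_plus_minus by blast
next
  case False
  obtain \<sigma> where \<sigma>: "\<sigma> \<in> \<Sigma>" "x \<in> \<sigma>" using x fans(3) by blast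
  then have "\<sigma> \<notin> minus_fan d \<Sigma>" using x(2) False by (force simp: minus_fan_def)
  then show ?thesis using plus_or_minus[OF \<sigma>(1)] \<sigma>(2) by blast
qed

lemma cover_minus:
  assumes x: "x \<in> tuples {1..d}" "x d \<le> 0"
  shows "\<exists>\<sigma>\<in>minus_fan d \<Sigma>. x \<in> \<sigma>"
proof (cases "x d = 0")
  case True
  then show ?thesis using tuples_tilde[OF x(1)] fans(4) tilde_in_plus_minus by blast
next
  case False
  obtain \<sigma> where \<sigma>: "\<sigma> \<in> \<Sigma>" "x \<in> \<sigma>" using x fans(3) by blast
  then have "\<sigma> \<notin> plus_fan d \<Sigma>" using x(2) False by (force simp: plus_fan_def)
  then show ?thesis using plus_or_minus[OF \<sigma>(1)] \<sigma>(2) by blast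
qed

lemma gens_plus_iff: "v \<in> gens (plus_fan d \<Sigma>) \<longleftrightarrow> v \<in> gens \<Sigma> \<and> 0 \<le> v d"
proof -
  have "(\<forall>x\<in>cone_of {v}. 0 \<le> x d) \<longleftrightarrow> 0 \<le> v d"
  proof
    assume "\<forall>x\<in>cone_of {v}. 0 \<le> x d"
    then have "0 \<le> rvec v d" using rvec_in_cone_of[of "{v}" v] by simp
    then show "0 \<le> v d" by (simp add: rvec_def)
  qed (auto simp: cone_of_singleton rvec_def)
  then show ?thesis by (auto simp: gens_def plus_fan_def)
qed

lemma gens_minus_iff: "v \<in> gens (minus_fan d \<Sigma>) \<longleftrightarrow> v \<in> gens \<Sigma> \<and> v d \<le> 0"
proof -
  have "(\<forall>x\<in>cone_of {v}. x d \<le> 0) \<longleftrightarrow> v d \<le> 0"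
  proof
    assume "\<forall>x\<in>cone_of {v}. x d \<le> 0"
    then have "rvec v d \<le> 0" using rvec_in_cone_of[of "{v}" v] by simp
    then show "v d \<le> 0" by (simp add: rvec_def)
  qed (auto simp: cone_of_singleton rvec_def mult_nonneg_nonpos)
  then show ?thesis by (auto simp: gens_def minus_fan_def)
qed

lemma gens_tilde_iff: "v \<in> gens \<Sigma>t \<longleftrightarrow> v \<in> gens \<Sigma> \<and> v d = 0"
proof
  assume v: "v \<in> gens \<Sigma>t"
  then have "rvec v d = 0" using gens_rvec_in[OF v] tilde_coord by blast
  then show "v \<in> gens \<Sigma> \<and> v d = 0" using v subfan by (auto simp: gens_def rvec_def)
next
  assume v: "v \<in> gens \<Sigma> \<and> v d = 0"
  then have "cone_of {v} \<in> \<Sigma>t"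
    by (intro cone_in_tilde) (auto simp: gens_def cone_of_singleton rvec_def)
  then show "v \<in> gens \<Sigma>t" using v by (auto simp: gens_def)
qed

text \<open>The sum of \<open>R\<close> lies in \<sigma> and, by completeness in the hyperplane, in
  a cone of \<open>\<Sigma>t\<close>; their common face contains the sum, hence each of its
  summands.\<close>

lemma conv_tilde:
  assumes R: "finite R" "R \<subseteq> gens \<Sigma>t" and \<sigma>: "\<sigma> \<in> \<Sigma>" "\<And>v. v \<in> R \<Longrightarrow> rvec v \<in> \<sigma>"
  shows "\<exists>\<tau>\<in>\<Sigma>t. \<forall>v\<in>R. rvec v \<in> \<tau>"
proof -
  have "(\<lambda>i. \<Sum>v\<in>R. 1 * rvec v i) \<in> tuples {1..d - 1}"
    using R(2) fan_gens(2)[OF fans(2)] by (intro sum_in_tuples rvec_tuples) blast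
  then obtain \<tau> where \<tau>: "\<tau> \<in> \<Sigma>t" "(\<lambda>i. \<Sum>v\<in>R. 1 * rvec v i) \<in> \<tau>" using fans(4) by blast
  have "(\<lambda>i. \<Sum>v\<in>R. 1 * rvec v i) \<in> \<sigma>"
  proof -
    obtain S \<mu> where S: "finite S" "\<sigma> = cone_of S" "\<And>v. v \<in> gens \<Sigma> \<Longrightarrow> rvec v \<in> \<sigma> \<Longrightarrow> v \<in> S"
      using fan_cone[OF fans(1) \<sigma>(1)] by metis
    have "R \<subseteq> S" using R(2) S(3) \<sigma>(2) gens_tilde_iff by blast
    then have "(\<lambda>i. \<Sum>v\<in>R. 1 * rvec v i) = (\<lambda>i. \<Sum>v\<in>S. (if v \<in> R then 1 else 0) * rvec v i)"
      using S(1) R(1) by (auto simp: fun_eq_iff intro!: sum.mono_neutral_cong_left)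
    then show ?thesis unfolding S(2) using cone_of_combI[of S "\<lambda>v. if v \<in> R then 1 else 0"] by simp
  qed
  then have "(\<lambda>i. \<Sum>v\<in>R. 1 * rvec v i) \<in> \<sigma> \<inter> \<tau>" using \<tau> by simp
  moreover have "\<tau> \<in> \<Sigma>" using \<tau> subfan by blast
  ultimately have "rvec v \<in> \<sigma> \<inter> \<tau>" if "v \<in> R" for v
    using face_contains_summands[OF fanD(5)[OF fans(1) \<sigma>(1)] R(1) \<sigma>(2), of \<tau> "\<lambda>_. 1"] that by simp
  then show ?thesis using \<tau>(1) by blast
qed

text \<open>The perturbing direction \<open>w\<close> lies in the hyperplane, so the perturbed
  points stay in the closed half-space and are covered by the half fan. A functional \<chi> that is
  negative on a single ray thus shows that this ray can be added to \<open>R\<close>.\<close>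

lemma star_plus_minus:
  assumes \<Sigma>': "\<Sigma>' = plus_fan d \<Sigma> \<or> \<Sigma>' = minus_fan d \<Sigma>"
    and R: "finite R" "\<sigma> \<in> \<Sigma>'" "\<And>v. v \<in> R \<Longrightarrow> rvec v \<in> \<sigma>"
    and w: "w \<in> lattice d" "w d = 0" and \<chi>: "\<And>v. v \<in> R \<Longrightarrow> pairing d \<chi> v = 0" "pairing d \<chi> w < 0"
  shows "\<exists>\<tau>\<in>\<Sigma>'. (\<forall>v\<in>R. rvec v \<in> \<tau>) \<and> (\<exists>u\<in>gens \<Sigma>'. rvec u \<in> \<tau> \<and> pairing d \<chi> u < 0)"
proof -
  have sub: "\<Sigma>' \<subseteq> \<Sigma>" using \<Sigma>' by (auto simp: plus_fan_def minus_fan_def)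
  have \<sigma>: "\<sigma> \<in> \<Sigma>" using R(2) sub by blast
  have "\<exists>\<tau>\<in>\<Sigma>'. (\<forall>v\<in>R. rvec v \<in> \<tau>) \<and> (\<exists>u\<in>gens \<Sigma>. rvec u \<in> \<tau> \<and> pairing d (rvec \<chi>) (rvec u) < 0)"
  proof (rule star_cone[OF fans(1) sub \<sigma> R(1)])
    fix n :: nat
    let ?x = "\<lambda>i. (\<Sum>v\<in>R. rvec v i) + rvec w i / real n"
    have "(\<lambda>i. \<Sum>v\<in>R. 1 * rvec v i) \<in> tuples {1..d}"
      using R(3) cone_subset_tuples[OF fans(1) \<sigma>] by (intro sum_in_tuples) blast
    then have x: "?x \<in> tuples {1..d}"
      using rvec_tuples[OF w(1)] by (simp add: tuples_def)
    from \<Sigma>' show "\<exists>\<tau>\<in>\<Sigma>'. ?x \<in> \<tau>"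
    proof
      assume p: "\<Sigma>' = plus_fan d \<Sigma>"
      then have "0 \<le> rvec v d" if "v \<in> R" for v using R(2) R(3)[OF that] by (simp add: plus_fan_def)
      then have "0 \<le> ?x d" using w(2) by (simp add: rvec_def[of w] sum_nonneg)
      then show ?thesis using cover_plus[OF x] p by simp
    next
      assume m: "\<Sigma>' = minus_fan d \<Sigma>"
      then have "rvec v d \<le> 0" if "v \<in> R" for v using R(2) R(3)[OF that] by (simp add: minus_fan_def)
      then have "?x d \<le> 0" using w(2) by (simp add: rvec_def[of w] sum_nonpos)
      then show ?thesis using cover_minus[OF x] m by simp
    qed
  qed (use R(3) \<chi> in \<open>simp_all add: pairing_rvec\<close>)
  then obtain \<tau> u where *: "\<tau> \<in> \<Sigma>'" "\<forall>v\<in>R. rvec v \<in> \<tau>" "u \<in> gens \<Sigma>" "rvec u \<in> \<tau>" "pairing d \<chi> u < 0"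
    by (auto simp: pairing_rvec)
  have "u \<in> gens \<Sigma>'"
    using \<Sigma>' *(1,3,4) gens_plus_iff[of u] gens_minus_iff[of u] by (auto simp: plus_fan_def minus_fan_def rvec_def)
  then show ?thesis using * by blast
qed

end

section \<open>Charts of toric varieties\<close>

lemma std_eq_iff: "std i = std j \<longleftrightarrow> i = j"
  by (metis std_def zero_neq_one)

lemma prod_std:
  fixes f :: "(nat \<Rightarrow> int) \<Rightarrow> complex"
  shows "(\<Prod>v\<in>std ` S. f v) = (\<Prod>i\<in>S. f (std i))"
proof (rule prod.reindex[unfolded comp_def])
  show "inj_on std S" by (rule inj_onI) (simp add: std_eq_iff)
qed

text \<open>The torus element with values \<open>l\<close> on \<open>J\<close> and 1 on all rays
  outside \<open>J\<close>, \<open>x\<close> and the vectors \<open>std i\<close>. Its value at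
  \<open>x\<close> solves the \<open>d\<close>-th equation: since \<open>x d\<close> will be 1 or
  -1, the exponent \<open>- x d\<close> yields the inverse of the product over \<open>J\<close>. The
  value at \<open>std i\<close> then solves the \<open>i\<close>-th equation.\<close>

definition basis_norm :: "nat \<Rightarrow> (nat \<Rightarrow> int) \<Rightarrow> (nat \<Rightarrow> int) set \<Rightarrow> ((nat \<Rightarrow> int) \<Rightarrow> complex) \<Rightarrow> (nat \<Rightarrow> int) \<Rightarrow> complex" where
  "basis_norm d x J l = (let g = (\<Prod>u\<in>J. l u powi u d) powi (- x d) in
     (\<lambda>v. if v \<in> J then l v else if v = x then g
          else if v \<in> std ` {1..<d} then inverse (g powi pairing d v x * (\<Prod>u\<in>J. l u powi pairing d v u))
          else 1))"

lemma basis_norm_tor: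
  assumes d: "2 \<le> d" and I: "finite I" and J: "J \<subseteq> I" "x \<notin> J" "std ` {1..<d} \<inter> J = {}"
    and x: "x \<in> I" "x d * x d = 1" and std: "std ` {1..<d} \<subseteq> I" and l: "\<And>v. v \<in> J \<Longrightarrow> l v \<noteq> 0"
  shows "basis_norm d x J l \<in> tor d I"
proof -
  define g where "g = (\<Prod>u\<in>J. l u powi u d) powi (- x d)"
  have finJ: "finite J" using I J(1) finite_subset by blast
  have P0: "(\<Prod>u\<in>J. l u powi f u) \<noteq> 0" for f using finJ l by simp
  have g0: "g \<noteq> 0" unfolding g_def using P0[of "\<lambda>u. u d"] by simp
  let ?b = "basis_norm d x J l"
  have b: "?b v = (if v \<in> J then l v else if v = x then g
          else if v \<in> std ` {1..<d} then inverse (g powi pairing d v x * (\<Prod>u\<in>J. l u powi pairing d v u))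
          else 1)" for v
    by (simp add: basis_norm_def g_def Let_def)
  have xd: "x d \<noteq> 0" using x(2) by auto
  then have xs: "x \<notin> std ` {1..<d}" by (auto simp: std_def)
  show ?thesis
    unfolding tor_def
  proof (intro CollectI conjI allI ballI)
    show "?b v \<noteq> 0" for v unfolding b using l g0 P0 by auto
    fix i assume i: "i \<in> {1..d}"
    have "(\<Prod>v\<in>I. ?b v powi v i) = (\<Prod>v\<in>J \<union> ({x} \<union> std ` {1..<d}). ?b v powi v i)"
      by (rule prod.mono_neutral_right) (use I J x std b in auto)
    also have "\<dots> = (\<Prod>v\<in>J. ?b v powi v i) * (\<Prod>v\<in>{x} \<union> std ` {1..<d}. ?b v powi v i)"
      by (rule prod.union_disjoint) (use finJ J in auto)
    also have "(\<Prod>v\<in>{x} \<union> std ` {1..<d}. ?b v powi v i) = ?b x powi x i * (\<Prod>v\<in>std ` {1..<d}. ?b v powi v i)"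
      using xs by simp
    also have "(\<Prod>v\<in>std ` {1..<d}. ?b v powi v i) = (\<Prod>j=1..<d. ?b (std j) powi (std j i))"
      by (rule prod_std)
    also have "(\<Prod>v\<in>J. ?b v powi v i) = (\<Prod>v\<in>J. l v powi v i)" by (rule prod.cong) (simp_all add: b)
    also have "?b x = g" using J(2) by (simp add: b)
    finally have eq: "(\<Prod>v\<in>I. ?b v powi v i) =
      (\<Prod>v\<in>J. l v powi v i) * (g powi x i * (\<Prod>j=1..<d. ?b (std j) powi (std j i)))" .
    show "(\<Prod>v\<in>I. ?b v powi v i) = 1"
    proof (cases "i = d")
      case True
      have "(\<Prod>j=1..<d. ?b (std j) powi (std j i)) = 1"
        by (rule prod.neutral) (auto simp: True std_def)
      moreover have "g powi x d = (\<Prod>v\<in>J. l v powi v d) powi (- 1)"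
        unfolding g_def power_int_mult[symmetric] using x(2) by simp
      ultimately show ?thesis using P0[of "\<lambda>u. u d"] by (subst eq) (simp add: True power_int_minus)
    next
      case False
      then have i': "i \<in> {1..<d}" using i by auto
      have "(\<Prod>j=1..<d. ?b (std j) powi (std j i)) = (\<Prod>j=1..<d. if j = i then ?b (std i) else 1)"
        by (rule prod.cong) (auto simp: std_def)
      also have "\<dots> = ?b (std i)" using i' by simp
      also have "\<dots> = inverse (g powi x i * (\<Prod>u\<in>J. l u powi u i))"
      proof -
        have "std i \<in> std ` {1..<d}" using i' by (rule imageI)
        then have "std i \<notin> J" "std i \<noteq> x" "std i \<in> std ` {1..<d}" using J(3) xs by blast+
        then show ?thesis unfolding b using pairing_std[OF i] by simp
      qed
      finally show ?thesis unfolding eq using g0 P0[of "\<lambda>u. u i"] by (simp add: field_simps)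
    qed
  qed
qed

lemma basis_norm_simps: "v \<in> J \<Longrightarrow> basis_norm d x J l v = l v"
  by (simp add: basis_norm_def Let_def)

lemma basis_norm_regular:
  assumes l: "\<And>u. u \<in> J \<Longrightarrow> regular_at I U (\<lambda>X. l X u) X0" "\<And>u. u \<in> J \<Longrightarrow> l X0 u \<noteq> 0"
    and X0: "X0 \<in> U" and J: "finite J"
  shows "regular_at I U (\<lambda>X. basis_norm d x J (l X) v) X0"
proof -
  have P: "regular_at I U (\<lambda>X. \<Prod>u\<in>J. l X u powi f u) X0" for f
    by (rule regular_at_prod, rule regular_at_powi) (use l X0 in auto)
  have P0: "(\<Prod>u\<in>J. l X0 u powi f u) \<noteq> 0" for f using J l(2) by simp
  let ?g = "\<lambda>X. (\<Prod>u\<in>J. l X u powi u d) powi (- x d)"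
  have g: "regular_at I U ?g X0" by (rule regular_at_powi[OF P P0 X0])
  have g0: "?g X0 \<noteq> 0" using P0[of "\<lambda>u. u d"] by simp
  have "regular_at I U (\<lambda>X. inverse (?g X powi pairing d v x * (\<Prod>u\<in>J. l X u powi pairing d v u))) X0"
    by (rule regular_at_inverse[OF regular_at_mult[OF regular_at_powi[OF g g0 X0] P] _ X0])
       (use g0 P0[of "\<lambda>u. pairing d v u"] in simp)
  moreover have "regular_at I U (\<lambda>X. 1) X0" by (rule regular_at_poly[OF poly_fun.const])
  ultimately show ?thesis
    using l(1)[of v] g unfolding basis_norm_def Let_def by (cases "v \<in> J"; cases "v = x"; cases "v \<in> std ` {1..<d}") simp_all
qed

locale toric_chart =
  fixes d :: nat and \<Sigma>1 \<Sigma>' :: "(nat \<Rightarrow> real) set set" and s s' :: "(nat \<Rightarrow> int) \<Rightarrow> nat \<Rightarrow> int"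
    and A Ai :: "coords \<Rightarrow> coords" and N :: "coords \<Rightarrow> coords" and U1' :: "coords set"
  assumes fin1: "finite (gens \<Sigma>1)" and fin': "finite (gens \<Sigma>')"
    and s's: "\<And>v. s' (s v) = v" and s_sub: "s ` gens \<Sigma>1 \<subseteq> gens \<Sigma>'"
    and tor_iff: "\<And>g. (\<And>v. g v \<noteq> 0) \<Longrightarrow> (\<And>v. v \<in> gens \<Sigma>' - s ` gens \<Sigma>1 \<Longrightarrow> g v = 1) \<Longrightarrow>
        g \<in> tor d (gens \<Sigma>') \<longleftrightarrow> (\<lambda>v. g (s v)) \<in> tor d (gens \<Sigma>1)"
    and A_U: "\<And>X. X \<in> U_fan \<Sigma>1 \<Longrightarrow> A X \<in> U_fan \<Sigma>1" and Ai_U: "\<And>X. X \<in> U_fan \<Sigma>1 \<Longrightarrow> Ai X \<in> U_fan \<Sigma>1"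
    and A_Ai: "\<And>X. X \<in> U_fan \<Sigma>1 \<Longrightarrow> A (Ai X) = X" and Ai_A: "\<And>X. X \<in> U_fan \<Sigma>1 \<Longrightarrow> Ai (A X) = X"
    and A_equiv: "\<And>g X. g \<in> tor d (gens \<Sigma>1) \<Longrightarrow> X \<in> U_fan \<Sigma>1 \<Longrightarrow> A (\<lambda>v. g v * X v) = (\<lambda>v. g v * A X v)"
    and A_poly: "\<And>v. v \<in> gens \<Sigma>1 \<Longrightarrow> (\<lambda>X. A X v) \<in> poly_fun (gens \<Sigma>1)"
    and Ai_poly: "\<And>v. v \<in> gens \<Sigma>1 \<Longrightarrow> (\<lambda>X. Ai X v) \<in> poly_fun (gens \<Sigma>1)"
    and embed: "\<And>Y. Y \<in> U_fan \<Sigma>1 \<Longrightarrow>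
        (\<lambda>v. if v \<in> s ` gens \<Sigma>1 then Y (s' v) else if v \<in> gens \<Sigma>' then 1 else 0) \<in> U_fan \<Sigma>'"
    and open_U1': "openin (Top (quasi_affine (gens \<Sigma>') (U_fan \<Sigma>'))) U1'"
    and restr: "\<And>X. X \<in> U1' \<Longrightarrow> (\<lambda>v. if v \<in> gens \<Sigma>1 then X (s v) else 0) \<in> U_fan \<Sigma>1"
    and nz: "\<And>X v. X \<in> U1' \<Longrightarrow> v \<in> gens \<Sigma>' - s ` gens \<Sigma>1 \<Longrightarrow> X v \<noteq> 0"
    and N_tor: "\<And>X. X \<in> U1' \<Longrightarrow> N X \<in> tor d (gens \<Sigma>')"
    and N_inv: "\<And>X v. X \<in> U1' \<Longrightarrow> v \<in> gens \<Sigma>' - s ` gens \<Sigma>1 \<Longrightarrow> N X v = inverse (X v)"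
    and N_reg: "\<And>X v. X \<in> U1' \<Longrightarrow> v \<in> gens \<Sigma>' \<Longrightarrow> regular_at (gens \<Sigma>') U1' (\<lambda>Y. N Y v) X"
begin

definition emb :: "coords \<Rightarrow> coords" where
  "emb X = (\<lambda>v. if v \<in> s ` gens \<Sigma>1 then A X (s' v) else if v \<in> gens \<Sigma>' then 1 else 0)"

text \<open>A representative of the orbit is chosen arbitrarily; \<open>orbit_emb_eq_iff\<close>
  makes the result independent of it.\<close>

definition embq :: "coords set \<Rightarrow> coords set" where
  "embq p = orbit d \<Sigma>' (emb (inv_into (U_fan \<Sigma>1) (orbit d \<Sigma>1) p))"

definition ret :: "coords \<Rightarrow> coords" where
  "ret X = Ai (\<lambda>v. if v \<in> gens \<Sigma>1 then N X (s v) * X (s v) else 0)"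

lemma emb_U: "X \<in> U_fan \<Sigma>1 \<Longrightarrow> emb X \<in> U_fan \<Sigma>'"
  unfolding emb_def by (rule embed[OF A_U])

lemma emb_tuples: "X \<in> U_fan \<Sigma>1 \<Longrightarrow> emb X \<in> tuples (gens \<Sigma>')"
  using emb_U U_fan_tuples by blast

lemma A_tuples: "X \<in> U_fan \<Sigma>1 \<Longrightarrow> A X v \<noteq> 0 \<Longrightarrow> v \<in> gens \<Sigma>1"
  using A_U U_fan_tuples by (fastforce simp: tuples_def)

lemma emb_s: "v \<in> gens \<Sigma>1 \<Longrightarrow> emb X (s v) = A X v"
  by (simp add: emb_def s's)

text \<open>Both embedded points have coordinate 1 at the unmatched rays, so a torus element
  relating them is 1 there and comes from the torus of the smaller fan. Equivariance and
  invertibility of \<open>A\<close> transfer the relation to \<open>X\<close> and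
  \<open>Y\<close>.\<close>

lemma orbit_emb_eq_iff:
  assumes X: "X \<in> U_fan \<Sigma>1" and Y: "Y \<in> U_fan \<Sigma>1"
  shows "orbit d \<Sigma>' (emb X) = orbit d \<Sigma>' (emb Y) \<longleftrightarrow> orbit d \<Sigma>1 X = orbit d \<Sigma>1 Y"
proof -
  have XY: "X \<in> tuples (gens \<Sigma>1)" "Y \<in> tuples (gens \<Sigma>1)" using X Y U_fan_tuples by blast+
  show ?thesis
    unfolding orbit_eq_iff[OF fin' emb_tuples[OF X] emb_tuples[OF Y]] orbit_eq_iff[OF fin1 XY]
  proof
    assume "\<exists>g\<in>tor d (gens \<Sigma>'). emb Y = (\<lambda>v. g v * emb X v)"
    then obtain g where g: "g \<in> tor d (gens \<Sigma>')" "emb Y = (\<lambda>v. g v * emb X v)" by blast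
    have "g v = 1" if "v \<in> gens \<Sigma>' - s ` gens \<Sigma>1" for v
      using fun_cong[OF g(2), of v] that by (simp add: emb_def)
    then have gs: "(\<lambda>v. g (s v)) \<in> tor d (gens \<Sigma>1)" using tor_iff[of g] tor_nonzero[OF g(1)] g(1) by simp
    have "A Y = (\<lambda>v. g (s v) * A X v)"
    proof
      fix v
      show "A Y v = g (s v) * A X v"
      proof (cases "v \<in> gens \<Sigma>1")
        case True
        then show ?thesis using fun_cong[OF g(2), of "s v"] by (simp add: emb_s)
      next
        case False
        then have "A X v = 0" "A Y v = 0" using A_tuples[OF X, of v] A_tuples[OF Y, of v] by blast+
        then show ?thesis by simp
      qed
    qed
    also have "\<dots> = A (\<lambda>v. g (s v) * X v)" using A_equiv[OF gs X] by simp
    finally have "Ai (A Y) = Ai (A (\<lambda>v. g (s v) * X v))" by simp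
    then have "Y = (\<lambda>v. g (s v) * X v)"
      using Ai_A[OF Y] Ai_A[OF tor_mult_in_U_fan[OF fin1 X], of "\<lambda>v. g (s v)"] tor_nonzero[OF g(1)] by simp
    then show "\<exists>g\<in>tor d (gens \<Sigma>1). Y = (\<lambda>v. g v * X v)" by (rule bexI[OF _ gs])
  next
    assume "\<exists>g\<in>tor d (gens \<Sigma>1). Y = (\<lambda>v. g v * X v)"
    then obtain g where g: "g \<in> tor d (gens \<Sigma>1)" "Y = (\<lambda>v. g v * X v)" by blast
    define h where "h = (\<lambda>v. if v \<in> s ` gens \<Sigma>1 then g (s' v) else 1)"
    have "(\<lambda>v. h (s v)) \<in> tor d (gens \<Sigma>1)"
      using g(1) by (auto simp: h_def tor_def s's cong: prod.cong)
    then have "h \<in> tor d (gens \<Sigma>')" using tor_iff[of h] tor_nonzero[OF g(1)] by (simp add: h_def)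
    moreover have "emb Y = (\<lambda>v. h v * emb X v)"
      unfolding g(2) by (auto simp: h_def fun_eq_iff emb_def A_equiv[OF g(1) X])
    ultimately show "\<exists>g\<in>tor d (gens \<Sigma>'). emb Y = (\<lambda>v. g v * emb X v)" by blast
  qed
qed

lemma embq_orbit: "X \<in> U_fan \<Sigma>1 \<Longrightarrow> embq (orbit d \<Sigma>1 X) = orbit d \<Sigma>' (emb X)"
proof -
  assume X: "X \<in> U_fan \<Sigma>1"
  have o: "orbit d \<Sigma>1 X \<in> orbit d \<Sigma>1 ` U_fan \<Sigma>1" using X by blast
  show ?thesis unfolding embq_def
    using orbit_emb_eq_iff[OF inv_into_into[OF o] X] f_inv_into_f[OF o] by simp
qed

lemma embq_inj: "inj_on embq (pts (toric d \<Sigma>1))"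
  unfolding pts_toric by (rule inj_onI) (auto simp: embq_orbit orbit_emb_eq_iff)

lemma embq_morphism: "morphism (toric d \<Sigma>1) (toric d \<Sigma>') embq"
  unfolding toric_def[of d \<Sigma>1]
proof (rule morphism_from_quotient)
  have "morphism (quasi_affine (gens \<Sigma>1) (U_fan \<Sigma>1)) (quasi_affine (gens \<Sigma>') (U_fan \<Sigma>')) emb"
  proof (rule morphism_quasi_affine[OF U_fan_tuples U_fan_tuples])
    show "emb ` U_fan \<Sigma>1 \<subseteq> U_fan \<Sigma>'" using emb_U by blast
    fix v X assume "v \<in> gens \<Sigma>'"
    have "(\<lambda>X. emb X v) \<in> poly_fun (gens \<Sigma>1)"
    proof (cases "v \<in> s ` gens \<Sigma>1")
      case True
      then have "s' v \<in> gens \<Sigma>1" using s's by auto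
      then show ?thesis using True A_poly by (simp add: emb_def)
    next
      case False
      then show ?thesis by (cases "v \<in> gens \<Sigma>'") (simp_all add: emb_def poly_fun.const)
    qed
    then show "regular_at (gens \<Sigma>1) (U_fan \<Sigma>1) (\<lambda>X. emb X v) X" by (rule regular_at_poly)
  qed
  then have "morphism (quasi_affine (gens \<Sigma>1) (U_fan \<Sigma>1)) (toric d \<Sigma>') (orbit d \<Sigma>' \<circ> emb)"
    unfolding toric_def by (rule morphism_compose[OF _ morphism_quotient_map])
  then show "morphism (quasi_affine (gens \<Sigma>1) (U_fan \<Sigma>1)) (toric d \<Sigma>') (embq \<circ> orbit d \<Sigma>1)"
    by (rule morphism_quasi_affine_cong[OF U_fan_tuples]) (simp add: embq_orbit)
qed

lemma U1'_sub: "U1' \<subseteq> U_fan \<Sigma>'"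
  using open_U1' unfolding openin_quasi_affine[OF U_fan_tuples] by blast

lemma ret_base_U:
  assumes X: "X \<in> U1'"
  shows "(\<lambda>v. if v \<in> gens \<Sigma>1 then N X (s v) * X (s v) else 0) \<in> U_fan \<Sigma>1"
proof -
  have "(\<lambda>v. N X (s v) * (if v \<in> gens \<Sigma>1 then X (s v) else 0)) \<in> U_fan \<Sigma>1"
    by (rule tor_mult_in_U_fan[OF fin1 restr[OF X]]) (rule tor_nonzero[OF N_tor[OF X]])
  then show ?thesis by (simp add: if_distrib[of "\<lambda>x. _ * x"] cong: if_cong)
qed

lemma ret_U: "X \<in> U1' \<Longrightarrow> ret X \<in> U_fan \<Sigma>1"
  unfolding ret_def by (rule Ai_U[OF ret_base_U])

lemma embq_ret:
  assumes X: "X \<in> U1'"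
  shows "embq (orbit d \<Sigma>1 (ret X)) = orbit d \<Sigma>' X"
proof -
  have XU: "X \<in> U_fan \<Sigma>'" using X U1'_sub by blast
  have Xt: "X \<in> tuples (gens \<Sigma>')" using XU U_fan_tuples by blast
  have "emb (ret X) = (\<lambda>v. N X v * X v)"
  proof
    fix v
    show "emb (ret X) v = N X v * X v"
    proof (cases "v \<in> s ` gens \<Sigma>1")
      case True
      then show ?thesis by (auto simp: emb_def ret_def A_Ai[OF ret_base_U[OF X]] s's)
    next
      case False
      then show ?thesis using N_inv[OF X, of v] nz[OF X, of v] Xt by (auto simp: emb_def tuples_def)
    qed
  qed
  then have "orbit d \<Sigma>' X = orbit d \<Sigma>' (emb (ret X))"
    using orbit_eq_iff[OF fin' Xt emb_tuples[OF ret_U[OF X]]] N_tor[OF X] by blast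
  then show ?thesis using embq_orbit[OF ret_U[OF X]] by simp
qed

lemma ret_morphism: "morphism (quasi_affine (gens \<Sigma>') U1') (toric d \<Sigma>1) (orbit d \<Sigma>1 \<circ> ret)"
proof -
  have t: "U1' \<subseteq> tuples (gens \<Sigma>')" using U1'_sub U_fan_tuples by blast
  have "morphism (quasi_affine (gens \<Sigma>') U1') (quasi_affine (gens \<Sigma>1) (U_fan \<Sigma>1)) ret"
  proof (rule morphism_quasi_affine[OF t U_fan_tuples])
    show "ret ` U1' \<subseteq> U_fan \<Sigma>1" using ret_U by blast
    fix v X assume v: "v \<in> gens \<Sigma>1" and X: "X \<in> U1'"
    show "regular_at (gens \<Sigma>') U1' (\<lambda>X. ret X v) X"
      unfolding ret_def
    proof (rule regular_at_poly_compose[OF Ai_poly[OF v]])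
      fix u assume u: "u \<in> gens \<Sigma>1"
      then have su: "s u \<in> gens \<Sigma>'" using s_sub by blast
      show "regular_at (gens \<Sigma>') U1' (\<lambda>X. if u \<in> gens \<Sigma>1 then N X (s u) * X (s u) else 0) X"
        unfolding if_P[OF u]
        by (rule regular_at_mult[OF N_reg[OF X su] regular_at_poly[OF poly_fun.coord[OF su]]])
    qed
  qed
  then show ?thesis unfolding toric_def by (rule morphism_compose[OF _ morphism_quotient_map])
qed

end

section \<open>Changes of the fiber coordinates\<close>

declare One_nat_def [simp del]

section \<open>Shears and the rays of the sheared fan\<close>

lemma shear_shear_minus: "shear d q (shear d (\<lambda>i. - q i) x) = x" "shear d (\<lambda>i. - q i) (shear d q x) = x"
  by (auto simp: shear_def fun_eq_iff)

definition ishear :: "nat \<Rightarrow> (nat \<Rightarrow> int) \<Rightarrow> (nat \<Rightarrow> int) \<Rightarrow> nat \<Rightarrow> int" where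
  "ishear d q v = (\<lambda>i. if i \<in> {1..<d} then v i + q i * v d else v i)"

lemma ishear_ishear_minus: "ishear d q (ishear d (\<lambda>i. - q i) v) = v" "ishear d (\<lambda>i. - q i) (ishear d q v) = v"
  by (auto simp: ishear_def fun_eq_iff)

lemma ishear_d [simp]: "ishear d q v d = v d"
  by (simp add: ishear_def)

lemma ishear_eq_self: "v d = 0 \<Longrightarrow> ishear d q v = v"
  by (auto simp: ishear_def fun_eq_iff)

lemma rvec_ishear: "rvec (ishear d q v) = shear d q (rvec v)"
  by (auto simp: rvec_def ishear_def shear_def fun_eq_iff)

lemma ishear_scale: "ishear d q (\<lambda>i. l * w i) = (\<lambda>i. l * ishear d q w i)"
  by (auto simp: ishear_def fun_eq_iff algebra_simps)

lemma shear_scale: "shear d q (\<lambda>i. l * w i) = (\<lambda>i. l * shear d q w i)"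
  by (auto simp: shear_def fun_eq_iff algebra_simps)

lemma cone_of_ishear: "cone_of {ishear d q v} = shear d q ` cone_of {v}"
proof -
  have "cone_of {u} = (\<lambda>r i. r * rvec u i) ` {0..}" for u
    by (auto simp: cone_of_singleton)
  then show ?thesis by (simp add: image_image shear_scale rvec_ishear)
qed

lemma primitive_ishear: "primitive v \<Longrightarrow> primitive (ishear d q v)"
  unfolding primitive_def
proof (intro allI impI)
  fix l w assume p: "\<forall>l w. v = (\<lambda>i. l * w i) \<longrightarrow> \<bar>l\<bar> = 1" and eq: "ishear d q v = (\<lambda>i. l * w i)"
  have "v = ishear d (\<lambda>i. - q i) (\<lambda>i. l * w i)" unfolding eq[symmetric] ishear_ishear_minus ..
  then show "\<bar>l\<bar> = 1" using p unfolding ishear_scale by blast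
qed

lemma gens_q_minus_fan: "gens (q_minus_fan d q \<Sigma>) = gens (plus_fan d \<Sigma>) \<union> ishear d q ` gens (minus_fan d \<Sigma>)"
proof (intro equalityI subsetI)
  fix v assume v: "v \<in> gens (q_minus_fan d q \<Sigma>)"
  then have prim: "primitive v" and c: "cone_of {v} \<in> plus_fan d \<Sigma> \<or> cone_of {v} \<in> (\<lambda>\<sigma>. shear d q ` \<sigma>) ` minus_fan d \<Sigma>"
    by (auto simp: gens_def q_minus_fan_def)
  from c show "v \<in> gens (plus_fan d \<Sigma>) \<union> ishear d q ` gens (minus_fan d \<Sigma>)"
  proof
    assume "cone_of {v} \<in> (\<lambda>\<sigma>. shear d q ` \<sigma>) ` minus_fan d \<Sigma>"
    then obtain \<sigma> where \<sigma>: "\<sigma> \<in> minus_fan d \<Sigma>" "cone_of {v} = shear d q ` \<sigma>" by blast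
    let ?u = "ishear d (\<lambda>i. - q i) v"
    have "cone_of {?u} = shear d (\<lambda>i. - q i) ` (shear d q ` \<sigma>)" unfolding cone_of_ishear \<sigma>(2) ..
    also have "\<dots> = \<sigma>" by (simp add: image_image shear_shear_minus)
    finally have "?u \<in> gens (minus_fan d \<Sigma>)" using \<sigma>(1) primitive_ishear[OF prim] by (simp add: gens_def)
    moreover have "v = ishear d q ?u" by (simp add: ishear_ishear_minus)
    ultimately show ?thesis by blast
  qed (use prim in \<open>simp add: gens_def\<close>)
next
  fix v assume "v \<in> gens (plus_fan d \<Sigma>) \<union> ishear d q ` gens (minus_fan d \<Sigma>)"
  then show "v \<in> gens (q_minus_fan d q \<Sigma>)"
    by (auto simp: gens_def q_minus_fan_def cone_of_ishear primitive_ishear)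
qed

text \<open>The geometric hypothesis on V-tilde enters here only through its combinatorial
  consequences \<open>a1\<close> and \<open>aj\<close>; these are established by the later study of
  regular functions on V-tilde.\<close>

locale gluing = split_fan +
  fixes r m n k :: nat and a b c :: "nat \<Rightarrow> nat \<Rightarrow> int" and t :: complex
  assumes pos: "1 \<le> r" "1 \<le> m" "1 \<le> n"
    and gens_tilde: "gens \<Sigma>t = std ` {1..<d} \<union> a ` {1..r}"
      "inj_on a {1..r}" "std ` {1..<d} \<inter> a ` {1..r} = {}"
    and gens_plus: "gens (plus_fan d \<Sigma>) = b ` {1..m} \<union> gens \<Sigma>t"
      "inj_on b {1..m}" "b ` {1..m} \<inter> gens \<Sigma>t = {}"
    and gens_minus: "gens (minus_fan d \<Sigma>) = c ` {1..n} \<union> gens \<Sigma>t"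
      "inj_on c {1..n}" "c ` {1..n} \<inter> gens \<Sigma>t = {}"
    and b1: "b 1 = std d"
    and cone_minus: "cone_of (std ` {1..<d} \<union> {c 1}) \<in> minus_fan d \<Sigma>"
    and cond1: "\<forall>j \<in> {2..m}. b j 1 = 0"
    and cond2: "\<forall>j \<in> {1..n}. 0 \<le> int k * c j d + c j 1"
    and t: "t \<noteq> 0"
    and a1: "a 1 1 = - 1" and aj: "\<And>j. j \<in> {2..r} \<Longrightarrow> a j 1 = 0"
begin

abbreviation "Gt \<equiv> gens \<Sigma>t"
abbreviation "\<Sigma>p \<equiv> plus_fan d \<Sigma>"
abbreviation "\<Sigma>m \<equiv> minus_fan d \<Sigma>"
abbreviation "Gp \<equiv> gens (plus_fan d \<Sigma>)"
abbreviation "Gm \<equiv> gens (minus_fan d \<Sigma>)"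

definition q :: "nat \<Rightarrow> int" where "q = (\<lambda>i. if i = 1 then 2 * int k else - int k * a 1 i)"

abbreviation "\<Sigma>q \<equiv> q_minus_fan d q \<Sigma>"
abbreviation "Gq \<equiv> gens (q_minus_fan d q \<Sigma>)"
abbreviation "sh \<equiv> ishear d q"
abbreviation "sh' \<equiv> ishear d (\<lambda>i. - q i)"

lemma finG: "finite Gt" "finite Gp" "finite Gm" "finite Gq"
proof -
  show "finite Gt" by (rule fan_gens[OF fans(2)])
  have "Gp \<subseteq> gens \<Sigma>" "Gm \<subseteq> gens \<Sigma>" using gens_plus_iff gens_minus_iff by blast+
  then show "finite Gp" "finite Gm" using fan_gens(1)[OF fans(1)] finite_subset by blast+
  then show "finite Gq" unfolding gens_q_minus_fan by simp
qed

lemma Gt_iff: "v \<in> Gt \<longleftrightarrow> v \<in> Gp \<and> v \<in> Gm"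
  using gens_tilde_iff gens_plus_iff gens_minus_iff by force

lemma Gp_d: "v \<in> Gp \<Longrightarrow> 0 \<le> v d" "v \<in> Gp \<Longrightarrow> v d = 0 \<longleftrightarrow> v \<in> Gt"
  using gens_tilde_iff gens_plus_iff by blast+

lemma Gm_d: "v \<in> Gm \<Longrightarrow> v d \<le> 0" "v \<in> Gm \<Longrightarrow> v d = 0 \<longleftrightarrow> v \<in> Gt"
  using gens_tilde_iff gens_minus_iff by blast+

lemma Gp_minus_Gt: "Gp - Gt = b ` {1..m}"
  using gens_plus by blast

lemma Gm_minus_Gt: "Gm - Gt = c ` {1..n}"
  using gens_minus by blast

lemma std_Gt: "std ` {1..<d} \<subseteq> Gt"
  using gens_tilde(1) by blast

lemma std1_Gt: "std 1 \<in> Gt" and a1_Gt: "a 1 \<in> Gt"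
  using gens_tilde(1) d2 pos(1) by auto

lemma std1_ne_a1: "std 1 \<noteq> a 1"
proof
  assume "std 1 = a 1"
  then have "std 1 1 = a 1 1" by simp
  then show False using a1 by (simp add: std_def)
qed

lemma Gt_1: "v \<in> Gt \<Longrightarrow> v 1 = (if v = std 1 then 1 else if v = a 1 then - 1 else 0)"
proof -
  assume "v \<in> Gt"
  then consider i where "i \<in> {1..<d}" "v = std i" | j where "j \<in> {1..r}" "v = a j"
    using gens_tilde(1) by blast
  then show ?thesis
  proof cases
    case 1
    then have "std i \<noteq> a 1" using gens_tilde(3) pos(1) by fastforce
    then show ?thesis using 1 by (simp add: std_eq_iff) (simp add: std_def)
  next
    case 2
    then have "a j \<noteq> std 1" using gens_tilde(3) d2 by fastforce
    then show ?thesis using 2 a1 aj[of j] inj_onD[OF gens_tilde(2), of j 1] pos(1) by (cases "j = 1") auto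
  qed
qed

text \<open>This is where the condition on the \<open>b j\<close> is used: the first equation of the
  torus on the plus side involves \<open>std 1\<close> and \<open>a 1\<close> only and says that
  their coordinates have the same degree.\<close>

lemma Gp_1: "v \<in> Gp \<Longrightarrow> v 1 = (if v = std 1 then 1 else if v = a 1 then - 1 else 0)"
proof -
  assume v: "v \<in> Gp"
  show ?thesis
  proof (cases "v \<in> Gt")
    case False
    then have ne: "v \<noteq> std 1" "v \<noteq> a 1" using std1_Gt a1_Gt by auto
    obtain j where j: "j \<in> {1..m}" "v = b j" using False v Gp_minus_Gt by blast
    have "v 1 = 0"
      using j cond1 b1 d2 by (cases "j = 1") (auto simp: std_def)
    then show ?thesis using ne by simp
  qed (rule Gt_1)
qed

text \<open>The dual vector of \<open>c 1\<close> in the given cone vanishes on \<open>std i\<close>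
  for \<open>i < d\<close>, so its pairing with \<open>c 1\<close> reduces to a product of two
  integers equal to 1. The sign is fixed by lying in the lower half.\<close>

lemma c1_d: "c 1 d = - 1"
proof -
  have cm: "cone_of (std ` {1..<d} \<union> {c 1}) \<in> \<Sigma>" using cone_minus by (simp add: minus_fan_def)
  obtain S \<mu> where S: "finite S" "cone_of (std ` {1..<d} \<union> {c 1}) = cone_of S"
    "\<And>u u'. u \<in> S \<Longrightarrow> u' \<in> S \<Longrightarrow> pairing d (\<mu> u) u' = (if u = u' then 1 else 0)"
    "\<And>v. v \<in> gens \<Sigma> \<Longrightarrow> rvec v \<in> cone_of (std ` {1..<d} \<union> {c 1}) \<Longrightarrow> v \<in> S"
    using fan_cone[OF fans(1) cm] by metis
  have mem: "v \<in> S" if "v \<in> std ` {1..<d} \<union> {c 1}" for v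
  proof (rule S(4))
    show "v \<in> gens \<Sigma>" using that std_Gt gens_tilde_iff gens_minus gens_minus_iff pos(3) by fastforce
    show "rvec v \<in> cone_of (std ` {1..<d} \<union> {c 1})" by (rule rvec_in_cone_of) (use that in auto)
  qed
  have c1: "c 1 \<in> S" "c 1 \<in> Gm - Gt" using mem Gm_minus_Gt pos(3) by auto
  have "pairing d (\<mu> (c 1)) (c 1) = (\<Sum>i=1..d. if i = d then \<mu> (c 1) d * c 1 d else 0)"
    unfolding pairing_def
  proof (rule sum.cong)
    fix i assume i: "i \<in> {1..d}"
    show "\<mu> (c 1) i * c 1 i = (if i = d then \<mu> (c 1) d * c 1 d else 0)"
    proof (cases "i = d")
      case False
      then have si: "std i \<in> std ` {1..<d}" using i by auto
      have "std i \<in> Gt" by (rule subsetD[OF std_Gt si])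
      then have "c 1 \<noteq> std i" using c1(2) by auto
      then have "pairing d (\<mu> (c 1)) (std i) = 0" using S(3)[OF c1(1) mem[of "std i"]] si by auto
      then show ?thesis using pairing_std_right[OF i] False by simp
    qed simp
  qed simp
  also have "\<dots> = \<mu> (c 1) d * c 1 d" using d2 by simp
  finally have "\<mu> (c 1) d * c 1 d = 1" using S(3)[OF c1(1) c1(1)] by simp
  then have "\<bar>c 1 d\<bar> = 1" by (metis abs_zmult_eq_1 mult.commute abs_1)
  moreover have "c 1 d \<le> 0" using Gm_d(1) c1(2) by blast
  ultimately show ?thesis by linarith
qed

lemma prod_Gp_d: "(\<Prod>v\<in>Gp. g v powi v d) = (\<Prod>v\<in>Gp - Gt. (g v::complex) powi v d)"
proof (rule prod.mono_neutral_right)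
  show "\<forall>v\<in>Gp - (Gp - Gt). g v powi v d = 1"
  proof
    fix v assume "v \<in> Gp - (Gp - Gt)"
    then have "v d = 0" using Gp_d(2)[of v] by blast
    then show "g v powi v d = 1" by simp
  qed
qed (use finG in auto)

lemma prod_Gm_d: "(\<Prod>v\<in>Gm. g v powi v d) = (\<Prod>v\<in>Gm - Gt. (g v::complex) powi v d)"
proof (rule prod.mono_neutral_right)
  show "\<forall>v\<in>Gm - (Gm - Gt). g v powi v d = 1"
  proof
    fix v assume "v \<in> Gm - (Gm - Gt)"
    then have "v d = 0" using Gm_d(2)[of v] by blast
    then show "g v powi v d = 1" by simp
  qed
qed (use finG in auto)

lemma prod_Gp_1: "(\<Prod>v\<in>Gp. g v powi v 1) = g (std 1) * inverse (g (a 1) :: complex)"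
proof -
  have "(\<Prod>v\<in>Gp. g v powi v 1) = (\<Prod>v\<in>{std 1, a 1}. g v powi v 1)"
  proof (rule prod.mono_neutral_right)
    show "{std 1, a 1} \<subseteq> Gp" using std1_Gt a1_Gt Gt_iff by blast
    show "\<forall>v\<in>Gp - {std 1, a 1}. g v powi v 1 = 1"
    proof
      fix v assume "v \<in> Gp - {std 1, a 1}"
      then have "v 1 = 0" using Gp_1[of v] by auto
      then show "g v powi v 1 = 1" by simp
    qed
  qed (rule finG)
  then show ?thesis using std1_ne_a1 Gt_1[OF std1_Gt] Gt_1[OF a1_Gt] by (simp add: power_int_minus)
qed

lemma prod_Gt_1: "(\<Prod>v\<in>Gt. g v powi v 1) = g (std 1) * inverse (g (a 1) :: complex)"
proof -
  have "(\<Prod>v\<in>Gt. g v powi v 1) = (\<Prod>v\<in>{std 1, a 1}. g v powi v 1)"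
  proof (rule prod.mono_neutral_right)
    show "{std 1, a 1} \<subseteq> Gt" using std1_Gt a1_Gt by blast
    show "\<forall>v\<in>Gt - {std 1, a 1}. g v powi v 1 = 1"
    proof
      fix v assume "v \<in> Gt - {std 1, a 1}"
      then have "v 1 = 0" using Gt_1[of v] by auto
      then show "g v powi v 1 = 1" by simp
    qed
  qed (rule finG)
  then show ?thesis using std1_ne_a1 Gt_1[OF std1_Gt] Gt_1[OF a1_Gt] by (simp add: power_int_minus)
qed

lemma prod_Gm_1: "(\<Prod>v\<in>Gm. g v powi v 1) = g (std 1) * inverse (g (a 1)) * (\<Prod>v\<in>Gm - Gt. (g v::complex) powi v 1)"
proof -
  have "Gm = Gt \<union> (Gm - Gt)" using Gt_iff by blast
  then have "(\<Prod>v\<in>Gm. g v powi v 1) = (\<Prod>v\<in>Gt. g v powi v 1) * (\<Prod>v\<in>Gm - Gt. g v powi v 1)"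
    using prod.union_disjoint[of Gt "Gm - Gt" "\<lambda>v. g v powi v 1"] finG by auto
  then show ?thesis unfolding prod_Gt_1 .
qed

section \<open>The substitutions on the two halves\<close>

definition zc :: "coords \<Rightarrow> complex" where
  "zc X = (\<Prod>v\<in>Gp - Gt. X v ^ nat (v d))"

text \<open>The polynomial form of x w^(c_11 - k) / t in homogeneous coordinates of the minus side.
  The exponents are nonnegative precisely by the second condition, so \<open>nat\<close> loses
  nothing.\<close>

definition mu :: "coords \<Rightarrow> complex" where
  "mu X = X (std 1) * (\<Prod>v\<in>Gm - Gt. X v ^ nat (int k * v d + v 1)) / t"

text \<open>The matrix with rows (z^k, -t) and (1/t, 0) has determinant 1 and polynomial entries in
  the coordinates, hence its inverse \<open>Api\<close> is polynomial too.\<close>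

definition Ap :: "coords \<Rightarrow> coords" where
  "Ap X = X(std 1 := zc X ^ k * X (std 1) - t * X (a 1), a 1 := X (std 1) / t)"

definition Api :: "coords \<Rightarrow> coords" where
  "Api X = X(std 1 := t * X (a 1), a 1 := zc X ^ k * X (a 1) - X (std 1) / t)"

definition Am :: "coords \<Rightarrow> coords" where "Am X = X(a 1 := X (a 1) + mu X)"

definition Ami :: "coords \<Rightarrow> coords" where "Ami X = X(a 1 := X (a 1) - mu X)"

lemma zc_upd: "v \<in> Gt \<Longrightarrow> zc (X(v := y)) = zc X"
  unfolding zc_def by (rule prod.cong) auto

lemma zc_upd2: "zc (X(std 1 := y, a 1 := y')) = zc X"
  by (simp add: zc_upd[OF std1_Gt] zc_upd[OF a1_Gt])

lemma mu_upd: "mu (X(a 1 := y)) = mu X"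
  unfolding mu_def using std1_ne_a1 a1_Gt by (auto intro!: prod.cong)

lemma Ap_Api: "Ap (Api X) = X" and Api_Ap: "Api (Ap X) = X"
  using t std1_ne_a1
  by (rule_tac ext, simp_all add: Ap_def Api_def zc_upd2 field_simps)

lemma Am_Ami: "Am (Ami X) = X" and Ami_Am: "Ami (Am X) = X"
  by (rule_tac ext, simp_all add: Am_def Ami_def mu_upd)

lemma zc_equiv: "g \<in> tor d Gp \<Longrightarrow> zc (\<lambda>v. g v * X v) = zc X"
proof -
  assume g: "g \<in> tor d Gp"
  have "(\<Prod>v\<in>Gp - Gt. g v ^ nat (v d)) = (\<Prod>v\<in>Gp - Gt. g v powi v d)"
    by (rule prod.cong) (use Gp_d(1) in \<open>auto simp: power_int_def\<close>)
  also have "\<dots> = 1" unfolding prod_Gp_d[symmetric] using g d2 by (auto simp: tor_def)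
  finally show ?thesis by (simp add: zc_def power_mult_distrib prod.distrib)
qed

lemma tor_Gp_1: "g \<in> tor d Gp \<Longrightarrow> g (std 1) = g (a 1)"
  using prod_Gp_1[of g] d2 tor_nonzero[of g d Gp "a 1"] by (auto simp: tor_def field_simps)

lemma Ap_equiv: "g \<in> tor d Gp \<Longrightarrow> Ap (\<lambda>v. g v * X v) = (\<lambda>v. g v * Ap X v)"
proof -
  assume g: "g \<in> tor d Gp"
  show ?thesis
    unfolding Ap_def zc_equiv[OF g] using tor_Gp_1[OF g] by (rule_tac ext) (simp add: algebra_simps)
qed

text \<open>Multiply the first torus equation by the \<open>k\<close>-th power of the last: the
  exponents add up to those of \<open>mu\<close>, and the result says that \<open>mu\<close> has the
  degree of the coordinate of \<open>a 1\<close>.\<close>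

lemma mu_equiv: "g \<in> tor d Gm \<Longrightarrow> mu (\<lambda>v. g v * X v) = g (a 1) * mu X"
proof -
  assume g: "g \<in> tor d Gm"
  have g0: "g v \<noteq> 0" for v using g by (rule tor_nonzero)
  have one: "g (std 1) * inverse (g (a 1)) * (\<Prod>v\<in>Gm - Gt. g v powi v 1) = 1"
    unfolding prod_Gm_1[symmetric] using g d2 by (auto simp: tor_def)
  have dd: "(\<Prod>v\<in>Gm - Gt. g v powi v d) = 1"
    unfolding prod_Gm_d[symmetric] using g d2 by (auto simp: tor_def)
  have "(\<Prod>v\<in>Gm - Gt. g v powi (v d * int k)) = (\<Prod>v\<in>Gm - Gt. g v powi v d) powi int k"
    unfolding powi_prod power_int_mult ..
  then have dk: "(\<Prod>v\<in>Gm - Gt. g v powi (v d * int k)) = 1" unfolding dd by simp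
  have "(\<Prod>v\<in>Gm - Gt. g v ^ nat (int k * v d + v 1)) = (\<Prod>v\<in>Gm - Gt. g v powi (v d * int k) * g v powi v 1)"
  proof (rule prod.cong)
    fix v assume "v \<in> Gm - Gt"
    then have "0 \<le> int k * v d + v 1" using cond2 unfolding Gm_minus_Gt by auto
    then have "g v ^ nat (int k * v d + v 1) = g v powi (int k * v d + v 1)" by (simp add: power_int_def)
    then show "g v ^ nat (int k * v d + v 1) = g v powi (v d * int k) * g v powi v 1"
      using g0[of v] by (simp add: power_int_add mult.commute)
  qed simp
  also have "\<dots> = (\<Prod>v\<in>Gm - Gt. g v powi v 1)"
    using dk by (simp add: prod.distrib)
  finally have ga: "g (std 1) * (\<Prod>v\<in>Gm - Gt. g v ^ nat (int k * v d + v 1)) = g (a 1)"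
    using one g0[of "a 1"] by (simp add: field_simps)
  have "mu (\<lambda>v. g v * X v) = (g (std 1) * (\<Prod>v\<in>Gm - Gt. g v ^ nat (int k * v d + v 1))) * mu X"
    by (simp add: mu_def power_mult_distrib prod.distrib)
  then show ?thesis unfolding ga .
qed

lemma Am_equiv: "g \<in> tor d Gm \<Longrightarrow> Am (\<lambda>v. g v * X v) = (\<lambda>v. g v * Am X v)"
proof -
  assume g: "g \<in> tor d Gm"
  show ?thesis unfolding Am_def mu_equiv[OF g] by (rule ext) (simp add: algebra_simps)
qed

text \<open>The other vanishing rays \<open>R\<close> have first coordinate 0. Moving from their sum
  in the direction of \<open>std 1\<close> or its negative leads to a cone containing
  \<open>R\<close> and a ray with positive or negative first coordinate, and these rays are
  \<open>std 1\<close> and \<open>a 1\<close> alone. So either one may vanish together with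
  \<open>R\<close>; simultaneous vanishing of both is excluded or inherited from \<open>X\<close> by
  the last hypothesis.\<close>

lemma swap_U:
  assumes X: "X \<in> U_fan \<Sigma>p" and Y: "\<And>v. v \<noteq> std 1 \<Longrightarrow> v \<noteq> a 1 \<Longrightarrow> Y v = X v"
    and YX: "Y (std 1) = 0 \<Longrightarrow> Y (a 1) = 0 \<Longrightarrow> X (std 1) = 0 \<and> X (a 1) = 0"
  shows "Y \<in> U_fan \<Sigma>p"
proof -
  obtain \<sigma> where \<sigma>: "\<sigma> \<in> \<Sigma>p" "\<And>v. v \<in> Gp \<Longrightarrow> X v = 0 \<Longrightarrow> rvec v \<in> \<sigma>"
    and Xt: "X \<in> tuples Gp" using X unfolding U_fan_iff[OF finG(2)] by blast
  have "std 1 \<in> Gp" "a 1 \<in> Gp" using std1_Gt a1_Gt Gt_iff by blast+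
  then have "Y v = 0" if "v \<notin> Gp" for v using that Xt Y[of v] by (auto simp: tuples_def)
  then have Yt: "Y \<in> tuples Gp" by (simp add: tuples_def)
  define R where "R = {v \<in> Gp. v \<noteq> std 1 \<and> v \<noteq> a 1 \<and> X v = 0}"
  have R: "finite R" "\<And>v. v \<in> R \<Longrightarrow> rvec v \<in> \<sigma>" using finG(2) \<sigma>(2) by (auto simp: R_def)
  have w: "std 1 \<in> lattice d" "std 1 d = 0" "(\<lambda>i. - std 1 i) \<in> lattice d" "- std 1 d = 0"
    using d2 by (auto simp: std_def lattice_def tuples_def)
  have i1: "1 \<in> {1..d}" using d2 by auto
  have neg: "pairing d (\<lambda>i. - std 1 i) v = - v 1" for v using pairing_std[OF i1, of v] by (simp add: pairing_def sum_negf)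
  have one: "std 1 1 = (1::int)" by (simp add: std_def)
  have R1: "v 1 = 0" if "v \<in> R" for v using Gp_1[of v] that by (auto simp: R_def)
  have \<tau>: "\<exists>\<tau>\<in>\<Sigma>p. (\<forall>v\<in>R. rvec v \<in> \<tau>) \<and> rvec e \<in> \<tau>" if "e = std 1 \<or> e = a 1" for e
    using that
  proof
    assume e: "e = std 1"
    have "\<exists>\<tau>\<in>\<Sigma>p. (\<forall>v\<in>R. rvec v \<in> \<tau>) \<and> (\<exists>u\<in>gens \<Sigma>p. rvec u \<in> \<tau> \<and> pairing d (\<lambda>i. - std 1 i) u < 0)"
      by (rule star_plus_minus[OF _ R(1) \<sigma>(1) R(2) w(1,2)]) (simp_all add: neg one R1)
    then obtain \<tau> u where *: "\<tau> \<in> \<Sigma>p" "\<forall>v\<in>R. rvec v \<in> \<tau>" "u \<in> Gp" "rvec u \<in> \<tau>" "0 < u 1"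
      by (auto simp: neg)
    have "u = std 1" using Gp_1[OF *(3)] *(5) by (simp split: if_splits)
    then show ?thesis using * e by blast
  next
    assume e: "e = a 1"
    have "\<exists>\<tau>\<in>\<Sigma>p. (\<forall>v\<in>R. rvec v \<in> \<tau>) \<and> (\<exists>u\<in>gens \<Sigma>p. rvec u \<in> \<tau> \<and> pairing d (std 1) u < 0)"
      by (rule star_plus_minus[OF _ R(1) \<sigma>(1) R(2) w(3,4)]) (simp_all add: pairing_std[OF i1] one R1)
    then obtain \<tau> u where *: "\<tau> \<in> \<Sigma>p" "\<forall>v\<in>R. rvec v \<in> \<tau>" "u \<in> Gp" "rvec u \<in> \<tau>" "u 1 < 0"
      by (auto simp: pairing_std[OF i1])
    have "u = a 1" using Gp_1[OF *(3)] *(5) by (simp split: if_splits)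
    then show ?thesis using * e by blast
  qed
  have "\<exists>\<tau>\<in>\<Sigma>p. \<forall>v\<in>Gp. Y v = 0 \<longrightarrow> rvec v \<in> \<tau>"
  proof (cases "Y (std 1) = 0 \<and> Y (a 1) = 0")
    case True
    then have "X v = 0" if "Y v = 0" for v using that YX Y[of v] by metis
    then show ?thesis using \<sigma> by blast
  next
    case False
    \<comment> \<open>At most one of the two coordinates vanishes; \<open>e\<close> names it, and is
      an arbitrary choice if neither does.\<close>
    then obtain e where e: "e = std 1 \<or> e = a 1" "\<forall>v. (v = std 1 \<or> v = a 1) \<and> Y v = 0 \<longrightarrow> v = e" by metis
    obtain \<tau> where \<tau>': "\<tau> \<in> \<Sigma>p" "\<forall>v\<in>R. rvec v \<in> \<tau>" "rvec e \<in> \<tau>" using \<tau>[OF e(1)] by blast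
    have "rvec v \<in> \<tau>" if "v \<in> Gp" "Y v = 0" for v
    proof (cases "v = std 1 \<or> v = a 1")
      case True
      then show ?thesis using e(2) that(2) \<tau>'(3) by blast
    next
      case False
      then have "v \<in> R" using that Y[of v] by (simp add: R_def)
      then show ?thesis using \<tau>'(2) by blast
    qed
    then show ?thesis using \<tau>'(1) by blast
  qed
  then show ?thesis unfolding U_fan_iff[OF finG(2)] using Yt by blast
qed

lemma Ap_U: "X \<in> U_fan \<Sigma>p \<Longrightarrow> Ap X \<in> U_fan \<Sigma>p"
  by (erule swap_U) (use t std1_ne_a1 in \<open>auto simp: Ap_def\<close>)

lemma Api_U: "X \<in> U_fan \<Sigma>p \<Longrightarrow> Api X \<in> U_fan \<Sigma>p"
  by (erule swap_U) (use t std1_ne_a1 in \<open>auto simp: Api_def\<close>)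

text \<open>Use the functional \<chi> = first coordinate plus \<open>k\<close> times the last. On
  the rays of the minus side it is negative at \<open>a 1\<close> only. If \<open>mu X\<close> is
  nonzero, every vanishing ray other than \<open>a 1\<close> lies on \<chi> = 0, so crossing this
  hyperplane yields a cone that contains all of them together with \<open>a 1\<close>, whose
  coordinate may then be anything.\<close>

lemma translate_U:
  assumes X: "X \<in> U_fan \<Sigma>m" and y: "y \<noteq> X (a 1) \<Longrightarrow> mu X \<noteq> 0"
  shows "X(a 1 := y) \<in> U_fan \<Sigma>m"
proof -
  obtain \<sigma> where \<sigma>: "\<sigma> \<in> \<Sigma>m" "\<And>v. v \<in> Gm \<Longrightarrow> X v = 0 \<Longrightarrow> rvec v \<in> \<sigma>"
    and Xt: "X \<in> tuples Gm" using X unfolding U_fan_iff[OF finG(3)] by blast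
  have "a 1 \<in> Gm" using a1_Gt Gt_iff by blast
  then have Yt: "X(a 1 := y) \<in> tuples Gm" using Xt by (auto simp: tuples_def)
  have "\<exists>\<tau>\<in>\<Sigma>m. \<forall>v\<in>Gm. (X(a 1 := y)) v = 0 \<longrightarrow> rvec v \<in> \<tau>"
  proof (cases "y = X (a 1)")
    case True
    then show ?thesis using \<sigma> by auto
  next
    case False
    then have mu: "mu X \<noteq> 0" by (rule y)
    define R where "R = {v \<in> Gm. v \<noteq> a 1 \<and> X v = 0}"
    have R: "finite R" "\<And>v. v \<in> R \<Longrightarrow> rvec v \<in> \<sigma>" using finG(3) \<sigma>(2) by (auto simp: R_def)
    define \<chi> where "\<chi> = (\<lambda>i. std 1 i + int k * std d i)"
    have i1: "1 \<in> {1..d}" "d \<in> {1..d}" using d2 by auto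
    have \<chi>: "pairing d \<chi> v = v 1 + int k * v d" for v
    proof -
      have "pairing d \<chi> v = pairing d (std 1) v + int k * pairing d (std d) v"
        by (simp add: \<chi>_def pairing_def algebra_simps sum.distrib sum_distrib_left)
      then show ?thesis using pairing_std i1 by simp
    qed
    have w: "(\<lambda>i. - std 1 i) \<in> lattice d" "- std 1 d = 0"
      using d2 by (auto simp: std_def lattice_def tuples_def)
    have Gm_\<chi>: "pairing d \<chi> v \<ge> 0" if "v \<in> Gm" "v \<noteq> a 1" for v
    proof (cases "v \<in> Gt")
      case True
      then show ?thesis using Gt_1[OF True] Gm_d(2)[OF that(1)] that(2) by (simp add: \<chi>)
    next
      case False
      then have "v \<in> c ` {1..n}" using that(1) unfolding Gm_minus_Gt[symmetric] by simp
      then obtain j where j: "j \<in> {1..n}" "v = c j" by (rule imageE)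
      then show ?thesis using cond2 by (simp add: \<chi> add.commute)
    qed
    have "\<exists>\<tau>\<in>\<Sigma>m. (\<forall>v\<in>R. rvec v \<in> \<tau>) \<and> (\<exists>u\<in>gens \<Sigma>m. rvec u \<in> \<tau> \<and> pairing d \<chi> u < 0)"
    proof (rule star_plus_minus[OF _ R(1) \<sigma>(1) R(2) w])
      show "pairing d \<chi> (\<lambda>i. - std 1 i) < 0" unfolding \<chi> using d2 by (simp add: std_def)
      fix v assume v: "v \<in> R"
      show "pairing d \<chi> v = 0"
      proof (cases "v \<in> Gt")
        case True
        have "v \<noteq> std 1" using v mu by (auto simp: R_def mu_def)
        then show ?thesis using Gt_1[OF True] Gm_d(2)[of v] True v by (simp add: \<chi> R_def)
      next
        case False
        then have "v \<in> Gm - Gt" using v by (simp add: R_def)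
        moreover have "(\<Prod>v\<in>Gm - Gt. X v ^ nat (int k * v d + v 1)) \<noteq> 0" using mu by (simp add: mu_def)
        ultimately have "X v ^ nat (int k * v d + v 1) \<noteq> 0" using finG(3) by (auto simp: prod_zero_iff)
        \<comment> \<open>A coordinate that vanishes can occur in the nonzero product
          \<open>mu X\<close> only with exponent 0.\<close>
        then have "nat (int k * v d + v 1) = 0" using v by (auto simp: R_def)
        then show ?thesis using Gm_\<chi>[of v] v by (simp add: \<chi> R_def)
      qed
    qed simp
    then obtain \<tau> u where \<tau>: "\<tau> \<in> \<Sigma>m" "\<forall>v\<in>R. rvec v \<in> \<tau>" "u \<in> Gm" "rvec u \<in> \<tau>" "pairing d \<chi> u < 0" by blast
    then have "u = a 1" using Gm_\<chi>[of u] by force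
    have "rvec v \<in> \<tau>" if "v \<in> Gm" "(X(a 1 := y)) v = 0" for v
      using \<tau>(2,4) that \<open>u = a 1\<close> by (cases "v = a 1") (auto simp: R_def)
    then show ?thesis using \<tau>(1) by blast
  qed
  then show ?thesis unfolding U_fan_iff[OF finG(3)] using Yt by blast
qed

lemma Am_U: "X \<in> U_fan \<Sigma>m \<Longrightarrow> Am X \<in> U_fan \<Sigma>m"
  unfolding Am_def by (rule translate_U) auto

lemma Ami_U: "X \<in> U_fan \<Sigma>m \<Longrightarrow> Ami X \<in> U_fan \<Sigma>m"
  unfolding Ami_def by (rule translate_U) auto

lemma poly_zc: "zc \<in> poly_fun Gp"
  unfolding zc_def[abs_def] by (intro poly_fun_prod poly_fun_power poly_fun.coord) auto

lemma poly_mu: "mu \<in> poly_fun Gm"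
proof -
  have "(\<lambda>X. (X (std 1) * (\<Prod>v\<in>Gm - Gt. X v ^ nat (int k * v d + v 1))) * inverse t) \<in> poly_fun Gm"
    using std1_Gt Gt_iff
    by (intro poly_fun.mult poly_fun_prod poly_fun_power poly_fun.coord poly_fun.const) auto
  then show ?thesis by (simp add: mu_def[abs_def] divide_inverse)
qed

lemma Ap_poly: "v \<in> Gp \<Longrightarrow> (\<lambda>X. Ap X v) \<in> poly_fun Gp"
proof -
  assume v: "v \<in> Gp"
  have e: "std 1 \<in> Gp" "a 1 \<in> Gp" using std1_Gt a1_Gt Gt_iff by blast+
  have "(\<lambda>X. zc X ^ k * X (std 1) - t * X (a 1)) \<in> poly_fun Gp"
    by (intro poly_fun_diff poly_fun.mult poly_fun_power poly_zc poly_fun.coord poly_fun.const e)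
  moreover have "(\<lambda>X. X (std 1) * inverse t) \<in> poly_fun Gp"
    by (intro poly_fun.mult poly_fun.coord poly_fun.const e)
  moreover have "(\<lambda>X. X v) \<in> poly_fun Gp" by (rule poly_fun.coord[OF v])
  ultimately show ?thesis
    by (cases "v = a 1"; cases "v = std 1") (simp_all add: Ap_def divide_inverse)
qed

lemma Api_poly: "v \<in> Gp \<Longrightarrow> (\<lambda>X. Api X v) \<in> poly_fun Gp"
proof -
  assume v: "v \<in> Gp"
  have e: "std 1 \<in> Gp" "a 1 \<in> Gp" using std1_Gt a1_Gt Gt_iff by blast+
  have "(\<lambda>X. zc X ^ k * X (a 1) - X (std 1) * inverse t) \<in> poly_fun Gp"
    by (intro poly_fun_diff poly_fun.mult poly_fun_power poly_zc poly_fun.coord poly_fun.const e)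
  moreover have "(\<lambda>X. t * X (a 1)) \<in> poly_fun Gp"
    by (intro poly_fun.mult poly_fun.coord poly_fun.const e)
  moreover have "(\<lambda>X. X v) \<in> poly_fun Gp" by (rule poly_fun.coord[OF v])
  ultimately show ?thesis
    by (cases "v = a 1"; cases "v = std 1") (simp_all add: Api_def divide_inverse)
qed

lemma Am_poly: "v \<in> Gm \<Longrightarrow> (\<lambda>X. Am X v) \<in> poly_fun Gm" and Ami_poly: "v \<in> Gm \<Longrightarrow> (\<lambda>X. Ami X v) \<in> poly_fun Gm"
proof -
  assume v: "v \<in> Gm"
  have e: "a 1 \<in> Gm" using a1_Gt Gt_iff by blast
  have "(\<lambda>X. X (a 1) + mu X) \<in> poly_fun Gm" by (intro poly_fun.add poly_mu poly_fun.coord e)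
  moreover have "(\<lambda>X. X (a 1) - mu X) \<in> poly_fun Gm" by (intro poly_fun_diff poly_mu poly_fun.coord e)
  moreover have "(\<lambda>X. X v) \<in> poly_fun Gm" by (rule poly_fun.coord[OF v])
  ultimately show "(\<lambda>X. Am X v) \<in> poly_fun Gm" "(\<lambda>X. Ami X v) \<in> poly_fun Gm"
    by (cases "v = a 1"; simp add: Am_def Ami_def)+
qed

end

section \<open>The two charts of the sheared variety\<close>

context gluing
begin

lemma q_subset: "\<Sigma>p \<subseteq> \<Sigma>q" "\<sigma> \<in> \<Sigma>m \<Longrightarrow> shear d q ` \<sigma> \<in> \<Sigma>q"
  by (auto simp: q_minus_fan_def)

lemma Gq_eq: "Gq = Gp \<union> sh ` (Gm - Gt)"
proof -
  have "sh v = v" if "v \<in> Gt" for v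
    using that gens_tilde_iff by (intro ishear_eq_self) blast
  then have "sh ` Gm \<subseteq> Gp \<union> sh ` (Gm - Gt)" using Gt_iff by fastforce
  then show ?thesis unfolding gens_q_minus_fan by blast
qed

lemma sh_Gt: "v \<in> Gt \<Longrightarrow> sh v = v" "v \<in> Gt \<Longrightarrow> sh' v = v"
  using gens_tilde_iff by (simp_all add: ishear_eq_self)

lemma sh_inj: "inj_on sh S"
  by (rule inj_on_inverseI[of _ "sh'"]) (simp add: ishear_ishear_minus)

lemma sh_Gm_disjoint: "v \<in> Gm - Gt \<Longrightarrow> sh v \<notin> Gp"
proof
  assume v: "v \<in> Gm - Gt" "sh v \<in> Gp"
  then have "0 \<le> v d" using Gp_d(1)[of "sh v"] by simp
  then show False using v(1) Gm_d[of v] by force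
qed

lemma Gq_minus_Gp: "Gq - Gp = sh ` (Gm - Gt)"
  unfolding Gq_eq using sh_Gm_disjoint by blast

lemma Gq_minus_shGm: "Gq - sh ` Gm = Gp - Gt"
proof -
  have "v \<notin> sh ` Gm" if v: "v \<in> Gp - Gt" for v
  proof
    assume "v \<in> sh ` Gm"
    then obtain u where u: "u \<in> Gm" "v = sh u" by blast
    then have "u d = 0" using Gp_d(1)[of v] Gm_d(1)[of u] v by simp
    then have "u \<in> Gt" using Gm_d(2) u by blast
    then show False using u v sh_Gt by simp
  qed
  moreover have "Gt \<subseteq> sh ` Gm"
  proof
    fix v assume "v \<in> Gt"
    then show "v \<in> sh ` Gm" using sh_Gt(1)[of v] Gt_iff by (intro image_eqI[of _ _ v]) auto
  qed
  ultimately show ?thesis unfolding gens_q_minus_fan by blast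
qed

lemma tor_plus_iff:
  assumes g: "\<And>v. g v \<noteq> 0" "\<And>v. v \<in> Gq - Gp \<Longrightarrow> g v = 1"
  shows "g \<in> tor d Gq \<longleftrightarrow> g \<in> tor d Gp"
proof -
  have "(\<Prod>v\<in>Gq. g v powi v i) = (\<Prod>v\<in>Gp. g v powi v i)" for i
    by (rule prod.mono_neutral_right) (use finG g(2) in \<open>auto simp: gens_q_minus_fan\<close>)
  then show ?thesis using g(1) by (simp add: tor_def)
qed

text \<open>Shearing the rays multiplies the \<open>i\<close>-th monomial by a power of the
  \<open>d\<close>-th and leaves the \<open>d\<close>-th unchanged, so the torus equations before
  and after the shear are equivalent.\<close>

lemma prod_shear:
  fixes g :: "(nat \<Rightarrow> int) \<Rightarrow> complex"
  assumes g: "\<And>v. v \<in> S \<Longrightarrow> g v \<noteq> 0" and i: "i \<in> {1..d}"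
  shows "(\<Prod>u\<in>S. g u powi sh u i) =
    (\<Prod>u\<in>S. g u powi u i) * (if i < d then (\<Prod>u\<in>S. g u powi u d) powi q i else 1)"
proof (cases "i < d")
  case True
  have "(\<Prod>u\<in>S. g u powi sh u i) = (\<Prod>u\<in>S. g u powi u i * (g u powi u d) powi q i)"
  proof (rule prod.cong)
    fix u assume "u \<in> S"
    have "sh u i = u i + u d * q i" using True i by (simp add: ishear_def mult.commute)
    then show "g u powi sh u i = g u powi u i * (g u powi u d) powi q i"
      using g[OF \<open>u \<in> S\<close>] by (simp add: power_int_add power_int_mult)
  qed simp
  then show ?thesis using True by (simp add: prod.distrib powi_prod)
next
  case False
  then have "i = d" using i by simp
  then show ?thesis by simp
qed

lemma tor_minus_iff:
  assumes g: "\<And>v. g v \<noteq> 0" "\<And>v. v \<in> Gq - sh ` Gm \<Longrightarrow> g v = 1"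
  shows "g \<in> tor d Gq \<longleftrightarrow> (\<lambda>v. g (sh v)) \<in> tor d Gm"
proof -
  define h where "h = (\<lambda>v. g (sh v))"
  have h0: "h v \<noteq> 0" for v using g(1) by (simp add: h_def)
  have eq: "(\<Prod>v\<in>Gq. g v powi v i) = (\<Prod>u\<in>Gm. h u powi sh u i)" for i
  proof -
    have "(\<Prod>v\<in>Gq. g v powi v i) = (\<Prod>v\<in>sh ` Gm. g v powi v i)"
      by (rule prod.mono_neutral_right) (use finG g(2) in \<open>auto simp: gens_q_minus_fan\<close>)
    also have "\<dots> = (\<Prod>u\<in>Gm. h u powi sh u i)"
      unfolding h_def by (rule prod.reindex[OF sh_inj, unfolded comp_def])
    finally show ?thesis .
  qed
  have di: "d \<in> {1..d}" using d2 by simp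
  have d: "(\<Prod>v\<in>Gq. g v powi v d) = (\<Prod>u\<in>Gm. h u powi u d)"
    unfolding eq using prod_shear[where g = h and S = Gm, OF h0 di] by simp
  show ?thesis
  proof
    assume L: "g \<in> tor d Gq"
    then have 1: "(\<Prod>v\<in>Gq. g v powi v i) = 1" if "i \<in> {1..d}" for i using that by (simp add: tor_def)
    have hd: "(\<Prod>u\<in>Gm. h u powi u d) = 1" using 1[OF di] unfolding d .
    have "(\<Prod>u\<in>Gm. h u powi u i) = 1" if i: "i \<in> {1..d}" for i
      using prod_shear[where g = h and S = Gm, OF h0 i] 1[OF i] hd unfolding eq[of i] by (simp split: if_splits)
    then show "(\<lambda>v. g (sh v)) \<in> tor d Gm" using h0 by (simp add: tor_def h_def)
  next
    assume "(\<lambda>v. g (sh v)) \<in> tor d Gm"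
    then have 1: "(\<Prod>u\<in>Gm. h u powi u i) = 1" if "i \<in> {1..d}" for i using that by (simp add: tor_def h_def)
    have "(\<Prod>v\<in>Gq. g v powi v i) = 1" if i: "i \<in> {1..d}" for i
      unfolding eq using prod_shear[where g = h and S = Gm, OF h0 i] 1[OF i] 1[OF di] by simp
    then show "g \<in> tor d Gq" using g(1) by (simp add: tor_def)
  qed
qed

definition Up :: "coords set" where "Up = (\<Union>\<sigma>\<in>\<Sigma>p. U_chart \<Sigma>q \<sigma>)"

definition Um :: "coords set" where "Um = (\<Union>\<sigma>\<in>\<Sigma>m. U_chart \<Sigma>q (shear d q ` \<sigma>))"

lemma Up_iff: "X \<in> Up \<longleftrightarrow> X \<in> tuples Gq \<and> (\<exists>\<sigma>\<in>\<Sigma>p. \<forall>v\<in>Gq. X v = 0 \<longrightarrow> rvec v \<in> \<sigma>)"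
  by (auto simp: Up_def U_chart_iff[OF finG(4)])

lemma Um_iff: "X \<in> Um \<longleftrightarrow> X \<in> tuples Gq \<and> (\<exists>\<sigma>\<in>\<Sigma>m. \<forall>v\<in>Gq. X v = 0 \<longrightarrow> rvec v \<in> shear d q ` \<sigma>)"
  by (auto simp: Um_def U_chart_iff[OF finG(4)])

lemma Uq_eq: "U_fan \<Sigma>q = Up \<union> Um"
  by (auto simp: U_fan_def Up_def Um_def q_minus_fan_def)

lemma open_Up: "openin (Top (quasi_affine Gq (U_fan \<Sigma>q))) Up"
  unfolding Up_def by (rule openin_Union) (use openin_U_chart[OF finG(4)] q_subset(1) in auto)

lemma open_Um: "openin (Top (quasi_affine Gq (U_fan \<Sigma>q))) Um"
  unfolding Um_def by (rule openin_Union) (use openin_U_chart[OF finG(4)] q_subset(2) in auto)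

text \<open>\<open>b 1\<close> has last coordinate 1 and \<open>sh (c 1)\<close>, used in the next
  definition, has last coordinate -1; each completes \<open>std 1\<close>, ...,
  \<open>std (d - 1)\<close> to a lattice basis, as \<open>basis_norm\<close> requires.\<close>

definition Np :: "coords \<Rightarrow> coords" where
  "Np X = basis_norm d (b 1) (Gq - Gp) (\<lambda>v. inverse (X v))"

definition Nm :: "coords \<Rightarrow> coords" where
  "Nm X = basis_norm d (sh (c 1)) (Gq - sh ` Gm) (\<lambda>v. inverse (X v))"

lemma nz_Up: "X \<in> Up \<Longrightarrow> v \<in> Gq - Gp \<Longrightarrow> X v \<noteq> 0"
proof
  assume X: "X \<in> Up" and v: "v \<in> Gq - Gp" and 0: "X v = 0"
  then obtain \<sigma> where "\<sigma> \<in> \<Sigma>p" "rvec v \<in> \<sigma>" unfolding Up_iff by blast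
  then have "0 \<le> v d" by (force simp: plus_fan_def rvec_def)
  obtain u where u: "u \<in> Gm - Gt" "v = sh u" using v unfolding Gq_minus_Gp by blast
  then show False using \<open>0 \<le> v d\<close> Gm_d[of u] by force
qed

lemma nz_Um: "X \<in> Um \<Longrightarrow> v \<in> Gq - sh ` Gm \<Longrightarrow> X v \<noteq> 0"
proof
  assume X: "X \<in> Um" and v: "v \<in> Gq - sh ` Gm" and 0: "X v = 0"
  then obtain \<sigma> where \<sigma>: "\<sigma> \<in> \<Sigma>m" "rvec v \<in> shear d q ` \<sigma>"
    unfolding Um_iff by blast
  then obtain x where x: "x \<in> \<sigma>" "rvec v = shear d q x" by blast
  then have "rvec v d = x d" by (simp add: shear_def)
  then have "v d \<le> 0" using x(1) \<sigma>(1) by (force simp: minus_fan_def rvec_def)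
  then show False using v Gp_d[of v] unfolding Gq_minus_shGm by force
qed

sublocale P: toric_chart d \<Sigma>p \<Sigma>q "\<lambda>v. v" "\<lambda>v. v" Ap Api Np Up
proof
  show "finite Gp" "finite Gq" by (rule finG)+
  show "(\<lambda>v. v) ` Gp \<subseteq> Gq" by (simp add: gens_q_minus_fan)
  show "g \<in> tor d Gq \<longleftrightarrow> (\<lambda>v. g v) \<in> tor d Gp"
    if "\<And>v. g v \<noteq> 0" "\<And>v. v \<in> Gq - (\<lambda>v. v) ` Gp \<Longrightarrow> g v = 1" for g
    using tor_plus_iff[of g] that by simp
  show "Ap X \<in> U_fan \<Sigma>p" "Api X \<in> U_fan \<Sigma>p" if "X \<in> U_fan \<Sigma>p" for X
    using Ap_U[OF that] Api_U[OF that] by auto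
  show "Ap (Api X) = X" "Api (Ap X) = X" for X by (rule Ap_Api Api_Ap)+
  show "Ap (\<lambda>v. g v * X v) = (\<lambda>v. g v * Ap X v)" if "g \<in> tor d Gp" for g X using that by (rule Ap_equiv)
  show "(\<lambda>X. Ap X v) \<in> poly_fun Gp" "(\<lambda>X. Api X v) \<in> poly_fun Gp" if "v \<in> Gp" for v
    using that by (rule Ap_poly Api_poly)+
  show "(\<lambda>v. if v \<in> (\<lambda>v. v) ` Gp then Y v else if v \<in> Gq then 1 else 0) \<in> U_fan \<Sigma>q" if Y: "Y \<in> U_fan \<Sigma>p" for Y
  proof -
    obtain \<sigma> where "\<sigma> \<in> \<Sigma>p" "\<forall>v\<in>Gp. Y v = 0 \<longrightarrow> rvec v \<in> \<sigma>" using Y unfolding U_fan_iff[OF finG(2)] by blast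
    then show ?thesis
      unfolding U_fan_iff[OF finG(4)] using q_subset(1)
      by (auto simp: tuples_def gens_q_minus_fan intro!: bexI[of _ \<sigma>])
  qed
  show "openin (Top (quasi_affine Gq (U_fan \<Sigma>q))) Up" by (rule open_Up)
  show "(\<lambda>v. if v \<in> Gp then X v else 0) \<in> U_fan \<Sigma>p" if X: "X \<in> Up" for X
  proof -
    obtain \<sigma> where "\<sigma> \<in> \<Sigma>p" "\<forall>v\<in>Gq. X v = 0 \<longrightarrow> rvec v \<in> \<sigma>"
      using X unfolding Up_iff by blast
    then show ?thesis unfolding U_fan_iff[OF finG(2)] by (auto simp: tuples_def gens_q_minus_fan intro!: bexI[of _ \<sigma>])
  qed
  show nz: "X v \<noteq> 0" if "X \<in> Up" "v \<in> Gq - (\<lambda>v. v) ` Gp" for X v using nz_Up that by simp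
  have stdGp: "std ` {1..<d} \<subseteq> Gp" using std_Gt Gt_iff by blast
  have b1Gp: "b 1 \<in> Gp" using gens_plus(1) pos(2) by auto
  show "Np X \<in> tor d Gq" if X: "X \<in> Up" for X
    unfolding Np_def
  proof (rule basis_norm_tor[OF d2 finG(4)])
    show "b 1 d * b 1 d = 1" using b1 by (simp add: std_def)
    show "inverse (X v) \<noteq> 0" if "v \<in> Gq - Gp" for v using nz_Up[OF X that] by simp
    show "b 1 \<notin> Gq - Gp" "std ` {1..<d} \<inter> (Gq - Gp) = {}" "b 1 \<in> Gq" "std ` {1..<d} \<subseteq> Gq"
      using b1Gp stdGp unfolding gens_q_minus_fan by auto
  qed auto
  show "Np X v = inverse (X v)" if "X \<in> Up" "v \<in> Gq - (\<lambda>v. v) ` Gp" for X v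
    unfolding Np_def using that by (intro basis_norm_simps) simp
  show "regular_at Gq Up (\<lambda>Y. Np Y v) X" if X: "X \<in> Up" for X v
    unfolding Np_def
  proof (rule basis_norm_regular)
    show "regular_at Gq Up (\<lambda>X. inverse (X u)) X" if u: "u \<in> Gq - Gp" for u
      by (rule regular_at_inverse[OF regular_at_poly[OF poly_fun.coord] nz_Up[OF X u] X]) (use u in simp)
    show "inverse (X u) \<noteq> 0" if "u \<in> Gq - Gp" for u using nz_Up[OF X that] by simp
  qed (use X finG in auto)
qed (rule refl)

sublocale M: toric_chart d \<Sigma>m \<Sigma>q sh sh' Am Ami Nm Um
proof
  show "finite Gm" "finite Gq" by (rule finG)+
  show "sh' (sh v) = v" for v by (rule ishear_ishear_minus)
  show "sh ` Gm \<subseteq> Gq" by (simp add: gens_q_minus_fan)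
  show "g \<in> tor d Gq \<longleftrightarrow> (\<lambda>v. g (sh v)) \<in> tor d Gm"
    if "\<And>v. g v \<noteq> 0" "\<And>v. v \<in> Gq - sh ` Gm \<Longrightarrow> g v = 1" for g
    using tor_minus_iff[of g] that by simp
  show "Am X \<in> U_fan \<Sigma>m" "Ami X \<in> U_fan \<Sigma>m" if "X \<in> U_fan \<Sigma>m" for X
    using Am_U[OF that] Ami_U[OF that] by auto
  show "Am (Ami X) = X" "Ami (Am X) = X" for X by (rule Am_Ami Ami_Am)+
  show "Am (\<lambda>v. g v * X v) = (\<lambda>v. g v * Am X v)" if "g \<in> tor d Gm" for g X using that by (rule Am_equiv)
  show "(\<lambda>X. Am X v) \<in> poly_fun Gm" "(\<lambda>X. Ami X v) \<in> poly_fun Gm" if "v \<in> Gm" for v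
    using that by (rule Am_poly Ami_poly)+
  show "(\<lambda>v. if v \<in> sh ` Gm then Y (sh' v) else if v \<in> Gq then 1 else 0) \<in> U_fan \<Sigma>q" if Y: "Y \<in> U_fan \<Sigma>m" for Y
  proof -
    obtain \<sigma> where \<sigma>: "\<sigma> \<in> \<Sigma>m" "\<forall>v\<in>Gm. Y v = 0 \<longrightarrow> rvec v \<in> \<sigma>" using Y unfolding U_fan_iff[OF finG(3)] by blast
    have "rvec (sh u) \<in> shear d q ` \<sigma>" if "u \<in> Gm" "Y u = 0" for u
      unfolding rvec_ishear using \<sigma>(2) that by blast
    then show ?thesis
      unfolding U_fan_iff[OF finG(4)] using q_subset(2)[OF \<sigma>(1)]
      by (auto simp: tuples_def gens_q_minus_fan ishear_ishear_minus intro!: bexI[of _ "shear d q ` \<sigma>"])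
  qed
  show "openin (Top (quasi_affine Gq (U_fan \<Sigma>q))) Um" by (rule open_Um)
  show "(\<lambda>v. if v \<in> Gm then X (sh v) else 0) \<in> U_fan \<Sigma>m" if X: "X \<in> Um" for X
  proof -
    obtain \<sigma> where \<sigma>: "\<sigma> \<in> \<Sigma>m" "\<forall>v\<in>Gq. X v = 0 \<longrightarrow> rvec v \<in> shear d q ` \<sigma>"
      using X unfolding Um_iff by blast
    have "rvec u \<in> \<sigma>" if u: "u \<in> Gm" "X (sh u) = 0" for u
    proof -
      have "sh u \<in> Gq" using u(1) by (simp add: gens_q_minus_fan)
      then have "shear d q (rvec u) \<in> shear d q ` \<sigma>" using \<sigma>(2) u(2) rvec_ishear by metis
      then show ?thesis using shear_shear_minus(2) by (metis imageE)
    qed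
    then show ?thesis unfolding U_fan_iff[OF finG(3)] using \<sigma>(1) by (auto simp: tuples_def intro!: bexI[of _ \<sigma>])
  qed
  show nz: "X v \<noteq> 0" if "X \<in> Um" "v \<in> Gq - sh ` Gm" for X v using nz_Um that by simp
  have stdGm: "std ` {1..<d} \<subseteq> sh ` Gm"
  proof
    fix v assume "v \<in> std ` {1..<d}"
    then have "v \<in> Gt" using std_Gt by blast
    then show "v \<in> sh ` Gm" using sh_Gt(1)[of v] Gt_iff by (intro image_eqI[of _ _ v]) auto
  qed
  have c1: "sh (c 1) \<in> sh ` Gm" using gens_minus(1) pos(3) by auto
  show "Nm X \<in> tor d Gq" if X: "X \<in> Um" for X
    unfolding Nm_def
  proof (rule basis_norm_tor[OF d2 finG(4)])
    show "sh (c 1) d * sh (c 1) d = 1" using c1_d by simp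
    show "inverse (X v) \<noteq> 0" if "v \<in> Gq - sh ` Gm" for v using nz_Um[OF X that] by simp
    show "sh (c 1) \<notin> Gq - sh ` Gm" "std ` {1..<d} \<inter> (Gq - sh ` Gm) = {}" "sh (c 1) \<in> Gq" "std ` {1..<d} \<subseteq> Gq"
      using c1 stdGm unfolding gens_q_minus_fan by auto
  qed auto
  show "Nm X v = inverse (X v)" if "X \<in> Um" "v \<in> Gq - sh ` Gm" for X v
    unfolding Nm_def using that by (intro basis_norm_simps) simp
  show "regular_at Gq Um (\<lambda>Y. Nm Y v) X" if X: "X \<in> Um" for X v
    unfolding Nm_def
  proof (rule basis_norm_regular)
    show "regular_at Gq Um (\<lambda>X. inverse (X u)) X" if u: "u \<in> Gq - sh ` Gm" for u
      by (rule regular_at_inverse[OF regular_at_poly[OF poly_fun.coord] nz_Um[OF X u] X]) (use u in simp)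
    show "inverse (X u) \<noteq> 0" if "u \<in> Gq - sh ` Gm" for u using nz_Um[OF X that] by simp
  qed (use X finG in auto)
qed

end

section \<open>The transition between the two charts\<close>

context gluing
begin

definition Up0 :: "coords set" where "Up0 = (\<Union>\<sigma>\<in>\<Sigma>t. U_chart \<Sigma>p \<sigma>)"

definition Um0 :: "coords set" where "Um0 = (\<Union>\<sigma>\<in>\<Sigma>t. U_chart \<Sigma>m \<sigma>)"

text \<open>If no coordinate off the hyperplane vanishes, the vanishing rays lie in the hyperplane
  and in a common cone of the large fan, and \<open>conv_tilde\<close> provides a common cone of
  \<open>\<Sigma>t\<close>.\<close>

lemma Up0_iff: "X \<in> Up0 \<longleftrightarrow> X \<in> U_fan \<Sigma>p \<and> (\<forall>v\<in>Gp - Gt. X v \<noteq> 0)"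
proof
  assume "X \<in> Up0"
  then obtain \<sigma> where \<sigma>: "\<sigma> \<in> \<Sigma>t" "X \<in> tuples Gp" "\<forall>v\<in>Gp. X v = 0 \<longrightarrow> rvec v \<in> \<sigma>"
    unfolding Up0_def by (auto simp: U_chart_iff[OF finG(2)])
  have "X v \<noteq> 0" if v: "v \<in> Gp - Gt" for v
  proof
    assume "X v = 0"
    then have "rvec v d = 0" using tilde_coord[OF \<sigma>(1)] \<sigma>(3) v by blast
    then have "v d = 0" by (simp add: rvec_def)
    then show False using Gp_d(2) v by blast
  qed
  moreover have "\<sigma> \<in> \<Sigma>p" using tilde_in_plus_minus[OF \<sigma>(1)] by blast
  ultimately show "X \<in> U_fan \<Sigma>p \<and> (\<forall>v\<in>Gp - Gt. X v \<noteq> 0)"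
    unfolding U_fan_iff[OF finG(2)] using \<sigma> by blast
next
  assume X: "X \<in> U_fan \<Sigma>p \<and> (\<forall>v\<in>Gp - Gt. X v \<noteq> 0)"
  then obtain \<sigma> where \<sigma>: "\<sigma> \<in> \<Sigma>p" "X \<in> tuples Gp" "\<forall>v\<in>Gp. X v = 0 \<longrightarrow> rvec v \<in> \<sigma>"
    unfolding U_fan_iff[OF finG(2)] by blast
  have "\<sigma> \<in> \<Sigma>" using \<sigma>(1) by (simp add: plus_fan_def)
  then have "\<exists>\<tau>\<in>\<Sigma>t. \<forall>v\<in>{v \<in> Gp. X v = 0}. rvec v \<in> \<tau>"
    using finG(2) X \<sigma>(3) by (intro conv_tilde[of _ \<sigma>]) auto
  then show "X \<in> Up0" unfolding Up0_def using \<sigma>(2) by (auto simp: U_chart_iff[OF finG(2)])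
qed

lemma Um0_iff: "X \<in> Um0 \<longleftrightarrow> X \<in> U_fan \<Sigma>m \<and> (\<forall>v\<in>Gm - Gt. X v \<noteq> 0)"
proof
  assume "X \<in> Um0"
  then obtain \<sigma> where \<sigma>: "\<sigma> \<in> \<Sigma>t" "X \<in> tuples Gm" "\<forall>v\<in>Gm. X v = 0 \<longrightarrow> rvec v \<in> \<sigma>"
    unfolding Um0_def by (auto simp: U_chart_iff[OF finG(3)])
  have "X v \<noteq> 0" if v: "v \<in> Gm - Gt" for v
  proof
    assume "X v = 0"
    then have "rvec v d = 0" using tilde_coord[OF \<sigma>(1)] \<sigma>(3) v by blast
    then have "v d = 0" by (simp add: rvec_def)
    then show False using Gm_d(2) v by blast
  qed
  moreover have "\<sigma> \<in> \<Sigma>m" using tilde_in_plus_minus[OF \<sigma>(1)] by blast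
  ultimately show "X \<in> U_fan \<Sigma>m \<and> (\<forall>v\<in>Gm - Gt. X v \<noteq> 0)"
    unfolding U_fan_iff[OF finG(3)] using \<sigma> by blast
next
  assume X: "X \<in> U_fan \<Sigma>m \<and> (\<forall>v\<in>Gm - Gt. X v \<noteq> 0)"
  then obtain \<sigma> where \<sigma>: "\<sigma> \<in> \<Sigma>m" "X \<in> tuples Gm" "\<forall>v\<in>Gm. X v = 0 \<longrightarrow> rvec v \<in> \<sigma>"
    unfolding U_fan_iff[OF finG(3)] by blast
  have "\<sigma> \<in> \<Sigma>" using \<sigma>(1) by (simp add: minus_fan_def)
  then have "\<exists>\<tau>\<in>\<Sigma>t. \<forall>v\<in>{v \<in> Gm. X v = 0}. rvec v \<in> \<tau>"
    using finG(3) X \<sigma>(3) by (intro conv_tilde[of _ \<sigma>]) auto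
  then show "X \<in> Um0" unfolding Um0_def using \<sigma>(2) by (auto simp: U_chart_iff[OF finG(3)])
qed

text \<open>Products over the rays off the hyperplane, with their \<open>i\<close>-th coordinates as
  exponents. All such rays are treated alike; for \<open>i = d\<close> one gets
  \<open>zplus\<close>, and the inverse of \<open>wminus\<close> on the minus side.\<close>

definition Bp :: "coords \<Rightarrow> nat \<Rightarrow> complex" where "Bp X i = (\<Prod>v\<in>Gp - Gt. X v powi v i)"

definition Dm :: "coords \<Rightarrow> nat \<Rightarrow> complex" where "Dm X i = (\<Prod>v\<in>Gm - Gt. X v powi v i)"

text \<open>The tuple prescribed by the identification, as a function of \<open>X\<close>. For
  \<open>v = std i\<close> the number \<open>pairing d v u\<close> is the coordinate
  \<open>u i\<close>, which avoids recovering the index \<open>i\<close> from the ray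
  \<open>v\<close>.\<close>

definition xplus :: "coords \<Rightarrow> coords" where
  "xplus X = (\<lambda>v. if v \<in> std ` {1..<d} then X v * (\<Prod>j=2..m. X (b j) powi pairing d v (b j))
     else if v \<in> Gt then X v else 0)"

definition zplus :: "coords \<Rightarrow> complex" where
  "zplus X = X (b 1) * (\<Prod>j=2..m. X (b j) powi b j d)"

definition xminus :: "coords \<Rightarrow> coords" where
  "xminus X = (\<lambda>v. if v \<in> std ` {1..<d}
     then X v * (\<Prod>j=2..n. X (c j) powi (pairing d v (c j) + pairing d v (c 1) * c j d))
     else if v \<in> Gt then X v else 0)"

definition wminus :: "coords \<Rightarrow> complex" where
  "wminus X = X (c 1) * (\<Prod>j=2..n. X (c j) powi (- c j d))"

definition patch :: "coords \<Rightarrow> complex \<Rightarrow> coords" where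
  "patch x w = (\<lambda>v. if v = std 1 then x v * w powi c 1 1 + t * x (a 1) * w ^ k
     else if v \<in> std ` {1..<d} then x v * w powi pairing d v (c 1) else x v)"

lemma prod_b: "(\<Prod>v\<in>Gp - Gt. f v) = f (b 1) * (\<Prod>j=2..m. (f (b j) :: complex))"
proof -
  have "(\<Prod>v\<in>Gp - Gt. f v) = (\<Prod>j=1..m. f (b j))"
    unfolding Gp_minus_Gt using prod.reindex[OF gens_plus(2)] by (simp add: comp_def)
  then show ?thesis using prod.atLeast_Suc_atMost[OF pos(2)] by (simp add: numeral_2_eq_2 One_nat_def)
qed

lemma prod_c: "(\<Prod>v\<in>Gm - Gt. f v) = f (c 1) * (\<Prod>j=2..n. (f (c j) :: complex))"
proof -
  have "(\<Prod>v\<in>Gm - Gt. f v) = (\<Prod>j=1..n. f (c j))"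
    unfolding Gm_minus_Gt using prod.reindex[OF gens_minus(2)] by (simp add: comp_def)
  then show ?thesis using prod.atLeast_Suc_atMost[OF pos(3)] by (simp add: numeral_2_eq_2 One_nat_def)
qed

lemma std_in: "i \<in> {1..<d} \<Longrightarrow> std i \<in> std ` {1..<d}" "i \<in> {1..<d} \<Longrightarrow> std i \<in> Gt"
  using std_Gt by blast+

lemma pairing_std': "i \<in> {1..<d} \<Longrightarrow> pairing d (std i) v = v i"
  by (rule pairing_std) auto

lemma a_not_std: "j \<in> {1..r} \<Longrightarrow> a j \<notin> std ` {1..<d}"
  using gens_tilde(3) by blast

lemma a_in: "j \<in> {1..r} \<Longrightarrow> a j \<in> Gt"
  using gens_tilde(1) by blast

lemma Gt_cases:
  assumes "v \<in> Gt"
  obtains i where "i \<in> {1..<d}" "v = std i" | j where "j \<in> {1..r}" "v = a j"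
  using assms gens_tilde(1) by blast

lemma xplus_std: "i \<in> {1..<d} \<Longrightarrow> xplus X (std i) = X (std i) * Bp X i"
proof -
  assume i: "i \<in> {1..<d}"
  have "Bp X i = (\<Prod>j=2..m. X (b j) powi b j i)"
    unfolding Bp_def prod_b using i b1 by (simp add: std_def)
  then show ?thesis using std_in(1)[OF i] by (simp add: xplus_def pairing_std'[OF i])
qed

lemma xplus_a: "j \<in> {1..r} \<Longrightarrow> xplus X (a j) = X (a j)"
  using a_not_std a_in by (simp add: xplus_def)

lemma zplus_eq: "zplus X = Bp X d"
  unfolding zplus_def Bp_def prod_b using b1 by (simp add: std_def)

lemma wminus_eq: "wminus X = inverse (Dm X d)"
  unfolding wminus_def Dm_def prod_c c1_d
  by (simp add: power_int_minus prod_inversef[unfolded comp_def])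

lemma Bp_1: "Bp X 1 = 1"
  unfolding Bp_def
proof (rule prod.neutral, rule ballI)
  fix v assume v: "v \<in> Gp - Gt"
  then have "v 1 = 0" using Gp_1[of v] std1_Gt a1_Gt by auto
  then show "X v powi v 1 = 1" by simp
qed

lemma Bp_nonzero: "X \<in> Up0 \<Longrightarrow> Bp X i \<noteq> 0"
  unfolding Bp_def Up0_iff using finG(2) by simp

lemma Dm_nonzero: "X \<in> Um0 \<Longrightarrow> Dm X i \<noteq> 0"
  unfolding Dm_def Um0_iff using finG(3) by simp

text \<open>The correction c_1i c_jd in the exponents of the identification is cancelled by the
  factor w^(c_1i) of the patching; what remains treats \<open>c 1\<close> and the other
  \<open>c j\<close> symmetrically.\<close>

lemma xminus_std:
  assumes X: "X \<in> Um0" and i: "i \<in> {1..<d}"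
  shows "xminus X (std i) * wminus X powi c 1 i = X (std i) * Dm X i"
proof -
  have nz: "X (c j) \<noteq> 0" if "j \<in> {1..n}" for j using X that Gm_minus_Gt by (auto simp: Um0_iff)
  have "wminus X powi c 1 i = X (c 1) powi c 1 i * (\<Prod>j=2..n. X (c j) powi (- c j d * c 1 i))"
    by (simp only: wminus_def power_int_mult_distrib powi_prod power_int_mult)
  moreover have "(\<Prod>j=2..n. X (c j) powi (c j i + c 1 i * c j d)) * (\<Prod>j=2..n. X (c j) powi (- c j d * c 1 i)) =
      (\<Prod>j=2..n. X (c j) powi c j i)"
    unfolding prod.distrib[symmetric]
  proof (rule prod.cong)
    fix j assume "j \<in> {2..n}"
    then have "X (c j) \<noteq> 0" using nz by simp
    then show "X (c j) powi (c j i + c 1 i * c j d) * X (c j) powi (- c j d * c 1 i) = X (c j) powi c j i"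
      by (simp add: power_int_add[symmetric] algebra_simps)
  qed simp
  ultimately show ?thesis
    using std_in(1)[OF i] unfolding Dm_def prod_c
    by (simp add: xminus_def pairing_std'[OF i] mult_ac)
qed

lemma patch_std1:
  assumes Y: "Y \<in> Um0"
  shows "patch (xminus Y) (wminus Y) (std 1) = Y (std 1) * Dm Y 1 + t * Y (a 1) * wminus Y ^ k"
proof -
  have 1: "1 \<in> {1..<d}" using d2 by simp
  have "xminus Y (a 1) = Y (a 1)" using a_not_std[of 1] a_in[of 1] pos(1) by (simp add: xminus_def)
  then show ?thesis using xminus_std[OF Y 1] by (simp add: patch_def)
qed

lemma patch_std:
  assumes Y: "Y \<in> Um0" and i: "i \<in> {1..<d}" "i \<noteq> 1"
  shows "patch (xminus Y) (wminus Y) (std i) = Y (std i) * Dm Y i"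
  using xminus_std[OF Y i(1)] std_in(1)[OF i(1)] i(2)
  by (simp add: patch_def pairing_std'[OF i(1)] std_eq_iff)

lemma patch_a:
  assumes j: "j \<in> {1..r}"
  shows "patch (xminus Y) w (a j) = Y (a j)"
proof -
  have "a j \<noteq> std 1" using a_not_std[OF j] std_in(1)[of 1] d2 by force
  then show ?thesis using a_not_std[OF j] a_in[OF j] by (simp add: patch_def xminus_def)
qed

lemma patch_tuples: "x \<in> tuples Gt \<Longrightarrow> patch x w \<in> tuples Gt"
  using std1_Gt std_Gt by (auto simp: patch_def tuples_def)

lemma xplus_tuples: "xplus X \<in> tuples Gt" and xminus_tuples: "xminus X \<in> tuples Gt"
  using std_Gt by (auto simp: xplus_def xminus_def tuples_def)

lemma xplus_U: "X \<in> Up0 \<Longrightarrow> xplus X \<in> U_fan \<Sigma>t"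
proof -
  assume X: "X \<in> Up0"
  then obtain \<sigma> where \<sigma>: "\<sigma> \<in> \<Sigma>t" "\<forall>v\<in>Gp. X v = 0 \<longrightarrow> rvec v \<in> \<sigma>"
    unfolding Up0_def by (auto simp: U_chart_iff[OF finG(2)])
  have "X v = 0" if "v \<in> Gt" "xplus X v = 0" for v
    using that(1) by (rule Gt_cases) (use that(2) xplus_std xplus_a Bp_nonzero[OF X] in auto)
  then show ?thesis unfolding U_fan_iff[OF finG(1)] using \<sigma> xplus_tuples Gt_iff by blast
qed

lemma xminus_U: "X \<in> Um0 \<Longrightarrow> xminus X \<in> U_fan \<Sigma>t"
proof -
  assume X: "X \<in> Um0"
  then obtain \<sigma> where \<sigma>: "\<sigma> \<in> \<Sigma>t" "\<forall>v\<in>Gm. X v = 0 \<longrightarrow> rvec v \<in> \<sigma>"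
    unfolding Um0_def by (auto simp: U_chart_iff[OF finG(3)])
  have "X v = 0" if v: "v \<in> Gt" "xminus X v = 0" for v
    using v(1)
  proof (rule Gt_cases)
    fix i assume "i \<in> {1..<d}" "v = std i"
    then show ?thesis using xminus_std[OF X, of i] v(2) Dm_nonzero[OF X, of i] by simp
  next
    fix j assume "j \<in> {1..r}" "v = a j"
    then show ?thesis using v(2) a_not_std a_in by (simp add: xminus_def)
  qed
  then show ?thesis unfolding U_fan_iff[OF finG(1)] using \<sigma> xminus_tuples Gt_iff by blast
qed

lemma zc_eq: "X \<in> Up0 \<Longrightarrow> zc X = zplus X"
  unfolding zc_def zplus_eq Bp_def
  by (rule prod.cong) (use Gp_d(1) in \<open>auto simp: power_int_def\<close>)

lemma mu_eq: "Y \<in> Um0 \<Longrightarrow> mu Y = Y (std 1) * Dm Y 1 / (t * wminus Y ^ k)"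
proof -
  assume Y: "Y \<in> Um0"
  have nz: "Y v \<noteq> 0" if "v \<in> Gm - Gt" for v using Y that by (auto simp: Um0_iff)
  have "(\<Prod>v\<in>Gm - Gt. Y v ^ nat (int k * v d + v 1)) = (\<Prod>v\<in>Gm - Gt. (Y v powi v d) ^ k * Y v powi v 1)"
  proof (rule prod.cong)
    fix v assume v: "v \<in> Gm - Gt"
    then have "0 \<le> int k * v d + v 1" using cond2 unfolding Gm_minus_Gt by auto
    then have "Y v ^ nat (int k * v d + v 1) = Y v powi (v d * int k + v 1)" by (simp add: power_int_def mult.commute)
    also have "\<dots> = (Y v powi v d) powi int k * Y v powi v 1"
      using nz[OF v] by (simp add: power_int_add power_int_mult)
    finally show "Y v ^ nat (int k * v d + v 1) = (Y v powi v d) ^ k * Y v powi v 1" by simp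
  qed simp
  also have "\<dots> = Dm Y d ^ k * Dm Y 1" by (simp add: Dm_def prod.distrib prod_power_distrib)
  finally show ?thesis
    unfolding mu_def wminus_eq using t Dm_nonzero[OF Y, of d] by (simp add: field_simps)
qed

text \<open>
  The torus element moving the image of \<open>X\<close> in the plus chart to that of \<open>Y\<close> in the minus chart is forced on
  the rays outside \<open>\<Sigma>t\<close>, where one of the two images has coordinates 1.  On the rays of \<open>\<Sigma>t\<close> it is
  \<open>kap X Y / \<eta>\<close>, where \<open>\<eta>\<close> is an element of the torus of \<open>\<Sigma>t\<close>.
\<close>

definition kap :: "coords \<Rightarrow> coords \<Rightarrow> coords" where
  "kap X Y v = (if v = std 1 then wminus Y ^ k / Dm Y 1
     else if v = a 1 then inverse (wminus Y ^ k)
     else if v \<in> std ` {1..<d} then (\<Prod>u\<in>Gp - Gt. X u powi pairing d v u) / (\<Prod>u\<in>Gm - Gt. Y u powi pairing d v u)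
     else 1)"

definition transition :: "coords \<Rightarrow> coords \<Rightarrow> coords \<Rightarrow> coords" where
  "transition X Y \<eta> v = (if v \<in> Gp - Gt then inverse (X v) else if v \<in> sh ` (Gm - Gt) then Y (sh' v)
     else if v \<in> Gt then kap X Y v / \<eta> v else 1)"

lemma kap_std: "i \<in> {1..<d} \<Longrightarrow> i \<noteq> 1 \<Longrightarrow> kap X Y (std i) = Bp X i / Dm Y i"
proof -
  assume i: "i \<in> {1..<d}" "i \<noteq> 1"
  have "std i \<noteq> a 1" using std_in(1)[OF i(1)] a_not_std[of 1] pos(1) by force
  then show ?thesis using i std_in(1)[OF i(1)] by (simp add: kap_def pairing_std' std_eq_iff Bp_def Dm_def)
qed

lemma kap_std1: "kap X Y (std 1) = wminus Y ^ k / Dm Y 1"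
  by (simp add: kap_def)

lemma kap_a1: "kap X Y (a 1) = inverse (wminus Y ^ k)"
  using std1_ne_a1 by (simp add: kap_def)

lemma kap_a: "j \<in> {1..r} \<Longrightarrow> j \<noteq> 1 \<Longrightarrow> kap X Y (a j) = 1"
  using a_not_std[of j] std_in(1)[of 1] d2 inj_onD[OF gens_tilde(2), of j 1] pos(1) by (auto simp: kap_def)

lemma wminus_nonzero: "Y \<in> Um0 \<Longrightarrow> wminus Y \<noteq> 0"
  unfolding wminus_eq using Dm_nonzero by simp

lemma kap_nonzero: "X \<in> Up0 \<Longrightarrow> Y \<in> Um0 \<Longrightarrow> v \<in> Gt \<Longrightarrow> kap X Y v \<noteq> 0"
proof -
  assume XY: "X \<in> Up0" "Y \<in> Um0" and v: "v \<in> Gt"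
  from v show ?thesis
  proof (rule Gt_cases)
    fix i assume "i \<in> {1..<d}" "v = std i"
    then show ?thesis
      using kap_std1[of X Y] kap_std[of i X Y] wminus_nonzero[OF XY(2)] Dm_nonzero[OF XY(2)] Bp_nonzero[OF XY(1)]
      by (cases "i = 1") auto
  next
    fix j assume "j \<in> {1..r}" "v = a j"
    then show ?thesis using kap_a1[of X Y] kap_a[of j X Y] wminus_nonzero[OF XY(2)] by (cases "j = 1") auto
  qed
qed

text \<open>This is where the shear vector is forced. Up to factors that cancel, the left side is a
  power of w with exponent k + k - 2k for \<open>i = 1\<close>, using \<open>a 1 1 = - 1\<close>,
  and -k a_1i + k a_1i for the other \<open>i\<close>.\<close>

lemma prod_kap:
  assumes XY: "X \<in> Up0" "Y \<in> Um0" and i: "i \<in> {1..<d}"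
  shows "(\<Prod>v\<in>Gt. kap X Y v powi v i) * (Dm Y i * Dm Y d powi q i) = Bp X i"
proof -
  have disj: "std ` {1..<d} \<inter> a ` {1..r} = {}" by (rule gens_tilde(3))
  have "(\<Prod>v\<in>Gt. kap X Y v powi v i) = (\<Prod>v\<in>std ` {1..<d}. kap X Y v powi v i) * (\<Prod>v\<in>a ` {1..r}. kap X Y v powi v i)"
    unfolding gens_tilde(1) by (rule prod.union_disjoint) (use disj in auto)
  also have "(\<Prod>v\<in>std ` {1..<d}. kap X Y v powi v i) = (\<Prod>l=1..<d. kap X Y (std l) powi std l i)" by (rule prod_std)
  also have "\<dots> = (\<Prod>l=1..<d. if l = i then kap X Y (std i) else 1)"
    by (rule prod.cong) (auto simp: std_def)
  also have "\<dots> = kap X Y (std i)" using i by simp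
  also have "(\<Prod>v\<in>a ` {1..r}. kap X Y v powi v i) = (\<Prod>j=1..r. kap X Y (a j) powi a j i)"
    using prod.reindex[OF gens_tilde(2)] by (simp add: comp_def)
  also have "\<dots> = (\<Prod>j=1..r. if j = 1 then inverse (wminus Y ^ k) powi a 1 i else 1)"
    by (rule prod.cong) (auto simp: kap_a kap_a1)
  also have "\<dots> = inverse (wminus Y ^ k) powi a 1 i" using pos(1) by simp
  finally have eq: "(\<Prod>v\<in>Gt. kap X Y v powi v i) = kap X Y (std i) * inverse (wminus Y ^ k) powi a 1 i" .
  have w0: "wminus Y \<noteq> 0" by (rule wminus_nonzero[OF XY(2)])
  have Dd: "Dm Y d = wminus Y powi (- 1)" using Dm_nonzero[OF XY(2), of d] by (simp add: wminus_eq power_int_minus)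
  have inv: "inverse (wminus Y ^ k) = wminus Y powi (- int k)" by (simp add: power_int_minus)
  show ?thesis
  proof (cases "i = 1")
    case True
    have "wminus Y ^ k * (wminus Y powi (- int k)) powi a 1 1 * Dm Y d powi q 1 =
        wminus Y powi int k * wminus Y powi (- int k * a 1 1) * wminus Y powi (- 1 * (2 * int k))"
      by (simp only: Dd q_def if_True refl power_int_mult power_int_of_nat)
    also have "\<dots> = wminus Y powi (int k + - int k * a 1 1 + - 1 * (2 * int k))"
      by (simp only: power_int_add[OF disjI1[OF w0]])
    also have "\<dots> = 1" unfolding a1 by simp
    finally have "wminus Y ^ k * (wminus Y powi (- int k)) powi a 1 1 * Dm Y d powi q 1 = 1" .
    moreover have "(\<Prod>v\<in>Gt. kap X Y v powi v 1) = kap X Y (std 1) * inverse (wminus Y ^ k) powi a 1 1"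
      using eq unfolding True .
    ultimately show ?thesis
      unfolding True Bp_1 using Dm_nonzero[OF XY(2), of 1] by (simp add: kap_std1 inv mult_ac)
  next
    case False
    have "(wminus Y powi (- int k)) powi a 1 i * Dm Y d powi q i =
        wminus Y powi (- int k * a 1 i) * wminus Y powi (- 1 * (- int k * a 1 i))"
      by (simp only: Dd q_def False if_False power_int_mult)
    also have "\<dots> = wminus Y powi (- int k * a 1 i + - 1 * (- int k * a 1 i))"
      by (simp only: power_int_add[OF disjI1[OF w0]])
    also have "\<dots> = 1" by simp
    finally have "(wminus Y powi (- int k)) powi a 1 i * Dm Y d powi q i = 1" .
    then show ?thesis
      unfolding eq kap_std[OF i False] inv using Dm_nonzero[OF XY(2), of i] by (simp add: mult_ac)
  qed
qed

end

text \<open>\<open>W\<close>, \<open>D\<close>, \<open>h\<close> stand for w^k,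
  \<open>Dm Y 1\<close> and the common value of \<eta> at \<open>std 1\<close> and
  \<open>a 1\<close>; \<open>x\<close>, \<open>x'\<close> and \<open>y\<close>, \<open>y'\<close>
  are the coordinates of these two rays on the plus and the minus side. The second equation on the
  left determines \<open>x\<close>, and with this \<open>x\<close> the first one reduces to
  \<open>x' = h * y'\<close>.\<close>

lemma chart_change_algebra:
  fixes W D h t :: complex
  assumes "W \<noteq> 0" "D \<noteq> 0" "h \<noteq> 0" "t \<noteq> 0"
  shows "(y = (W / D) / h * ((1 / W) * x - t * x') \<and> y' + y * D / (t * W) = inverse W / h * (x / t)) \<longleftrightarrow>
    (x = h * (y * D + t * y' * W) \<and> x' = h * y')"
proof -
  have "(W / D) / h * ((1 / W) * x - t * x') = (x - t * W * x') / (D * h)"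
    using assms by (simp add: field_simps)
  then have 1: "y = (W / D) / h * ((1 / W) * x - t * x') \<longleftrightarrow> y * D * h = x - t * W * x'"
    using assms by (simp add: eq_divide_eq mult.assoc)
  have 2: "y' + y * D / (t * W) = inverse W / h * (x / t) \<longleftrightarrow> (y' * t * W + y * D) * h = x"
  proof -
    have e1: "inverse W / h * (x / t) = x / (h * (t * W))" using assms by (simp add: field_simps)
    have e2: "y' + y * D / (t * W) = (y' * t * W + y * D) * h / (h * (t * W))" using assms by (simp add: field_simps)
    have nz: "h * (t * W) \<noteq> 0" using assms by simp
    show ?thesis
      unfolding e1 e2 by (simp only: divide_cancel_right nz simp_thms)
  qed
  have 3: "y * D * h = x - t * W * x' \<longleftrightarrow> t * W * x' = t * W * (h * y')"
    if "x = (y' * t * W + y * D) * h"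
    unfolding that by (auto simp: algebra_simps)
  show ?thesis
    unfolding 1 2 using 3 assms(1,4) by (auto simp: algebra_simps)
qed

context gluing
begin

lemma Am_other: "v \<noteq> a 1 \<Longrightarrow> Am Y v = Y v"
  by (simp add: Am_def)

lemma Ap_other: "v \<noteq> std 1 \<Longrightarrow> v \<noteq> a 1 \<Longrightarrow> Ap X v = X v"
  by (simp add: Ap_def)

lemma tor_Gt_1: "\<eta> \<in> tor (d - 1) Gt \<Longrightarrow> \<eta> (std 1) = \<eta> (a 1)"
  using prod_Gt_1[of \<eta>] d2 tor_nonzero[of \<eta> "d - 1" Gt "a 1"] by (auto simp: tor_def field_simps)

text \<open>The equations at \<open>std 1\<close> and \<open>a 1\<close> are equivalent only as a
  pair, because the two substitutions mix these coordinates. At every other ray the equivalence is a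
  comparison of monomials.\<close>

lemma chart_change_iff:
  assumes X: "X \<in> Up0" and Y: "Y \<in> Um0" and zw: "zplus X = 1 / wminus Y" and \<eta>: "\<eta> \<in> tor (d - 1) Gt"
  shows "(\<forall>v\<in>Gt. Am Y v = kap X Y v / \<eta> v * Ap X v) \<longleftrightarrow>
    (\<forall>v\<in>Gt. xplus X v = \<eta> v * patch (xminus Y) (wminus Y) v)" (is "(\<forall>v\<in>Gt. ?L v) \<longleftrightarrow> (\<forall>v\<in>Gt. ?R v)")
proof -
  have \<eta>0: "\<eta> v \<noteq> 0" for v using \<eta> by (rule tor_nonzero)
  have w0: "wminus Y \<noteq> 0" by (rule wminus_nonzero[OF Y])
  have one: "1 \<in> {1..<d}" "1 \<in> {1..r}" using d2 pos(1) by auto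
  have 1: "?L (std 1) \<and> ?L (a 1) \<longleftrightarrow> ?R (std 1) \<and> ?R (a 1)"
  proof -
    have "Am Y (std 1) = Y (std 1)" "Am Y (a 1) = Y (a 1) + Y (std 1) * Dm Y 1 / (t * wminus Y ^ k)"
      using std1_ne_a1 mu_eq[OF Y] by (simp_all add: Am_def)
    moreover have "Ap X (std 1) = (1 / wminus Y ^ k) * X (std 1) - t * X (a 1)" "Ap X (a 1) = X (std 1) / t"
      using std1_ne_a1 by (simp_all add: Ap_def zc_eq[OF X] zw power_divide)
    moreover have "xplus X (std 1) = X (std 1)" "xplus X (a 1) = X (a 1)"
      using xplus_std[OF one(1)] xplus_a[OF one(2)] by (simp_all add: Bp_1)
    ultimately show ?thesis
      using chart_change_algebra[of "wminus Y ^ k" "Dm Y 1" "\<eta> (a 1)" t "Y (std 1)" "X (std 1)" "X (a 1)" "Y (a 1)"]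
        w0 Dm_nonzero[OF Y] \<eta>0 t
      by (simp only: kap_std1 kap_a1 patch_std1[OF Y] patch_a[OF one(2)] tor_Gt_1[OF \<eta>]) simp
  qed
  have 2: "?L v \<longleftrightarrow> ?R v" if v: "v \<in> Gt" "v \<noteq> std 1" "v \<noteq> a 1" for v
    using v(1)
  proof (rule Gt_cases)
    fix i assume i: "i \<in> {1..<d}" "v = std i"
    then have "i \<noteq> 1" using v by auto
    then show ?thesis
      using v i kap_std[OF i(1)] patch_std[OF Y i(1)] xplus_std[OF i(1)] \<eta>0[of v] Dm_nonzero[OF Y, of i]
      by (auto simp: Am_other Ap_other field_simps)
  next
    fix j assume j: "j \<in> {1..r}" "v = a j"
    then have "j \<noteq> 1" using v by auto
    then show ?thesis
      using v j kap_a[OF j(1)] patch_a[OF j(1)] xplus_a[OF j(1)] \<eta>0[of v]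
      by (auto simp: Am_other Ap_other field_simps)
  qed
  show ?thesis
  proof
    assume L: "\<forall>v\<in>Gt. ?L v"
    then have "?R (std 1) \<and> ?R (a 1)" using 1 std1_Gt a1_Gt by blast
    then show "\<forall>v\<in>Gt. ?R v" using L 2 by metis
  next
    assume R: "\<forall>v\<in>Gt. ?R v"
    then have "?L (std 1) \<and> ?L (a 1)" using 1 std1_Gt a1_Gt by blast
    then show "\<forall>v\<in>Gt. ?L v" using R 2 by metis
  qed
qed

lemma trans_simps:
  "v \<in> Gp - Gt \<Longrightarrow> transition X Y \<eta> v = inverse (X v)"
  "u \<in> Gm - Gt \<Longrightarrow> transition X Y \<eta> (sh u) = Y u"
  "v \<in> Gt \<Longrightarrow> transition X Y \<eta> v = kap X Y v / \<eta> v"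
proof -
  show "v \<in> Gp - Gt \<Longrightarrow> transition X Y \<eta> v = inverse (X v)" by (simp add: transition_def)
  show "u \<in> Gm - Gt \<Longrightarrow> transition X Y \<eta> (sh u) = Y u"
    using sh_Gm_disjoint[of u] by (auto simp: transition_def ishear_ishear_minus)
  assume v: "v \<in> Gt"
  have "v \<notin> sh ` (Gm - Gt)"
  proof
    assume "v \<in> sh ` (Gm - Gt)"
    then have "v \<notin> Gp" using sh_Gm_disjoint by blast
    then show False using v Gt_iff by blast
  qed
  then show "transition X Y \<eta> v = kap X Y v / \<eta> v" using v by (simp add: transition_def)
qed

lemma trans_nonzero:
  assumes X: "X \<in> Up0" and Y: "Y \<in> Um0" and \<eta>: "\<And>v. \<eta> v \<noteq> 0"
  shows "transition X Y \<eta> v \<noteq> 0"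
proof -
  have "Y (sh' v) \<noteq> 0" if v: "v \<in> sh ` (Gm - Gt)"
  proof -
    obtain u where "u \<in> Gm - Gt" "v = sh u" using v by blast
    then show ?thesis using Y by (auto simp: Um0_iff ishear_ishear_minus)
  qed
  moreover have "inverse (X v) \<noteq> 0" if "v \<in> Gp - Gt" using X that by (simp add: Up0_iff)
  ultimately show ?thesis using kap_nonzero[OF X Y, of v] \<eta>[of v] unfolding transition_def by simp
qed

text \<open>By \<open>prod_kap\<close> the contributions of the rays off the hyperplane cancel
  against those of \<open>kap\<close>. So the first \<open>d - 1\<close> torus equations concern
  \<eta> alone and are those of V-tilde, while the last one becomes z w = 1.\<close>

lemma prod_trans:
  assumes X: "X \<in> Up0" and Y: "Y \<in> Um0" and \<eta>: "\<And>v. \<eta> v \<noteq> 0" and i: "i \<in> {1..d}"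
  shows "(\<Prod>v\<in>Gq. transition X Y \<eta> v powi v i) =
    (if i < d then inverse (\<Prod>v\<in>Gt. \<eta> v powi v i) else inverse (zplus X * wminus Y))"
proof -
  let ?T = "transition X Y \<eta>"
  have Gq: "Gq = Gt \<union> ((Gp - Gt) \<union> sh ` (Gm - Gt))" unfolding Gq_eq using Gt_iff by blast
  have disj: "sh ` (Gm - Gt) \<inter> Gp = {}" using sh_Gm_disjoint by blast
  have "(\<Prod>v\<in>Gq. ?T v powi v i) = (\<Prod>v\<in>Gt. ?T v powi v i) * (\<Prod>v\<in>(Gp - Gt) \<union> sh ` (Gm - Gt). ?T v powi v i)"
    unfolding Gq by (rule prod.union_disjoint) (use finG disj Gt_iff in auto)
  also have "(\<Prod>v\<in>(Gp - Gt) \<union> sh ` (Gm - Gt). ?T v powi v i) =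
      (\<Prod>v\<in>Gp - Gt. ?T v powi v i) * (\<Prod>v\<in>sh ` (Gm - Gt). ?T v powi v i)"
    by (rule prod.union_disjoint) (use finG disj in auto)
  also have "(\<Prod>v\<in>Gp - Gt. ?T v powi v i) = inverse (Bp X i)"
    unfolding Bp_def prod_inversef[unfolded comp_def, symmetric]
    by (rule prod.cong) (simp_all add: trans_simps power_int_inverse)
  also have "(\<Prod>v\<in>sh ` (Gm - Gt). ?T v powi v i) = (\<Prod>u\<in>Gm - Gt. ?T (sh u) powi sh u i)"
    by (rule prod.reindex[OF sh_inj, unfolded comp_def])
  also have "\<dots> = (\<Prod>u\<in>Gm - Gt. Y u powi sh u i)"
    by (rule prod.cong) (simp_all add: trans_simps)
  also have "\<dots> = Dm Y i * (if i < d then Dm Y d powi q i else 1)"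
    unfolding Dm_def by (rule prod_shear[OF _ i]) (use Y in \<open>auto simp: Um0_iff\<close>)
  also have "(\<Prod>v\<in>Gt. ?T v powi v i) = (\<Prod>v\<in>Gt. kap X Y v powi v i * inverse (\<eta> v powi v i))"
    by (rule prod.cong) (simp_all add: trans_simps divide_inverse power_int_mult_distrib power_int_inverse)
  also have "\<dots> = (\<Prod>v\<in>Gt. kap X Y v powi v i) * inverse (\<Prod>v\<in>Gt. \<eta> v powi v i)"
    by (simp add: prod.distrib prod_inversef[unfolded comp_def])
  finally have eq: "(\<Prod>v\<in>Gq. ?T v powi v i) = (\<Prod>v\<in>Gt. kap X Y v powi v i) * inverse (\<Prod>v\<in>Gt. \<eta> v powi v i) *
      (inverse (Bp X i) * (Dm Y i * (if i < d then Dm Y d powi q i else 1)))" .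
  show ?thesis
  proof (cases "i < d")
    case True
    then have "i \<in> {1..<d}" using i by simp
    then show ?thesis unfolding eq using prod_kap[OF X Y, of i] Bp_nonzero[OF X, of i] True by (simp add: field_simps)
  next
    case False
    then have id: "i = d" using i by simp
    have z: "v d = 0" if "v \<in> Gt" for v using that gens_tilde_iff by blast
    have "(\<Prod>v\<in>Gt. f v powi v d) = 1" for f :: "(nat \<Rightarrow> int) \<Rightarrow> complex"
      by (rule prod.neutral) (simp add: z)
    then show ?thesis using eq unfolding id by (simp add: zplus_eq wminus_eq)
  qed
qed

lemma trans_tor_iff:
  assumes X: "X \<in> Up0" and Y: "Y \<in> Um0" and \<eta>: "\<And>v. \<eta> v \<noteq> 0"
  shows "transition X Y \<eta> \<in> tor d Gq \<longleftrightarrow> zplus X = 1 / wminus Y \<and> \<eta> \<in> tor (d - 1) Gt"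
proof -
  have ins: "{1..d} = insert d {1..d - 1}" using d2 by auto
  have T0: "transition X Y \<eta> v \<noteq> 0" for v by (rule trans_nonzero[OF X Y \<eta>])
  have w0: "wminus Y \<noteq> 0" by (rule wminus_nonzero[OF Y])
  have zw: "inverse (zplus X * wminus Y) = 1 \<longleftrightarrow> zplus X = 1 / wminus Y"
    using w0 by (auto simp: field_simps)
  have "transition X Y \<eta> \<in> tor d Gq \<longleftrightarrow> (\<forall>i\<in>{1..d}. (\<Prod>v\<in>Gq. transition X Y \<eta> v powi v i) = 1)"
    using T0 by (simp add: tor_def)
  also have "\<dots> \<longleftrightarrow> (\<forall>i\<in>{1..d}. (if i < d then inverse (\<Prod>v\<in>Gt. \<eta> v powi v i) else inverse (zplus X * wminus Y)) = 1)"
    using prod_trans[OF X Y \<eta>] by simp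
  also have "\<dots> \<longleftrightarrow> (\<forall>i\<in>insert d {1..d - 1}. (if i < d then inverse (\<Prod>v\<in>Gt. \<eta> v powi v i) else inverse (zplus X * wminus Y)) = 1)"
    by (simp only: ins)
  also have "\<dots> \<longleftrightarrow> zplus X = 1 / wminus Y \<and> (\<forall>i\<in>{1..d - 1}. inverse (\<Prod>v\<in>Gt. \<eta> v powi v i) = 1)"
  proof -
    have lt: "(i < d) = True" if "i \<in> {1..d - 1}" for i using that d2 by auto
    show ?thesis
      by (simp only: ball_simps less_irrefl if_False zw lt if_True cong: ball_cong)
  qed
  also have "\<dots> \<longleftrightarrow> zplus X = 1 / wminus Y \<and> \<eta> \<in> tor (d - 1) Gt"
    using \<eta> by (simp add: tor_def)
  finally show ?thesis .
qed

text \<open>Coincidence of two embedded points is turned into the prescribed patching. Membership of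
  the torus element in \<open>tor d Gq\<close> accounts for z = 1/w and for \<eta> being in the
  torus of V-tilde, and the equality of coordinates accounts for the formula of the
  patching.\<close>

lemma emb_transition:
  assumes X: "X \<in> Up0" and Y: "Y \<in> Um0"
  shows "(\<exists>g\<in>tor d Gq. M.emb Y = (\<lambda>v. g v * P.emb X v)) \<longleftrightarrow>
    zplus X = 1 / wminus Y \<and> (\<exists>\<eta>\<in>tor (d - 1) Gt. xplus X = (\<lambda>v. \<eta> v * patch (xminus Y) (wminus Y) v))"
proof -
  have XU: "X \<in> U_fan \<Sigma>p" and YU: "Y \<in> U_fan \<Sigma>m" using X Y by (simp_all add: Up0_iff Um0_iff)
  have X0: "X v \<noteq> 0" if "v \<in> Gp - Gt" for v using X that by (simp add: Up0_iff)
  have Pe: "P.emb X v = Ap X v" if "v \<in> Gp" for v using P.emb_s[OF that] .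
  have Pe1: "P.emb X v = 1" if "v \<in> sh ` (Gm - Gt)" for v
  proof -
    have "v \<notin> Gp" "v \<in> Gq" using that sh_Gm_disjoint Gq_eq by blast+
    then show ?thesis by (simp add: P.emb_def)
  qed
  have Me: "M.emb Y (sh u) = Am Y u" if "u \<in> Gm" for u using M.emb_s[OF that] .
  have Met: "M.emb Y v = Am Y v" if "v \<in> Gt" for v using Me[of v] that sh_Gt(1)[OF that] Gt_iff by simp
  have Me1: "M.emb Y v = 1" if "v \<in> Gp - Gt" for v
  proof -
    have "v \<in> Gq - sh ` Gm" using that unfolding Gq_minus_shGm .
    then show ?thesis by (simp add: M.emb_def)
  qed
  have Ap0: "Ap X v = X v" if "v \<in> Gp - Gt" for v
    using that std1_Gt a1_Gt by (intro Ap_other) auto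
  have Am0: "Am Y v = Y v" if "v \<in> Gm - Gt" for v
    using that a1_Gt by (intro Am_other) auto
  have Gq: "v \<in> Gt \<or> v \<in> Gp - Gt \<or> v \<in> sh ` (Gm - Gt)" if "v \<in> Gq" for v using that unfolding Gq_eq by blast
  have rel: "M.emb Y = (\<lambda>v. transition X Y \<eta> v * P.emb X v) \<longleftrightarrow> (\<forall>v\<in>Gt. Am Y v = kap X Y v / \<eta> v * Ap X v)" for \<eta>
  proof
    assume eq: "M.emb Y = (\<lambda>v. transition X Y \<eta> v * P.emb X v)"
    show "\<forall>v\<in>Gt. Am Y v = kap X Y v / \<eta> v * Ap X v"
    proof
      fix v assume v: "v \<in> Gt"
      show "Am Y v = kap X Y v / \<eta> v * Ap X v"
        using fun_cong[OF eq, of v] Met[OF v] Pe[of v] v Gt_iff trans_simps(3)[OF v] by simp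
    qed
  next
    assume L: "\<forall>v\<in>Gt. Am Y v = kap X Y v / \<eta> v * Ap X v"
    show "M.emb Y = (\<lambda>v. transition X Y \<eta> v * P.emb X v)"
    proof
      fix v
      show "M.emb Y v = transition X Y \<eta> v * P.emb X v"
      proof (cases "v \<in> Gq")
        case False
        then show ?thesis using M.emb_tuples[OF YU] P.emb_tuples[OF XU] by (simp add: tuples_def)
      next
        case True
        then consider "v \<in> Gt" | "v \<in> Gp - Gt" | "v \<in> sh ` (Gm - Gt)" using Gq by blast
        then show ?thesis
        proof cases
          case 1
          then show ?thesis using L Met[OF 1] Pe[of v] Gt_iff trans_simps(3)[OF 1] by simp
        next
          case 2
          then show ?thesis using Me1[OF 2] Pe[of v] Ap0[OF 2] trans_simps(1)[OF 2] X0[OF 2] by simp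
        next
          case 3
          then obtain u where u: "u \<in> Gm - Gt" "v = sh u" by blast
          then show ?thesis using Pe1[OF 3] Me[of u] Am0[OF u(1)] trans_simps(2)[OF u(1)] by simp
        qed
      qed
    qed
  qed
  have xp: "xplus X = (\<lambda>v. \<eta> v * patch (xminus Y) (wminus Y) v) \<longleftrightarrow>
      (\<forall>v\<in>Gt. xplus X v = \<eta> v * patch (xminus Y) (wminus Y) v)" for \<eta>
    using xplus_tuples[of X] patch_tuples[OF xminus_tuples[of Y], of "wminus Y"]
    by (auto simp: fun_eq_iff[of "xplus X"] tuples_def)
  show ?thesis
  proof
    assume "\<exists>g\<in>tor d Gq. M.emb Y = (\<lambda>v. g v * P.emb X v)"
    then obtain g where g: "g \<in> tor d Gq" "M.emb Y = (\<lambda>v. g v * P.emb X v)" by blast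
    have g0: "g v \<noteq> 0" for v by (rule tor_nonzero[OF g(1)])
    \<comment> \<open>Solved from \<open>g v = kap X Y v / \<eta> v\<close> on \<open>Gt\<close>;
      the value 1 elsewhere keeps \<eta> nowhere zero.\<close>
    define \<eta> where "\<eta> = (\<lambda>v. if v \<in> Gt then kap X Y v / g v else 1)"
    have \<eta>0: "\<eta> v \<noteq> 0" for v using kap_nonzero[OF X Y] g0 by (simp add: \<eta>_def)
    have gT: "g v = transition X Y \<eta> v" if "v \<in> Gq" for v
    proof -
      consider "v \<in> Gt" | "v \<in> Gp - Gt" | "v \<in> sh ` (Gm - Gt)" using \<open>v \<in> Gq\<close> Gq by blast
      then show ?thesis
      proof cases
        case 1
        then show ?thesis using trans_simps(3)[OF 1] kap_nonzero[OF X Y 1] by (simp add: \<eta>_def)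
      next
        case 2
        then show ?thesis using fun_cong[OF g(2), of v] Me1[OF 2] Pe[of v] Ap0[OF 2] trans_simps(1)[OF 2] X0[OF 2]
          by (simp add: field_simps)
      next
        case 3
        then obtain u where u: "u \<in> Gm - Gt" "v = sh u" by blast
        then show ?thesis using fun_cong[OF g(2), of v] Pe1[OF 3] Me[of u] Am0[OF u(1)] trans_simps(2)[OF u(1)] by simp
      qed
    qed
    have "(\<Prod>v\<in>Gq. transition X Y \<eta> v powi v i) = (\<Prod>v\<in>Gq. g v powi v i)" for i
      by (rule prod.cong) (simp_all add: gT)
    then have T: "transition X Y \<eta> \<in> tor d Gq" using g(1) trans_nonzero[OF X Y \<eta>0] by (simp add: tor_def)
    have both: "zplus X = 1 / wminus Y \<and> \<eta> \<in> tor (d - 1) Gt"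
      by (rule iffD1[OF trans_tor_iff[where \<eta> = \<eta>, OF X Y \<eta>0] T])
    have zw: "zplus X = 1 / wminus Y" by (rule conjunct1[OF both])
    have \<eta>: "\<eta> \<in> tor (d - 1) Gt" by (rule conjunct2[OF both])
    have "M.emb Y = (\<lambda>v. transition X Y \<eta> v * P.emb X v)"
    proof
      fix v
      show "M.emb Y v = transition X Y \<eta> v * P.emb X v"
        using fun_cong[OF g(2), of v] gT[of v] P.emb_tuples[OF XU] by (cases "v \<in> Gq") (simp_all add: tuples_def)
    qed
    then have "xplus X = (\<lambda>v. \<eta> v * patch (xminus Y) (wminus Y) v)"
      unfolding rel xp chart_change_iff[OF X Y zw \<eta>] .
    then show "zplus X = 1 / wminus Y \<and> (\<exists>\<eta>\<in>tor (d - 1) Gt. xplus X = (\<lambda>v. \<eta> v * patch (xminus Y) (wminus Y) v))"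
      using zw \<eta> by blast
  next
    assume R: "zplus X = 1 / wminus Y \<and> (\<exists>\<eta>\<in>tor (d - 1) Gt. xplus X = (\<lambda>v. \<eta> v * patch (xminus Y) (wminus Y) v))"
    then obtain \<eta> where zw: "zplus X = 1 / wminus Y" and \<eta>: "\<eta> \<in> tor (d - 1) Gt"
      and eq: "xplus X = (\<lambda>v. \<eta> v * patch (xminus Y) (wminus Y) v)" by blast
    have "transition X Y \<eta> \<in> tor d Gq"
      by (rule iffD2[OF trans_tor_iff[where \<eta> = \<eta>, OF X Y tor_nonzero[OF \<eta>]] conjI[OF zw \<eta>]])
    moreover have "M.emb Y = (\<lambda>v. transition X Y \<eta> v * P.emb X v)"
      using eq unfolding rel xp chart_change_iff[OF X Y zw \<eta>] .
    ultimately show "\<exists>g\<in>tor d Gq. M.emb Y = (\<lambda>v. g v * P.emb X v)" by blast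
  qed
qed

end

section \<open>Comparison with the prescribed patching\<close>

context gluing
begin

lemma ident_plus_eq:
  "ident_plus d \<Sigma>t \<Sigma>p r m a b = {(orbit d \<Sigma>p X, (orbit (d - 1) \<Sigma>t (xplus X), zplus X)) | X. X \<in> Up0}"
proof (intro equalityI subsetI)
  fix p assume "p \<in> ident_plus d \<Sigma>t \<Sigma>p r m a b"
  then obtain X x z where p: "p = (orbit d \<Sigma>p X, (orbit (d - 1) \<Sigma>t x, z))" "X \<in> Up0" "x \<in> U_fan \<Sigma>t"
    and x: "\<forall>i \<in> {1..<d}. x (std i) = X (std i) * (\<Prod>j=2..m. X (b j) powi b j i)" "\<forall>j \<in> {1..r}. x (a j) = X (a j)"
    and z: "z = X (b 1) * (\<Prod>j=2..m. X (b j) powi b j d)"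
    unfolding ident_plus_def Up0_def by blast
  have xt: "x \<in> tuples Gt" using p(3) U_fan_tuples by blast
  have "x = xplus X"
  proof
    fix v
    show "x v = xplus X v"
    proof (cases "v \<in> Gt")
      case True
      then show ?thesis
      proof (rule Gt_cases)
        fix i assume "i \<in> {1..<d}" "v = std i"
        then show ?thesis using x(1) std_in(1)[of i] by (simp add: xplus_def pairing_std')
      next
        fix j assume "j \<in> {1..r}" "v = a j"
        then show ?thesis using x(2) xplus_a by simp
      qed
    next
      case False
      then show ?thesis using xt xplus_tuples[of X] by (simp add: tuples_def)
    qed
  qed
  then show "p \<in> {(orbit d \<Sigma>p X, (orbit (d - 1) \<Sigma>t (xplus X), zplus X)) | X. X \<in> Up0}"
    using p z by (auto simp: zplus_def)
next
  fix p assume "p \<in> {(orbit d \<Sigma>p X, (orbit (d - 1) \<Sigma>t (xplus X), zplus X)) | X. X \<in> Up0}"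
  then obtain X where p: "p = (orbit d \<Sigma>p X, (orbit (d - 1) \<Sigma>t (xplus X), zplus X))" "X \<in> Up0" by blast
  have "\<forall>i \<in> {1..<d}. xplus X (std i) = X (std i) * (\<Prod>j=2..m. X (b j) powi b j i)"
    using std_in(1) by (simp add: xplus_def pairing_std')
  then show "p \<in> ident_plus d \<Sigma>t \<Sigma>p r m a b"
    unfolding ident_plus_def p(1) zplus_def using p(2) xplus_U[OF p(2)] xplus_a unfolding Up0_def by blast
qed

lemma ident_minus_eq:
  "ident_minus d \<Sigma>t \<Sigma>m r n a c = {(orbit d \<Sigma>m X, (orbit (d - 1) \<Sigma>t (xminus X), wminus X)) | X. X \<in> Um0}"
proof (intro equalityI subsetI)
  fix p assume "p \<in> ident_minus d \<Sigma>t \<Sigma>m r n a c"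
  then obtain X x w where p: "p = (orbit d \<Sigma>m X, (orbit (d - 1) \<Sigma>t x, w))" "X \<in> Um0" "x \<in> U_fan \<Sigma>t"
    and x: "\<forall>i \<in> {1..<d}. x (std i) = X (std i) * (\<Prod>j=2..n. X (c j) powi (c j i + c 1 i * c j d))"
      "\<forall>j \<in> {1..r}. x (a j) = X (a j)"
    and w: "w = X (c 1) * (\<Prod>j=2..n. X (c j) powi (- c j d))"
    unfolding ident_minus_def Um0_def by blast
  have xt: "x \<in> tuples Gt" using p(3) U_fan_tuples by blast
  have "x = xminus X"
  proof
    fix v
    show "x v = xminus X v"
    proof (cases "v \<in> Gt")
      case True
      then show ?thesis
      proof (rule Gt_cases)
        fix i assume "i \<in> {1..<d}" "v = std i"
        then show ?thesis using x(1) std_in(1)[of i] by (simp add: xminus_def pairing_std')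
      next
        fix j assume "j \<in> {1..r}" "v = a j"
        then show ?thesis using x(2) a_not_std a_in by (simp add: xminus_def)
      qed
    next
      case False
      then show ?thesis using xt xminus_tuples[of X] by (simp add: tuples_def)
    qed
  qed
  then show "p \<in> {(orbit d \<Sigma>m X, (orbit (d - 1) \<Sigma>t (xminus X), wminus X)) | X. X \<in> Um0}"
    using p w by (auto simp: wminus_def)
next
  fix p assume "p \<in> {(orbit d \<Sigma>m X, (orbit (d - 1) \<Sigma>t (xminus X), wminus X)) | X. X \<in> Um0}"
  then obtain X where p: "p = (orbit d \<Sigma>m X, (orbit (d - 1) \<Sigma>t (xminus X), wminus X))" "X \<in> Um0" by blast
  have "\<forall>i \<in> {1..<d}. xminus X (std i) = X (std i) * (\<Prod>j=2..n. X (c j) powi (c j i + c 1 i * c j d))"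
    using std_in(1) by (simp add: xminus_def pairing_std')
  moreover have "\<forall>j \<in> {1..r}. xminus X (a j) = X (a j)"
    using a_not_std a_in by (simp add: xminus_def)
  ultimately show "p \<in> ident_minus d \<Sigma>t \<Sigma>m r n a c"
    unfolding ident_minus_def p(1) wminus_def using p(2) xminus_U[OF p(2)] unfolding Um0_def by blast
qed

lemma patching_eq:
  "patching d \<Sigma>t r a c k t = {((orbit (d - 1) \<Sigma>t x, w), (orbit (d - 1) \<Sigma>t (patch x w), 1 / w)) | x w.
     x \<in> U_fan \<Sigma>t \<and> w \<noteq> 0 \<and> patch x w \<in> U_fan \<Sigma>t}"
proof (intro equalityI subsetI)
  fix p assume "p \<in> patching d \<Sigma>t r a c k t"
  then obtain x w x' z where p: "p = ((orbit (d - 1) \<Sigma>t x, w), (orbit (d - 1) \<Sigma>t x', z))"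
    "x \<in> U_fan \<Sigma>t" "w \<noteq> 0" "x' \<in> U_fan \<Sigma>t" "z = 1 / w"
    and x': "x' (std 1) = x (std 1) * w powi c 1 1 + t * x (a 1) * w ^ k"
      "\<forall>i \<in> {2..<d}. x' (std i) = x (std i) * w powi c 1 i" "\<forall>j \<in> {1..r}. x' (a j) = x (a j)"
    unfolding patching_def by blast
  have xt: "x \<in> tuples Gt" "x' \<in> tuples Gt" using p U_fan_tuples by blast+
  have "x' = patch x w"
  proof
    fix v
    show "x' v = patch x w v"
    proof (cases "v \<in> Gt")
      case True
      then show ?thesis
      proof (rule Gt_cases)
        fix i assume "i \<in> {1..<d}" "v = std i"
        then show ?thesis using x'(1,2) std_in(1)[of i]
          by (cases "i = 1") (simp_all add: patch_def pairing_std' std_eq_iff)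
      next
        fix j assume j: "j \<in> {1..r}" "v = a j"
        then have "a j \<noteq> std 1" using a_not_std[OF j(1)] std_in(1)[of 1] d2 by force
        then show ?thesis using j x'(3) a_not_std by (simp add: patch_def)
      qed
    next
      case False
      then show ?thesis using xt(2) patch_tuples[OF xt(1), of w] by (simp add: tuples_def)
    qed
  qed
  then show "p \<in> {((orbit (d - 1) \<Sigma>t x, w), (orbit (d - 1) \<Sigma>t (patch x w), 1 / w)) | x w.
     x \<in> U_fan \<Sigma>t \<and> w \<noteq> 0 \<and> patch x w \<in> U_fan \<Sigma>t}" using p by blast
next
  fix p assume "p \<in> {((orbit (d - 1) \<Sigma>t x, w), (orbit (d - 1) \<Sigma>t (patch x w), 1 / w)) | x w.
     x \<in> U_fan \<Sigma>t \<and> w \<noteq> 0 \<and> patch x w \<in> U_fan \<Sigma>t}"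
  then obtain x w where p: "p = ((orbit (d - 1) \<Sigma>t x, w), (orbit (d - 1) \<Sigma>t (patch x w), 1 / w))"
    "x \<in> U_fan \<Sigma>t" "w \<noteq> 0" "patch x w \<in> U_fan \<Sigma>t" by blast
  have "patch x w (std 1) = x (std 1) * w powi c 1 1 + t * x (a 1) * w ^ k" by (simp add: patch_def)
  moreover have "\<forall>i \<in> {2..<d}. patch x w (std i) = x (std i) * w powi c 1 i"
  proof
    fix i assume "i \<in> {2..<d}"
    then have i: "i \<in> {1..<d}" "i \<noteq> 1" by auto
    then show "patch x w (std i) = x (std i) * w powi c 1 i"
      using std_in(1)[OF i(1)] by (simp add: patch_def pairing_std' std_eq_iff)
  qed
  moreover have "\<forall>j \<in> {1..r}. patch x w (a j) = x (a j)"
  proof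
    fix j assume j: "j \<in> {1..r}"
    have "a j \<noteq> std 1" using a_not_std[OF j] std_in(1)[of 1] d2 by force
    then show "patch x w (a j) = x (a j)" using a_not_std[OF j] by (simp add: patch_def)
  qed
  ultimately show "p \<in> patching d \<Sigma>t r a c k t" unfolding patching_def p(1) using p(2-4) by blast
qed

text \<open>The sum in the first coordinate is homogeneous because \<open>std 1\<close> and
  \<open>a 1\<close> have the same degree on V-tilde. Hence the patching respects orbits.\<close>

lemma patch_equiv: "\<gamma> \<in> tor (d - 1) Gt \<Longrightarrow> patch (\<lambda>v. \<gamma> v * x v) w = (\<lambda>v. \<gamma> v * patch x w v)"
  using tor_Gt_1[of \<gamma>] by (auto simp: patch_def algebra_simps intro!: ext)

definition identified :: "(coords set \<times> coords set) set" where
  "identified = (ident_minus d \<Sigma>t \<Sigma>m r n a c O patching d \<Sigma>t r a c k t O (ident_plus d \<Sigma>t \<Sigma>p r m a b)\<inverse>)\<inverse>"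

text \<open>The composed relations match orbits on V-tilde twice, with possibly different
  representatives: \<gamma> relates those on the minus side, \<eta> those on the plus side. By
  \<open>patch_equiv\<close> both merge into one torus element.\<close>

lemma identifiedE:
  assumes "(p, p') \<in> identified"
  obtains X Y where "X \<in> Up0" "Y \<in> Um0" "p = orbit d \<Sigma>p X" "p' = orbit d \<Sigma>m Y" "zplus X = 1 / wminus Y"
    "\<exists>\<eta>\<in>tor (d - 1) Gt. xplus X = (\<lambda>v. \<eta> v * patch (xminus Y) (wminus Y) v)"
proof -
  from assms obtain \<xi> \<zeta> where 1: "(p', \<xi>) \<in> ident_minus d \<Sigma>t \<Sigma>m r n a c" "(\<xi>, \<zeta>) \<in> patching d \<Sigma>t r a c k t"
    "(p, \<zeta>) \<in> ident_plus d \<Sigma>t \<Sigma>p r m a b"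
    unfolding identified_def by blast
  obtain Y where Y: "Y \<in> Um0" "p' = orbit d \<Sigma>m Y" "\<xi> = (orbit (d - 1) \<Sigma>t (xminus Y), wminus Y)"
    using 1(1) unfolding ident_minus_eq by blast
  obtain X where X: "X \<in> Up0" "p = orbit d \<Sigma>p X" "\<zeta> = (orbit (d - 1) \<Sigma>t (xplus X), zplus X)"
    using 1(3) unfolding ident_plus_eq by blast
  obtain x w where x: "\<xi> = (orbit (d - 1) \<Sigma>t x, w)" "\<zeta> = (orbit (d - 1) \<Sigma>t (patch x w), 1 / w)" "x \<in> U_fan \<Sigma>t"
    using 1(2) unfolding patching_eq by blast
  have w: "w = wminus Y" "zplus X = 1 / wminus Y" using X(3) Y(3) x(1,2) by auto
  have xt: "x \<in> tuples Gt" using x(3) U_fan_tuples by blast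
  have "orbit (d - 1) \<Sigma>t (xminus Y) = orbit (d - 1) \<Sigma>t x" using Y(3) x(1) by simp
  then obtain \<gamma> where \<gamma>: "\<gamma> \<in> tor (d - 1) Gt" "x = (\<lambda>v. \<gamma> v * xminus Y v)"
    using orbit_eq_iff[OF finG(1) xminus_tuples xt] by blast
  have "orbit (d - 1) \<Sigma>t (patch x w) = orbit (d - 1) \<Sigma>t (xplus X)" using X(3) x(2) by simp
  then obtain \<eta> where \<eta>: "\<eta> \<in> tor (d - 1) Gt" "xplus X = (\<lambda>v. \<eta> v * patch x w v)"
    using orbit_eq_iff[OF finG(1) patch_tuples[OF xt] xplus_tuples] by blast
  have "xplus X = (\<lambda>v. (\<eta> v * \<gamma> v) * patch (xminus Y) (wminus Y) v)"
    unfolding \<eta>(2) \<gamma>(2) patch_equiv[OF \<gamma>(1)] w(1) by (simp add: mult.assoc)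
  then have "\<exists>\<eta>\<in>tor (d - 1) Gt. xplus X = (\<lambda>v. \<eta> v * patch (xminus Y) (wminus Y) v)"
    by (rule bexI[OF _ tor_mult[OF \<eta>(1) \<gamma>(1)]])
  then show thesis by (rule that[OF X(1) Y(1) X(2) Y(2) w(2)])
qed

lemma identifiedI:
  assumes X: "X \<in> Up0" and Y: "Y \<in> Um0" and z: "zplus X = 1 / wminus Y"
    and \<eta>: "\<eta> \<in> tor (d - 1) Gt" "xplus X = (\<lambda>v. \<eta> v * patch (xminus Y) (wminus Y) v)"
  shows "(orbit d \<Sigma>p X, orbit d \<Sigma>m Y) \<in> identified"
proof -
  let ?P = "patch (xminus Y) (wminus Y)"
  have \<eta>': "(\<lambda>v. inverse (\<eta> v)) \<in> tor (d - 1) Gt" by (rule tor_inverse[OF \<eta>(1)])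
  have P: "?P = (\<lambda>v. inverse (\<eta> v) * xplus X v)"
    unfolding \<eta>(2) using tor_nonzero[OF \<eta>(1)] by (simp add: fun_eq_iff)
  have "?P \<in> U_fan \<Sigma>t"
    unfolding P by (rule tor_mult_in_U_fan[OF finG(1) xplus_U[OF X]]) (rule tor_nonzero[OF \<eta>'])
  then have "((orbit (d - 1) \<Sigma>t (xminus Y), wminus Y), (orbit (d - 1) \<Sigma>t ?P, 1 / wminus Y)) \<in> patching d \<Sigma>t r a c k t"
    unfolding patching_eq using xminus_U[OF Y] wminus_nonzero[OF Y] by blast
  moreover have "orbit (d - 1) \<Sigma>t ?P = orbit (d - 1) \<Sigma>t (xplus X)"
    using orbit_eq_iff[OF finG(1) patch_tuples[OF xminus_tuples] xplus_tuples] \<eta> by blast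
  moreover have "(orbit d \<Sigma>p X, (orbit (d - 1) \<Sigma>t (xplus X), zplus X)) \<in> ident_plus d \<Sigma>t \<Sigma>p r m a b"
    unfolding ident_plus_eq using X by blast
  moreover have "(orbit d \<Sigma>m Y, (orbit (d - 1) \<Sigma>t (xminus Y), wminus Y)) \<in> ident_minus d \<Sigma>t \<Sigma>m r n a c"
    unfolding ident_minus_eq using Y by blast
  ultimately show ?thesis unfolding identified_def z[symmetric] by auto
qed

text \<open>If the images agree, \<open>X\<close> vanishes at no ray strictly above the hyperplane,
  since the other image has coordinate 1 there, and symmetrically for \<open>Y\<close>. So both
  points lie over the common open part and \<open>emb_transition\<close> applies.\<close>

lemma embq_eq_iff:
  assumes X: "X \<in> U_fan \<Sigma>p" and Y: "Y \<in> U_fan \<Sigma>m"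
  shows "P.embq (orbit d \<Sigma>p X) = M.embq (orbit d \<Sigma>m Y) \<longleftrightarrow> (orbit d \<Sigma>p X, orbit d \<Sigma>m Y) \<in> identified"
proof
  assume "P.embq (orbit d \<Sigma>p X) = M.embq (orbit d \<Sigma>m Y)"
  then have "orbit d \<Sigma>q (P.emb X) = orbit d \<Sigma>q (M.emb Y)"
    using P.embq_orbit[OF X] M.embq_orbit[OF Y] by simp
  then have ex: "\<exists>g\<in>tor d Gq. M.emb Y = (\<lambda>v. g v * P.emb X v)"
    using orbit_eq_iff[OF finG(4) P.emb_tuples[OF X] M.emb_tuples[OF Y]] by blast
  then obtain g where g: "g \<in> tor d Gq" "M.emb Y = (\<lambda>v. g v * P.emb X v)" by blast
  have "X v \<noteq> 0" if v: "v \<in> Gp - Gt" for v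
  proof
    assume "X v = 0"
    have "v \<in> Gq - sh ` Gm" using v unfolding Gq_minus_shGm .
    then have "M.emb Y v = 1" by (simp add: M.emb_def)
    moreover have "P.emb X v = 0"
      using v P.emb_s[of v X] Ap_other[of v X] std1_Gt a1_Gt \<open>X v = 0\<close> by auto
    ultimately show False using fun_cong[OF g(2), of v] by simp
  qed
  then have X0: "X \<in> Up0" unfolding Up0_iff using X by blast
  have "Y v \<noteq> 0" if v: "v \<in> Gm - Gt" for v
  proof
    assume "Y v = 0"
    have "sh v \<notin> Gp" "sh v \<in> Gq" using v sh_Gm_disjoint Gq_eq by blast+
    then have "P.emb X (sh v) = 1" by (simp add: P.emb_def)
    moreover have "M.emb Y (sh v) = 0"
      using v M.emb_s[of v Y] Am_other[of v Y] a1_Gt \<open>Y v = 0\<close> by auto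
    ultimately show False using fun_cong[OF g(2), of "sh v"] tor_nonzero[OF g(1)] by simp
  qed
  then have Y0: "Y \<in> Um0" unfolding Um0_iff using Y by blast
  show "(orbit d \<Sigma>p X, orbit d \<Sigma>m Y) \<in> identified"
    using ex unfolding emb_transition[OF X0 Y0] using identifiedI[OF X0 Y0] by blast
next
  assume "(orbit d \<Sigma>p X, orbit d \<Sigma>m Y) \<in> identified"
  then obtain X' Y' where *: "X' \<in> Up0" "Y' \<in> Um0" "orbit d \<Sigma>p X = orbit d \<Sigma>p X'" "orbit d \<Sigma>m Y = orbit d \<Sigma>m Y'"
    "zplus X' = 1 / wminus Y'" "\<exists>\<eta>\<in>tor (d - 1) Gt. xplus X' = (\<lambda>v. \<eta> v * patch (xminus Y') (wminus Y') v)"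
    by (rule identifiedE)
  have XU: "X' \<in> U_fan \<Sigma>p" and YU: "Y' \<in> U_fan \<Sigma>m" using *(1,2) by (simp_all add: Up0_iff Um0_iff)
  have "\<exists>g\<in>tor d Gq. M.emb Y' = (\<lambda>v. g v * P.emb X' v)"
    unfolding emb_transition[OF *(1,2)] using *(5,6) by blast
  then have "orbit d \<Sigma>q (P.emb X') = orbit d \<Sigma>q (M.emb Y')"
    using orbit_eq_iff[OF finG(4) P.emb_tuples[OF XU] M.emb_tuples[OF YU]] by blast
  then show "P.embq (orbit d \<Sigma>p X) = M.embq (orbit d \<Sigma>m Y)"
    unfolding *(3,4) P.embq_orbit[OF XU] M.embq_orbit[OF YU] .
qed

theorem deformed_variety_isomorphic:
  "isomorphic (deformed_variety d \<Sigma>t \<Sigma> r m n a b c k t) (toric d \<Sigma>q)"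
proof -
  have R: "identified \<subseteq> pts (toric d \<Sigma>p) \<times> pts (toric d \<Sigma>m)"
  proof
    fix e assume "e \<in> identified"
    then obtain p p' where e: "e = (p, p')" "(p, p') \<in> identified" by (cases e) auto
    from e(2) show "e \<in> pts (toric d \<Sigma>p) \<times> pts (toric d \<Sigma>m)"
      by (rule identifiedE) (auto simp: e(1) pts_toric Up0_iff Um0_iff)
  qed
  have "isomorphic (glue (toric d \<Sigma>p) (toric d \<Sigma>m) identified) (quotient_space (quasi_affine Gq (U_fan \<Sigma>q)) (orbit d \<Sigma>q))"
  proof (rule isomorphic_glue_quotient[OF U_fan_tuples open_Up open_Um Uq_eq])
    show "morphism (toric d \<Sigma>p) (quotient_space (quasi_affine Gq (U_fan \<Sigma>q)) (orbit d \<Sigma>q)) P.embq"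
      using P.embq_morphism unfolding toric_def[of d \<Sigma>q] .
    show "morphism (toric d \<Sigma>m) (quotient_space (quasi_affine Gq (U_fan \<Sigma>q)) (orbit d \<Sigma>q)) M.embq"
      using M.embq_morphism unfolding toric_def[of d \<Sigma>q] .
    show "P.embq x = M.embq y \<longleftrightarrow> (x, y) \<in> identified" if "x \<in> pts (toric d \<Sigma>p)" "y \<in> pts (toric d \<Sigma>m)" for x y
      using that unfolding pts_toric using embq_eq_iff by blast
    show "P.embq ((orbit d \<Sigma>p \<circ> P.ret) u) = orbit d \<Sigma>q u" if "u \<in> Up" for u using P.embq_ret[OF that] by simp
    show "M.embq ((orbit d \<Sigma>m \<circ> M.ret) u) = orbit d \<Sigma>q u" if "u \<in> Um" for u using M.embq_ret[OF that] by simp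
  qed (rule P.embq_inj M.embq_inj R P.ret_morphism M.ret_morphism)+
  then show ?thesis
    unfolding deformed_variety_def identified_def toric_def[of d \<Sigma>q] .
qed

end

section \<open>Regular functions and homogeneous polynomials\<close>

text \<open>Among the fractions representing \<open>h\<close> wherever their denominator is nonzero,
  take one whose denominator has least degree. If it is not constant it has a root
  \<open>s0\<close>; comparison with a local fraction at \<open>s0\<close> shows that the numerator
  vanishes there as well, and cancelling the common factor contradicts minimality.\<close>

lemma locally_rational_is_polynomial:
  fixes h :: "complex \<Rightarrow> complex"
  assumes loc: "\<And>s0. \<exists>p q. poly q s0 \<noteq> 0 \<and> (\<forall>s. poly q s \<noteq> 0 \<longrightarrow> h s = poly p s / poly q s)"
  shows "\<exists>P. \<forall>s. h s = poly P s"
proof -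
  define R where "R = (\<lambda>n. \<exists>p q. q \<noteq> 0 \<and> degree q = n \<and> (\<forall>s. poly q s \<noteq> 0 \<longrightarrow> h s = poly p s / poly q s))"
  obtain pz qz where z: "poly qz 0 \<noteq> 0" "\<forall>s. poly qz s \<noteq> 0 \<longrightarrow> h s = poly pz s / poly qz s"
    using loc[of 0] by blast
  have "qz \<noteq> 0" using z(1) by auto
  with z(2) have "R (degree qz)" unfolding R_def by blast
  then have ex: "\<exists>n. R n" by blast
  define n where "n = (LEAST n. R n)"
  have "R n" unfolding n_def using ex by (rule LeastI_ex)
  then obtain p q where pq: "q \<noteq> 0" "degree q = n" "\<And>s. poly q s \<noteq> 0 \<Longrightarrow> h s = poly p s / poly q s"
    unfolding R_def by blast
  show ?thesis
  proof (cases "n = 0")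
    case True
    then obtain c where c: "q = [:c:]" using pq(2) degree_eq_zeroE by blast
    then have "c \<noteq> 0" using pq(1) by simp
    then have "h s = poly (smult (inverse c) p) s" for s
      using pq(3)[of s] by (simp add: c field_simps)
    then show ?thesis by blast
  next
    case False
    then have "\<not> constant (poly q)" using constant_degree pq(2) by metis
    then obtain s0 where s0: "poly q s0 = 0" using fundamental_theorem_of_algebra by blast
    obtain p' q' where l: "poly q' s0 \<noteq> 0" "\<And>s. poly q' s \<noteq> 0 \<Longrightarrow> h s = poly p' s / poly q' s"
      using loc[of s0] by blast
    have q'0: "q' \<noteq> 0" using l(1) by auto
    have "q * q' * (p * q' - p' * q) = 0"
    proof -
      have "poly (q * q' * (p * q' - p' * q)) s = 0" for s
      proof (cases "poly q s = 0 \<or> poly q' s = 0")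
        case False
        then have "poly p s / poly q s = poly p' s / poly q' s" using pq(3) l(2) by metis
        then show ?thesis using False by (simp add: field_simps)
      qed auto
      then show ?thesis using poly_all_0_iff_0 by blast
    qed
    then have eq: "p * q' = p' * q" using pq(1) q'0 by simp
    then have "poly p s0 * poly q' s0 = 0" using s0 by (metis poly_mult mult_zero_right)
    then have "poly p s0 = 0" using l(1) by simp
    then obtain p1 q1 where f: "p = [:- s0, 1:] * p1" "q = [:- s0, 1:] * q1"
      using s0 unfolding poly_eq_0_iff_dvd dvd_def by blast
    have q1: "q1 \<noteq> 0" using f(2) pq(1) by auto
    have "[:- s0, 1:] * (p1 * q') = [:- s0, 1:] * (p' * q1)" using eq unfolding f by (simp only: mult_ac)
    then have eq1: "p1 * q' = p' * q1" using mult_cancel_left[of "[:- s0, 1:]"] by (simp del: mult_pCons_left)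
    have "degree q = Suc (degree q1)" unfolding f(2) using q1 by (subst degree_mult_eq) auto
    then have less: "degree q1 < n" using pq(2) by simp
    \<comment> \<open>Away from \<open>s0\<close> the cancelled factor is nonzero. At
      \<open>s0\<close> itself the old fraction says nothing, and the value comes from the local one
      through \<open>eq1\<close>.\<close>
    have "h s = poly p1 s / poly q1 s" if s: "poly q1 s \<noteq> 0" for s
    proof (cases "s = s0")
      case True
      have "poly p1 s0 * poly q' s0 = poly p' s0 * poly q1 s0" using eq1 by (metis poly_mult)
      then have "poly p1 s0 / poly q1 s0 = poly p' s0 / poly q' s0"
        using l(1) s unfolding True by (simp add: frac_eq_eq)
      then show ?thesis using l unfolding True by simp
    next
      case False
      have "poly p s = (s - s0) * poly p1 s" "poly q s = (s - s0) * poly q1 s"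
        by (simp_all add: f algebra_simps)
      then show ?thesis using pq(3)[of s] s False by simp
    qed
    then have "R (degree q1)" unfolding R_def using q1 by blast
    then show ?thesis using less not_less_Least unfolding n_def by blast
  qed
qed

lemma nonvanishing_poly_constant:
  fixes P :: "complex poly"
  assumes "\<And>s. poly P s \<noteq> 0"
  shows "poly P s = poly P s'"
  using assms fundamental_theorem_of_algebra[of P] unfolding constant_def by blast

lemma no_nonzero_root_monom:
  fixes p :: "complex poly"
  assumes "\<And>s. s \<noteq> 0 \<Longrightarrow> poly p s \<noteq> 0"
  shows "\<exists>c n. p = monom c n"
proof -
  have p0: "p \<noteq> 0" using assms[of 1] by auto
  obtain r where r: "p = [:- 0, 1:] ^ order 0 p * r" "\<not> [:- 0, 1:] dvd r" using order_decomp[OF p0, of 0] by blast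
  have "poly r s \<noteq> 0" for s
  proof (cases "s = 0")
    case True
    then show ?thesis using r(2) poly_eq_0_iff_dvd[of r 0] by simp
  next
    case False
    have "poly p s = poly ([:- 0, 1:] ^ order 0 p) s * poly r s" by (subst r(1)) (rule poly_mult)
    then show ?thesis using assms[OF False] by auto
  qed
  then have "constant (poly r)" using fundamental_theorem_of_algebra by blast
  then obtain c where c: "r = [:c:]" using constant_degree[of r] degree_eq_zeroE by blast
  have "p = monom c (order 0 p)"
    by (subst r(1)) (simp add: c monom_altdef mult.commute)
  then show ?thesis by blast
qed

text \<open>\<open>P x\<close> is \<open>p\<close> evaluated along the line through the origin and
  \<open>x\<close>, as a polynomial in the scaling factor; its coefficients are the homogeneous
  components of \<open>p\<close>.\<close>

lemma poly_fun_homogeneous_components: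
  assumes "p \<in> poly_fun I"
  obtains P where "\<And>i. (\<lambda>x. coeff (P x) i) \<in> poly_fun I" "\<And>x l. p (\<lambda>i. l * x i) = poly (P x) l"
    "\<And>x l i. coeff (P (\<lambda>j. l * x j)) i = l ^ i * coeff (P x) i"
proof -
  have "\<exists>P. (\<forall>i. (\<lambda>x. coeff (P x) i) \<in> poly_fun I) \<and> (\<forall>x l. p (\<lambda>i. l * x i) = poly (P x) l)"
    using assms
  proof induction
    case (const c)
    have "(\<lambda>x. coeff [:c:] i) \<in> poly_fun I" for i by (rule poly_fun.const)
    then show ?case by (intro exI[of _ "\<lambda>_. [:c:]"]) simp
  next
    case (coord i)
    have "(\<lambda>x. coeff (monom (x i) 1) j) \<in> poly_fun I" for j
      using coord by (cases "j = 1") (auto intro: poly_fun.intros)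
    then show ?case by (intro exI[of _ "\<lambda>x. monom (x i) 1"]) (auto simp: poly_monom mult.commute)
  next
    case (add p q)
    then obtain P Q where PQ: "\<And>i. (\<lambda>x. coeff (P x) i) \<in> poly_fun I" "\<And>x l. p (\<lambda>i. l * x i) = poly (P x) l"
      "\<And>i. (\<lambda>x. coeff (Q x) i) \<in> poly_fun I" "\<And>x l. q (\<lambda>i. l * x i) = poly (Q x) l"
      by blast
    have "(\<lambda>x. coeff (P x + Q x) i) \<in> poly_fun I" for i
      using poly_fun.add[OF PQ(1,3)] by simp
    then show ?case using PQ(2,4) by (intro exI[of _ "\<lambda>x. P x + Q x"]) simp
  next
    case (mult p q)
    then obtain P Q where PQ: "\<And>i. (\<lambda>x. coeff (P x) i) \<in> poly_fun I" "\<And>x l. p (\<lambda>i. l * x i) = poly (P x) l"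
      "\<And>i. (\<lambda>x. coeff (Q x) i) \<in> poly_fun I" "\<And>x l. q (\<lambda>i. l * x i) = poly (Q x) l"
      by blast
    have "(\<lambda>x. coeff (P x * Q x) i) \<in> poly_fun I" for i
      unfolding coeff_mult by (intro poly_fun_sum poly_fun.mult PQ(1,3))
    then show ?case using PQ(2,4) by (intro exI[of _ "\<lambda>x. P x * Q x"]) simp
  qed
  then obtain P where P: "\<And>i. (\<lambda>x. coeff (P x) i) \<in> poly_fun I" "\<And>x l. p (\<lambda>i. l * x i) = poly (P x) l"
    by blast
  have "coeff (P (\<lambda>j. l * x j)) i = l ^ i * coeff (P x) i" for x l i
  proof -
    have "poly (P (\<lambda>j. l * x j)) s = poly (pcompose (P x) [:0, l:]) s" for s
    proof -
      have "poly (P (\<lambda>j. l * x j)) s = p (\<lambda>i. s * (l * x i))" by (rule P(2)[symmetric])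
      also have "(\<lambda>i. s * (l * x i)) = (\<lambda>i. (s * l) * x i)" by (simp add: mult.assoc)
      also have "p \<dots> = poly (P x) (s * l)" by (rule P(2))
      finally show ?thesis by (simp add: poly_pcompose mult.commute)
    qed
    then have "P (\<lambda>j. l * x j) = pcompose (P x) [:0, l:]" by (simp add: poly_eq_poly_eq_iff[symmetric] fun_eq_iff)
    then show ?thesis by (simp add: coeff_pcompose_linear)
  qed
  then show thesis using that P by blast
qed

lemma poly_fun_restrict:
  assumes "p \<in> poly_fun I"
  shows "p x = p (\<lambda>i. if i \<in> I then x i else 0)" "(\<lambda>i. if i \<in> I then x i else 0) \<in> tuples I"
  by (rule poly_fun_cong[OF assms]) (simp_all add: tuples_def)

lemma poly_fun_nonzero_on_tuples:
  assumes "p \<in> poly_fun I" "p x \<noteq> 0"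
  shows "\<exists>x\<in>tuples I. p x \<noteq> 0"
  using assms poly_fun_restrict[OF assms(1), of x] by metis

text \<open>Density of the nonvanishing locus of \<open>h\<close>: otherwise some point would avoid
  the zeros of both \<open>h\<close> and the difference.\<close>

lemma poly_fun_eqI:
  assumes p: "p \<in> poly_fun I" and q: "q \<in> poly_fun I" and h: "h \<in> poly_fun I" "h x0 \<noteq> 0"
    and eq: "\<And>x. x \<in> tuples I \<Longrightarrow> h x \<noteq> 0 \<Longrightarrow> p x = q x"
  shows "p x = q x"
proof (rule ccontr)
  assume ne: "p x \<noteq> q x"
  have "\<exists>x\<in>tuples I. \<forall>f\<in>{h, \<lambda>x. p x - q x}. f x \<noteq> 0"
  proof (rule poly_fun_common_nonzero)
    fix f assume "f \<in> {h, \<lambda>x. p x - q x}"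
    then show f: "f \<in> poly_fun I" using poly_fun_diff[OF p q] h(1) by blast
    have "f x0 \<noteq> 0 \<or> f x \<noteq> 0" using \<open>f \<in> {h, \<lambda>x. p x - q x}\<close> h(2) ne by auto
    then show "\<exists>x\<in>tuples I. f x \<noteq> 0" using poly_fun_nonzero_on_tuples[OF f] by blast
  qed simp
  then show False using eq by auto
qed

lemma poly_fun_upd_zero:
  assumes "p \<in> poly_fun I"
  shows "(\<lambda>x. p (x(v := 0))) \<in> poly_fun I"
proof (rule poly_fun_compose[OF assms])
  fix i assume "i \<in> I"
  then show "(\<lambda>x. (x(v := 0)) i) \<in> poly_fun I"
    by (cases "i = v") (simp_all add: poly_fun.const poly_fun.coord)
qed

lemma poly_fun_split_coord:
  assumes "p \<in> poly_fun I"
  shows "\<exists>p'\<in>poly_fun I. \<forall>x. p x = p (x(v := 0)) + x v * p' x"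
  using assms
proof induction
  case (const c)
  show ?case by (rule bexI[OF _ poly_fun.const[of 0]]) simp
next
  case (coord i)
  show ?case
  proof (cases "i = v")
    case True
    then show ?thesis by (intro bexI[OF _ poly_fun.const[of 1]]) simp
  next
    case False
    then show ?thesis by (intro bexI[OF _ poly_fun.const[of 0]]) simp
  qed
next
  case (add p q)
  then obtain p' q' where pq: "p' \<in> poly_fun I" "q' \<in> poly_fun I" "\<And>x. p x = p (x(v := 0)) + x v * p' x"
    "\<And>x. q x = q (x(v := 0)) + x v * q' x" by blast
  have "p x + q x = p (x(v := 0)) + q (x(v := 0)) + x v * (p' x + q' x)" for x
    using pq(3,4)[of x] by (simp add: algebra_simps)
  then show ?case by (rule bexI[OF allI poly_fun.add[OF pq(1,2)]])
next
  case (mult p q)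
  then obtain p' q' where pq: "p' \<in> poly_fun I" "q' \<in> poly_fun I" "\<And>x. p x = p (x(v := 0)) + x v * p' x"
    "\<And>x. q x = q (x(v := 0)) + x v * q' x" by blast
  have p0: "(\<lambda>x. p (x(v := 0))) \<in> poly_fun I"
    by (rule poly_fun_upd_zero[OF mult(1)])
  have "p x * q x = p (x(v := 0)) * q (x(v := 0)) + x v * (p' x * q x + p (x(v := 0)) * q' x)" for x
  proof -
    have "p x * q x = (p (x(v := 0)) + x v * p' x) * q x" by (simp only: pq(3)[of x, symmetric])
    also have "\<dots> = p (x(v := 0)) * q x + x v * (p' x * q x)" by (simp add: algebra_simps)
    also have "p (x(v := 0)) * q x = p (x(v := 0)) * (q (x(v := 0)) + x v * q' x)"
      by (simp only: pq(4)[of x, symmetric])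
    finally show ?thesis by (simp add: algebra_simps)
  qed
  then have "\<forall>x. p x * q x = p (x(v := 0)) * q (x(v := 0)) + x v * (p' x * q x + p (x(v := 0)) * q' x)"
    by (rule allI)
  then show ?case
    by (rule bexI[where x = "\<lambda>x. p' x * q x + p (x(v := 0)) * q' x"])
      (intro poly_fun.intros pq(1,2) mult(2) p0)
qed

text \<open>Since \<open>h\<close> is not identically zero on the hyperplane where the coordinate
  \<open>v\<close> vanishes, \<open>p\<close> vanishes on a dense part of that hyperplane, hence on
  all of it, and the remainder of \<open>p\<close> modulo the coordinate is zero.\<close>

lemma poly_fun_coord_dvd:
  assumes p: "p \<in> poly_fun I" and h: "h \<in> poly_fun I" "h x0 \<noteq> 0" "x0 v = 0"
    and zero: "\<And>x. x \<in> tuples I \<Longrightarrow> x v = 0 \<Longrightarrow> h x \<noteq> 0 \<Longrightarrow> p x = 0"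
  shows "\<exists>p'\<in>poly_fun I. \<forall>x. p x = x v * p' x"
proof -
  have sub: "(\<lambda>x. f (x(v := 0))) \<in> poly_fun I" if "f \<in> poly_fun I" for f
    by (rule poly_fun_upd_zero[OF that])
  have "p (x(v := 0)) = 0" for x
  proof (rule poly_fun_eqI[OF sub[OF p] poly_fun.const sub[OF h(1)]])
    show "h (x0(v := 0)) \<noteq> 0" using h(2,3) by (metis fun_upd_triv)
    fix x assume "x \<in> tuples I" "h (x(v := 0)) \<noteq> 0"
    then show "p (x(v := 0)) = 0" by (intro zero) (auto simp: tuples_def)
  qed
  then show ?thesis using poly_fun_split_coord[OF p, of v] by simp
qed

text \<open>Only meaningful if \<open>h\<close> is constant on the fibers of \<open>\<pi>\<close>.\<close>

definition lift_fun :: "'a set \<Rightarrow> ('a \<Rightarrow> 'b) \<Rightarrow> ('a \<Rightarrow> complex) \<Rightarrow> 'b \<Rightarrow> complex" where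
  "lift_fun U \<pi> h p = h (SOME x. x \<in> U \<and> \<pi> x = p)"

lemma lift_fun_eq:
  assumes "x \<in> U" "\<And>x y. x \<in> U \<Longrightarrow> y \<in> U \<Longrightarrow> \<pi> x = \<pi> y \<Longrightarrow> h x = h y"
  shows "lift_fun U \<pi> h (\<pi> x) = h x"
proof -
  have "(SOME y. y \<in> U \<and> \<pi> y = \<pi> x) \<in> U \<and> \<pi> (SOME y. y \<in> U \<and> \<pi> y = \<pi> x) = \<pi> x"
    by (rule someI[of _ x]) (use assms(1) in simp)
  then show ?thesis unfolding lift_fun_def using assms by blast
qed

text \<open>An invariant function that is regular on a saturated open set \<open>V\<close> descends
  to the quotient and is then pulled back along \<Psi>. The second conclusion only expresses that
  the preimage of the image of \<open>V\<close> is open.\<close>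

lemma regular_at_pullback:
  assumes U: "U \<subseteq> tuples I" and U': "U' \<subseteq> tuples J"
    and \<Psi>: "morphism (quasi_affine J U') (quotient_space (quasi_affine I U) \<pi>) \<Psi>"
    and V: "openin (Top (quasi_affine I U)) V" and sat: "\<And>x y. x \<in> V \<Longrightarrow> y \<in> U \<Longrightarrow> \<pi> y = \<pi> x \<Longrightarrow> y \<in> V"
    and reg: "\<And>x. x \<in> V \<Longrightarrow> regular_at I U h x"
    and inv: "\<And>x y. x \<in> U \<Longrightarrow> y \<in> U \<Longrightarrow> \<pi> x = \<pi> y \<Longrightarrow> h x = h y"
    and y: "y \<in> U'" "x \<in> V" "\<Psi> y = \<pi> x"
  shows "regular_at J U' (\<lambda>y. lift_fun U \<pi> h (\<Psi> y)) y"
    "\<exists>q\<in>poly_fun J. q y \<noteq> 0 \<and> (\<forall>y'\<in>U'. q y' \<noteq> 0 \<longrightarrow> \<Psi> y' \<in> \<pi> ` V)"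
proof -
  let ?Q = "quotient_space (quasi_affine I U) \<pi>"
  have VU: "V \<subseteq> U" using V openin_quasi_affine[OF U] by blast
  have yW: "y \<in> {y \<in> U'. \<Psi> y \<in> \<pi> ` V}" using y by simp
  have pre: "{x \<in> U. \<pi> x \<in> \<pi> ` V} = V" using sat VU by blast
  have W: "openin (Top ?Q) (\<pi> ` V)"
    unfolding openin_quotient_space pts_quasi_affine[OF U] pre using V VU by blast
  have "lift_fun U \<pi> h \<circ> \<pi> \<in> Reg (quasi_affine I U) {x \<in> U. \<pi> x \<in> \<pi> ` V}"
    unfolding pre Reg_quasi_affine[OF U]
  proof (intro conjI V ballI)
    fix x assume x: "x \<in> V"
    show "regular_at I U (lift_fun U \<pi> h \<circ> \<pi>) x"
    proof (rule regular_at_cong[OF reg[OF x]])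
      show "x \<in> U" using x VU by blast
      show "(lift_fun U \<pi> h \<circ> \<pi>) y = h y" if "y \<in> U" for y
        unfolding comp_def by (rule lift_fun_eq[OF that inv])
    qed
  qed
  then have "lift_fun U \<pi> h \<in> Reg ?Q (\<pi> ` V)"
    by (simp add: quotient_space_def pts_quasi_affine[OF U])
  then have "lift_fun U \<pi> h \<circ> \<Psi> \<in> Reg (quasi_affine J U') {y \<in> U'. \<Psi> y \<in> \<pi> ` V}"
    using morphism_Reg[OF \<Psi> W] by (simp add: pts_quasi_affine[OF U'])
  then show "regular_at J U' (\<lambda>y. lift_fun U \<pi> h (\<Psi> y)) y"
    unfolding Reg_quasi_affine[OF U'] comp_def using yW by blast
  have "openin (Top (quasi_affine J U')) {y \<in> U'. \<Psi> y \<in> \<pi> ` V}"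
    using morphism_preimage[OF \<Psi> W] by (simp add: pts_quasi_affine[OF U'])
  then have "\<exists>q\<in>poly_fun J. q y \<noteq> 0 \<and> (\<forall>y'\<in>U'. q y' \<noteq> 0 \<longrightarrow> y' \<in> {y \<in> U'. \<Psi> y \<in> \<pi> ` V})"
    unfolding openin_quasi_affine[OF U'] by (elim conjE) (rule bspec[OF _ yW])
  then show "\<exists>q\<in>poly_fun J. q y \<noteq> 0 \<and> (\<forall>y'\<in>U'. q y' \<noteq> 0 \<longrightarrow> \<Psi> y' \<in> \<pi> ` V)"
    by simp
qed

section \<open>Functions with zeros along one divisor only\<close>

lemma regular_on_curve:
  assumes reg: "\<And>s. \<gamma> s \<in> U \<and> regular_at I U F (\<gamma> s)" and \<gamma>: "\<And>i. i \<in> I \<Longrightarrow> \<exists>q. \<forall>s. \<gamma> s i = poly q s"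
  shows "\<exists>P. \<forall>s. F (\<gamma> s) = poly P s"
proof (rule locally_rational_is_polynomial)
  fix s0
  from reg[of s0] obtain p q where pq: "p \<in> poly_fun I" "q \<in> poly_fun I" "q (\<gamma> s0) \<noteq> 0"
    "\<And>y. y \<in> U \<Longrightarrow> q y \<noteq> 0 \<Longrightarrow> F y = p y / q y"
    by (auto elim: regular_atE)
  obtain P where P: "\<And>s. p (\<gamma> s) = poly P s" using poly_fun_on_curve[where \<gamma> = \<gamma>, OF pq(1) \<gamma>] by blast
  obtain Q where Q: "\<And>s. q (\<gamma> s) = poly Q s" using poly_fun_on_curve[where \<gamma> = \<gamma>, OF pq(2) \<gamma>] by blast
  show "\<exists>p q. poly q s0 \<noteq> 0 \<and> (\<forall>s. poly q s \<noteq> 0 \<longrightarrow> F (\<gamma> s) = poly p s / poly q s)"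
  proof (intro exI conjI allI impI)
    show "poly Q s0 \<noteq> 0" using pq(3) unfolding Q .
    show "F (\<gamma> s) = poly P s / poly Q s" if "poly Q s \<noteq> 0" for s
      using pq(4)[of "\<gamma> s"] reg[of s] that unfolding P Q by blast
  qed
qed

lemma complex_powi_surj:
  assumes "k \<noteq> 0" "s \<noteq> (0::complex)"
  shows "\<exists>z. z \<noteq> 0 \<and> z powi k = s"
proof -
  define m where "m = nat \<bar>k\<bar>"
  have m: "m \<noteq> 0" using assms(1) by (simp add: m_def)
  define z where "z = rcis (root m (cmod s)) (Arg s / real m)"
  have zm: "z ^ m = s"
    unfolding z_def DeMoivre2 using m by (simp add: rcis_cmod_Arg)
  have z0: "z \<noteq> 0" using zm assms(2) m by (auto simp: power_0_left)
  show ?thesis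
  proof (cases "0 \<le> k")
    case True
    then show ?thesis using z0 zm by (intro exI[of _ z]) (simp add: power_int_def m_def)
  next
    case False
    then show ?thesis using z0 zm by (intro exI[of _ "inverse z"]) (simp add: power_int_def m_def)
  qed
qed

text \<open>To be applied to the fan of V-tilde, with \<open>e\<close> equal to
  \<open>d - 1\<close>.\<close>

locale basis_fan =
  fixes e r :: nat and \<Sigma> :: "(nat \<Rightarrow> real) set set" and a :: "nat \<Rightarrow> nat \<Rightarrow> int"
  assumes e1: "1 \<le> e" and r1: "1 \<le> r"
    and complete: "complete_fan e \<Sigma>"
    and gens: "gens \<Sigma> = std ` {1..e} \<union> a ` {1..r}" "inj_on a {1..r}" "std ` {1..e} \<inter> a ` {1..r} = {}"
begin

abbreviation "G \<equiv> gens \<Sigma>"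
abbreviation "U \<equiv> U_fan \<Sigma>"

lemma fanG: "fan e \<Sigma>" using complete by (simp add: complete_fan_def)

lemma finG: "finite G" using gens(1) by simp

lemma std_a: "i \<in> {1..e} \<Longrightarrow> std i \<in> G" "j \<in> {1..r} \<Longrightarrow> a j \<in> G"
  "i \<in> {1..e} \<Longrightarrow> j \<in> {1..r} \<Longrightarrow> std i \<noteq> a j" "j \<in> {1..r} \<Longrightarrow> l \<in> {1..r} \<Longrightarrow> a j = a l \<longleftrightarrow> j = l"
proof -
  show "std i \<in> G" if "i \<in> {1..e}" unfolding gens(1) using that by blast
  show "a j \<in> G" if "j \<in> {1..r}" unfolding gens(1) using that by blast
  show "std i \<noteq> a j" if "i \<in> {1..e}" "j \<in> {1..r}" using gens(3) that by blast
  show "a j = a l \<longleftrightarrow> j = l" if "j \<in> {1..r}" "l \<in> {1..r}" using gens(2) that by (rule inj_on_eq_iff)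
qed

lemma one_in: "1 \<in> {1..e}" "1 \<in> {1..r}" using e1 r1 by simp_all

lemma std1_a1: "std 1 \<in> G" "a 1 \<in> G" "std 1 \<noteq> a 1"
  by (rule std_a one_in)+

lemma in_U: "X \<in> tuples G \<Longrightarrow> \<rho> \<in> G \<Longrightarrow> (\<And>v. v \<in> G \<Longrightarrow> v \<noteq> \<rho> \<Longrightarrow> X v \<noteq> 0) \<Longrightarrow> X \<in> U"
  unfolding U_fan_iff[OF finG] using gens_rvec_in[of \<rho> \<Sigma>] by blast

lemma sum_G: "(\<Sum>v\<in>G. f v) = (\<Sum>i=1..e. f (std i)) + (\<Sum>j=1..r. f (a j) :: 'b :: comm_monoid_add)"
proof -
  have "(\<Sum>v\<in>G. f v) = (\<Sum>v\<in>std ` {1..e}. f v) + (\<Sum>v\<in>a ` {1..r}. f v)"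
    unfolding gens(1) by (rule sum.union_disjoint) (use gens(3) in auto)
  moreover have "(\<Sum>v\<in>std ` {1..e}. f v) = (\<Sum>i=1..e. f (std i))"
    by (rule sum.reindex_cong[of std]) (auto simp: inj_on_def std_eq_iff)
  moreover have "(\<Sum>v\<in>a ` {1..r}. f v) = (\<Sum>j=1..r. f (a j))"
    using sum.reindex[OF gens(2)] by (simp add: comp_def)
  ultimately show ?thesis by simp
qed

text \<open>The one-parameter subgroup belonging to the linear relation that expresses
  \<open>a j\<close> in the standard basis: the exponents \<epsilon> are the coefficients of this
  relation.\<close>

lemma tor_one_parameter:
  assumes j: "j \<in> {1..r}" and z: "z \<noteq> 0"
  obtains g where "g \<in> tor e G" "g (a j) = z" "\<And>i. i \<in> {1..e} \<Longrightarrow> g (std i) = z powi (- a j i)"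
    "\<And>l. l \<in> {1..r} \<Longrightarrow> l \<noteq> j \<Longrightarrow> g (a l) = 1"
proof -
  define \<epsilon> :: "(nat \<Rightarrow> int) \<Rightarrow> int"
    where "\<epsilon> v = (if v = a j then 1 else 0) - (\<Sum>l=1..e. if v = std l then a j l else 0)" for v
  have a: "\<epsilon> (a l) = (if l = j then 1 else 0)" if l: "l \<in> {1..r}" for l
  proof -
    have "(\<Sum>i=1..e. if a l = std i then a j i else 0) = 0"
      by (rule sum.neutral) (use std_a(3) l in fastforce)
    then show ?thesis using std_a(4)[OF l j] by (simp add: \<epsilon>_def)
  qed
  have std_app: "std l i = (if i = l then 1 else 0)" for l i by (simp add: std_def)
  have s: "\<epsilon> (std i) = - a j i" if i: "i \<in> {1..e}" for i
    using std_a(3)[OF i j] i by (simp add: \<epsilon>_def std_eq_iff)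
  have "(\<lambda>v. z powi \<epsilon> v) \<in> tor e G"
    unfolding tor_def
  proof (intro CollectI conjI allI ballI)
    show "z powi \<epsilon> v \<noteq> 0" for v using z by simp
    fix i assume i: "i \<in> {1..e}"
    have "(\<Prod>v\<in>G. (z powi \<epsilon> v) powi v i) = z powi (\<Sum>v\<in>G. \<epsilon> v * v i)"
      unfolding power_int_mult[symmetric] by (rule prod_powi_sum[OF z])
    also have "(\<Sum>v\<in>G. \<epsilon> v * v i) = (\<Sum>l=1..e. \<epsilon> (std l) * std l i) + (\<Sum>l=1..r. \<epsilon> (a l) * a l i)"
      by (rule sum_G)
    also have "(\<Sum>l=1..e. \<epsilon> (std l) * std l i) = (\<Sum>l=1..e. if l = i then - a j i else 0)"
      by (rule sum.cong) (auto simp: s std_app)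
    also have "(\<Sum>l=1..r. \<epsilon> (a l) * a l i) = (\<Sum>l=1..r. if l = j then a j i else 0)"
      by (rule sum.cong) (auto simp: a)
    finally show "(\<Prod>v\<in>G. (z powi \<epsilon> v) powi v i) = 1" using i j by simp
  qed
  then show thesis by (rule that) (simp_all add: a a[OF j] s)
qed

lemma unit_forces_zero_coordinate:
  assumes reg: "\<And>X. X \<in> U \<Longrightarrow> X (a 1) \<noteq> 0 \<Longrightarrow> regular_at G U F X"
    and inv: "\<And>X g. X \<in> U \<Longrightarrow> g \<in> tor e G \<Longrightarrow> F (\<lambda>v. g v * X v) = F X"
    and nz: "\<And>X. X \<in> U \<Longrightarrow> X (a 1) \<noteq> 0 \<Longrightarrow> X (std 1) \<noteq> 0 \<Longrightarrow> F X \<noteq> 0"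
    and zero: "F (\<lambda>v. if v \<in> G - {std 1} then 1 else 0) = 0"
    and j: "j \<in> {2..r}"
  shows "a j 1 = 0"
proof (rule ccontr)
  assume aj: "a j 1 \<noteq> 0"
  define P :: "complex \<Rightarrow> coords" where "P s v = (if v = std 1 then s else if v \<in> G then 1 else 0)" for s v
  have PU: "P s \<in> U" for s
    by (rule in_U[OF _ std1_a1(1)]) (use std1_a1(1) in \<open>auto simp: P_def tuples_def\<close>)
  have Pa: "P s (a 1) = 1" for s using std1_a1 by (simp add: P_def)
  have "\<exists>q. \<forall>s. P s v = poly q s" for v
    by (cases "v = std 1") (auto simp: P_def intro: exI[of _ "[:0, 1:]"] exI[of _ "[:c:]" for c])
  then obtain \<Phi> where \<Phi>: "\<And>s. F (P s) = poly \<Phi> s"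
    using regular_on_curve[of P U G F] PU reg[OF PU] Pa by auto
  have P0: "P 0 = (\<lambda>v. if v \<in> G - {std 1} then 1 else 0)"
    by (rule ext) (simp add: P_def)
  have \<Phi>0: "poly \<Phi> 0 = 0" using zero \<Phi>[of 0] unfolding P0 by simp
  have \<Phi>1: "poly \<Phi> 1 \<noteq> 0"
    using nz[OF PU[of 1]] Pa[of 1] unfolding \<Phi> by (simp add: P_def)
  \<comment> \<open>Letting a single coordinate run through all values, including 0, stays inside
    \<open>U\<close>, because a single ray always spans a cone.\<close>
  have set_one: "F (X(v := 1)) = F X" if X: "X \<in> tuples G" "\<And>u. u \<in> G \<Longrightarrow> X u \<noteq> 0" and v: "v \<in> G" "v \<noteq> std 1" "v \<noteq> a 1" for X v
  proof -
    have U: "X(v := s) \<in> U" for s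
      by (rule in_U[OF _ v(1)]) (use X v(1) in \<open>auto simp: tuples_def\<close>)
    have nz': "(X(v := s)) (a 1) \<noteq> 0" "(X(v := s)) (std 1) \<noteq> 0" for s using X(2) std1_a1 v(2,3) by auto
    have "\<exists>q. \<forall>s. (X(v := s)) u = poly q s" for u
      by (cases "u = v") (auto intro: exI[of _ "[:0, 1:]"] exI[of _ "[:c:]" for c])
    then obtain Q where Q: "\<And>s. F (X(v := s)) = poly Q s"
      using regular_on_curve[of "\<lambda>s. X(v := s)" U G F] U reg[OF U nz'(1)] by auto
    have "poly Q s \<noteq> 0" for s using nz[OF U nz'] unfolding Q .
    then have "poly Q 1 = poly Q (X v)" by (rule nonvanishing_poly_constant)
    then show ?thesis using Q[of 1] Q[of "X v"] by simp
  qed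
  have set_ones: "F (\<lambda>v. if v \<in> S then 1 else X v) = F X"
    if X: "X \<in> tuples G" "\<And>u. u \<in> G \<Longrightarrow> X u \<noteq> 0" and S: "S \<subseteq> G - {std 1, a 1}" for X S
  proof -
    have "finite S" using S finG finite_subset by blast
    then show ?thesis using S
    proof (induction S)
      case (insert v S)
      have *: "(\<lambda>u. if u \<in> insert v S then 1 else X u) = (\<lambda>u. if u \<in> S then 1 else X u)(v := 1)" by auto
      have "F ((\<lambda>u. if u \<in> S then 1 else X u)(v := 1)) = F (\<lambda>u. if u \<in> S then 1 else X u)"
        by (rule set_one) (use X insert.prems in \<open>auto simp: tuples_def\<close>)
      then show ?case using insert.IH insert.prems unfolding * by simp
    qed simp
  qed
  \<comment> \<open>With \<open>a j 1\<close> nonzero, the subgroup of \<open>a j\<close> moves the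
    coordinate of \<open>std 1\<close> from 1 to any given nonzero \<open>s\<close>, after
    extracting a root \<open>z\<close>. It fixes the coordinate of \<open>a 1\<close> because
    \<open>j\<close> is at least 2, and \<open>set_ones\<close> resets all other
    coordinates.\<close>
  have const: "poly \<Phi> s = poly \<Phi> 1" if s: "s \<noteq> 0" for s
  proof -
    obtain z where z: "z \<noteq> 0" "z powi (- a j 1) = s" using complex_powi_surj[of "- a j 1" s] aj s by auto
    have j1: "j \<in> {1..r}" "(1::nat) \<noteq> j" using j by auto
    obtain g where g: "g \<in> tor e G" "g (a j) = z" "\<And>i. i \<in> {1..e} \<Longrightarrow> g (std i) = z powi (- a j i)"
      "\<And>l. l \<in> {1..r} \<Longrightarrow> l \<noteq> j \<Longrightarrow> g (a l) = 1" using tor_one_parameter[OF j1(1) z(1)] by metis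
    define X where "X = (\<lambda>v. g v * P 1 v)"
    have X: "X \<in> tuples G" "\<And>u. u \<in> G \<Longrightarrow> X u \<noteq> 0"
      using tor_nonzero[OF g(1)] std1_a1(1) by (auto simp: X_def P_def tuples_def)
    have X1: "X (std 1) = s" "X (a 1) = 1"
      using g(3)[OF one_in(1)] g(4)[OF one_in(2) j1(2)] std1_a1 z(2) by (simp_all add: X_def P_def)
    have Ps: "(\<lambda>v. if v \<in> G - {std 1, a 1} then 1 else X v) = P s"
    proof
      fix v
      consider "v = std 1" | "v = a 1" "v \<noteq> std 1" | "v \<in> G - {std 1, a 1}" | "v \<notin> G" "v \<noteq> std 1" "v \<noteq> a 1" by blast
      then show "(if v \<in> G - {std 1, a 1} then 1 else X v) = P s v"
        by cases (use X1 X(1) std1_a1 in \<open>auto simp: P_def tuples_def\<close>)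
    qed
    have "F (P s) = F X" using set_ones[OF X, of "G - {std 1, a 1}"] unfolding Ps by simp
    also have "\<dots> = F (P 1)" unfolding X_def by (rule inv[OF PU g(1)])
    finally show ?thesis unfolding \<Phi> .
  qed
  \<comment> \<open>The factor of the variable makes the equation, known for nonzero
    \<open>s\<close>, hold at 0 too. So \<Phi> is constant, against its values at 0 and 1.\<close>
  have "poly ([:0, 1:] * (\<Phi> - [:poly \<Phi> 1:])) s = 0" for s
    using const[of s] by (cases "s = 0") auto
  then have "[:0, 1:] * (\<Phi> - [:poly \<Phi> 1:]) = 0" using poly_all_0_iff_0 by blast
  then have "\<Phi> - [:poly \<Phi> 1:] = 0" unfolding mult_eq_0_iff by auto
  then have "poly \<Phi> 0 = poly [:poly \<Phi> 1:] 0" by simp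
  then show False using \<Phi>0 \<Phi>1 by simp
qed

end

section \<open>Maps to projective space\<close>

definition line_class :: "(nat \<Rightarrow> complex) \<Rightarrow> (nat \<Rightarrow> complex) set" where
  "line_class x = {(\<lambda>i. s * x i) | s. s \<noteq> 0}"

abbreviation punctured :: "nat \<Rightarrow> (nat \<Rightarrow> complex) set" where
  "punctured n \<equiv> tuples {0..n} - {\<lambda>_. 0}"

lemma proj_space_eq: "proj_space n = quotient_space (quasi_affine {0..n} (punctured n)) line_class"
  unfolding proj_space_def line_class_def[abs_def] ..

lemma line_class_eq_iff: "line_class x = line_class y \<longleftrightarrow> (\<exists>s. s \<noteq> 0 \<and> y = (\<lambda>i. s * x i))"
proof
  assume "line_class x = line_class y"
  moreover have "y \<in> line_class y" unfolding line_class_def by (rule CollectI, rule exI[of _ 1]) simp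
  ultimately show "\<exists>s. s \<noteq> 0 \<and> y = (\<lambda>i. s * x i)" unfolding line_class_def by blast
next
  assume "\<exists>s. s \<noteq> 0 \<and> y = (\<lambda>i. s * x i)"
  then obtain s where s: "s \<noteq> 0" "y = (\<lambda>i. s * x i)" by blast
  have "(\<lambda>i. r * x i) \<in> line_class y" if "r \<noteq> 0" for r
    unfolding line_class_def s(2) using s(1) that by (intro CollectI exI[of _ "r / s"]) simp
  moreover have "(\<lambda>i. r * y i) \<in> line_class x" if "r \<noteq> 0" for r
    unfolding line_class_def s(2) using s(1) that by (intro CollectI exI[of _ "r * s"]) (simp add: mult.assoc)
  ultimately show "line_class x = line_class y" unfolding line_class_def by blast
qed

lemma pts_proj_space: "pts (proj_space n) = line_class ` punctured n"
  unfolding proj_space_eq pts_quotient_space by (subst pts_quasi_affine) auto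

lemma openin_punctured_nonzero:
  assumes "p \<in> poly_fun {0..n}"
  shows "openin (Top (quasi_affine {0..n} (punctured n))) {x \<in> punctured n. p x \<noteq> 0}"
  by (subst openin_quasi_affine) (use assms in auto)

context basis_fan
begin

text \<open>A point of the divisor of \<rho> that lies on no other torus-invariant divisor.\<close>

definition deg_point :: "(nat \<Rightarrow> int) \<Rightarrow> coords" where
  "deg_point \<rho> = (\<lambda>v. if v \<in> G - {\<rho>} then 1 else 0)"

lemma deg_point_U: "\<rho> \<in> G \<Longrightarrow> deg_point \<rho> \<in> U"
  by (rule in_U[of _ \<rho>]) (auto simp: deg_point_def tuples_def)

lemma deg_point_zero: "deg_point \<rho> \<rho> = 0"
  by (simp add: deg_point_def)

lemma UG: "U \<subseteq> tuples G" by (rule U_fan_tuples)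

lemma orbit_tor: "X \<in> U \<Longrightarrow> g \<in> tor e G \<Longrightarrow> orbit e \<Sigma> (\<lambda>v. g v * X v) = orbit e \<Sigma> X"
  by (rule sym, rule iffD2[OF orbit_eq_iff[OF finG subsetD[OF UG] subsetD[OF UG]]])
    (use tor_mult_in_U_fan[OF finG] tor_nonzero in auto)

lemma orbit_eqD: "X \<in> U \<Longrightarrow> Y \<in> U \<Longrightarrow> orbit e \<Sigma> X = orbit e \<Sigma> Y \<Longrightarrow> \<exists>g\<in>tor e G. Y = (\<lambda>v. g v * X v)"
  by (rule iffD1[OF orbit_eq_iff[OF finG subsetD[OF UG] subsetD[OF UG]]])

text \<open>The common core of both cases for V-tilde. \<open>A\<close> and \<open>B\<close> have
  equal degree, so \<open>A / B\<close> is a well-defined function on points of projective space,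
  and its pullback is regular away from the divisor of \<open>a 1\<close> and vanishes at most on
  that of \<open>std 1\<close>. Linear forms serve for a bundle, powers of equations of divisors for
  projective space.\<close>

lemma map_to_projective_space_forces_zero:
  assumes \<Theta>: "morphism (quasi_affine G U) (proj_space n) \<Theta>"
    and inv: "\<And>X g. X \<in> U \<Longrightarrow> g \<in> tor e G \<Longrightarrow> \<Theta> (\<lambda>v. g v * X v) = \<Theta> X"
    and A: "A \<in> poly_fun {0..n}" "\<And>s x. A (\<lambda>i. s * x i) = s ^ N * A x"
    and B: "B \<in> poly_fun {0..n}" "\<And>s x. B (\<lambda>i. s * x i) = s ^ N * B x"
    and zA: "\<And>X x. X \<in> U \<Longrightarrow> x \<in> punctured n \<Longrightarrow> \<Theta> X = line_class x \<Longrightarrow> A x = 0 \<Longrightarrow> X (std 1) = 0"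
    and zB: "\<And>X x. X \<in> U \<Longrightarrow> x \<in> punctured n \<Longrightarrow> \<Theta> X = line_class x \<Longrightarrow> B x = 0 \<Longrightarrow> X (a 1) = 0"
    and x0: "x0 \<in> punctured n" "\<Theta> (deg_point (std 1)) = line_class x0" "A x0 = 0"
    and j: "j \<in> {2..r}"
  shows "a j 1 = 0"
proof -
  let ?h = "\<lambda>x. A x / B x"
  define F where "F X = lift_fun (punctured n) line_class ?h (\<Theta> X)" for X
  have hinv: "?h x = ?h y" if cl: "line_class x = line_class y" for x y
  proof -
    obtain s where s: "s \<noteq> 0" "y = (\<lambda>i. s * x i)" using cl unfolding line_class_eq_iff by blast
    then show ?thesis by (simp add: A(2) B(2))
  qed
  have F: "F X = ?h x" if "x \<in> punctured n" "\<Theta> X = line_class x" for X x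
    unfolding F_def that(2) by (rule lift_fun_eq[OF that(1) hinv])
  have rep: "\<exists>x\<in>punctured n. \<Theta> X = line_class x" if "X \<in> U" for X
    using morphism_pts[OF \<Theta>] that unfolding pts_proj_space by (auto simp: pts_quasi_affine[OF UG])
  show ?thesis
  proof (rule unit_forces_zero_coordinate[of F, OF _ _ _ _ j])
    fix X assume X: "X \<in> U" "X (a 1) \<noteq> 0"
    obtain x where x: "x \<in> punctured n" "\<Theta> X = line_class x" using rep[OF X(1)] by blast
    have Bx: "B x \<noteq> 0" using zB[OF X(1) x] X(2) by blast
    show "regular_at G U F X"
      unfolding F_def
    proof (rule regular_at_pullback(1))
      show "punctured n \<subseteq> tuples {0..n}" by blast
      show "morphism (quasi_affine G U) (quotient_space (quasi_affine {0..n} (punctured n)) line_class) \<Theta>"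
        using \<Theta> unfolding proj_space_eq .
      show "openin (Top (quasi_affine {0..n} (punctured n))) {x \<in> punctured n. B x \<noteq> 0}"
        by (rule openin_punctured_nonzero[OF B(1)])
      show "y \<in> {x \<in> punctured n. B x \<noteq> 0}"
        if xy: "x \<in> {x \<in> punctured n. B x \<noteq> 0}" "y \<in> punctured n" "line_class y = line_class x" for x y
      proof -
        obtain s where "s \<noteq> 0" "y = (\<lambda>i. s * x i)" using xy(3) line_class_eq_iff[of x y] by auto
        then show ?thesis using xy by (simp add: B(2))
      qed
      show "regular_at {0..n} (punctured n) ?h x" if "x \<in> {x \<in> punctured n. B x \<noteq> 0}" for x
        by (rule regular_atI[OF A(1) B(1)]) (use that in auto)
      show "?h x = ?h y" if "line_class x = line_class y" for x y by (rule hinv[OF that])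
      show "x \<in> {x \<in> punctured n. B x \<noteq> 0}" using x(1) Bx by simp
    qed (rule UG X(1) x(2))+
    show "F X \<noteq> 0" if "X (std 1) \<noteq> 0"
    proof -
      have "A x \<noteq> 0" using zA[OF X(1) x] that by blast
      then show ?thesis unfolding F[OF x] using Bx by simp
    qed
  next
    show "F (\<lambda>v. g v * X v) = F X" if "X \<in> U" "g \<in> tor e G" for X g
      unfolding F_def inv[OF that] ..
    show "F (\<lambda>v. if v \<in> G - {std 1} then 1 else 0) = 0"
      using F[OF x0(1,2)] unfolding deg_point_def x0(3) by simp
  qed
qed

lemma morphism_orbit: "morphism (quasi_affine G U) (toric e \<Sigma>) (orbit e \<Sigma>)"
  unfolding toric_def by (rule morphism_quotient_map)

lemma orbit_in_divisor_iff:
  assumes "X \<in> U"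
  shows "orbit e \<Sigma> X \<in> toric_divisor e \<Sigma> \<rho> \<longleftrightarrow> X \<rho> = 0"
proof -
  have Xt: "X \<in> tuples G" using assms UG by blast
  have "(\<forall>Y\<in>orbit e \<Sigma> X. Y \<rho> = 0) \<longleftrightarrow> X \<rho> = 0"
    unfolding orbit_eq[OF finG Xt] using tor_one[of e G] tor_nonzero[of _ e G] by fastforce
  then show ?thesis unfolding toric_divisor_def pts_toric using assms by blast
qed

text \<open>\<open>A y\<close> is the linear form on the projective line whose only zero is
  \<open>y\<close>. With \<open>p\<close> and \<open>q\<close> the base points under the two fibers,
  \<open>A p / A q\<close> is the desired function.\<close>

lemma bundle_forces_zero:
  assumes "bundle_with_fibers e \<Sigma> (std 1) (a 1)" and j: "j \<in> {2..r}"
  shows "a j 1 = 0"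
proof -
  obtain n \<Delta> \<pi> \<phi> where b: "toric_bundle_over_P1 n \<Delta> \<pi>" "isomorphism (toric e \<Sigma>) (toric n \<Delta>) \<phi>"
    "\<And>w. w \<in> {std 1, a 1} \<Longrightarrow> \<exists>y\<in>pts (proj_space 1). toric_divisor e \<Sigma> w = {p \<in> pts (toric e \<Sigma>). \<pi> (\<phi> p) = y}"
    using assms(1) unfolding bundle_with_fibers_def by blast
  have \<pi>: "morphism (toric n \<Delta>) (proj_space 1) \<pi>" using b(1) unfolding toric_bundle_over_P1_def toric_morphism_def by blast
  have \<phi>: "morphism (toric e \<Sigma>) (toric n \<Delta>) \<phi>" using b(2) unfolding isomorphism_def by blast
  define \<Theta> where "\<Theta> X = \<pi> (\<phi> (orbit e \<Sigma> X))" for X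
  have \<Theta>m: "morphism (quasi_affine G U) (proj_space 1) \<Theta>"
    using morphism_compose[OF morphism_compose[OF morphism_orbit \<phi>] \<pi>] unfolding comp_def \<Theta>_def .
  obtain p where p: "p \<in> punctured 1" "toric_divisor e \<Sigma> (std 1) = {q \<in> pts (toric e \<Sigma>). \<pi> (\<phi> q) = line_class p}"
    using b(3)[of "std 1"] unfolding pts_proj_space by blast
  obtain q where q: "q \<in> punctured 1" "toric_divisor e \<Sigma> (a 1) = {p \<in> pts (toric e \<Sigma>). \<pi> (\<phi> p) = line_class q}"
    using b(3)[of "a 1"] unfolding pts_proj_space by blast
  have div: "\<Theta> X = line_class y \<longleftrightarrow> X \<rho> = 0"
    if "X \<in> U" "toric_divisor e \<Sigma> \<rho> = {p \<in> pts (toric e \<Sigma>). \<pi> (\<phi> p) = line_class y}" for X y \<rho>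
    using orbit_in_divisor_iff[OF that(1), of \<rho>] that(1) unfolding that(2) \<Theta>_def pts_toric by blast
  define A where "A y x = y 1 * x 0 - y 0 * x 1" for x y :: "nat \<Rightarrow> complex"
  have Ap: "A y \<in> poly_fun {0..1}" for y
    unfolding A_def[abs_def] by (intro poly_fun_diff poly_fun.mult poly_fun.const poly_fun.coord) auto
  have hom: "A y (\<lambda>i. s * x i) = s ^ 1 * A y x" for y s x by (simp add: A_def algebra_simps)
  have par: "line_class x = line_class y" if xy: "x \<in> punctured 1" "y \<in> punctured 1" "A y x = 0" for x y
  proof -
    have out: "x i = 0" "y i = 0" if "i \<noteq> 0" "i \<noteq> 1" for i using xy(1,2) that by (auto simp: tuples_def)
    have eq: "y 1 * x 0 = y 0 * x 1" using xy(3) by (simp add: A_def)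
    have ex: "\<exists>l. z l \<noteq> 0 \<and> (l = 0 \<or> l = 1)" if "z \<in> punctured 1" for z
    proof (rule ccontr)
      assume "\<nexists>l. z l \<noteq> 0 \<and> (l = 0 \<or> l = 1)"
      then have "z l = 0" for l using that by (cases "l = 0 \<or> l = 1") (auto simp: tuples_def)
      then show False using that by auto
    qed
    obtain l where l: "x l \<noteq> 0" "l = 0 \<or> l = 1" using ex[OF xy(1)] by blast
    have yi: "y i = y l / x l * x i" for i
    proof (cases "i = 0 \<or> i = 1")
      case True
      then show ?thesis using l eq by (auto simp: field_simps)
    qed (simp add: out)
    obtain l' where "y l' \<noteq> 0" using ex[OF xy(2)] by blast
    then have "y l / x l \<noteq> 0" using yi[of l'] by auto
    then show ?thesis unfolding line_class_eq_iff using yi by blast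
  qed
  show ?thesis
  proof (rule map_to_projective_space_forces_zero[OF \<Theta>m _ Ap hom Ap hom _ _ p(1) _ _ j])
    show "\<Theta> (\<lambda>v. g v * X v) = \<Theta> X" if "X \<in> U" "g \<in> tor e G" for X g
      unfolding \<Theta>_def orbit_tor[OF that] ..
    show "X (std 1) = 0" if "X \<in> U" "x \<in> punctured 1" "\<Theta> X = line_class x" "A p x = 0" for X x
      using div[OF that(1) p(2)] par[OF that(2) p(1) that(4)] that(3) by simp
    show "X (a 1) = 0" if "X \<in> U" "x \<in> punctured 1" "\<Theta> X = line_class x" "A q x = 0" for X x
      using div[OF that(1) q(2)] par[OF that(2) q(1) that(4)] that(3) by simp
    show "\<Theta> (deg_point (std 1)) = line_class p"
      using div[OF deg_point_U[OF std1_a1(1)] p(2)] deg_point_zero by simp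
    show "A p p = 0" by (simp add: A_def)
  qed
qed

end

section \<open>Hypersurfaces in projective space\<close>

locale proj_fan = basis_fan +
  fixes n :: nat and \<phi> :: "coords set \<Rightarrow> (nat \<Rightarrow> complex) set" and \<psi> :: "(nat \<Rightarrow> complex) set \<Rightarrow> coords set"
  assumes \<phi>: "morphism (toric e \<Sigma>) (proj_space n) \<phi>" and \<psi>: "morphism (proj_space n) (toric e \<Sigma>) \<psi>"
    and inverse: "\<And>p. p \<in> pts (toric e \<Sigma>) \<Longrightarrow> \<psi> (\<phi> p) = p" "\<And>q. q \<in> pts (proj_space n) \<Longrightarrow> \<phi> (\<psi> q) = q"
begin

definition "\<Phi> X = \<phi> (orbit e \<Sigma> X)"
definition "\<Psi> x = \<psi> (line_class x)"

lemma \<Phi>_morphism: "morphism (quasi_affine G U) (quotient_space (quasi_affine {0..n} (punctured n)) line_class) \<Phi>"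
  using morphism_compose[OF morphism_orbit \<phi>] unfolding comp_def \<Phi>_def proj_space_eq .

lemma \<Psi>_morphism: "morphism (quasi_affine {0..n} (punctured n)) (quotient_space (quasi_affine G U) (orbit e \<Sigma>)) \<Psi>"
proof -
  have "morphism (quasi_affine {0..n} (punctured n)) (proj_space n) line_class"
    unfolding proj_space_eq by (rule morphism_quotient_map)
  from morphism_compose[OF this \<psi>] show ?thesis unfolding comp_def \<Psi>_def toric_def .
qed

lemma \<Phi>_\<Psi>_iff:
  assumes "X \<in> U" "x \<in> punctured n"
  shows "\<Phi> X = line_class x \<longleftrightarrow> \<Psi> x = orbit e \<Sigma> X"
proof -
  have "orbit e \<Sigma> X \<in> pts (toric e \<Sigma>)" "line_class x \<in> pts (proj_space n)"
    using assms by (simp_all add: pts_toric pts_proj_space)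
  from inverse(1)[OF this(1)] inverse(2)[OF this(2)] show ?thesis unfolding \<Phi>_def \<Psi>_def by metis
qed

lemma \<Phi>_rep:
  assumes "X \<in> U"
  obtains x where "x \<in> punctured n" "\<Phi> X = line_class x"
proof -
  have "orbit e \<Sigma> X \<in> pts (toric e \<Sigma>)" using assms by (simp add: pts_toric)
  from morphism_pts[OF \<phi> this] show thesis using that unfolding \<Phi>_def pts_proj_space by blast
qed

lemma \<Psi>_rep:
  assumes "x \<in> punctured n"
  obtains X where "X \<in> U" "\<Psi> x = orbit e \<Sigma> X"
proof -
  have "line_class x \<in> pts (proj_space n)" using assms by (simp add: pts_proj_space)
  from morphism_pts[OF \<psi> this] show thesis using that unfolding \<Psi>_def pts_toric by blast
qed

lemma punctured_scale: "x \<in> punctured n \<Longrightarrow> s \<noteq> 0 \<Longrightarrow> (\<lambda>i. s * x i) \<in> punctured n"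
  by (auto simp: tuples_def fun_eq_iff)

lemma \<Psi>_scale: "s \<noteq> 0 \<Longrightarrow> \<Psi> (\<lambda>i. s * x i) = \<Psi> x"
proof -
  assume "s \<noteq> 0"
  then have "line_class x = line_class (\<lambda>i. s * x i)" unfolding line_class_eq_iff by blast
  then show ?thesis unfolding \<Psi>_def by simp
qed

text \<open>The affine cone, without its vertex, over the hypersurface in projective space that
  corresponds to the divisor of \<rho>.\<close>

definition divisor_cone :: "(nat \<Rightarrow> int) \<Rightarrow> (nat \<Rightarrow> complex) set" where
  "divisor_cone \<rho> = {x \<in> punctured n. \<Psi> x \<in> toric_divisor e \<Sigma> \<rho>}"

lemma divisor_cone_iff: "x \<in> punctured n \<Longrightarrow> X \<in> U \<Longrightarrow> \<Psi> x = orbit e \<Sigma> X \<Longrightarrow> x \<in> divisor_cone \<rho> \<longleftrightarrow> X \<rho> = 0"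
  unfolding divisor_cone_def using orbit_in_divisor_iff by simp

lemma divisor_cone_scale: "x \<in> divisor_cone \<rho> \<Longrightarrow> s \<noteq> 0 \<Longrightarrow> (\<lambda>i. s * x i) \<in> divisor_cone \<rho>"
  unfolding divisor_cone_def using punctured_scale \<Psi>_scale by simp

lemma orbit_saturated:
  assumes "X \<in> U" "Y \<in> U" "orbit e \<Sigma> Y = orbit e \<Sigma> X"
  obtains g where "g \<in> tor e G" "\<And>v. g v \<noteq> 0" "Y = (\<lambda>v. g v * X v)"
  using orbit_eqD[OF assms(1,2)] assms(3) tor_nonzero by metis

text \<open>The complement of the divisor is open and saturated, so some polynomial vanishes on the
  cone and not at \<open>y\<close>. The cone is stable under scaling, hence every homogeneous
  component vanishes on it, and one of them is nonzero at \<open>y\<close>.\<close>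

lemma homogeneous_separation:
  assumes y: "y \<in> punctured n" "y \<notin> divisor_cone \<rho>"
  shows "\<exists>g\<in>poly_fun {0..n}. \<exists>M. (\<forall>s x. g (\<lambda>i. s * x i) = s ^ M * g x) \<and>
    (\<forall>x\<in>divisor_cone \<rho>. g x = 0) \<and> g y \<noteq> 0"
proof -
  obtain X where X: "X \<in> U" "\<Psi> y = orbit e \<Sigma> X" using \<Psi>_rep[OF y(1)] by blast
  have X\<rho>: "X \<rho> \<noteq> 0" using divisor_cone_iff[OF y(1) X] y(2) by blast
  define V where "V = {X \<in> U. X \<rho> \<noteq> 0}"
  have \<rho>G: "\<rho> \<in> G" using X(1) X\<rho> UG by (auto simp: tuples_def)
  have V: "openin (Top (quasi_affine G U)) V"
    unfolding V_def openin_quasi_affine[OF UG] using poly_fun.coord[OF \<rho>G] by auto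
  have sat: "Y \<in> V" if "X \<in> V" "Y \<in> U" "orbit e \<Sigma> Y = orbit e \<Sigma> X" for X Y
  proof -
    obtain g where "\<And>v. g v \<noteq> 0" "Y = (\<lambda>v. g v * X v)"
      using orbit_saturated[of X Y] \<open>X \<in> V\<close> \<open>Y \<in> U\<close> \<open>orbit e \<Sigma> Y = orbit e \<Sigma> X\<close> unfolding V_def by blast
    then show ?thesis using \<open>X \<in> V\<close> \<open>Y \<in> U\<close> by (simp add: V_def)
  qed
  have "\<exists>q\<in>poly_fun {0..n}. q y \<noteq> 0 \<and> (\<forall>x\<in>punctured n. q x \<noteq> 0 \<longrightarrow> \<Psi> x \<in> orbit e \<Sigma> ` V)"
  proof (rule regular_at_pullback(2)[where h = "\<lambda>_. 0" and x = X, OF UG _ \<Psi>_morphism V])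
    show "punctured n \<subseteq> tuples {0..n}" by blast
    show "X \<in> V" using X(1) X\<rho> by (simp add: V_def)
    show "regular_at G U (\<lambda>_. 0) X" for X by (rule regular_at_poly[OF poly_fun.const])
    show "Y \<in> V" if "X \<in> V" "Y \<in> U" "orbit e \<Sigma> Y = orbit e \<Sigma> X" for X Y by (rule sat[OF that])
  qed (rule refl y(1) X(2))+
  then obtain q where q: "q \<in> poly_fun {0..n}" "q y \<noteq> 0" "\<And>x. x \<in> punctured n \<Longrightarrow> q x \<noteq> 0 \<Longrightarrow> \<Psi> x \<in> orbit e \<Sigma> ` V"
    by blast
  have q0: "q x = 0" if "x \<in> divisor_cone \<rho>" for x
  proof (rule ccontr)
    assume "q x \<noteq> 0"
    have x: "x \<in> punctured n" using that unfolding divisor_cone_def by blast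
    obtain X where "X \<in> V" "\<Psi> x = orbit e \<Sigma> X" using q(3)[OF x \<open>q x \<noteq> 0\<close>] by blast
    then show False using divisor_cone_iff[OF x, of X] that unfolding V_def by blast
  qed
  obtain P where P: "\<And>i. (\<lambda>x. coeff (P x) i) \<in> poly_fun {0..n}" "\<And>x l. q (\<lambda>i. l * x i) = poly (P x) l"
    "\<And>x l i. coeff (P (\<lambda>j. l * x j)) i = l ^ i * coeff (P x) i"
    using poly_fun_homogeneous_components[OF q(1)] by metis
  have "poly (P y) 1 = q y" using P(2)[of 1 y] by simp
  then have "P y \<noteq> 0" using q(2) by auto
  then obtain M where M: "coeff (P y) M \<noteq> 0" by (auto simp: poly_eq_iff)
  show ?thesis
  proof (intro bexI[where x = "\<lambda>x. coeff (P x) M"] exI[of _ M] conjI allI ballI P(1) P(3) M)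
    fix x assume x: "x \<in> divisor_cone \<rho>"
    have "poly ([:0, 1:] * P x) s = 0" for s
    proof (cases "s = 0")
      case False
      then have "poly (P x) s = 0" using q0[OF divisor_cone_scale[OF x False]] P(2)[of s x] by simp
      then show ?thesis by simp
    qed simp
    then have "[:0, 1:] * P x = 0" using poly_all_0_iff_0 by blast
    then have "P x = 0" unfolding mult_eq_0_iff by auto
    then show "coeff (P x) M = 0" by simp
  qed
qed

end

section \<open>Normal form of homogeneous coordinates near a divisor\<close>

context basis_fan
begin

text \<open>
  The representative of an orbit near \<open>D\<^sub>\<rho>\<close> whose coordinates are 1 outside \<open>\<rho>\<close> and the standard basis.  Its
  coordinates are invariant Laurent monomials, so they descend to regular functions on the toric variety.
\<close>

definition nform_factor :: "(nat \<Rightarrow> int) \<Rightarrow> (nat \<Rightarrow> int) \<Rightarrow> coords \<Rightarrow> complex" where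
  "nform_factor \<rho> m X = (\<Prod>u\<in>G - {\<rho>}. X u powi pairing e m u)"

definition nform :: "(nat \<Rightarrow> int) \<Rightarrow> (nat \<Rightarrow> int) \<Rightarrow> coords \<Rightarrow> coords" where
  "nform \<rho> m X v = (if v = \<rho> then X \<rho> * nform_factor \<rho> m X
     else if v \<in> std ` {1..e} then \<Prod>u\<in>G - {\<rho>}. X u powi (pairing e v u - pairing e v \<rho> * pairing e m u)
     else if v \<in> G then 1 else 0)"

lemma pairing_left_diff: "pairing e (\<lambda>i. v i - c * m i) u = pairing e v u - c * pairing e m u"
  for v m u :: "nat \<Rightarrow> int"
  by (simp add: pairing_def algebra_simps sum_subtractf sum_distrib_left)

lemma tor_pairing_remove:
  assumes "g \<in> tor e G" "\<rho> \<in> G"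
  shows "g \<rho> powi pairing e m \<rho> * (\<Prod>u\<in>G - {\<rho>}. g u powi pairing e m u) = 1"
  using tor_pairing[OF assms(1), of m] prod.remove[OF finG assms(2), of "\<lambda>u. g u powi pairing e m u"] by simp

text \<open>Every entry is 1, 0 or the Laurent monomial of a character. At \<rho> the character is
  \<open>m\<close>, whose exponent at \<rho> is 1; at a standard vector \<open>v\<close> it is
  \<open>v\<close> minus a multiple of \<open>m\<close> chosen orthogonal to \<rho>, so that the
  possibly vanishing coordinate of \<rho> does not occur.\<close>

lemma nform_invariant:
  assumes g: "g \<in> tor e G" and \<rho>: "\<rho> \<in> G" "pairing e m \<rho> = 1"
  shows "nform \<rho> m (\<lambda>v. g v * X v) = nform \<rho> m X"
proof
  fix v
  have split: "(\<Prod>u\<in>G - {\<rho>}. (g u * X u) powi f u) = (\<Prod>u\<in>G - {\<rho>}. g u powi f u) * (\<Prod>u\<in>G - {\<rho>}. X u powi f u)" for f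
    by (simp add: power_int_mult_distrib prod.distrib)
  have 1: "g \<rho> * (\<Prod>u\<in>G - {\<rho>}. g u powi pairing e m u) = 1"
    using tor_pairing_remove[OF g \<rho>(1), of m] \<rho>(2) by simp
  have 2: "(\<Prod>u\<in>G - {\<rho>}. g u powi (pairing e v u - pairing e v \<rho> * pairing e m u)) = 1"
    using tor_pairing_remove[OF g \<rho>(1), of "\<lambda>i. v i - pairing e v \<rho> * m i"] unfolding pairing_left_diff by (simp add: \<rho>(2))
  have "nform_factor \<rho> m (\<lambda>v. g v * X v) = (\<Prod>u\<in>G - {\<rho>}. g u powi pairing e m u) * nform_factor \<rho> m X"
    unfolding nform_factor_def by (rule split)
  then have 3: "g \<rho> * X \<rho> * nform_factor \<rho> m (\<lambda>v. g v * X v) = X \<rho> * nform_factor \<rho> m X"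
    using 1 by (simp add: algebra_simps)
  show "nform \<rho> m (\<lambda>v. g v * X v) v = nform \<rho> m X v"
    unfolding nform_def split 2 3 by simp
qed

lemma nform_deg_point:
  assumes "\<rho> \<in> G" shows "nform \<rho> m (deg_point \<rho>) = deg_point \<rho>"
proof
  fix v
  have "(\<Prod>u\<in>G - {\<rho>}. deg_point \<rho> u powi f u) = 1" for f
    by (rule prod.neutral) (simp add: deg_point_def)
  then show "nform \<rho> m (deg_point \<rho>) v = deg_point \<rho> v"
    using std_a(1) by (auto simp: nform_def deg_point_def)
qed

lemma nform_regular:
  assumes X: "X \<in> U" "\<And>v. v \<in> G - {\<rho>} \<Longrightarrow> X v \<noteq> 0" and \<rho>: "\<rho> \<in> G"
  shows "regular_at G U (\<lambda>X. nform \<rho> m X v) X"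
proof -
  have P: "regular_at G U (\<lambda>X. \<Prod>u\<in>G - {\<rho>}. X u powi f u) X" for f
  proof (rule regular_at_prod)
    fix u assume "u \<in> G - {\<rho>}"
    then show "regular_at G U (\<lambda>X. X u powi f u) X"
      by (intro regular_at_powi regular_at_poly poly_fun.coord X) auto
  qed
  have 1: "regular_at G U (\<lambda>X. X \<rho> * nform_factor \<rho> m X) X"
    unfolding nform_factor_def by (intro regular_at_mult P regular_at_poly poly_fun.coord \<rho>)
  consider "v = \<rho>" | "v \<noteq> \<rho>" "v \<in> std ` {1..e}" | "v \<noteq> \<rho>" "v \<notin> std ` {1..e}" by blast
  then show ?thesis
  proof cases
    case 1
    with \<open>regular_at G U (\<lambda>X. X \<rho> * nform_factor \<rho> m X) X\<close> show ?thesis by (simp add: nform_def)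
  next
    case 2
    then show ?thesis using P by (simp add: nform_def)
  next
    case 3
    then show ?thesis by (cases "v \<in> G") (simp_all add: nform_def regular_at_poly[OF poly_fun.const])
  qed
qed

text \<open>The \<open>i\<close>-th torus equation is solved by the entry at \<open>std i\<close>.
  If \<rho> is itself \<open>std i\<close>, that entry is the one of \<rho>, and the equation holds
  because \<open>m\<close> is then the \<open>i\<close>-th coordinate character.\<close>

lemma nform_in_orbit:
  assumes X: "\<And>v. v \<in> G - {\<rho>} \<Longrightarrow> X v \<noteq> 0" "X \<in> tuples G" and \<rho>: "\<rho> \<in> G"
    and m: "\<And>i. i \<in> {1..e} \<Longrightarrow> \<rho> = std i \<Longrightarrow> m = std i"
  shows "\<exists>g\<in>tor e G. nform \<rho> m X = (\<lambda>v. g v * X v)"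
proof -
  let ?N = "nform \<rho> m X" and ?M = "nform_factor \<rho> m X"
  have M0: "?M \<noteq> 0" unfolding nform_factor_def using X(1) finG by simp
  have N0: "?N v \<noteq> 0" if "v \<in> G - {\<rho>}" for v using that X(1) finG by (simp add: nform_def)
  define g where "g v = (if v = \<rho> then ?M else if v \<in> G then ?N v / X v else 1)" for v
  have g0: "g v \<noteq> 0" for v using M0 N0 X(1) by (simp add: g_def)
  have eq: "?N = (\<lambda>v. g v * X v)"
  proof
    fix v
    show "?N v = g v * X v"
      using X \<rho> std_a(1) by (auto simp: g_def nform_def tuples_def)
  qed
  have "g \<in> tor e G"
    unfolding tor_def
  proof (intro CollectI conjI allI ballI g0)
    fix i assume i: "i \<in> {1..e}"
    let ?Q = "\<Prod>v\<in>G - {\<rho>}. X v powi v i"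
    have Q0: "?Q \<noteq> 0" using X(1) finG by simp
    have "(\<Prod>v\<in>G. g v powi v i) = ?M powi \<rho> i * (\<Prod>v\<in>G - {\<rho>}. g v powi v i)"
      using prod.remove[OF finG \<rho>, of "\<lambda>v. g v powi v i"] by (simp add: g_def)
    also have "(\<Prod>v\<in>G - {\<rho>}. g v powi v i) = (\<Prod>v\<in>G - {\<rho>}. ?N v powi v i / X v powi v i)"
      by (rule prod.cong) (auto simp: g_def power_int_divide_distrib)
    also have "\<dots> = (\<Prod>v\<in>G - {\<rho>}. ?N v powi v i) / ?Q" by (rule prod_dividef)
    also have "(\<Prod>v\<in>G - {\<rho>}. ?N v powi v i) = (\<Prod>v\<in>G - {\<rho>}. if v = std i then ?N (std i) else 1)"
    proof (rule prod.cong)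
      fix v assume v: "v \<in> G - {\<rho>}"
      show "?N v powi v i = (if v = std i then ?N (std i) else 1)"
      proof (cases "v \<in> std ` {1..e}")
        case True
        then obtain l where "v = std l" by blast
        then show ?thesis by (cases "l = i") (simp_all add: std_eq_iff, simp_all add: std_def)
      next
        case False
        then have "?N v = 1" "v \<noteq> std i" using v i by (auto simp: nform_def)
        then show ?thesis by simp
      qed
    qed simp
    also have "\<dots> = (if std i \<noteq> \<rho> then ?N (std i) else 1)"
      using std_a(1)[OF i] finG by (simp add: prod.delta)
    finally have pr: "(\<Prod>v\<in>G. g v powi v i) = ?M powi \<rho> i * ((if std i \<noteq> \<rho> then ?N (std i) else 1) / ?Q)" .
    show "(\<Prod>v\<in>G. g v powi v i) = 1"
    proof (cases "std i = \<rho>")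
      case True
      have "m = std i" using m[OF i] True by simp
      then have "?M = ?Q" unfolding nform_factor_def by (simp add: pairing_std[OF i])
      moreover have "\<rho> i = 1" unfolding True[symmetric] by (simp add: std_def)
      ultimately show ?thesis using pr True Q0 by simp
    next
      case False
      have "?N (std i) = (\<Prod>u\<in>G - {\<rho>}. X u powi (u i - \<rho> i * pairing e m u))"
        using False i by (simp add: nform_def pairing_std)
      also have "\<dots> = (\<Prod>u\<in>G - {\<rho>}. X u powi u i / (X u powi pairing e m u) powi \<rho> i)"
      proof (rule prod.cong)
        fix u assume "u \<in> G - {\<rho>}"
        then have "X u \<noteq> 0" by (rule X(1))
        then show "X u powi (u i - \<rho> i * pairing e m u) = X u powi u i / (X u powi pairing e m u) powi \<rho> i"
          by (simp add: power_int_diff power_int_mult[symmetric] mult.commute)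
      qed simp
      also have "\<dots> = ?Q / ?M powi \<rho> i" unfolding prod_dividef nform_factor_def powi_prod ..
      finally show ?thesis using pr False Q0 M0 by simp
    qed
  qed
  then show ?thesis using eq by blast
qed

end

section \<open>Equations of the divisors in projective space\<close>

context proj_fan
begin

lemma divisor_cone_proper: "\<rho> \<in> G \<Longrightarrow> \<exists>y\<in>punctured n. y \<notin> divisor_cone \<rho>"
proof -
  assume \<rho>: "\<rho> \<in> G"
  have X: "(\<lambda>v. if v \<in> G then 1 else 0) \<in> U"
    by (rule in_U[OF _ \<rho>]) (auto simp: tuples_def)
  obtain y where y: "y \<in> punctured n" "\<Phi> (\<lambda>v. if v \<in> G then 1 else 0) = line_class y" using \<Phi>_rep[OF X] .
  have "\<Psi> y = orbit e \<Sigma> (\<lambda>v. if v \<in> G then 1 else 0)" using \<Phi>_\<Psi>_iff[OF X y(1)] y(2) by blast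
  from divisor_cone_iff[OF y(1) X this, of \<rho>] show ?thesis using y(1) \<rho> by auto
qed

text \<open>The normal form is invariant, so its entries descend to the toric variety, and pulled
  back along \<Psi> they give homogeneous coordinates of \<open>\<Psi> x\<close> that depend
  regularly on \<open>x\<close>. The polynomial \<open>q\<close> cuts out a neighbourhood on which
  all coordinates other than that of \<rho> are nonzero.\<close>

lemma local_lift:
  assumes \<rho>: "\<rho> \<in> G" "pairing e m \<rho> = 1" "\<forall>i\<in>{1..e}. \<rho> = std i \<longrightarrow> m = std i"
    and x0: "x0 \<in> punctured n" "\<Psi> x0 = orbit e \<Sigma> (deg_point \<rho>)"
  shows "\<exists>L q. (\<forall>v. regular_at {0..n} (punctured n) (\<lambda>x. L x v) x0) \<and> L x0 = deg_point \<rho> \<and>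
    q \<in> poly_fun {0..n} \<and> q x0 \<noteq> 0 \<and>
    (\<forall>x\<in>punctured n. q x \<noteq> 0 \<longrightarrow> L x \<in> U \<and> \<Psi> x = orbit e \<Sigma> (L x))"
proof -
  define V where "V = {X \<in> U. \<forall>v\<in>G - {\<rho>}. X v \<noteq> 0}"
  define L where "L x v = lift_fun U (orbit e \<Sigma>) (\<lambda>X. nform \<rho> m X v) (\<Psi> x)" for x v
  have V: "openin (Top (quasi_affine G U)) V"
    unfolding openin_quasi_affine[OF UG]
  proof (intro conjI ballI)
    show "V \<subseteq> U" by (auto simp: V_def)
    fix X assume "X \<in> V"
    then show "\<exists>q\<in>poly_fun G. q X \<noteq> 0 \<and> (\<forall>y\<in>U. q y \<noteq> 0 \<longrightarrow> y \<in> V)"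
      using finG by (intro bexI[of _ "\<lambda>X. \<Prod>v\<in>G - {\<rho>}. X v"] poly_fun_prod poly_fun.coord) (auto simp: V_def)
  qed
  have sat: "Y \<in> V" if XY: "X \<in> V" "Y \<in> U" "orbit e \<Sigma> Y = orbit e \<Sigma> X" for X Y
  proof -
    obtain g where "\<And>v. g v \<noteq> 0" "Y = (\<lambda>v. g v * X v)"
      using orbit_saturated[of X Y] XY unfolding V_def by blast
    then show ?thesis using XY(1,2) by (simp add: V_def)
  qed
  have inv: "nform \<rho> m X v = nform \<rho> m Y v" if XY: "X \<in> U" "Y \<in> U" "orbit e \<Sigma> X = orbit e \<Sigma> Y" for X Y v
  proof -
    obtain g where g: "g \<in> tor e G" "Y = (\<lambda>v. g v * X v)"
      using orbit_saturated[OF XY(1,2) XY(3)[symmetric]] by blast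
    show ?thesis unfolding g(2) by (rule fun_cong[OF nform_invariant[OF g(1) \<rho>(1,2), symmetric]])
  qed
  have L: "L x = nform \<rho> m X" if "X \<in> U" "\<Psi> x = orbit e \<Sigma> X" for x X
  proof
    fix v
    show "L x v = nform \<rho> m X v"
      unfolding L_def that(2) by (rule lift_fun_eq[OF that(1) inv])
  qed
  have P: "deg_point \<rho> \<in> V" using deg_point_U[OF \<rho>(1)] by (simp add: V_def deg_point_def)
  have T: "punctured n \<subseteq> tuples {0..n}" by blast
  have nreg: "regular_at G U (\<lambda>X. nform \<rho> m X v) X" if "X \<in> V" for X v
    by (rule nform_regular[OF _ _ \<rho>(1)]) (use that in \<open>auto simp: V_def\<close>)
  have Lreg: "regular_at {0..n} (punctured n) (\<lambda>x. L x v) x0" for v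
    unfolding L_def
    by (rule regular_at_pullback(1)[where h = "\<lambda>X. nform \<rho> m X v" and V = V and x = "deg_point \<rho>",
          OF UG T \<Psi>_morphism V sat nreg inv x0(1) P x0(2)])
  have "\<exists>q\<in>poly_fun {0..n}. q x0 \<noteq> 0 \<and> (\<forall>x\<in>punctured n. q x \<noteq> 0 \<longrightarrow> \<Psi> x \<in> orbit e \<Sigma> ` V)"
    by (rule regular_at_pullback(2)[where h = "\<lambda>_. 0" and V = V and x = "deg_point \<rho>", OF UG T \<Psi>_morphism V sat regular_at_poly[OF poly_fun.const] refl x0(1) P x0(2)])
  then obtain q where q: "q \<in> poly_fun {0..n}" "q x0 \<noteq> 0" "\<And>x. x \<in> punctured n \<Longrightarrow> q x \<noteq> 0 \<Longrightarrow> \<Psi> x \<in> orbit e \<Sigma> ` V"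
    by blast
  show ?thesis
  proof (intro exI conjI ballI impI)
    show "\<forall>v. regular_at {0..n} (punctured n) (\<lambda>x. L x v) x0" using Lreg by (rule allI)
    show "q \<in> poly_fun {0..n}" "q x0 \<noteq> 0" by (rule q(1,2))+
    show "L x0 = deg_point \<rho>"
      using L[OF deg_point_U[OF \<rho>(1)] x0(2)] nform_deg_point[OF \<rho>(1)] by simp
    fix x assume x: "x \<in> punctured n" "q x \<noteq> 0"
    obtain X where X: "X \<in> V" "\<Psi> x = orbit e \<Sigma> X" using q(3)[OF x] by blast
    have XU: "X \<in> U" using X(1) by (simp add: V_def)
    obtain g where g: "g \<in> tor e G" "nform \<rho> m X = (\<lambda>v. g v * X v)"
      using nform_in_orbit[of \<rho> X m] X(1) XU UG \<rho> unfolding V_def by blast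
    have "(\<lambda>v. g v * X v) \<in> U" by (rule tor_mult_in_U_fan[OF finG XU tor_nonzero[OF g(1)]])
    then show "L x \<in> U" unfolding L[OF XU X(2)] g(2) .
    show "\<Psi> x = orbit e \<Sigma> (L x)" unfolding L[OF XU X(2)] g(2) orbit_tor[OF XU g(1)] by (rule X(2))
  qed
qed

text \<open>Dividing by the power of a coordinate nonzero at \<open>x0\<close> makes
  \<open>g\<close> a function on projective space near that point. On the toric side it is regular
  at \<open>deg_point \<rho>\<close> and vanishes where the coordinate of \<rho> does, so its
  numerator is divisible by this coordinate.\<close>

lemma homogeneous_local_factor:
  assumes \<rho>: "\<rho> \<in> G" and x0: "x0 \<in> punctured n" "\<Psi> x0 = orbit e \<Sigma> (deg_point \<rho>)" and i: "i \<in> {0..n}" "x0 i \<noteq> 0"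
    and g: "g \<in> poly_fun {0..n}" "\<forall>s x. g (\<lambda>i. s * x i) = s ^ M * g x" "\<forall>x\<in>divisor_cone \<rho>. g x = 0"
  shows "\<exists>\<alpha>\<in>poly_fun G. \<exists>\<beta>\<in>poly_fun G. \<beta> (deg_point \<rho>) \<noteq> 0 \<and>
    (\<forall>X\<in>U. \<forall>x\<in>punctured n. \<Psi> x = orbit e \<Sigma> X \<longrightarrow> \<beta> X \<noteq> 0 \<longrightarrow> g x / x i ^ M = X \<rho> * \<alpha> X / \<beta> X)"
proof -
  let ?h = "\<lambda>x. g x / x i ^ M"
  have hinv: "?h x = ?h y" if xy: "line_class x = line_class y" for x y
  proof -
    obtain s where "s \<noteq> 0" "y = (\<lambda>i. s * x i)" using xy unfolding line_class_eq_iff by blast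
    then show ?thesis using g(2) by (simp add: power_mult_distrib)
  qed
  define \<Gamma> where "\<Gamma> X = lift_fun (punctured n) line_class ?h (\<Phi> X)" for X
  have \<Gamma>: "\<Gamma> X = ?h x" if "X \<in> U" "x \<in> punctured n" "\<Psi> x = orbit e \<Sigma> X" for X x
  proof -
    have cl: "\<Phi> X = line_class x" using \<Phi>_\<Psi>_iff[OF that(1,2)] that(3) by blast
    show ?thesis unfolding \<Gamma>_def cl by (rule lift_fun_eq[OF that(2) hinv])
  qed
  have P: "deg_point \<rho> \<in> U" by (rule deg_point_U[OF \<rho>])
  have "regular_at G U \<Gamma> (deg_point \<rho>)"
    unfolding \<Gamma>_def
  proof (rule regular_at_pullback(1)[OF _ UG \<Phi>_morphism openin_punctured_nonzero[OF poly_fun.coord[OF i(1)]] _ _ _ P])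
    show "punctured n \<subseteq> tuples {0..n}" by blast
    show "y \<in> {x \<in> punctured n. x i \<noteq> 0}"
      if xy: "x \<in> {x \<in> punctured n. x i \<noteq> 0}" "y \<in> punctured n" "line_class y = line_class x" for x y
    proof -
      have "line_class x = line_class y" using xy(3) by simp
      then obtain s where "s \<noteq> 0" "y = (\<lambda>i. s * x i)" unfolding line_class_eq_iff by blast
      then show ?thesis using xy(1,2) by simp
    qed
    show "regular_at {0..n} (punctured n) ?h x" if "x \<in> {x \<in> punctured n. x i \<noteq> 0}" for x
      by (rule regular_atI[OF g(1) poly_fun_power[OF poly_fun.coord[OF i(1)]]]) (use that in auto)
    show "?h x = ?h y" if "line_class x = line_class y" for x y by (rule hinv[OF that])
    show "x0 \<in> {x \<in> punctured n. x i \<noteq> 0}" using x0(1) i(2) by simp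
    show "\<Phi> (deg_point \<rho>) = line_class x0" using \<Phi>_\<Psi>_iff[OF P x0(1)] x0(2) by blast
  qed
  then obtain p \<beta> where p: "p \<in> poly_fun G" "\<beta> \<in> poly_fun G" "\<beta> (deg_point \<rho>) \<noteq> 0"
    "\<And>X. X \<in> U \<Longrightarrow> \<beta> X \<noteq> 0 \<Longrightarrow> \<Gamma> X = p X / \<beta> X" by (rule regular_atE) blast
  \<comment> \<open>Outside the zeros of \<open>?H\<close> only the coordinate of \<rho> can vanish,
    which guarantees membership in \<open>U\<close>, and the fraction for \<Gamma> is valid.\<close>
  let ?H = "\<lambda>X. \<beta> X * (\<Prod>v\<in>G - {\<rho>}. X v)"
  have "\<exists>p'\<in>poly_fun G. \<forall>X. p X = X \<rho> * p' X"
  proof (rule poly_fun_coord_dvd[OF p(1), where h = ?H and ?x0.0 = "deg_point \<rho>"])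
    show "?H \<in> poly_fun G" by (intro poly_fun.mult p(2) poly_fun_prod poly_fun.coord) auto
    show "?H (deg_point \<rho>) \<noteq> 0" using p(3) finG by (simp add: deg_point_def)
    show "deg_point \<rho> \<rho> = 0" by (rule deg_point_zero)
    fix X assume X: "X \<in> tuples G" "X \<rho> = 0" "?H X \<noteq> 0"
    have XU: "X \<in> U" by (rule in_U[OF X(1) \<rho>]) (use X(3) finG in auto)
    obtain x where x: "x \<in> punctured n" "\<Phi> X = line_class x" using \<Phi>_rep[OF XU] .
    have \<Psi>x: "\<Psi> x = orbit e \<Sigma> X" using \<Phi>_\<Psi>_iff[OF XU x(1)] x(2) by blast
    have "g x = 0" using g(3) divisor_cone_iff[OF x(1) XU \<Psi>x] X(2) by blast
    then have "\<Gamma> X = 0" using \<Gamma>[OF XU x(1) \<Psi>x] by simp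
    then show "p X = 0" using p(4)[OF XU] X(3) by simp
  qed
  then obtain \<alpha> where \<alpha>: "\<alpha> \<in> poly_fun G" "\<And>X. p X = X \<rho> * \<alpha> X" by blast
  show ?thesis
  proof (rule bexI[OF _ \<alpha>(1)], rule bexI[OF _ p(2)], intro conjI p(3) ballI impI)
    fix X x assume X: "X \<in> U" "x \<in> punctured n" "\<Psi> x = orbit e \<Sigma> X" "\<beta> X \<noteq> 0"
    show "g x / x i ^ M = X \<rho> * \<alpha> X / \<beta> X"
      using \<Gamma>[OF X(1-3)] p(4)[OF X(1,4)] \<alpha>(2)[of X] by simp
  qed
qed

lemma fraction_cross_multiply:
  fixes g :: complex
  assumes "g / y = (u / w) * (a1 / a2) / (b1 / b2)" "y \<noteq> 0" "w \<noteq> 0" "a2 \<noteq> 0" "b1 \<noteq> 0" "b2 \<noteq> 0"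
  shows "g * (w * a2 * b1) = y * u * a1 * b2"
proof -
  have "g = y * ((u / w) * (a1 / a2) / (b1 / b2))" using assms(1,2) by (simp add: divide_eq_eq mult.commute)
  then show ?thesis using assms(2-) by simp
qed

text \<open>Let \<open>u\<close> be the numerator of the lifted coordinate of \<rho> and
  \<open>f\<close> a prime factor of \<open>u\<close> vanishing at \<open>x0\<close>. Substituting
  the lift into the local factorization of \<open>g\<close> gives an identity in which
  \<open>g\<close> times a polynomial nonzero at \<open>x0\<close> is a multiple of
  \<open>u\<close>. The prime \<open>f\<close> cannot divide that polynomial, so it divides
  \<open>g\<close>.\<close>

lemma divisor_generator:
  assumes \<rho>: "\<rho> \<in> G" "pairing e m \<rho> = 1" "\<forall>i\<in>{1..e}. \<rho> = std i \<longrightarrow> m = std i"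
    and x0: "x0 \<in> punctured n" "\<Psi> x0 = orbit e \<Sigma> (deg_point \<rho>)"
  shows "\<exists>f\<in>poly_fun {0..n}. f x0 = 0 \<and>
    (\<forall>g\<in>poly_fun {0..n}. \<forall>M. (\<forall>s x. g (\<lambda>i. s * x i) = s ^ M * g x) \<longrightarrow> (\<forall>x\<in>divisor_cone \<rho>. g x = 0) \<longrightarrow>
      (\<forall>x. f x = 0 \<longrightarrow> g x = 0))"
proof -
  obtain L q where LQ: "(\<forall>v. regular_at {0..n} (punctured n) (\<lambda>x. L x v) x0) \<and> L x0 = deg_point \<rho> \<and>
    q \<in> poly_fun {0..n} \<and> q x0 \<noteq> 0 \<and>
    (\<forall>x\<in>punctured n. q x \<noteq> 0 \<longrightarrow> L x \<in> U \<and> \<Psi> x = orbit e \<Sigma> (L x))"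
    using local_lift[OF \<rho> x0] by (elim exE) (rule that)
  then have L: "\<And>v. regular_at {0..n} (punctured n) (\<lambda>x. L x v) x0" "L x0 = deg_point \<rho>"
    and q: "q \<in> poly_fun {0..n}" "q x0 \<noteq> 0" by blast+
  have Lq: "L x \<in> U \<and> \<Psi> x = orbit e \<Sigma> (L x)" if "x \<in> punctured n" "q x \<noteq> 0" for x
    using LQ that by blast
  have x0t: "x0 \<in> tuples {0..n}" using x0(1) by blast
  obtain i where i: "i \<in> {0..n}" "x0 i \<noteq> 0"
  proof (rule ccontr)
    assume no: "\<not> thesis"
    have "x0 i = 0" for i
      using no that x0t by (cases "i \<in> {0..n}") (auto simp: tuples_def)
    then show False using x0(1) by auto
  qed
  have nz: "x \<in> punctured n" if "x \<in> tuples {0..n}" "x i \<noteq> 0" for x using that by auto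
  from L(1)[of \<rho>] obtain u w where u: "u \<in> poly_fun {0..n}" "w \<in> poly_fun {0..n}" "w x0 \<noteq> 0"
    "\<And>x. x \<in> punctured n \<Longrightarrow> w x \<noteq> 0 \<Longrightarrow> L x \<rho> = u x / w x" by (rule regular_atE) blast
  have ux0: "u x0 = 0" using u(4)[OF x0(1) u(3)] u(3) L(2) deg_point_zero by simp
  have coord: "(\<lambda>x. x i) \<in> poly_fun {0..n}" by (rule poly_fun.coord[OF i(1)])
  \<comment> \<open>If \<open>u\<close> were zero, a dense set of points would belong to the cone,
    and a homogeneous polynomial separating a point from the cone would vanish identically.\<close>
  have une: "\<exists>x. u x \<noteq> 0"
  proof (rule ccontr)
    assume "\<nexists>x. u x \<noteq> 0"
    then have u0: "u x = 0" for x by simp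
    obtain y where y: "y \<in> punctured n" "y \<notin> divisor_cone \<rho>" using divisor_cone_proper[OF \<rho>(1)] by blast
    obtain g M where g': "g \<in> poly_fun {0..n}" "\<forall>s x. g (\<lambda>i. s * x i) = s ^ M * g x"
        "\<forall>x\<in>divisor_cone \<rho>. g x = 0" "g y \<noteq> 0"
      using homogeneous_separation[OF y] by (elim exE conjE bexE) (rule that)
    have g: "g \<in> poly_fun {0..n}" "x \<in> divisor_cone \<rho> \<Longrightarrow> g x = 0" "g y \<noteq> 0" for x using g' by auto
    have "g y = 0"
    proof (rule poly_fun_eqI[OF g(1) poly_fun.const])
      show "(\<lambda>x. w x * q x * x i) \<in> poly_fun {0..n}" by (intro poly_fun.mult u(2) q(1) coord)
      show "w x0 * q x0 * x0 i \<noteq> 0" using u(3) q(2) i(2) by simp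
      fix x assume x: "x \<in> tuples {0..n}" "w x * q x * x i \<noteq> 0"
      have xp: "x \<in> punctured n" using nz x by auto
      have "L x \<rho> = 0" using u(4)[OF xp] x(2) u0 by simp
      moreover have "L x \<in> U" "\<Psi> x = orbit e \<Sigma> (L x)" using Lq[OF xp] x(2) by auto
      ultimately have "x \<in> divisor_cone \<rho>" using divisor_cone_iff[OF xp] by blast
      then show "g x = 0" by (rule g(2))
    qed
    then show False using g(3) by blast
  qed
  from poly_fun_prime_factor[OF _ u(1) x0t ux0 une] obtain f where
    f: "f \<in> poly_fun {0..n}" "f x0 = 0" "\<exists>g\<in>poly_fun {0..n}. \<forall>x. u x = f x * g x" and
    prime: "\<forall>p\<in>poly_fun {0..n}. \<forall>q\<in>poly_fun {0..n}. (\<exists>g\<in>poly_fun {0..n}. \<forall>x. p x * q x = f x * g x) \<longrightarrow>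
       (\<exists>g\<in>poly_fun {0..n}. \<forall>x. p x = f x * g x) \<or> (\<exists>g\<in>poly_fun {0..n}. \<forall>x. q x = f x * g x)"
    by auto
  from f(3) obtain f' where f': "f' \<in> poly_fun {0..n}" "\<And>x. u x = f x * f' x" by blast
  show ?thesis
  proof (intro bexI[OF _ f(1)] conjI f(2) ballI allI impI)
    fix g M x
    assume g: "g \<in> poly_fun {0..n}" "\<forall>s x. g (\<lambda>i. s * x i) = s ^ M * g x" "\<forall>x\<in>divisor_cone \<rho>. g x = 0"
      and fx: "f x = 0"
    obtain \<alpha> \<beta> where ab: "\<alpha> \<in> poly_fun G" "\<beta> \<in> poly_fun G" "\<beta> (deg_point \<rho>) \<noteq> 0"
      and ab': "\<forall>X\<in>U. \<forall>x\<in>punctured n. \<Psi> x = orbit e \<Sigma> X \<longrightarrow> \<beta> X \<noteq> 0 \<longrightarrow> g x / x i ^ M = X \<rho> * \<alpha> X / \<beta> X"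
      using homogeneous_local_factor[OF \<rho>(1) x0 i g] by (elim bexE conjE) (rule that)
    have "regular_at {0..n} (punctured n) (\<lambda>x. \<alpha> (L x)) x0" by (rule regular_at_poly_compose[OF ab(1) L(1)])
    then obtain a1 a2 where a: "a1 \<in> poly_fun {0..n}" "a2 \<in> poly_fun {0..n}" "a2 x0 \<noteq> 0"
      "\<And>x. x \<in> punctured n \<Longrightarrow> a2 x \<noteq> 0 \<Longrightarrow> \<alpha> (L x) = a1 x / a2 x" by (rule regular_atE) blast
    have "regular_at {0..n} (punctured n) (\<lambda>x. \<beta> (L x)) x0" by (rule regular_at_poly_compose[OF ab(2) L(1)])
    then obtain b1 b2 where b: "b1 \<in> poly_fun {0..n}" "b2 \<in> poly_fun {0..n}" "b2 x0 \<noteq> 0"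
      "\<And>x. x \<in> punctured n \<Longrightarrow> b2 x \<noteq> 0 \<Longrightarrow> \<beta> (L x) = b1 x / b2 x" by (rule regular_atE) blast
    have b1: "b1 x0 \<noteq> 0" using b(3) b(4)[OF x0(1) b(3)] ab(3) L(2) by auto
    let ?v = "\<lambda>x. w x * a2 x * b1 x"
    have vp: "?v \<in> poly_fun {0..n}" by (intro poly_fun.mult u(2) a(2) b(1))
    \<comment> \<open>The fractions can be compared only where all denominators are nonzero; by
      density the cross-multiplied identity holds everywhere.\<close>
    have id: "g y * ?v y = y i ^ M * u y * a1 y * b2 y" for y
    proof (rule poly_fun_eqI[where p = "\<lambda>y. g y * ?v y" and q = "\<lambda>y. y i ^ M * u y * a1 y * b2 y"
          and h = "\<lambda>x. q x * w x * a2 x * b1 x * b2 x * x i" and ?x0.0 = x0])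
      show "(\<lambda>y. g y * ?v y) \<in> poly_fun {0..n}" by (intro poly_fun.mult g(1) vp)
      show "(\<lambda>y. y i ^ M * u y * a1 y * b2 y) \<in> poly_fun {0..n}"
        by (intro poly_fun.mult poly_fun_power coord u(1) a(1) b(2))
      show "(\<lambda>x. q x * w x * a2 x * b1 x * b2 x * x i) \<in> poly_fun {0..n}"
        by (intro poly_fun.mult q(1) u(2) a(2) b(1,2) coord)
      show "q x0 * w x0 * a2 x0 * b1 x0 * b2 x0 * x0 i \<noteq> 0" using q(2) u(3) a(3) b1 b(3) i(2) by simp
      fix y assume y: "y \<in> tuples {0..n}" "q y * w y * a2 y * b1 y * b2 y * y i \<noteq> 0"
      have n0: "q y \<noteq> 0" "w y \<noteq> 0" "a2 y \<noteq> 0" "b1 y \<noteq> 0" "b2 y \<noteq> 0" "y i \<noteq> 0" using y(2) by auto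
      have yp: "y \<in> punctured n" by (rule nz[OF y(1) n0(6)])
      have LU: "L y \<in> U" "\<Psi> y = orbit e \<Sigma> (L y)" using Lq[OF yp n0(1)] by blast+
      have \<beta>0: "\<beta> (L y) \<noteq> 0" using b(4)[OF yp n0(5)] n0(4,5) by simp
      have "g y / y i ^ M = L y \<rho> * \<alpha> (L y) / \<beta> (L y)"
        by (rule mp[OF mp[OF bspec[OF bspec[OF ab' LU(1)] yp] LU(2)] \<beta>0])
      then have "g y / y i ^ M = (u y / w y) * (a1 y / a2 y) / (b1 y / b2 y)"
        unfolding u(4)[OF yp n0(2)] a(4)[OF yp n0(3)] b(4)[OF yp n0(5)] .
      then show "g y * ?v y = y i ^ M * u y * a1 y * b2 y"
        by (rule fraction_cross_multiply) (use n0 in auto)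
    qed
    have "g y * ?v y = f y * (y i ^ M * f' y * a1 y * b2 y)" for y
      unfolding id f'(2) by (simp only: mult_ac)
    moreover have "(\<lambda>y. y i ^ M * f' y * a1 y * b2 y) \<in> poly_fun {0..n}"
      by (intro poly_fun.mult poly_fun_power coord f'(1) a(1) b(2))
    ultimately have "\<exists>h\<in>poly_fun {0..n}. \<forall>y. g y * ?v y = f y * h y"
      by (intro bexI[of _ "\<lambda>y. y i ^ M * f' y * a1 y * b2 y"]) auto
    then have "(\<exists>h\<in>poly_fun {0..n}. \<forall>y. g y = f y * h y) \<or> (\<exists>h\<in>poly_fun {0..n}. \<forall>y. ?v y = f y * h y)"
      using bspec[OF bspec[OF prime g(1)] vp] by blast
    moreover have "\<not> (\<exists>h\<in>poly_fun {0..n}. \<forall>y. ?v y = f y * h y)"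
    proof
      assume "\<exists>h\<in>poly_fun {0..n}. \<forall>y. ?v y = f y * h y"
      then obtain h where "\<And>y. ?v y = f y * h y" by blast
      from this[of x0] show False using u(3) a(3) b1 f(2) by simp
    qed
    ultimately obtain h where "\<And>y. g y = f y * h y" by blast
    then show "g x = 0" using fx by simp
  qed
qed

text \<open>Zeros of \<open>f\<close> lie in the cone, since any point outside is separated from it
  by a homogeneous polynomial, which vanishes wherever \<open>f\<close> does. Off the cone
  \<open>f\<close> therefore has no zero along the punctured line through a point, so its
  restriction to the line is a monomial; a density argument makes the exponent constant, and
  \<open>f\<close> is homogeneous.\<close>

lemma divisor_equation:
  assumes \<rho>: "\<rho> \<in> G" "pairing e m \<rho> = 1" "\<forall>i\<in>{1..e}. \<rho> = std i \<longrightarrow> m = std i"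
    and x0: "x0 \<in> punctured n" "\<Psi> x0 = orbit e \<Sigma> (deg_point \<rho>)"
  shows "\<exists>f\<in>poly_fun {0..n}. \<exists>N. f x0 = 0 \<and> 1 \<le> N \<and> (\<forall>s x. f (\<lambda>i. s * x i) = s ^ N * f x) \<and>
    (\<forall>x\<in>punctured n. f x = 0 \<longrightarrow> x \<in> divisor_cone \<rho>)"
proof -
  obtain f where f: "f \<in> poly_fun {0..n}" "f x0 = 0"
    and gen: "\<forall>g\<in>poly_fun {0..n}. \<forall>M. (\<forall>s x. g (\<lambda>i. s * x i) = s ^ M * g x) \<longrightarrow> (\<forall>x\<in>divisor_cone \<rho>. g x = 0) \<longrightarrow>
      (\<forall>x. f x = 0 \<longrightarrow> g x = 0)"
    using divisor_generator[OF \<rho> x0] by (elim bexE conjE) (rule that)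
  have V: "x \<in> divisor_cone \<rho>" if x: "x \<in> punctured n" "f x = 0" for x
  proof (rule ccontr)
    assume nx: "x \<notin> divisor_cone \<rho>"
    obtain g M where g: "g \<in> poly_fun {0..n}" "\<forall>s x. g (\<lambda>i. s * x i) = s ^ M * g x"
      "\<forall>x\<in>divisor_cone \<rho>. g x = 0" "g x \<noteq> 0"
      using homogeneous_separation[OF x(1) nx] by (elim exE conjE bexE) (rule that)
    have "f x = 0 \<longrightarrow> g x = 0"
      by (rule spec[OF mp[OF mp[OF spec[OF bspec[OF gen g(1)]] g(2)] g(3)]])
    then show False using x(2) g(4) by blast
  qed
  obtain P where P: "\<And>i. (\<lambda>x. coeff (P x) i) \<in> poly_fun {0..n}" "\<And>x l. f (\<lambda>i. l * x i) = poly (P x) l"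
    using poly_fun_homogeneous_components[OF f(1)] by metis
  have mono: "\<exists>c N. P x = monom c N" if x: "x \<in> punctured n" "x \<notin> divisor_cone \<rho>" for x
  proof (rule no_nonzero_root_monom)
    fix s :: complex assume s: "s \<noteq> 0"
    have "(\<lambda>i. s * x i) \<notin> divisor_cone \<rho>"
    proof
      assume "(\<lambda>i. s * x i) \<in> divisor_cone \<rho>"
      then have "(\<lambda>i. inverse s * (s * x i)) \<in> divisor_cone \<rho>" by (rule divisor_cone_scale) (use s in simp)
      moreover have "(\<lambda>i. inverse s * (s * x i)) = x" using s by (simp add: mult.assoc[symmetric])
      ultimately show False using x(2) by simp
    qed
    then show "poly (P x) s \<noteq> 0" using V[OF punctured_scale[OF x(1) s]] P(2)[of s x] by metis
  qed
  obtain y where y: "y \<in> punctured n" "y \<notin> divisor_cone \<rho>" using divisor_cone_proper[OF \<rho>(1)] by blast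
  obtain g M where g': "g \<in> poly_fun {0..n}" "\<forall>s x. g (\<lambda>i. s * x i) = s ^ M * g x"
      "\<forall>x\<in>divisor_cone \<rho>. g x = 0" "g y \<noteq> 0"
    using homogeneous_separation[OF y] by (elim exE conjE bexE) (rule that)
  have g: "g \<in> poly_fun {0..n}" "x \<in> divisor_cone \<rho> \<Longrightarrow> g x = 0" "g y \<noteq> 0" for x using g' by auto
  obtain c N where N: "P y = monom c N" using mono[OF y] by blast
  have fy: "f y \<noteq> 0" using V[OF y(1)] y(2) by blast
  have val: "f x = poly (P x) 1" for x using P(2)[of 1 x] by simp
  have c0: "c \<noteq> 0" using fy unfolding val N by (simp add: poly_monom)
  obtain l where l: "y l \<noteq> 0" using y(1) by auto
  have lI: "l \<in> {0..n}" using y(1) l by (auto simp: tuples_def)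
  \<comment> \<open>A second nonzero component would be nonzero, together with the
    \<open>N\<close>-th one, at some point \<open>z\<close> off the cone, although there
    \<open>P z\<close> is a monomial. The coordinate function of \<open>l\<close> keeps
    \<open>z\<close> away from the origin.\<close>
  have zero: "coeff (P x) i = 0" if i: "i \<noteq> N" for x i
  proof (rule ccontr)
    assume ne: "coeff (P x) i \<noteq> 0"
    let ?S = "{\<lambda>x. coeff (P x) i, \<lambda>x. coeff (P x) N, g, \<lambda>x. x l}"
    have "\<exists>z\<in>tuples {0..n}. \<forall>p\<in>?S. p z \<noteq> 0"
    proof (rule poly_fun_common_nonzero)
      fix p assume p: "p \<in> ?S"
      show pp: "p \<in> poly_fun {0..n}" using p P(1) g(1) poly_fun.coord[OF lI] by auto
      have "p x \<noteq> 0 \<or> p y \<noteq> 0" using p ne c0 g(3) l by (auto simp: N)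
      then show "\<exists>x\<in>tuples {0..n}. p x \<noteq> 0" using poly_fun_nonzero_on_tuples[OF pp] by blast
    qed simp
    then obtain z where z: "z \<in> tuples {0..n}" "coeff (P z) i \<noteq> 0" "coeff (P z) N \<noteq> 0" "g z \<noteq> 0" "z l \<noteq> 0" by auto
    have "z \<in> punctured n" using z(1,5) by auto
    moreover have "z \<notin> divisor_cone \<rho>" using g(2) z(4) by blast
    ultimately obtain c' N' where "P z = monom c' N'" using mono by blast
    then show False using z(2,3) i by (auto split: if_splits)
  qed
  have Pm: "P x = monom (f x) N" for x
  proof -
    have "P x = monom (coeff (P x) N) N" by (rule poly_eqI) (use zero in auto)
    moreover from this have "f x = coeff (P x) N" unfolding val by (metis poly_monom power_one mult.right_neutral)
    ultimately show ?thesis by simp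
  qed
  have hom: "f (\<lambda>i. s * x i) = s ^ N * f x" for s x
    unfolding P(2) by (subst Pm) (simp add: poly_monom mult.commute)
  \<comment> \<open>For exponent 0, scaling by 0 shows that \<open>f\<close> is constant, but it
    vanishes at \<open>x0\<close> and not at \<open>y\<close>.\<close>
  have "N \<noteq> 0"
  proof
    assume "N = 0"
    then have "f x0 = f y" using hom[of 0 x0] hom[of 0 y] by simp
    then show False using f(2) fy by simp
  qed
  then have "1 \<le> N" by simp
  then show ?thesis
    by (intro bexI[OF _ f(1)] exI[of _ N] conjI f(2) allI hom ballI impI V)
qed

end

context proj_fan
begin

text \<open>The equations \<open>f\<close> and \<open>h\<close> of the two divisors have degrees
  \<open>M\<close> and \<open>N\<close>; raising \<open>f\<close> to the power \<open>N\<close> and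
  \<open>h\<close> to the power \<open>M\<close> makes the degrees equal. Both exponents are at
  least 1, so the zero sets do not change.\<close>

lemma projective_space_forces_zero:
  assumes j: "j \<in> {2..r}"
  shows "a j 1 = 0"
proof -
  have pt: "\<exists>x\<in>punctured n. \<Phi> (deg_point \<rho>) = line_class x \<and> \<Psi> x = orbit e \<Sigma> (deg_point \<rho>)" if \<rho>: "\<rho> \<in> G" for \<rho>
  proof -
    obtain x where x: "x \<in> punctured n" "\<Phi> (deg_point \<rho>) = line_class x" using \<Phi>_rep[OF deg_point_U[OF \<rho>]] .
    then show ?thesis using \<Phi>_\<Psi>_iff[OF deg_point_U[OF \<rho>] x(1)] by blast
  qed
  obtain x where x: "x \<in> punctured n" "\<Phi> (deg_point (std 1)) = line_class x" "\<Psi> x = orbit e \<Sigma> (deg_point (std 1))"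
    using pt[OF std1_a1(1)] by blast
  obtain y where y: "y \<in> punctured n" "\<Psi> y = orbit e \<Sigma> (deg_point (a 1))"
    using pt[OF std1_a1(2)] by blast
  have "pairing e (std 1) (std 1) = 1" unfolding pairing_std[OF one_in(1)] by (simp add: std_def)
  moreover have "\<forall>i\<in>{1..e}. std 1 = std i \<longrightarrow> std 1 = std i" by blast
  ultimately obtain f M where f: "f \<in> poly_fun {0..n}" "f x = 0" "1 \<le> M" "\<forall>s x. f (\<lambda>i. s * x i) = s ^ M * f x"
    "\<forall>x\<in>punctured n. f x = 0 \<longrightarrow> x \<in> divisor_cone (std 1)"
    using divisor_equation[OF std1_a1(1) _ _ x(1,3), of "std 1"] by blast
  \<comment> \<open>The ray of \<open>a 1\<close> is a nonsingular cone, and its dual vector is the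
    character taking the value 1 on \<open>a 1\<close> that the normal form requires. For
    \<open>std 1\<close> the coordinate character serves.\<close>
  have c: "cone_of {a 1} \<in> \<Sigma>" using gens_rvec_in[OF std1_a1(2)] by blast
  obtain S \<mu> where S: "\<And>u u'. u \<in> S \<Longrightarrow> u' \<in> S \<Longrightarrow> pairing e (\<mu> u) u' = (if u = u' then 1 else 0)"
    "\<And>v. v \<in> G \<Longrightarrow> rvec v \<in> cone_of {a 1} \<Longrightarrow> v \<in> S"
    using fan_cone[OF fanG c] by metis
  have "a 1 \<in> S" using S(2) gens_rvec_in[OF std1_a1(2)] std1_a1(2) by blast
  then have "pairing e (\<mu> (a 1)) (a 1) = 1" using S(1) by simp
  moreover have "\<forall>i\<in>{1..e}. a 1 = std i \<longrightarrow> \<mu> (a 1) = std i" using std_a(3) one_in(2) by metis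
  ultimately obtain h N where h: "h \<in> poly_fun {0..n}" "h y = 0" "1 \<le> N" "\<forall>s x. h (\<lambda>i. s * x i) = s ^ N * h x"
    "\<forall>x\<in>punctured n. h x = 0 \<longrightarrow> x \<in> divisor_cone (a 1)"
    using divisor_equation[OF std1_a1(2) _ _ y, of "\<mu> (a 1)"] by blast
  have hom: "(\<lambda>z. p z ^ l) \<in> poly_fun {0..n}" if "p \<in> poly_fun {0..n}" for p l by (rule poly_fun_power[OF that])
  show ?thesis
  proof (rule map_to_projective_space_forces_zero[where A = "\<lambda>z. f z ^ N" and B = "\<lambda>z. h z ^ M" and N = "M * N" and \<Theta> = \<Phi>])
    show "morphism (quasi_affine G U) (proj_space n) \<Phi>" using \<Phi>_morphism unfolding proj_space_eq .
    show "\<Phi> (\<lambda>v. g v * X v) = \<Phi> X" if "X \<in> U" "g \<in> tor e G" for X g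
      unfolding \<Phi>_def orbit_tor[OF that] ..
    show "f (\<lambda>i. s * z i) ^ N = s ^ (M * N) * f z ^ N" for s z
      using f(4) by (simp add: power_mult_distrib power_mult)
    show "h (\<lambda>i. s * z i) ^ M = s ^ (M * N) * h z ^ M" for s z
      using h(4) by (simp add: power_mult_distrib power_mult[symmetric] mult.commute)
    show "X (std 1) = 0" if X: "X \<in> U" "z \<in> punctured n" "\<Phi> X = line_class z" "f z ^ N = 0" for X z
    proof -
      have "\<Psi> z = orbit e \<Sigma> X" using \<Phi>_\<Psi>_iff[OF X(1,2)] X(3) by blast
      moreover have "z \<in> divisor_cone (std 1)" using f(5) X(2,4) by auto
      ultimately show ?thesis using divisor_cone_iff[OF X(2,1)] by blast
    qed
    show "X (a 1) = 0" if X: "X \<in> U" "z \<in> punctured n" "\<Phi> X = line_class z" "h z ^ M = 0" for X z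
    proof -
      have "\<Psi> z = orbit e \<Sigma> X" using \<Phi>_\<Psi>_iff[OF X(1,2)] X(3) by blast
      moreover have "z \<in> divisor_cone (a 1)" using h(5) X(2,4) by auto
      ultimately show ?thesis using divisor_cone_iff[OF X(2,1)] by blast
    qed
    show "f x ^ N = 0" using f(2) h(3) by simp
  qed (rule hom[OF f(1)] hom[OF h(1)] x j)+
qed

end

section \<open>First coordinates of the rays \<open>a j\<close>\<close>

context basis_fan
begin

lemma tilde_forces_zero:
  assumes "isomorphic (toric e \<Sigma>) (proj_space e) \<or> bundle_with_fibers e \<Sigma> (std 1) (a 1)" and j: "j \<in> {2..r}"
  shows "a j 1 = 0"
  using assms(1)
proof
  assume "isomorphic (toric e \<Sigma>) (proj_space e)"
  then obtain \<phi> \<psi> where "morphism (toric e \<Sigma>) (proj_space e) \<phi>" "morphism (proj_space e) (toric e \<Sigma>) \<psi>"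
    "\<forall>p\<in>pts (toric e \<Sigma>). \<psi> (\<phi> p) = p" "\<forall>q\<in>pts (proj_space e). \<phi> (\<psi> q) = q"
    unfolding isomorphic_def isomorphism_def by blast
  then interpret proj_fan e r \<Sigma> a e \<phi> \<psi> by unfold_locales auto
  show ?thesis by (rule projective_space_forces_zero[OF j])
next
  assume "bundle_with_fibers e \<Sigma> (std 1) (a 1)"
  then show ?thesis using j by (rule bundle_forces_zero)
qed

text \<open>The vectors \<open>std 2\<close>, ..., \<open>std e\<close> lie in one cone. By
  completeness a cone on the side of negative first coordinate contains them too, and the only ray
  available on that side is \<open>a 1\<close>. Nonsingularity of this cone makes the first
  coordinate of \<open>a 1\<close> equal to 1 up to sign.\<close>

lemma a1_first_coordinate:
  assumes zero: "\<And>j. j \<in> {2..r} \<Longrightarrow> a j 1 = 0"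
    and \<sigma>: "\<sigma> \<in> \<Sigma>" "\<And>i. i \<in> {2..e} \<Longrightarrow> rvec (std i) \<in> \<sigma>"
  shows "a 1 1 = - 1"
proof -
  have "\<exists>\<tau>\<in>\<Sigma>. (\<forall>v\<in>std ` {2..e}. rvec v \<in> \<tau>) \<and> (\<exists>u\<in>gens \<Sigma>. rvec u \<in> \<tau> \<and> pairing e (std 1) u < 0)"
  proof (rule complete_fan_star[OF complete _ \<sigma>(1), where w = "\<lambda>i. - std 1 i"])
    show "(\<lambda>i. - std 1 i) \<in> lattice e" using e1 by (auto simp: lattice_def tuples_def std_def)
    show "pairing e (std 1) v = 0" if "v \<in> std ` {2..e}" for v
      using that unfolding pairing_std[OF one_in(1)] by (auto simp: std_def)
    show "pairing e (std 1) (\<lambda>i. - std 1 i) < 0" unfolding pairing_std[OF one_in(1)] by (simp add: std_def)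
  qed (use \<sigma>(2) in auto)
  then obtain \<tau> u where \<tau>: "\<tau> \<in> \<Sigma>" "\<And>i. i \<in> {2..e} \<Longrightarrow> rvec (std i) \<in> \<tau>" and u: "u \<in> G" "rvec u \<in> \<tau>" "u 1 < 0"
    unfolding pairing_std[OF one_in(1)] by blast
  have "u = a 1"
  proof (rule ccontr)
    assume "u \<noteq> a 1"
    from u(1) have "u \<in> std ` {1..e} \<or> u \<in> a ` {1..r}" unfolding gens(1) by blast
    then show False
    proof
      assume "u \<in> std ` {1..e}"
      then have "0 \<le> u 1" by (auto simp: std_def)
      then show False using u(3) by simp
    next
      assume "u \<in> a ` {1..r}"
      then obtain j where j: "j \<in> {1..r}" "u = a j" by blast
      then have "j \<noteq> 1" using \<open>u \<noteq> a 1\<close> by auto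
      then have "a j 1 = 0" using j(1) by (intro zero) auto
      then show False using u(3) j(2) by simp
    qed
  qed
  obtain S \<mu> where S: "\<And>u u'. u \<in> S \<Longrightarrow> u' \<in> S \<Longrightarrow> pairing e (\<mu> u) u' = (if u = u' then 1 else 0)"
    "\<And>v. v \<in> G \<Longrightarrow> rvec v \<in> \<tau> \<Longrightarrow> v \<in> S"
    using fan_cone[OF fanG \<tau>(1)] by metis
  have aS: "a 1 \<in> S" using S(2) u \<open>u = a 1\<close> by blast
  have \<mu>: "\<mu> (a 1) i = 0" if i: "i \<in> {2..e}" for i
  proof -
    have i1: "i \<in> {1..e}" using i by auto
    have "std i \<in> S" using S(2) std_a(1)[OF i1] \<tau>(2)[OF i] by blast
    moreover have "a 1 \<noteq> std i" using std_a(3)[OF i1 one_in(2)] by metis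
    ultimately show ?thesis using S(1)[OF aS, of "std i"] pairing_std_right[OF i1, of "\<mu> (a 1)"] by simp
  qed
  have "pairing e (\<mu> (a 1)) (a 1) = (\<Sum>i=1..e. if i = 1 then \<mu> (a 1) 1 * a 1 1 else 0)"
    unfolding pairing_def
  proof (rule sum.cong)
    fix i assume "i \<in> {1..e}"
    then show "\<mu> (a 1) i * a 1 i = (if i = 1 then \<mu> (a 1) 1 * a 1 1 else 0)"
      using \<mu>[of i] by (cases "i = 1") auto
  qed simp
  also have "\<dots> = \<mu> (a 1) 1 * a 1 1" using e1 by simp
  finally have "\<mu> (a 1) 1 * a 1 1 = 1" using S(1)[OF aS aS] by simp
  then have "\<bar>a 1 1\<bar> = 1" by (metis abs_zmult_eq_1 mult.commute abs_1)
  then show ?thesis using u(3) \<open>u = a 1\<close> by simp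
qed

end

theorem theorem3p3:
  fixes d r m n k :: nat
    and \<Sigma>t \<Sigma> :: "(nat \<Rightarrow> real) set set"
    and a b c :: "nat \<Rightarrow> nat \<Rightarrow> int"
    and t :: complex
  assumes d: "2 \<le> d"
    and fan_tilde: "complete_fan (d - 1) \<Sigma>t"
    and fan: "complete_fan d \<Sigma>"
    and subfan: "\<Sigma>t \<subseteq> \<Sigma>"
    and pos: "1 \<le> r" "1 \<le> m" "1 \<le> n"
    and gens_tilde: "gens \<Sigma>t = std ` {1..<d} \<union> a ` {1..r}"
      "inj_on a {1..r}" "std ` {1..<d} \<inter> a ` {1..r} = {}"
    and gens_plus: "gens (plus_fan d \<Sigma>) = b ` {1..m} \<union> gens \<Sigma>t"
      "inj_on b {1..m}" "b ` {1..m} \<inter> gens \<Sigma>t = {}"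
    and gens_minus: "gens (minus_fan d \<Sigma>) = c ` {1..n} \<union> gens \<Sigma>t"
      "inj_on c {1..n}" "c ` {1..n} \<inter> gens \<Sigma>t = {}"
    and b1: "b 1 = std d"
    and tilde: "isomorphic (toric (d - 1) \<Sigma>t) (proj_space (d - 1)) \<or>
      bundle_with_fibers (d - 1) \<Sigma>t (std 1) (a 1)"
    and cone_plus: "cone_of (std ` {1..<d} \<union> {b 1}) \<in> plus_fan d \<Sigma>"
    and cone_minus: "cone_of (std ` {1..<d} \<union> {c 1}) \<in> minus_fan d \<Sigma>"
    and cond1: "\<forall>j \<in> {2..m}. b j 1 = 0"
    and cond2: "\<forall>j \<in> {1..n}. 0 \<le> int k * c j d + c j 1"
    and t: "t \<noteq> 0"
  shows "isomorphic (deformed_variety d \<Sigma>t \<Sigma> r m n a b c k t)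
    (toric d (q_minus_fan d (\<lambda>i. if i = 1 then 2 * int k else - int k * a 1 i) \<Sigma>))"
proof -
  interpret split_fan d \<Sigma>t \<Sigma>
    using d fan_tilde fan subfan by unfold_locales
  have up: "{1..<d} = {1..d - 1}" using d by auto
  interpret base: basis_fan "d - 1" r \<Sigma>t a
    using d pos(1) fan_tilde gens_tilde unfolding up by unfold_locales simp_all
  have zero: "a j 1 = 0" if "j \<in> {2..r}" for j
    using tilde that by (rule base.tilde_forces_zero)
  \<comment> \<open>The cone spanned by the standard basis contains \<open>std 2\<close>, ...,
    \<open>std (d - 1)\<close>; \<open>conv_tilde\<close> replaces it by a cone of
    \<open>\<Sigma>t\<close>, from which the opposite side is explored.\<close>
  have "\<exists>\<tau>\<in>\<Sigma>t. \<forall>v\<in>std ` {2..d - 1}. rvec v \<in> \<tau>"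
  proof (rule conv_tilde)
    show "std ` {2..d - 1} \<subseteq> gens \<Sigma>t" unfolding gens_tilde(1) by auto
    show "cone_of (std ` {1..<d} \<union> {b 1}) \<in> \<Sigma>" using cone_plus by (simp add: plus_fan_def)
    show "rvec v \<in> cone_of (std ` {1..<d} \<union> {b 1})" if "v \<in> std ` {2..d - 1}" for v
      by (rule rvec_in_cone_of) (use that in auto)
  qed simp
  then obtain \<sigma> where "\<sigma> \<in> \<Sigma>t" "\<And>i. i \<in> {2..d - 1} \<Longrightarrow> rvec (std i) \<in> \<sigma>" by blast
  with zero have "a 1 1 = - 1" by (rule base.a1_first_coordinate)
  with zero interpret gluing d \<Sigma>t \<Sigma> r m n k a b c t
    using pos gens_tilde gens_plus gens_minus b1 cone_minus cond1 cond2 t by unfold_locales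
  show ?thesis using deformed_variety_isomorphic unfolding q_def .
qed

end
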